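(* Let $G$ be the closed shrinking-diamond chain with oriented edges $c$, $t_0$, $u_k,v_k,t_k$ ($k\ge1$), let $$\mathscr Z(G)=\{R\in\mathbf I_1(G):\partial R=0,\ \operatorname{set}(R)=G\},$$ and for $R\in\mathscr Z(G)$ put $\operatorname{mult}_\infty(R)=\operatorname*{ess\,sup}_{x\in G}\theta_R(x)$ (essential supremum with respect to $\mathcal H^1$). Then $$\min_{R\in\mathscr Z(G)}\operatorname{mult}_\infty(R)=2,\qquad \min_{R\in\mathscr Z(G)}\mathbf M(R)=\frac32.$$ Both minima are attained by $$R_*=[\![c]\!]+[\![t_0]\!]+\sum_{k=1}^{\infty}\big(2[\![u_k]\!]-[\![v_k]\!]+[\![t_k]\!]\big).$$
   Context: Construction of $G$. Set $\lambda_k=2^{-k-2}$ for $k\ge1$. Take vertices $o,a_1,b_1,a_2,b_2,\dots$. Join $o$ to $a_1$ by an edge $t_0$ of length $1/4$. For every $k\ge1$ join $a_k$ to $b_k$ by two distinct parallel edges $u_k,v_k$, each of length $\lambda_k$, and join $b_k$ to $a_{k+1}$ by an edge $t_k$ of length $\lambda_k$. This forward chain has a unique completion point $z=\lim_k a_k=\lim_k b_k$. Attach an edge $c$ of length $1/4$ from $z$ to $o$. $G$ is the resulting space with its path metric $d_G$. Orientations: $t_0:o\to a_1$; $u_k,v_k:a_k\to b_k$; $t_k:b_k\to a_{k+1}$; $c:z\to o$. Currents are metric currents in the sense of Ambrosio–Kirchheim; $\mathbf I_1(G)$ is the group of integral $1$-currents in $G$ (integer rectifiable of finite mass, with boundary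 integer rectifiable of finite mass), $\mathbf M$ is mass, $\|R\|$ the mass measure, $\partial R$ the boundary, and $\theta_R$ the intrinsic nonnegative integer multiplicity in the rectifiable representation. For an oriented edge $e$ of length $\ell(e)$, $[\![e]\!]\in\mathbf I_1(G)$ is the push-forward of the standard integration current on $[0,\ell(e)]$ under the arclength parametrization of $e$ in its orientation. Infinite sums of edge currents are understood as convergent in mass. The characteristic set is $\operatorname{set}(R)=\{x\in G:\liminf_{r\downarrow0}\|R\|(B(x,r))/(2r)>0\}$. *)

theory Defs
  imports "HOL-Analysis.Analysis" "HOL-Probability.Essential_Supremum"
begin

section \<open>Path metrics from weighted steps\<close>

inductive walk :: "('p \<Rightarrow> 'p \<Rightarrow> real \<Rightarrow> bool) \<Rightarrow> 'p \<Rightarrow> 'p \<Rightarrow> real \<Rightarrow> bool"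
  for step where
  walk_nil: "walk step p p 0"
| walk_cons: "step p q a \<Longrightarrow> walk step q r l \<Longrightarrow> walk step p r (a + l)"

definition path_dist :: "('p \<Rightarrow> 'p \<Rightarrow> real \<Rightarrow> bool) \<Rightarrow> 'p \<Rightarrow> 'p \<Rightarrow> real" where
  "path_dist step p q = Inf {l. walk step p q l}"

lemma walk_single: "step p q a \<Longrightarrow> walk step p q a"
  using walk_cons[OF _ walk_nil, of step p q a] by simp

lemma walk_append: "walk step p q l \<Longrightarrow> walk step q r m \<Longrightarrow> walk step p r (l + m)"
  by (induction rule: walk.induct) (auto simp: add.assoc intro: walk.intros)

lemma walk_sym:
  assumes sym: "\<And>p q a. step p q a \<Longrightarrow> step q p a" and "walk step p q l"
  shows "walk step q p l"
  using assms(2)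
proof (induction rule: walk.induct)
  case (walk_cons p q a r l)
  have "walk step r p (l + a)"
    using walk_append[OF walk_cons.IH] walk_single[of step, OF sym] walk_cons.hyps(1) by blast
  then show ?case by (simp add: add.commute)
qed (rule walk_nil)

lemma walk_nonneg:
  assumes "\<And>p q a. step p q a \<Longrightarrow> 0 \<le> a" and "walk step p q l"
  shows "0 \<le> l"
  using assms(2) by (induction rule: walk.induct) (auto dest: assms(1))

lemma path_dist_le:
  assumes "\<And>p q a. step p q a \<Longrightarrow> 0 \<le> a" and "walk step p q l"
  shows "path_dist step p q \<le> l"
  unfolding path_dist_def
  by (rule cInf_lower) (use assms walk_nonneg[of step] in \<open>auto intro!: bdd_belowI[of _ 0]\<close>)

lemma path_dist_nonneg:
  assumes "\<And>p q a. step p q a \<Longrightarrow> 0 \<le> a" and "walk step p q l"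
  shows "0 \<le> path_dist step p q"
  unfolding path_dist_def
  by (rule cInf_greatest) (use assms walk_nonneg[of step] in auto)

lemma path_dist_refl:
  assumes "\<And>p q a. step p q a \<Longrightarrow> 0 \<le> a"
  shows "path_dist step p p = 0"
  using path_dist_le[of step, OF assms walk_nil] path_dist_nonneg[of step, OF assms walk_nil]
  by (meson antisym)

lemma path_dist_sym:
  assumes "\<And>p q a. step p q a \<Longrightarrow> step q p a"
  shows "path_dist step p q = path_dist step q p"
proof -
  have "{l. walk step p q l} = {l. walk step q p l}"
    using walk_sym[of step] assms by blast
  then show ?thesis by (simp add: path_dist_def)
qed

lemma path_dist_triangle:
  assumes nn: "\<And>p q a. step p q a \<Longrightarrow> 0 \<le> a"
    and pq: "walk step p q l" and qr: "walk step q r m"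
  shows "path_dist step p r \<le> path_dist step p q + path_dist step q r"
proof -
  have 1: "path_dist step p r - l' \<le> path_dist step q r" if "walk step p q l'" for l'
    unfolding path_dist_def[of step q r]
  proof (rule cInf_greatest)
    show "{l. walk step q r l} \<noteq> {}" using qr by auto
    fix m' assume "m' \<in> {l. walk step q r l}"
    then have "path_dist step p r \<le> l' + m'"
      by (intro path_dist_le[of step, OF nn] walk_append[OF that]) auto
    then show "path_dist step p r - l' \<le> m'" by simp
  qed
  have "path_dist step p r - path_dist step q r \<le> path_dist step p q"
    unfolding path_dist_def[of step p q]
  proof (rule cInf_greatest)
    show "{l. walk step p q l} \<noteq> {}" using pq by auto
    fix l' assume "l' \<in> {l. walk step p q l}"
    then show "path_dist step p r - path_dist step q r \<le> l'" using 1[of l'] by simp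
  qed
  then show ?thesis by simp
qed

section \<open>The closed shrinking-diamond chain\<close>

text \<open>The edges \<open>EU 0\<close> and \<open>EV 0\<close> are unused: \<open>u\<^sub>k\<close>, \<open>v\<^sub>k\<close> are indexed by \<open>k \<ge> 1\<close>.\<close>

datatype vertex = VO | VA nat | VB nat | VZ
datatype edge = EC | ET nat | EU nat | EV nat

definition edges :: "edge set" where
  "edges = {EC} \<union> range ET \<union> EU ` {1..} \<union> EV ` {1..}"

definition lam :: "nat \<Rightarrow> real" where
  "lam k = 1 / 2 ^ (k + 2)"

fun len :: "edge \<Rightarrow> real" where
  "len EC = 1 / 4"
| "len (ET k) = (if k = 0 then 1 / 4 else lam k)"
| "len (EU k) = lam k"
| "len (EV k) = lam k"

fun src :: "edge \<Rightarrow> vertex" where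
  "src EC = VZ"
| "src (ET k) = (if k = 0 then VO else VB k)"
| "src (EU k) = VA k"
| "src (EV k) = VA k"

fun tgt :: "edge \<Rightarrow> vertex" where
  "tgt EC = VO"
| "tgt (ET k) = VA (Suc k)"
| "tgt (EU k) = VB k"
| "tgt (EV k) = VB k"

text \<open>A point of the disjoint union of the edges is a pair of an edge and an arclength parameter.\<close>

type_synonym edge_point = "edge \<times> real"

definition edge_points :: "edge_point set" where
  "edge_points = {(e, s). e \<in> edges \<and> 0 \<le> s \<and> s \<le> len e}"

definition at_vertex :: "edge_point \<Rightarrow> vertex \<Rightarrow> bool" where
  "at_vertex p v \<longleftrightarrow> p \<in> edge_points \<and>
     (snd p = 0 \<and> v = src (fst p) \<or> snd p = len (fst p) \<and> v = tgt (fst p))"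

text \<open>First stage: the forward chain without its completion point, as a metric graph.\<close>

definition chain_points :: "edge_point set" where
  "chain_points = {p \<in> edge_points. fst p \<noteq> EC}"

inductive chain_step :: "edge_point \<Rightarrow> edge_point \<Rightarrow> real \<Rightarrow> bool" where
  chain_along: "(e, s) \<in> chain_points \<Longrightarrow> (e, t) \<in> chain_points \<Longrightarrow>
     chain_step (e, s) (e, t) \<bar>s - t\<bar>"
| chain_glue: "p \<in> chain_points \<Longrightarrow> q \<in> chain_points \<Longrightarrow> at_vertex p v \<Longrightarrow> at_vertex q v \<Longrightarrow>
     chain_step p q 0"

definition chain_dist :: "edge_point \<Rightarrow> edge_point \<Rightarrow> real" where
  "chain_dist = path_dist chain_step"

text \<open>Second stage: the completion adds the class of the Cauchy sequence of the \<open>a\<^sub>k\<close>. It is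
  represented by the initial point \<open>(EC, 0)\<close> of the edge \<open>c\<close>; \<open>cauchy_rep\<close> gives each
  point of the completed chain a representing Cauchy sequence.\<close>

definition z_point :: edge_point where
  "z_point = (EC, 0)"

definition cauchy_rep :: "edge_point \<Rightarrow> nat \<Rightarrow> edge_point" where
  "cauchy_rep p n = (if p = z_point then (EU (Suc n), 0) else p)"

definition completed_dist :: "edge_point \<Rightarrow> edge_point \<Rightarrow> real" where
  "completed_dist p q = lim (\<lambda>n. chain_dist (cauchy_rep p n) (cauchy_rep q n))"

text \<open>Third stage: the edge \<open>c\<close> is attached to the completed chain.\<close>

inductive graph_step :: "edge_point \<Rightarrow> edge_point \<Rightarrow> real \<Rightarrow> bool" where
  graph_chain: "p \<in> insert z_point chain_points \<Longrightarrow> q \<in> insert z_point chain_points \<Longrightarrow>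
     graph_step p q (completed_dist p q)"
| graph_along: "(EC, s) \<in> edge_points \<Longrightarrow> (EC, t) \<in> edge_points \<Longrightarrow>
     graph_step (EC, s) (EC, t) \<bar>s - t\<bar>"
| graph_glue: "at_vertex p v \<Longrightarrow> at_vertex q v \<Longrightarrow> graph_step p q 0"

definition graph_dist :: "edge_point \<Rightarrow> edge_point \<Rightarrow> real" where
  "graph_dist = path_dist graph_step"

definition same_point :: "edge_point \<Rightarrow> edge_point \<Rightarrow> bool" where
  "same_point p q \<longleftrightarrow> p \<in> edge_points \<and> q \<in> edge_points \<and> graph_dist p q = 0"

lemma lam_pos [simp]: "0 < lam k"
  by (simp add: lam_def)

lemma len_pos: "0 < len e"
  by (cases e) auto

lemma chain_edge_points:
  "e \<in> edges \<Longrightarrow> e \<noteq> EC \<Longrightarrow> 0 \<le> s \<Longrightarrow> s \<le> len e \<Longrightarrow> (e, s) \<in> chain_points"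
  by (auto simp: chain_points_def edge_points_def)

lemma chain_endpoints:
  assumes "e \<in> edges" "e \<noteq> EC"
  shows "(e, 0) \<in> chain_points" "(e, len e) \<in> chain_points"
  using assms len_pos[of e] by (auto intro!: chain_edge_points)

lemma edges_simps [simp]:
  "EC \<in> edges" "ET k \<in> edges" "EU k \<in> edges \<longleftrightarrow> 1 \<le> k" "EV k \<in> edges \<longleftrightarrow> 1 \<le> k"
  by (auto simp: edges_def)

lemma chain_step_nonneg: "chain_step p q a \<Longrightarrow> 0 \<le> a"
  by (induction rule: chain_step.induct) auto

lemma chain_step_sym: "chain_step p q a \<Longrightarrow> chain_step q p a"
proof (induction rule: chain_step.induct)
  case (chain_along e s t)
  then show ?case using chain_step.chain_along[of e t s] by (simp add: abs_minus_commute)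
qed (rule chain_glue)

lemma chain_along_walk:
  "(e, s) \<in> chain_points \<Longrightarrow> (e, t) \<in> chain_points \<Longrightarrow> walk chain_step (e, s) (e, t) \<bar>s - t\<bar>"
  by (intro walk_single chain_along)

lemma chain_glue_walk:
  assumes "e \<in> edges" "e \<noteq> EC" "e' \<in> edges" "e' \<noteq> EC" "tgt e = src e'"
  shows "walk chain_step (e, len e) (e', 0) 0"
  using assms chain_endpoints[of e] chain_endpoints[of e']
  by (intro walk_single chain_glue[of _ _ "src e'"]) (auto simp: at_vertex_def chain_points_def)

lemma chain_edge_walk:
  assumes "e \<in> edges" "e \<noteq> EC" "e' \<in> edges" "e' \<noteq> EC" "tgt e = src e'"
  shows "walk chain_step (e, 0) (e', 0) (len e)"
  using walk_append[OF chain_along_walk[OF chain_endpoints[OF assms(1,2)]] chain_glue_walk[OF assms]]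
    len_pos[of e] by simp

lemma chain_diamond_walk:
  "1 \<le> k \<Longrightarrow> walk chain_step (EU k, 0) (EU (Suc k), 0) (2 * lam k)"
  using walk_append[OF chain_edge_walk[of "EU k" "ET k"] chain_edge_walk[of "ET k" "EU (Suc k)"]]
  by auto

lemma chain_start_walk: "1 \<le> k \<Longrightarrow> \<exists>l. walk chain_step (ET 0, 0) (EU k, 0) l"
proof (induction k rule: dec_induct)
  case base
  show ?case using chain_edge_walk[of "ET 0" "EU 1"] by auto
next
  case (step n)
  then show ?case using chain_diamond_walk[of n] walk_append by meson
qed

lemma chain_origin_walk:
  assumes "p \<in> chain_points"
  shows "\<exists>l. walk chain_step (ET 0, 0) p l"
proof -
  obtain e s where p: "p = (e, s)" "e \<in> edges" "e \<noteq> EC" "0 \<le> s" "s \<le> len e"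
    using assms by (cases p) (auto simp: chain_points_def edge_points_def)
  have "\<exists>l. walk chain_step (ET 0, 0) (e, 0) l"
  proof (cases e)
    case EC
    then show ?thesis using p by simp
  next
    case (ET k)
    show ?thesis
    proof (cases "k = 0")
      case True
      then show ?thesis using ET walk_nil[of chain_step "(ET 0, 0)"] by auto
    next
      case False
      then have "1 \<le> k" by simp
      then obtain l where "walk chain_step (ET 0, 0) (EU k, 0) l"
        using chain_start_walk by blast
      moreover have "walk chain_step (EU k, 0) (ET k, 0) (len (EU k))"
        using \<open>1 \<le> k\<close> by (intro chain_edge_walk) auto
      ultimately have "walk chain_step (ET 0, 0) (ET k, 0) (l + len (EU k))"
        by (rule walk_append)
      then show ?thesis unfolding ET by blast
    qed
  next
    case (EU k)
    then show ?thesis using chain_start_walk[of k] p by auto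
  next
    case (EV k)
    then have k: "1 \<le> k" using p by simp
    have "walk chain_step (EU k, 0) (EV k, 0) 0"
      using k chain_endpoints[of "EU k"] chain_endpoints[of "EV k"]
      by (intro walk_single chain_glue[of _ _ "VA k"]) (auto simp: at_vertex_def chain_points_def)
    then show ?thesis
      unfolding EV using chain_start_walk[OF k] walk_append[of chain_step "(ET 0, 0)" "(EU k, 0)"]
      by meson
  qed
  moreover have "walk chain_step (e, 0) p \<bar>0 - s\<bar>"
    using chain_along_walk[OF chain_endpoints(1)[OF p(2,3)], of s] assms p(1) by simp
  ultimately show ?thesis using walk_append[of chain_step] by meson
qed

lemma chain_walk:
  assumes "p \<in> chain_points" "q \<in> chain_points"
  shows "\<exists>l. walk chain_step p q l"
  using chain_origin_walk[OF assms(1)] chain_origin_walk[OF assms(2)] walk_append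
    walk_sym[of chain_step, OF chain_step_sym] by meson

lemma chain_dist_nonneg: "p \<in> chain_points \<Longrightarrow> q \<in> chain_points \<Longrightarrow> 0 \<le> chain_dist p q"
  unfolding chain_dist_def using chain_walk path_dist_nonneg[of chain_step, OF chain_step_nonneg]
  by meson

lemma chain_dist_sym: "chain_dist p q = chain_dist q p"
  unfolding chain_dist_def by (rule path_dist_sym) (rule chain_step_sym)

lemma chain_dist_triangle:
  assumes "p \<in> chain_points" "q \<in> chain_points" "r \<in> chain_points"
  shows "chain_dist p r \<le> chain_dist p q + chain_dist q r"
  unfolding chain_dist_def
  using chain_walk[OF assms(1,2)] chain_walk[OF assms(2,3)]
    path_dist_triangle[of chain_step, OF chain_step_nonneg] by meson

lemma chain_a_points: "(EU (Suc n), 0) \<in> chain_points"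
  by (intro chain_edge_points) (auto intro: less_imp_le)

lemma chain_dist_a_convergent:
  assumes p: "p \<in> chain_points"
  shows "convergent (\<lambda>n. chain_dist p (EU (Suc n), 0))"
proof -
  define x where "x n = chain_dist p (EU (Suc n), 0)" for n
  have step: "chain_dist (EU (Suc n), 0) (EU (Suc (Suc n)), 0) \<le> 2 * lam (Suc n)" for n
    unfolding chain_dist_def
    by (rule path_dist_le[of chain_step, OF chain_step_nonneg chain_diamond_walk]) auto
  have "\<bar>x (Suc n) - x n\<bar> \<le> 2 * lam (Suc n)" for n
    using chain_dist_triangle[OF p chain_a_points[of n] chain_a_points[of "Suc n"]]
      chain_dist_triangle[OF p chain_a_points[of "Suc n"] chain_a_points[of n]] step[of n]
      chain_dist_sym[of "(EU (Suc n), 0)" "(EU (Suc (Suc n)), 0)"]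
    unfolding x_def by linarith
  moreover have "summable (\<lambda>n. 2 * lam (Suc n))"
    using summable_mult[OF summable_geometric[of "1/2::real"], of "1/4"]
    by (simp add: lam_def power_divide field_simps)
  ultimately have "summable (\<lambda>n. x (Suc n) - x n)"
    by (intro summable_comparison_test[of "\<lambda>n. x (Suc n) - x n" "\<lambda>n. 2 * lam (Suc n)"]) auto
  then have "convergent (\<lambda>n. \<Sum>i<n. x (Suc i) - x i)"
    by (simp add: summable_iff_convergent)
  then have "convergent (\<lambda>n. x n - x 0)"
    by (simp add: sum_lessThan_telescope)
  then have "convergent (\<lambda>n. (x n - x 0) + x 0)"
    by (intro convergent_add convergent_const)
  then show ?thesis by (simp add: x_def)
qed

lemma cauchy_rep_points: "p \<in> insert z_point chain_points \<Longrightarrow> cauchy_rep p n \<in> chain_points"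
  using chain_a_points by (auto simp: cauchy_rep_def)

lemma chain_dist_refl: "chain_dist p p = 0"
  unfolding chain_dist_def by (rule path_dist_refl) (rule chain_step_nonneg)

lemma completed_dist_nonneg:
  assumes "p \<in> insert z_point chain_points" "q \<in> insert z_point chain_points"
  shows "0 \<le> completed_dist p q"
proof -
  have z: "z_point \<notin> chain_points"
    by (simp add: z_point_def chain_points_def)
  have rep: "cauchy_rep x n = x" if "x \<in> chain_points" for x n
    using that z by (auto simp: cauchy_rep_def)
  have rep_z: "cauchy_rep z_point n = (EU (Suc n), 0)" for n
    by (simp add: cauchy_rep_def)
  consider "p = z_point" "q = z_point" | "p = z_point" "q \<in> chain_points"
    | "p \<in> chain_points" "q = z_point" | "p \<in> chain_points" "q \<in> chain_points"
    using assms by blast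
  then have "convergent (\<lambda>n. chain_dist (cauchy_rep p n) (cauchy_rep q n))"
  proof cases
    case 1
    then show ?thesis by (simp add: chain_dist_refl convergent_const)
  next
    case 2
    then show ?thesis
      using chain_dist_a_convergent[of q] by (simp add: rep rep_z chain_dist_sym[of _ q])
  next
    case 3
    then show ?thesis using chain_dist_a_convergent[of p] by (simp add: rep rep_z)
  next
    case 4
    then show ?thesis by (simp add: rep convergent_const)
  qed
  then have "(\<lambda>n. chain_dist (cauchy_rep p n) (cauchy_rep q n)) \<longlonglongrightarrow> completed_dist p q"
    by (simp add: completed_dist_def convergent_LIMSEQ_iff)
  then show ?thesis
    using assms by (intro LIMSEQ_le_const[of _ "completed_dist p q" 0])
      (auto intro!: chain_dist_nonneg cauchy_rep_points)
qed

lemma graph_step_nonneg: "graph_step p q a \<Longrightarrow> 0 \<le> a"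
  by (induction rule: graph_step.induct) (auto intro: completed_dist_nonneg)

lemma completed_dist_sym: "completed_dist p q = completed_dist q p"
  unfolding completed_dist_def by (subst chain_dist_sym) (rule refl)

lemma graph_step_sym:
  assumes "graph_step p q a"
  shows "graph_step q p a"
  using assms
proof cases
  case graph_chain
  then show ?thesis using graph_step.graph_chain[of q p] completed_dist_sym by simp
next
  case (graph_along s t)
  then show ?thesis using graph_step.graph_along[of t s] by (simp add: abs_minus_commute)
next
  case (graph_glue v)
  then show ?thesis using graph_step.graph_glue by blast
qed

lemma graph_z_walk:
  assumes "p \<in> edge_points"
  shows "\<exists>l. walk graph_step p z_point l"
proof (cases "fst p = EC")
  case True
  then have "p = (EC, snd p)" by (metis prod.collapse)
  moreover have "z_point \<in> edge_points" by (simp add: z_point_def edge_points_def)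
  ultimately show ?thesis
    using assms graph_along[of "snd p" 0] walk_single unfolding z_point_def by metis
next
  case False
  then show ?thesis
    using assms walk_single[of graph_step, OF graph_chain[of p z_point]]
    by (auto simp: chain_points_def)
qed

lemma graph_walk:
  assumes "p \<in> edge_points" "q \<in> edge_points"
  shows "\<exists>l. walk graph_step p q l"
  using graph_z_walk[OF assms(1)] graph_z_walk[OF assms(2)] walk_append
    walk_sym[of graph_step, OF graph_step_sym] by meson

lemma graph_dist_nonneg: "p \<in> edge_points \<Longrightarrow> q \<in> edge_points \<Longrightarrow> 0 \<le> graph_dist p q"
  unfolding graph_dist_def using graph_walk path_dist_nonneg[of graph_step, OF graph_step_nonneg]
  by meson

lemma graph_dist_refl: "graph_dist p p = 0"
  unfolding graph_dist_def by (rule path_dist_refl) (rule graph_step_nonneg)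

lemma graph_dist_sym: "graph_dist p q = graph_dist q p"
  unfolding graph_dist_def by (rule path_dist_sym) (rule graph_step_sym)

lemma graph_dist_triangle:
  assumes "p \<in> edge_points" "q \<in> edge_points" "r \<in> edge_points"
  shows "graph_dist p r \<le> graph_dist p q + graph_dist q r"
  unfolding graph_dist_def
  using graph_walk[OF assms(1,2)] graph_walk[OF assms(2,3)]
    path_dist_triangle[of graph_step, OF graph_step_nonneg] by meson

lemma same_point_part_equivp: "part_equivp same_point"
proof (rule part_equivpI)
  have "same_point (EC, 0) (EC, 0)"
    by (simp add: same_point_def edge_points_def graph_dist_refl)
  then show "\<exists>p. same_point p p" by blast
  show "symp same_point"
    by (auto simp: symp_def same_point_def graph_dist_sym)
  show "transp same_point"
  proof (rule transpI)
    fix p q r assume "same_point p q" "same_point q r"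
    then show "same_point p r"
      using graph_dist_triangle[of p q r] graph_dist_nonneg[of p r]
      by (auto simp: same_point_def)
  qed
qed

quotient_type diamond_chain = edge_point / partial: same_point
  by (rule same_point_part_equivp)

lemma graph_dist_cong:
  assumes "same_point p p'" "same_point q q'"
  shows "graph_dist p q = graph_dist p' q'"
  using assms graph_dist_triangle[of p p' q] graph_dist_triangle[of p' q' q]
    graph_dist_triangle[of p' p q'] graph_dist_triangle[of p q q']
    graph_dist_sym[of p p'] graph_dist_sym[of q q']
  by (auto simp: same_point_def)

instantiation diamond_chain :: metric_space
begin

lift_definition dist_diamond_chain :: "diamond_chain \<Rightarrow> diamond_chain \<Rightarrow> real" is graph_dist
  by (rule graph_dist_cong)

definition uniformity_diamond_chain :: "(diamond_chain \<times> diamond_chain) filter" where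
  "uniformity_diamond_chain = (INF e\<in>{0<..}. principal {(x, y). dist x y < e})"

definition open_diamond_chain :: "diamond_chain set \<Rightarrow> bool" where
  "open_diamond_chain U \<longleftrightarrow> (\<forall>x\<in>U. eventually (\<lambda>(x', y). x' = x \<longrightarrow> y \<in> U) uniformity)"

instance
proof
  fix x y z :: diamond_chain
  show "dist x y = 0 \<longleftrightarrow> x = y"
    by transfer (auto simp: same_point_def)
  show "dist x y \<le> dist x z + dist y z"
    by transfer (metis graph_dist_sym graph_dist_triangle same_point_def)
qed (rule uniformity_diamond_chain_def open_diamond_chain_def)+

end

text \<open>The arclength parametrization of an edge, extended to the real line by constants.\<close>

definition param :: "edge \<Rightarrow> real \<Rightarrow> diamond_chain" where
  "param e s = abs_diamond_chain (e, max 0 (min s (len e)))"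

section \<open>Metric currents of dimension 0 and 1\<close>

text \<open>A current is represented by a total functional on pairs of functions; only its values on
  \<open>Lip\<^sub>b(E) \<times> Lip(E)\<close> are ever used.\<close>

type_synonym 'a current0 = "('a \<Rightarrow> real) \<Rightarrow> real"
type_synonym 'a current1 = "('a \<Rightarrow> real) \<Rightarrow> ('a \<Rightarrow> real) \<Rightarrow> real"

definition Lip_fun :: "('a::metric_space \<Rightarrow> real) set" where
  "Lip_fun = {f. \<exists>L. L-lipschitz_on UNIV f}"

definition bLip_fun :: "('a::metric_space \<Rightarrow> real) set" where
  "bLip_fun = {f \<in> Lip_fun. bounded (range f)}"

definition lip :: "('a::metric_space \<Rightarrow> real) \<Rightarrow> real" where
  "lip f = Inf {L. L-lipschitz_on UNIV f}"

definition mass_bound :: "('a::metric_space) current1 \<Rightarrow> 'a measure \<Rightarrow> bool" where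
  "mass_bound T \<mu> \<longleftrightarrow> sets \<mu> = sets borel \<and> finite_measure \<mu> \<and>
     (\<forall>f\<in>bLip_fun. \<forall>\<pi>\<in>Lip_fun. \<bar>T f \<pi>\<bar> \<le> lip \<pi> * (\<integral>x. \<bar>f x\<bar> \<partial>\<mu>))"

definition metric_current1 :: "('a::metric_space) current1 \<Rightarrow> bool" where
  "metric_current1 T \<longleftrightarrow>
     (\<forall>f\<in>bLip_fun. \<forall>g\<in>bLip_fun. \<forall>\<pi>\<in>Lip_fun. \<forall>a b.
        T (\<lambda>x. a * f x + b * g x) \<pi> = a * T f \<pi> + b * T g \<pi>) \<and>
     (\<forall>f\<in>bLip_fun. \<forall>\<pi>\<in>Lip_fun. \<forall>\<rho>\<in>Lip_fun. \<forall>a b.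
        T f (\<lambda>x. a * \<pi> x + b * \<rho> x) = a * T f \<pi> + b * T f \<rho>) \<and>
     (\<forall>f\<in>bLip_fun. \<forall>\<pi>s \<pi> L. (\<forall>n. L-lipschitz_on UNIV (\<pi>s n)) \<and> (\<forall>x. (\<lambda>n. \<pi>s n x) \<longlonglongrightarrow> \<pi> x) \<longrightarrow>
        (\<lambda>n::nat. T f (\<pi>s n)) \<longlonglongrightarrow> T f \<pi>) \<and>
     (\<forall>f\<in>bLip_fun. \<forall>\<pi>\<in>Lip_fun. \<forall>U c. open U \<and> {x. f x \<noteq> 0} \<subseteq> U \<and> (\<forall>x\<in>U. \<pi> x = c) \<longrightarrow>
        T f \<pi> = 0) \<and>
     (\<exists>\<mu>. mass_bound T \<mu>)"

definition mass_measure :: "('a::metric_space) current1 \<Rightarrow> 'a measure" where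
  "mass_measure T = (THE \<mu>. mass_bound T \<mu> \<and>
     (\<forall>\<nu>. mass_bound T \<nu> \<longrightarrow> (\<forall>A\<in>sets borel. emeasure \<mu> A \<le> emeasure \<nu> A)))"

definition mass :: "('a::metric_space) current1 \<Rightarrow> ennreal" where
  "mass T = emeasure (mass_measure T) UNIV"

definition boundary :: "('a::metric_space) current1 \<Rightarrow> 'a current0" where
  "boundary T f = T (\<lambda>_. 1) f"

definition pushforward :: "('a \<Rightarrow> 'b) \<Rightarrow> 'a current1 \<Rightarrow> 'b current1" where
  "pushforward \<phi> T f \<pi> = T (\<lambda>x. f (\<phi> x)) (\<lambda>x. \<pi> (\<phi> x))"

text \<open>The extension of a current of finite mass to bounded Borel first arguments, by density of
  \<open>Lip\<^sub>b(E)\<close> in the integrable functions for the mass measure, and the restriction to a set.\<close>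

definition borel_extension :: "('a::metric_space) current1 \<Rightarrow> 'a current1" where
  "borel_extension T g \<pi> = (THE v. \<forall>F. (\<forall>n. F n \<in> bLip_fun) \<and>
     (\<lambda>n::nat. \<integral>\<^sup>+x. ennreal \<bar>F n x - g x\<bar> \<partial>mass_measure T) \<longlonglongrightarrow> 0 \<longrightarrow>
     (\<lambda>n. T (F n) \<pi>) \<longlonglongrightarrow> v)"

definition restrict_current :: "('a::metric_space) current1 \<Rightarrow> 'a set \<Rightarrow> 'a current1" where
  "restrict_current T A f \<pi> = borel_extension T (\<lambda>x. f x * indicator A x) \<pi>"

text \<open>The current in the real line induced by an integrable density.\<close>

definition line_current :: "(real \<Rightarrow> real) \<Rightarrow> real current1" where
  "line_current \<theta> f \<pi> = (\<integral>x. \<theta> x * f x * deriv \<pi> x \<partial>lebesgue)"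

text \<open>Convergence in mass of a series of currents.\<close>

definition mass_sums :: "(nat \<Rightarrow> ('a::metric_space) current1) \<Rightarrow> 'a current1 \<Rightarrow> bool" where
  "mass_sums X S \<longleftrightarrow> (\<forall>n. metric_current1 (X n)) \<and> metric_current1 S \<and>
     (\<lambda>n. mass (\<lambda>f \<pi>. S f \<pi> - (\<Sum>i<n. X i f \<pi>))) \<longlonglongrightarrow> 0"

section \<open>Hausdorff measure and rectifiability\<close>

definition hausdorff1_content :: "real \<Rightarrow> ('a::metric_space) set \<Rightarrow> ennreal" where
  "hausdorff1_content \<delta> A =
     (INF C \<in> {C::nat \<Rightarrow> 'a set. A \<subseteq> (\<Union>i. C i) \<and> (\<forall>i. bounded (C i) \<and> diameter (C i) \<le> \<delta>)}.
        \<Sum>i. ennreal (diameter (C i)))"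

definition hausdorff1_outer :: "('a::metric_space) set \<Rightarrow> ennreal" where
  "hausdorff1_outer A = (SUP \<delta> \<in> {0<..}. hausdorff1_content \<delta> A)"

definition hausdorff1 :: "('a::metric_space) measure" where
  "hausdorff1 = measure_of UNIV (sets borel) hausdorff1_outer"

definition countably_rectifiable1 :: "('a::metric_space) set \<Rightarrow> bool" where
  "countably_rectifiable1 S \<longleftrightarrow> (\<exists>(A::nat \<Rightarrow> real set) \<gamma>.
     (\<forall>i. \<exists>L. L-lipschitz_on (A i) (\<gamma> i)) \<and> hausdorff1_outer (S - (\<Union>i. \<gamma> i ` A i)) = 0)"

definition integer_rectifiable0 :: "('a::metric_space) current0 \<Rightarrow> bool" where
  "integer_rectifiable0 T \<longleftrightarrow> (\<exists>F (\<theta>::'a \<Rightarrow> int). finite F \<and>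
     (\<forall>f\<in>bLip_fun. T f = (\<Sum>x\<in>F. of_int (\<theta> x) * f x)))"

text \<open>The definition of Ambrosio and Kirchheim.\<close>

definition integer_rectifiable1 :: "('a::metric_space) current1 \<Rightarrow> bool" where
  "integer_rectifiable1 T \<longleftrightarrow> metric_current1 T \<and>
     (\<exists>S\<in>sets borel. countably_rectifiable1 S \<and> emeasure (mass_measure T) (- S) = 0) \<and>
     (\<forall>N\<in>sets borel. hausdorff1_outer N = 0 \<longrightarrow> emeasure (mass_measure T) N = 0) \<and>
     (\<forall>\<phi>\<in>Lip_fun. \<forall>A. open A \<longrightarrow> (\<exists>\<theta>::real \<Rightarrow> int.
        integrable lebesgue (\<lambda>x. real_of_int (\<theta> x)) \<and>
        (\<forall>f\<in>bLip_fun. \<forall>\<pi>\<in>Lip_fun. pushforward \<phi> (restrict_current T A) f \<pi> =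
           line_current (\<lambda>x. real_of_int (\<theta> x)) f \<pi>)))"

definition integral_currents1 :: "('a::metric_space) current1 set" where
  "integral_currents1 = {T. integer_rectifiable1 T \<and> integer_rectifiable0 (boundary T)}"

text \<open>The multiplicity in a rectifiable representation of \<open>T\<close>: a disjoint countable union of
  bi-Lipschitz images of Borel sets of reals, with an oriented integer multiplicity \<open>\<sigma>\<close> on each,
  represents \<open>T\<close>, and \<open>\<theta>\<close> is the absolute value of \<open>\<sigma>\<close>, read on the image. The last
  clause is the identity \<open>\<parallel>T\<parallel> = \<theta> \<H>\<^sup>1\<close>, in which the area factor of Ambrosio and
  Kirchheim is 1 because the dimension is 1. The two together determine \<open>\<theta>\<close> up to
  \<open>\<H>\<^sup>1\<close>-null sets.\<close>

definition is_multiplicity :: "('a::metric_space) current1 \<Rightarrow> ('a \<Rightarrow> nat) \<Rightarrow> bool" where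
  "is_multiplicity T \<theta> \<longleftrightarrow> (\<exists>(B::nat \<Rightarrow> real set) \<gamma> (\<sigma>::nat \<Rightarrow> real \<Rightarrow> int).
     (\<forall>i. B i \<in> sets borel) \<and>
     (\<forall>i. \<exists>c>0. \<exists>L. \<forall>s\<in>B i. \<forall>t\<in>B i.
        c * \<bar>s - t\<bar> \<le> dist (\<gamma> i s) (\<gamma> i t) \<and> dist (\<gamma> i s) (\<gamma> i t) \<le> L * \<bar>s - t\<bar>) \<and>
     disjoint_family (\<lambda>i. \<gamma> i ` B i) \<and>
     (\<forall>i. set_integrable lebesgue (B i) (\<lambda>s. real_of_int (\<sigma> i s))) \<and>
     (\<forall>f\<in>bLip_fun. \<forall>\<pi>\<in>Lip_fun.
        (\<lambda>i. LINT s:B i|lebesgue. real_of_int (\<sigma> i s) * f (\<gamma> i s) *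
           vector_derivative (\<lambda>t. \<pi> (\<gamma> i t)) (at s within B i)) sums T f \<pi>) \<and>
     (\<forall>i. \<forall>s\<in>B i. \<theta> (\<gamma> i s) = nat \<bar>\<sigma> i s\<bar>) \<and>
     (\<forall>x. x \<notin> (\<Union>i. \<gamma> i ` B i) \<longrightarrow> \<theta> x = 0) \<and>
     \<theta> \<in> borel \<rightarrow>\<^sub>M count_space UNIV \<and>
     (\<forall>A\<in>sets borel. emeasure (mass_measure T) A = (\<integral>\<^sup>+x\<in>A. of_nat (\<theta> x) \<partial>hausdorff1)))"

definition multiplicity :: "('a::metric_space) current1 \<Rightarrow> 'a \<Rightarrow> nat" where
  "multiplicity T = (SOME \<theta>. is_multiplicity T \<theta>)"

definition mult_inf :: "('a::metric_space) current1 \<Rightarrow> ennreal" where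
  "mult_inf T = esssup hausdorff1 (\<lambda>x. of_nat (multiplicity T x))"

definition charac_set :: "('a::metric_space) current1 \<Rightarrow> 'a set" where
  "charac_set T =
     {x. Liminf (at_right 0) (\<lambda>r. emeasure (mass_measure T) (ball x r) / ennreal (2 * r)) > 0}"

section \<open>Cycles carried by the whole chain\<close>

definition edge_current :: "edge \<Rightarrow> diamond_chain current1" where
  "edge_current e = pushforward (param e) (line_current (indicator {0..len e}))"

definition full_cycles :: "diamond_chain current1 set" where
  "full_cycles = {R \<in> integral_currents1. (\<forall>f\<in>bLip_fun. boundary R f = 0) \<and> charac_set R = UNIV}"

text \<open>The terms of the series for \<open>R\<^sub>*\<close>: term \<open>0\<close> is \<open>c + t\<^sub>0\<close>, and term \<open>k \<ge> 1\<close>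
  is the contribution of the \<open>k\<close>-th diamond.\<close>

fun star_term :: "nat \<Rightarrow> diamond_chain current1" where
  "star_term 0 f \<pi> = edge_current EC f \<pi> + edge_current (ET 0) f \<pi>"
| "star_term (Suc n) f \<pi> =
     2 * edge_current (EU (Suc n)) f \<pi> - edge_current (EV (Suc n)) f \<pi>
       + edge_current (ET (Suc n)) f \<pi>"

definition R_star :: "diamond_chain current1" where
  "R_star f \<pi> = (\<Sum>k. star_term k f \<pi>)"

end

theory Submission
  imports Defs
begin

text \<open>A current charges no countable set, since the continuity axiom forbids atoms, and a cycle tested
  on functions carried by one open edge \<open>e\<close> is a constant multiple \<open>c\<^sub>e\<close> of integration along \<open>e\<close>. Hence a
  cycle on the chain is the sum of the currents \<open>c\<^sub>e\<lbrakk>e\<rbrakk>\<close>; its multiplicity is \<open>\<bar>c\<^sub>e\<bar>\<close> on \<open>e\<close> and its mass is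
  the sum of the \<open>\<bar>c\<^sub>e\<bar>\<close> weighted by the lengths. Integer rectifiability makes the \<open>c\<^sub>e\<close> integers: the
  push-forward of the restriction to \<open>e\<close> under the coordinate of \<open>e\<close> has density \<open>c\<^sub>e\<close>. The
  characteristic set is everything only if no \<open>c\<^sub>e\<close> vanishes. Tent functions around the vertices give
  Kirchhoff's law: \<open>c\<close> and all the \<open>t\<^sub>k\<close> carry the same integer \<open>m\<close>, and the coefficients of \<open>u\<^sub>k\<close> and
  \<open>v\<^sub>k\<close> add up to \<open>m\<close>. Three nonzero integers \<open>u + v = m\<close> are not all odd, so one of them has absolute
  value at least 2 and \<open>\<bar>u\<bar> + \<bar>v\<bar> + \<bar>m\<bar> \<ge> 4\<close>; as the \<open>\<lambda>\<^sub>k\<close> sum to \<open>1/4\<close>, the mass is at least \<open>3/2\<close>.\<close>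

text \<open>Mass measure, Borel extension and multiplicity are given by description or choice, and
  the metric by infima over walks. None of them is computed from its definition: on an abstract
  network each is pinned down by an explicit candidate, the mass measure of the current with
  coefficients c being arclength weighted by |c|, and Hausdorff measure the case c = 1. A cycle T is
  constant along an edge because a function g of mean zero on the edge has a primitive that vanishes
  at both ends. Extended by 0 it is a Lipschitz \<pi> on the whole space, and T(g ds) equals T(1,
  \<pi>) = 0 up to an error that concentrates at the vertices. No balance is tested at z, where a
  hat function would be discontinuous along the a_k: the laws at o, a_k and b_k already link all the
  edges. That \<open>R_star\<close> closes up at z comes instead from a_k tending to z in a
  telescoping series. The coefficients 2, -1, 1 of a diamond are extremal for both problems at once:
  largest modulus 2 and sum of moduli 4.\<close>

section \<open>Lipschitz functions on the line\<close>

text \<open>Vitali's covering theorem. The excess of g over r has integral 0 on {g \<le> r}, so some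
  open set around it carries little excess; but every bad interval carries at least R - r per unit
  length, hence disjoint bad intervals inside the open set are short in total. The intervals contain
  x without being centred there, since a difference quotient at x needs an interval with x as an
  end.\<close>

lemma density_upper_negligible:
  fixes g :: "real \<Rightarrow> real"
  assumes g: "integrable lborel g" and "r < R"
  shows "negligible {x. g x \<le> r \<and> (\<forall>d>0. \<exists>c \<rho>. 0 < \<rho> \<and> \<rho> < d \<and> x \<in> cball c \<rho> \<and>
           R * (2 * \<rho>) \<le> (LINT y:cball c \<rho>|lborel. g y))}" (is "negligible ?B")
proof -
  have [measurable]: "g \<in> borel_measurable borel" using g by auto
  have "negligible (?B \<inter> ball 0 k)" for k :: real
    unfolding negligible_outer_le
  proof (intro allI impI)
    fix e :: real assume "0 < e"
    define h where "h y = max 0 (g y - r) * indicator (ball 0 k) y" for y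
    have h0: "0 \<le> h y" for y by (simp add: h_def)
    have [measurable]: "ball 0 k \<in> sets borel" by simp
    have [measurable]: "h \<in> borel_measurable borel" unfolding h_def by measurable
    have hint: "integrable lborel h"
    proof (rule Bochner_Integration.integrable_bound)
      show "integrable lborel (\<lambda>y. \<bar>g y\<bar> + \<bar>r\<bar> * indicator (ball 0 k) y)"
        using g by (intro Bochner_Integration.integrable_add integrable_abs integrable_mult_right)
          (auto intro!: integrable_real_indicator emeasure_bounded_finite simp: bounded_ball)
      show "AE y in lborel. norm (h y) \<le> norm (\<bar>g y\<bar> + \<bar>r\<bar> * indicator (ball 0 k) y)"
        by (auto simp: h_def indicator_def)
    qed measurable
    define \<tau> where "\<tau> = density lborel (\<lambda>y. ennreal (h y))"
    have [measurable_cong, simp]: "sets \<tau> = sets borel" by (simp add: \<tau>_def)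
    have fin: "emeasure \<tau> (space \<tau>) \<noteq> \<infinity>"
      using hint h0 by (simp add: \<tau>_def emeasure_density nn_integral_eq_integral)
    define A where "A = {x. g x \<le> r}"
    have A [measurable]: "A \<in> sets borel" unfolding A_def by measurable
    have "emeasure \<tau> A = 0"
      by (subst nn_integral_0_iff_AE | simp add: \<tau>_def emeasure_density)+
         (auto simp: A_def h_def indicator_def)
    then have "(INF U\<in>{U. A \<subseteq> U \<and> open U}. emeasure \<tau> U) < ennreal (e * (R - r))"
      using outer_regular[of \<tau> A] fin A \<open>0 < e\<close> \<open>r < R\<close> by simp
    then obtain U where U: "A \<subseteq> U" "open U" "emeasure \<tau> U < ennreal (e * (R - r))"
      unfolding INF_less_iff by auto
    define W where "W = U \<inter> ball 0 k"
    have W: "open W" using open_Int[OF U(2) open_ball] by (simp add: W_def)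
    define K where "K = {(c, \<rho>). 0 < \<rho> \<and> cball c \<rho> \<subseteq> W \<and> R * (2 * \<rho>) \<le> (LINT y:cball c \<rho>|lborel. g y)}"
    obtain C where C: "countable C" "C \<subseteq> K"
      "pairwise (\<lambda>i j. disjnt (cball (fst i) (snd i)) (cball (fst j) (snd j))) C"
      "negligible (?B \<inter> ball 0 k - (\<Union>i\<in>C. cball (fst i) (snd i)))"
    proof (rule Vitali_covering_theorem_cballs[of K snd "?B \<inter> ball 0 k" fst])
      show "0 < snd i" if "i \<in> K" for i using that by (auto simp: K_def)
      fix x d :: real assume x: "x \<in> ?B \<inter> ball 0 k" "0 < d"
      then have "x \<in> W" using U by (auto simp: W_def A_def)
      then obtain s where s: "0 < s" "ball x s \<subseteq> W" using W openE by blast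
      have "0 < min d (s/2)" using s x by simp
      then obtain c \<rho> where c: "0 < \<rho>" "\<rho> < min d (s/2)" "x \<in> cball c \<rho>"
        "R * (2 * \<rho>) \<le> (LINT y:cball c \<rho>|lborel. g y)" using x by blast
      have "cball c \<rho> \<subseteq> ball x s"
        using c by (auto simp: dist_real_def)
      then have "(c, \<rho>) \<in> K" using c s by (auto simp: K_def)
      then show "\<exists>i. i \<in> K \<and> x \<in> cball (fst i) (snd i) \<and> snd i < d"
        using c by (intro exI[of _ "(c, \<rho>)"]) auto
    qed
    define X where "X i = cball (fst i) (snd i)" for i :: "real \<times> real"
    have dj: "disjoint_family_on X C"
      using C(3) by (auto simp: disjoint_family_on_def pairwise_def disjnt_def X_def)
    have [measurable]: "X i \<in> sets borel" for i by (simp add: X_def)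
    have UX [measurable]: "(\<Union>i\<in>C. X i) \<in> sets borel" using C(1) by (intro sets.countable_UN') auto
    have each: "ennreal (R - r) * emeasure lborel (X i) \<le> emeasure \<tau> (X i)" if iC: "i \<in> C" for i
    proof -
      obtain c \<rho> where i: "i = (c, \<rho>)" "0 < \<rho>" "cball c \<rho> \<subseteq> W" 
        "R * (2 * \<rho>) \<le> (LINT y:cball c \<rho>|lborel. g y)"
        using iC C(2) by (cases i) (auto simp: K_def)
      have gi: "set_integrable lborel (cball c \<rho>) g"
        using set_integrable_subset[of lborel UNIV g "cball c \<rho>"] g by (simp add: set_integrable_def)
      have hi: "set_integrable lborel (cball c \<rho>) h"
        using set_integrable_subset[of lborel UNIV h "cball c \<rho>"] hint by (simp add: set_integrable_def)
      have m: "measure lborel (cball c \<rho>) = 2 * \<rho>" "emeasure lborel (cball c \<rho>) = ennreal (2 * \<rho>)"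
        using i(2) by (simp_all add: cball_eq_atLeastAtMost)
      have ri: "set_integrable lborel (cball c \<rho>) (\<lambda>_. r)"
        unfolding set_integrable_def using m by (simp add: integrable_scaleR_left integrable_real_indicator)
      have "(R - r) * (2 * \<rho>) \<le> (LINT y:cball c \<rho>|lborel. g y) - r * (2 * \<rho>)"
        using i by (simp add: algebra_simps)
      also have "r * (2 * \<rho>) = (LINT y:cball c \<rho>|lborel. r)"
        by (simp add: set_lebesgue_integral_def m)
      also have "(LINT y:cball c \<rho>|lborel. g y) - (LINT y:cball c \<rho>|lborel. r) =
          (LINT y:cball c \<rho>|lborel. g y - r)"
        by (rule set_integral_diff(2)[symmetric, OF gi ri])
      also have "\<dots> \<le> (LINT y:cball c \<rho>|lborel. h y)"
        using i(3) by (intro set_integral_mono set_integral_diff(1) gi ri hi) (auto simp: h_def W_def indicator_def)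
      finally have "ennreal ((R - r) * (2 * \<rho>)) \<le> ennreal (LINT y:cball c \<rho>|lborel. h y)"
        by (rule ennreal_leI)
      also have "\<dots> = (\<integral>\<^sup>+y\<in>cball c \<rho>. ennreal (h y) \<partial>lborel)"
        using hi h0 unfolding set_lebesgue_integral_def set_integrable_def
        by (subst nn_integral_eq_integral[symmetric]) (auto intro!: nn_integral_cong simp: indicator_def)
      also have "\<dots> = emeasure \<tau> (X i)"
        by (simp add: \<tau>_def emeasure_density X_def i)
      finally show ?thesis
        using \<open>r < R\<close> i by (simp add: X_def m ennreal_mult)
    qed
    have "ennreal (R - r) * emeasure lborel (\<Union>i\<in>C. X i) =
        (\<integral>\<^sup>+i. ennreal (R - r) * emeasure lborel (X i) \<partial>count_space C)"
      using C(1) dj by (subst emeasure_UN_countable) (auto simp: nn_integral_cmult)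
    also have "\<dots> \<le> (\<integral>\<^sup>+i. emeasure \<tau> (X i) \<partial>count_space C)"
      by (intro nn_integral_mono) (auto intro: each)
    also have "\<dots> = emeasure \<tau> (\<Union>i\<in>C. X i)"
      using C(1) dj by (subst emeasure_UN_countable) auto
    also have "\<dots> \<le> emeasure \<tau> U"
      using C(2) U by (intro emeasure_mono) (auto simp: K_def X_def W_def, fastforce)
    also have "\<dots> < ennreal (e * (R - r))" by (rule U)
    finally have *: "ennreal (R - r) * emeasure lborel (\<Union>i\<in>C. X i) < ennreal (e * (R - r))" .
    have le: "emeasure lborel (\<Union>i\<in>C. X i) \<le> ennreal e"
    proof (rule ccontr)
      assume "\<not> ?thesis"
      then have "ennreal (R - r) * ennreal e \<le> ennreal (R - r) * emeasure lborel (\<Union>i\<in>C. X i)"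
        by (intro mult_left_mono) auto
      with * show False using \<open>0 < e\<close> \<open>r < R\<close> by (simp add: ennreal_mult mult.commute)
    qed
    have lm: "(\<Union>i\<in>C. X i) \<in> lmeasurable"
      using le UX by (intro fmeasurableI) (auto simp: less_top[symmetric] top_unique)
    let ?N = "?B \<inter> ball 0 k - (\<Union>i\<in>C. X i)"
    have N: "?N \<in> lmeasurable" "measure lebesgue ?N = 0"
      using C(4) by (simp_all add: X_def negligible_imp_measurable negligible_imp_measure0)
    show "\<exists>T. ?B \<inter> ball 0 k \<subseteq> T \<and> T \<in> lmeasurable \<and> measure lebesgue T \<le> e"
    proof (intro exI[of _ "(\<Union>i\<in>C. X i) \<union> ?N"] conjI)
      show "(\<Union>i\<in>C. X i) \<union> ?N \<in> lmeasurable" using lm N by blast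
      have "measure lebesgue ((\<Union>i\<in>C. X i) \<union> ?N) \<le> measure lebesgue (\<Union>i\<in>C. X i) + 0"
        using measure_Un_le[of "\<Union>i\<in>C. X i" lebesgue ?N] lm N by (simp add: fmeasurableD)
      also have "measure lebesgue (\<Union>i\<in>C. X i) \<le> e"
        using le UX \<open>0 < e\<close> by (simp add: measure_def enn2real_leI)
      finally show "measure lebesgue ((\<Union>i\<in>C. X i) \<union> ?N) \<le> e" by simp
    qed blast
  qed
  then have "negligible (\<Union>k::nat. ?B \<inter> ball 0 (real k))"
    by (intro negligible_countable_Union) auto
  moreover have "?B \<subseteq> (\<Union>k::nat. ?B \<inter> ball 0 (real k))"
    using reals_Archimedean2 by auto
  ultimately show ?thesis by (rule negligible_subset)
qed

text \<open>Lebesgue's differentiation theorem. Outside the exceptional sets of g and of -g for all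
  rational pairs r < R, the difference quotients at x are eventually below g x + e and above g x -
  e.\<close>

lemma AE_has_derivative_primitive:
  fixes p g :: "real \<Rightarrow> real"
  assumes g: "integrable lborel g"
    and p: "\<And>a b. a \<le> b \<Longrightarrow> (LINT y:{a..b}|lborel. g y) = p b - p a"
  shows "AE x in lborel. (p has_real_derivative g x) (at x)"
proof -
  let ?B = "\<lambda>g r R. {x. g x \<le> r \<and> (\<forall>d>0. \<exists>c \<rho>. 0 < \<rho> \<and> \<rho> < d \<and> x \<in> cball c \<rho> \<and>
           R * (2 * \<rho>) \<le> (LINT y:cball c \<rho>|lborel. g y))}"
  define J where "J = {(r, R). r \<in> \<rat> \<and> R \<in> \<rat> \<and> r < (R::real)}"
  have J: "countable J"
    by (rule countable_subset[of _ "\<rat> \<times> \<rat>"]) (auto simp: J_def intro: countable_rat)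
  define D where "D r R = ?B g r R \<union> ?B (\<lambda>x. - g x) r R" for r R
  define N where "N = (\<Union>(r, R)\<in>J. D r R)"
  have "negligible N"
    unfolding N_def
  proof (intro negligible_countable_Union countable_image J, clarify)
    fix r R assume "(r, R) \<in> J"
    then have "r < R" by (simp add: J_def)
    moreover have "integrable lborel (\<lambda>x. - g x)" using g by simp
    ultimately show "negligible (D r R)"
      unfolding D_def by (intro negligible_Un density_upper_negligible g)
  qed
  have upper: "\<exists>d>0. \<forall>y. y \<noteq> x \<and> \<bar>y - x\<bar> < d \<longrightarrow> (q y - q x) / (y - x) < h x + e"
    if x: "\<And>r R. (r, R) \<in> J \<Longrightarrow> x \<notin> ?B h r R"
      and q: "\<And>a b. a \<le> b \<Longrightarrow> (LINT y:{a..b}|lborel. h y) = q b - q a" and "0 < e"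
    for x e :: real and h q :: "real \<Rightarrow> real"
  proof -
    obtain R where R: "R \<in> \<rat>" "h x < R" "R < h x + e"
      using Rats_dense_in_real[of "h x" "h x + e"] \<open>0 < e\<close> by auto
    obtain r where r: "r \<in> \<rat>" "h x < r" "r < R"
      using Rats_dense_in_real[of "h x" R] R by auto
    have "x \<notin> ?B h r R" using x[of r R] R r by (auto simp: J_def)
    then have "\<not> (\<forall>d>0. \<exists>c \<rho>. 0 < \<rho> \<and> \<rho> < d \<and> x \<in> cball c \<rho> \<and>
        R * (2 * \<rho>) \<le> (LINT y:cball c \<rho>|lborel. h y))" using r by simp
    then obtain d where d0: "0 < d" and nex: "\<not> (\<exists>c \<rho>. 0 < \<rho> \<and> \<rho> < d \<and> x \<in> cball c \<rho> \<and>
        R * (2 * \<rho>) \<le> (LINT y:cball c \<rho>|lborel. h y))"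
      by blast
    have d: "(LINT y:cball c \<rho>|lborel. h y) < R * (2 * \<rho>)"
      if "0 < \<rho>" "\<rho> < d" "x \<in> cball c \<rho>" for c \<rho>
      using nex that by (intro not_le_imp_less notI) blast
    show ?thesis
    proof (intro exI[of _ d] conjI allI impI)
      fix y assume y: "y \<noteq> x \<and> \<bar>y - x\<bar> < d"
      \<comment> \<open>The interval between x and y is a closed ball of radius half its length with
        x on its rim.\<close>
      have cb: "cball ((x + y) / 2) (\<bar>y - x\<bar> / 2) = {min x y .. max x y}"
        by (auto simp: cball_eq_atLeastAtMost field_simps abs_if)
      have "(LINT u:{min x y .. max x y}|lborel. h u) < R * (2 * (\<bar>y - x\<bar> / 2))"
        unfolding cb[symmetric] using y by (intro d) (auto simp: dist_real_def abs_if field_simps)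
      then have "q (max x y) - q (min x y) < R * \<bar>y - x\<bar>"
        by (simp add: q)
      moreover have "(q y - q x) / (y - x) = (q (max x y) - q (min x y)) / \<bar>y - x\<bar>"
        using y by (cases "x \<le> y") (auto simp: min_def max_def abs_if field_simps)
      ultimately have "(q y - q x) / (y - x) < R"
        using y by (simp add: pos_divide_less_eq)
      then show "(q y - q x) / (y - x) < h x + e" using R by simp
    qed (rule d0)
  qed
  have "(p has_real_derivative g x) (at x)" if "x \<notin> N" for x
    unfolding has_field_derivative_iff LIM_eq
  proof (intro allI impI)
    fix e :: real assume "0 < e"
    have gx: "x \<notin> ?B g r R" and mgx: "x \<notin> ?B (\<lambda>x. - g x) r R" if "(r, R) \<in> J" for r R
    proof -
      have "x \<notin> D r R"
        using \<open>x \<notin> N\<close> that unfolding N_def by blast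
      then have "x \<notin> ?B g r R \<and> x \<notin> ?B (\<lambda>x. - g x) r R"
        unfolding D_def Un_iff de_Morgan_disj .
      then show "x \<notin> ?B g r R" "x \<notin> ?B (\<lambda>x. - g x) r R"
        by (rule conjunct1, rule conjunct2)
    qed
    have "\<exists>d>0. \<forall>y. y \<noteq> x \<and> \<bar>y - x\<bar> < d \<longrightarrow> (p y - p x) / (y - x) < g x + e"
      by (rule upper[OF gx p \<open>0 < e\<close>])
    then obtain d1 where d1: "0 < d1" "\<And>y. y \<noteq> x \<Longrightarrow> \<bar>y - x\<bar> < d1 \<Longrightarrow> (p y - p x) / (y - x) < g x + e"
      by blast

    have mp: "(LINT y:{a..b}|lborel. - g y) = (- p b) - (- p a)" if "a \<le> b" for a b
      using p[OF that] by (simp add: set_lebesgue_integral_def)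
    have "\<exists>d>0. \<forall>y. y \<noteq> x \<and> \<bar>y - x\<bar> < d \<longrightarrow> (- p y - - p x) / (y - x) < - g x + e"
      by (rule upper[OF mgx mp \<open>0 < e\<close>])
    then obtain d2 where d2: "0 < d2" "\<And>y. y \<noteq> x \<Longrightarrow> \<bar>y - x\<bar> < d2 \<Longrightarrow> (- p y - - p x) / (y - x) < - g x + e"
      by blast
    show "\<exists>s>0. \<forall>y. y \<noteq> x \<and> norm (y - x) < s \<longrightarrow> norm ((p y - p x) / (y - x) - g x) < e"
    proof (intro exI[of _ "min d1 d2"] conjI allI impI)
      fix y assume y: "y \<noteq> x \<and> norm (y - x) < min d1 d2"
      define Q where "Q = (p y - p x) / (y - x)"
      have "(- p y - - p x) / (y - x) = - Q"
        unfolding Q_def minus_divide_left by simp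
      moreover have "y \<noteq> x" "\<bar>y - x\<bar> < d1" "\<bar>y - x\<bar> < d2" using y by simp_all
      ultimately have "Q < g x + e" "- Q < - g x + e"
        using d1(2)[of y] d2(2)[of y] unfolding Q_def by simp_all
      then show "norm ((p y - p x) / (y - x) - g x) < e"
        unfolding Q_def[symmetric] real_norm_def by linarith
    qed (use d1 d2 in simp)
  qed
  \<comment> \<open>N is only known to be Lebesgue null, so the claim is moved to the completed
    measure.\<close>
  then show ?thesis
    using \<open>negligible N\<close> unfolding negligible_iff_null_sets
    by (subst AE_completion_iff[symmetric], intro AE_I'[of N]) auto
qed

lemma lipschitz_real_abs: "L-lipschitz_on UNIV p \<Longrightarrow> \<bar>p x - p y\<bar> \<le> L * \<bar>x - y\<bar>" for p :: "real \<Rightarrow> real"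
  using lipschitz_onD[of L UNIV p x y] by (simp add: dist_real_def)

text \<open>A Lipschitz p need not be monotone, so f = p + 2 M x is used: its slopes lie between M
  and 3 M, hence it is a homeomorphism that maps null sets to null sets. The measure A \<mapsto>
  |f(A)| then has a Radon-Nikodym density, and subtracting 2 M from it gives the density of
  p.\<close>

lemma lipschitz_density:
  fixes p :: "real \<Rightarrow> real"
  assumes p: "L-lipschitz_on UNIV p"
  shows "\<exists>g\<in>borel_measurable borel. \<forall>a b. a \<le> b \<longrightarrow>
    set_integrable lborel {a..b} g \<and> (LINT y:{a..b}|lborel. g y) = p b - p a"
proof -
  \<comment> \<open>The added 1 keeps the slope of f positive when L = 0.\<close>
  define M where "M = L + 1"
  have "0 \<le> L" using p by (rule lipschitz_on_nonneg)
  then have "0 < M" by (simp add: M_def)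
  have pM: "\<bar>p x - p y\<bar> \<le> M * \<bar>x - y\<bar>" for x y
    using lipschitz_real_abs[OF p, of x y] by (simp add: M_def distrib_right)
  define f where "f x = p x + 2 * M * x" for x
  have lo: "M * (y - x) \<le> f y - f x" and hi: "f y - f x \<le> 3 * M * (y - x)" if "x \<le> y" for x y
  proof -
    have "\<bar>x - y\<bar> = y - x" using that by simp
    then have "p x - p y \<le> M * (y - x)" "p y - p x \<le> M * (y - x)"
      using pM[of x y] by (simp_all only: abs_le_iff) linarith+
    then show "M * (y - x) \<le> f y - f x" "f y - f x \<le> 3 * M * (y - x)"
      by (simp_all add: f_def algebra_simps)
  qed
  have sm: "f x < f y" if "x < y" for x y
  proof -
    have "0 < M * (y - x)" using that \<open>0 < M\<close> by simp
    then show ?thesis using lo[of x y] that by linarith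
  qed
  then have inj: "inj f" by (intro linorder_injI) (simp add: less_imp_neq)
  have ff: "\<bar>f x - f y\<bar> \<le> 3 * M * \<bar>x - y\<bar>" for x y
    using hi[of x y] hi[of y x] lo[of x y] lo[of y x] \<open>0 < M\<close>
      mult_nonneg_nonneg[of M "y - x"] mult_nonneg_nonneg[of M "x - y"]
    by (cases "x \<le> y") (simp_all add: abs_le_iff)
  have cont: "continuous_on A f" for A
    by (rule lipschitz_on_continuous_on[of "3 * M"], rule lipschitz_onI)
       (use ff \<open>0 < M\<close> in \<open>auto simp: dist_real_def\<close>)
  have surj: "\<exists>x. f x = y" for y
  proof -
    define b where "b = \<bar>y - f 0\<bar> / M"
    have b: "0 \<le> b" "M * b = \<bar>y - f 0\<bar>" using \<open>0 < M\<close> by (auto simp: b_def)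
    have "f (-b) \<le> y" "y \<le> f b" using lo[of "-b" 0] lo[of 0 b] b by auto
    then show ?thesis using IVT'[of f "-b" y b] b cont by auto
  qed
  define q where "q = inv f"
  have fq: "f (q y) = y" for y unfolding q_def using surj[of y] by (intro f_inv_into_f) (metis rangeI)
  have qf: "q (f x) = x" for x using inj by (simp add: q_def)
  have qA: "q -` A = f ` A" for A
  proof (intro set_eqI iffI)
    fix y assume "y \<in> q -` A"
    then show "y \<in> f ` A" using imageI[of "q y" A f] by (simp add: fq)
  qed (auto simp: qf)
  have qmono: "mono q"
  proof (rule monoI, rule ccontr)
    fix x y :: real assume "x \<le> y" "\<not> q x \<le> q y"
    then show False using sm[of "q y" "q x"] fq by simp
  qed
  then have [measurable]: "q \<in> borel_measurable borel" by (rule borel_measurable_mono)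
  define \<nu> where "\<nu> = distr lborel borel q"
  have [simp, measurable_cong]: "sets \<nu> = sets borel" by (simp add: \<nu>_def)
  have \<nu>: "emeasure \<nu> A = emeasure lborel (f ` A)" if "A \<in> sets borel" for A
    using that by (simp add: \<nu>_def emeasure_distr qA)
  have "absolutely_continuous lborel \<nu>"
    unfolding absolutely_continuous_def
  proof
    fix A :: "real set" assume A: "A \<in> null_sets lborel"
    then have Ab: "A \<in> sets borel" by auto
    have "negligible A" using A null_sets_completionI by (auto simp: negligible_iff_null_sets)
    then have "negligible (f ` A)"
      by (rule negligible_locally_Lipschitz_image[rotated])
         (use ff in \<open>auto intro!: exI[of _ UNIV] exI[of _ "3 * M"] simp: abs_minus_commute\<close>)
    moreover have "f ` A \<in> sets borel"
    proof -
      have "q -` A \<inter> space borel \<in> sets borel" using Ab by measurable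
      then show ?thesis by (simp add: qA)
    qed
    ultimately have "emeasure lborel (f ` A) = 0"
      by (simp add: negligible_iff_null_sets null_sets_completion_iff null_setsD1)
    then show "A \<in> null_sets \<nu>" using \<nu>[OF Ab] Ab by auto
  qed
  then obtain k where k [measurable]: "k \<in> borel_measurable lborel" and k\<nu>: "density lborel k = \<nu>"
    using sigma_finite_measure.Radon_Nikodym[OF sigma_finite_lborel, of \<nu>] by auto
  have kint: "(\<integral>\<^sup>+x\<in>{a..b}. k x \<partial>lborel) = ennreal (f b - f a)" if "a \<le> b" for a b
  proof -
    have "f ` {a..b} = {f a..f b}"
    proof (rule set_eqI, rule iffI)
      fix y assume y: "y \<in> {f a..f b}"
      then have "a \<le> q y" "q y \<le> b" using monoD[OF qmono, of "f a" y] monoD[OF qmono, of y "f b"] by (auto simp: qf)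
      then show "y \<in> f ` {a..b}" using fq[of y] by (metis atLeastAtMost_iff image_eqI)
    next
      fix y assume "y \<in> f ` {a..b}"
      then show "y \<in> {f a..f b}" using sm by (force simp: le_less)
    qed
    moreover have "f a \<le> f b" using sm[of a b] that by (cases "a = b") auto
    ultimately show ?thesis
      using \<nu>[of "{a..b}"] by (simp add: k\<nu>[symmetric] emeasure_density)
  qed
  \<comment> \<open>Radon-Nikodym yields values in [0, \<infinity>]; finiteness almost everywhere,
    interval by interval, permits the passage to a real density.\<close>
  have kfin: "AE x in lborel. k x \<noteq> \<infinity>"
  proof -
    have "AE x in lborel. k x * indicator {-real n..real n} x \<noteq> \<infinity>" for n
      using kint[of "- real n" "real n"] by (intro nn_integral_noteq_infinite) auto
    then have "AE x in lborel. \<forall>n::nat. k x * indicator {-real n..real n} x \<noteq> \<infinity>"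
      by (simp add: AE_all_countable)
    then show ?thesis
    proof (rule AE_mp, intro AE_I2 impI)
      fix x assume *: "\<forall>n::nat. k x * indicator {-real n..real n} x \<noteq> \<infinity>"
      obtain n :: nat where "\<bar>x\<bar> \<le> real n" using real_arch_simple by blast
      then show "k x \<noteq> \<infinity>" using *[rule_format, of n] by (simp add: abs_le_iff)
    qed
  qed
  define g where "g x = enn2real (k x) - 2 * M" for x
  have [measurable]: "g \<in> borel_measurable borel" unfolding g_def by measurable
  show ?thesis
  proof (intro bexI[of _ g] allI impI)
    fix a b :: real assume ab: "a \<le> b"
    have nn: "(\<integral>\<^sup>+x. ennreal (indicator {a..b} x * enn2real (k x)) \<partial>lborel) = ennreal (f b - f a)"
      unfolding kint[OF ab, symmetric] using kfin
      by (intro nn_integral_cong_AE) (auto elim!: eventually_mono simp: indicator_def less_top)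
    have "0 \<le> M * (b - a)" using \<open>0 < M\<close> ab by simp
    then have fab: "0 \<le> f b - f a" using lo[OF ab] by linarith
    have 1: "has_bochner_integral lborel (\<lambda>x. indicator {a..b} x * enn2real (k x)) (f b - f a)"
      by (rule has_bochner_integral_nn_integral) (use nn fab in auto)
    have 2: "has_bochner_integral lborel (\<lambda>x. indicator {a..b} x * (2 * M)) ((b - a) * (2 * M))"
      using has_bochner_integral_real_indicator[of "{a..b}" lborel] ab
      by (intro has_bochner_integral_mult_left) auto
    have "has_bochner_integral lborel (\<lambda>x. indicator {a..b} x *\<^sub>R g x) (f b - f a - (b - a) * (2 * M))"
      using has_bochner_integral_diff[OF 1 2] by (simp add: g_def algebra_simps)
    then show "set_integrable lborel {a..b} g \<and> (LINT y:{a..b}|lborel. g y) = p b - p a"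
      by (simp add: set_integrable_def set_lebesgue_integral_def has_bochner_integral_iff f_def algebra_simps)
  qed measurable
qed

section \<open>Closure properties of Lipschitz functions\<close>

lemma lipschitz_clamp: "1-lipschitz_on UNIV (\<lambda>x::real. max a (min x b))"
  by (rule lipschitz_onI) (auto simp: dist_real_def abs_if max_def min_def)

lemma Lip_fun_obtain:
  assumes "p \<in> Lip_fun"
  obtains L where "0 \<le> L" "L-lipschitz_on UNIV p"
  using assms lipschitz_on_nonneg unfolding Lip_fun_def by blast

lemma Lip_funI: "L-lipschitz_on UNIV f \<Longrightarrow> f \<in> Lip_fun"
  by (auto simp: Lip_fun_def)

lemma Lip_fun_continuous: "f \<in> Lip_fun \<Longrightarrow> continuous_on A f"
  unfolding Lip_fun_def using lipschitz_on_continuous_on continuous_on_subset by blast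

lemma Lip_fun_measurable [measurable_dest]: "f \<in> Lip_fun \<Longrightarrow> f \<in> borel_measurable borel"
  by (intro borel_measurable_continuous_onI Lip_fun_continuous)

lemma Lip_fun_compose: "f \<in> Lip_fun \<Longrightarrow> g \<in> Lip_fun \<Longrightarrow> (\<lambda>x. f (g x)) \<in> Lip_fun" for g :: "_ \<Rightarrow> real"
proof -
  assume "f \<in> Lip_fun" "g \<in> Lip_fun"
  then obtain L M where "L-lipschitz_on UNIV f" "M-lipschitz_on UNIV g"
    by (auto simp: Lip_fun_def)
  then have "(L * M)-lipschitz_on UNIV (f \<circ> g)"
    by (intro lipschitz_on_compose) (auto intro: lipschitz_on_subset)
  then show ?thesis by (auto simp: Lip_fun_def o_def)
qed

lemma Lip_fun_lincomb: "f \<in> Lip_fun \<Longrightarrow> g \<in> Lip_fun \<Longrightarrow> (\<lambda>x. a * f x + b * g x) \<in> Lip_fun"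
proof -
  assume "f \<in> Lip_fun" "g \<in> Lip_fun"
  then obtain L M where "L-lipschitz_on UNIV f" "M-lipschitz_on UNIV g"
    by (auto simp: Lip_fun_def)
  then have "(\<bar>a\<bar> * L + \<bar>b\<bar> * M)-lipschitz_on UNIV (\<lambda>x. a *\<^sub>R f x + b *\<^sub>R g x)"
    by (intro lipschitz_on_add lipschitz_on_cmult)
  then show ?thesis by (auto simp: Lip_fun_def)
qed

lemma Lip_fun_const: "(\<lambda>_. c) \<in> Lip_fun"
  by (rule Lip_funI[of 0]) (auto intro!: lipschitz_onI)

lemma Lip_fun_mult:
  assumes "f \<in> Lip_fun" "g \<in> Lip_fun" "bounded (range f)" "bounded (range g)"
  shows "(\<lambda>x. f x * g x) \<in> Lip_fun"
proof -
  obtain L M where L: "L-lipschitz_on UNIV f" and M: "M-lipschitz_on UNIV g"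
    using assms by (auto simp: Lip_fun_def)
  obtain A B where A: "\<And>x. norm (f x) \<le> A" and B: "\<And>x. norm (g x) \<le> B"
    using assms(3,4) by (auto simp: bounded_iff)
  have A0: "0 \<le> A" using A norm_ge_zero order_trans by blast
  have B0: "0 \<le> B" using B norm_ge_zero order_trans by blast
  show ?thesis
  proof (rule Lip_funI[of "A * M + B * L"], rule lipschitz_onI)
    fix x y
    have "f x * g x - f y * g y = f x * (g x - g y) + g y * (f x - f y)"
      by (simp add: algebra_simps)
    then have "dist (f x * g x) (f y * g y) \<le> \<bar>f x\<bar> * \<bar>g x - g y\<bar> + \<bar>g y\<bar> * \<bar>f x - f y\<bar>"
      using abs_triangle_ineq[of "f x * (g x - g y)" "g y * (f x - f y)"]
      by (simp add: dist_real_def abs_mult)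
    also have "\<dots> \<le> A * (M * dist x y) + B * (L * dist x y)"
      using A[of x] B[of y] lipschitz_onD[OF L, of x y] lipschitz_onD[OF M, of x y] A0 B0
      by (intro add_mono mult_mono) (auto simp: dist_real_def)
    finally show "dist (f x * g x) (f y * g y) \<le> (A * M + B * L) * dist x y"
      by (simp add: algebra_simps)
  qed (use A0 B0 L M in \<open>auto intro!: add_nonneg_nonneg mult_nonneg_nonneg dest: lipschitz_on_nonneg\<close>)
qed

section \<open>Differentiability almost everywhere\<close>

lemma DERIV_transform_at:
  fixes f g :: "real \<Rightarrow> real"
  assumes "(f has_real_derivative D) (at x)" "0 < d" "\<And>y. dist y x < d \<Longrightarrow> f y = g y"
  shows "(g has_real_derivative D) (at x)"
  by (rule has_field_derivative_transform_within[OF assms(1,2)]) (use assms(3) in auto)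

lemma lipschitz_AE_derivative:
  fixes p :: "real \<Rightarrow> real"
  assumes p: "L-lipschitz_on UNIV p"
  shows "\<exists>g\<in>borel_measurable borel. AE x in lborel. (p has_real_derivative g x) (at x)"
proof -
  obtain g where g [measurable]: "g \<in> borel_measurable borel"
    and gi: "\<And>a b. a \<le> b \<Longrightarrow> set_integrable lborel {a..b} g"
    and gp: "\<And>a b. a \<le> b \<Longrightarrow> (LINT y:{a..b}|lborel. g y) = p b - p a"
    using lipschitz_density[OF p] by blast
  have "AE x in lborel. \<bar>x\<bar> < real n \<longrightarrow> (p has_real_derivative g x) (at x)" for n
  proof -
    define N where "N = real n"
    have N: "0 \<le> N" by (simp add: N_def)
    define h where "h x = indicator {-N..N} x * g x" for x
    define r where "r x = p (max (-N) (min x N))" for x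
    have h: "integrable lborel h"
      using gi[of "-N" N] N by (simp add: h_def[abs_def] set_integrable_def)
    have hr: "(LINT y:{a..b}|lborel. h y) = r b - r a" if "a \<le> b" for a b
    proof (cases "max a (-N) \<le> min b N")
      case True
      have "(LINT y:{a..b}|lborel. h y) = (LINT y:{max a (-N)..min b N}|lborel. g y)"
        unfolding set_lebesgue_integral_def h_def
        by (intro Bochner_Integration.integral_cong) (auto simp: indicator_def)
      also have "\<dots> = p (min b N) - p (max a (-N))" using gp[OF True] .
      also have "\<dots> = r b - r a"
        using True N that unfolding r_def by (intro arg_cong2[where f="\<lambda>u v. p u - p v"]) auto
      finally show ?thesis .
    next
      case False
      have "(LINT y:{a..b}|lborel. h y) = (LINT y:{}|lborel. g y)"
        unfolding set_lebesgue_integral_def h_def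
        using False by (intro Bochner_Integration.integral_cong) (auto simp: indicator_def)
      moreover have "max (-N) (min a N) = max (-N) (min b N)"
        using False N that by auto
      ultimately show ?thesis by (simp add: r_def set_lebesgue_integral_def)
    qed
    have "AE x in lborel. (r has_real_derivative h x) (at x)"
      by (rule AE_has_derivative_primitive[OF h]) (rule hr)
    then show ?thesis
    proof (rule AE_mp, intro AE_I2 impI)
      fix x assume D: "(r has_real_derivative h x) (at x)" and x: "\<bar>x\<bar> < real n"
      have "h x = g x" using x by (simp add: h_def N_def indicator_def abs_less_iff)
      moreover have "(p has_real_derivative h x) (at x)"
        by (rule DERIV_transform_at[OF D, of "N - \<bar>x\<bar>"])
           (use x in \<open>auto simp: r_def N_def dist_real_def max_def min_def abs_if split: if_splits\<close>)
      ultimately show "(p has_real_derivative g x) (at x)" by simp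
    qed
  qed
  then have "AE x in lborel. \<forall>n. \<bar>x\<bar> < real n \<longrightarrow> (p has_real_derivative g x) (at x)"
    unfolding AE_all_countable ..
  then have "AE x in lborel. (p has_real_derivative g x) (at x)"
    by (rule eventually_mono) (use reals_Archimedean2 in blast)
  then show ?thesis using g by blast
qed

text \<open>A Borel version of the derivative, meaningful for Lipschitz functions only.\<close>

definition lderiv :: "(real \<Rightarrow> real) \<Rightarrow> real \<Rightarrow> real" where
  "lderiv p = (SOME g. g \<in> borel_measurable borel \<and>
     (AE x in lborel. (p has_real_derivative g x) (at x)) \<and>
     (\<forall>x. g x \<noteq> 0 \<longrightarrow> (p has_real_derivative g x) (at x)))"

text \<open>Setting the derivative to 0 on a Borel null set that contains the exceptional points
  makes the third property true at every x. It gives \<open>lderiv_bound\<close> and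
  \<open>lderiv_local_const\<close> pointwise instead of almost everywhere.\<close>

lemma lderiv_props:
  assumes "p \<in> Lip_fun"
  shows lderiv_measurable: "lderiv p \<in> borel_measurable borel"
    and lderiv_AE: "AE x in lborel. (p has_real_derivative lderiv p x) (at x)"
    and lderiv_nonzero: "lderiv p x \<noteq> 0 \<Longrightarrow> (p has_real_derivative lderiv p x) (at x)"
proof -
  obtain L where "L-lipschitz_on UNIV p" using assms by (auto simp: Lip_fun_def)
  then obtain g where g [measurable]: "g \<in> borel_measurable borel"
    and D: "AE x in lborel. (p has_real_derivative g x) (at x)"
    using lipschitz_AE_derivative by blast
  obtain N where N: "{x \<in> space lborel. \<not> (p has_real_derivative g x) (at x)} \<subseteq> N"
    "emeasure lborel N = 0" "N \<in> sets lborel" using D by (rule AE_E)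
  then have [measurable]: "N \<in> sets borel" by simp
  have "AE x in lborel. x \<notin> N" using N by (intro AE_not_in) auto
  then have "AE x in lborel. (p has_real_derivative g x * indicator (-N) x) (at x)"
    using N by (auto elim!: eventually_mono)
  moreover have "(\<lambda>x. g x * indicator (-N) x) \<in> borel_measurable borel" by measurable
  moreover have "\<forall>x. g x * indicator (-N) x \<noteq> 0 \<longrightarrow> (p has_real_derivative g x * indicator (-N) x) (at x)"
    using N by (auto simp: indicator_def)
  ultimately have "\<exists>g. g \<in> borel_measurable borel \<and>
     (AE x in lborel. (p has_real_derivative g x) (at x)) \<and>
     (\<forall>x. g x \<noteq> 0 \<longrightarrow> (p has_real_derivative g x) (at x))"
    by (intro exI[of _ "\<lambda>x. g x * indicator (-N) x"] conjI)
  from someI_ex[OF this]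
  show "lderiv p \<in> borel_measurable borel" "AE x in lborel. (p has_real_derivative lderiv p x) (at x)"
    "lderiv p x \<noteq> 0 \<Longrightarrow> (p has_real_derivative lderiv p x) (at x)"
    unfolding lderiv_def[symmetric] by blast+
qed

lemma lipschitz_derivative_bound:
  fixes p :: "real \<Rightarrow> real"
  assumes p: "L-lipschitz_on UNIV p" and D: "(p has_real_derivative d) (at x)"
  shows "\<bar>d\<bar> \<le> L"
proof (rule tendsto_upperbound[OF tendsto_rabs[OF D[unfolded has_field_derivative_iff]]])
  show "\<forall>\<^sub>F y in at x. \<bar>(p y - p x) / (y - x)\<bar> \<le> L"
    using lipschitz_real_abs[OF p]
    by (auto simp: eventually_at_filter abs_divide pos_divide_le_eq intro!: always_eventually)
qed simp

lemma lderiv_bound: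
  assumes p: "L-lipschitz_on UNIV p"
  shows "\<bar>lderiv p x\<bar> \<le> L"
proof (cases "lderiv p x = 0")
  case False
  then show ?thesis
    using lipschitz_derivative_bound[OF p] lderiv_nonzero[OF Lip_funI[OF p]] by blast
qed (use lipschitz_on_nonneg[OF p] in simp)

lemma lderiv_eq:
  assumes "p \<in> Lip_fun" "\<And>x. x \<in> S \<Longrightarrow> (p has_real_derivative d x) (at x)"
  shows "AE x in lborel. x \<in> S \<longrightarrow> lderiv p x = d x"
  using lderiv_AE[OF assms(1)] by (rule eventually_mono) (use assms(2) DERIV_unique in blast)

lemma lderiv_lincomb:
  assumes p: "p \<in> Lip_fun" and q: "q \<in> Lip_fun"
  shows "AE x in lborel. lderiv (\<lambda>x. a * p x + b * q x) x = a * lderiv p x + b * lderiv q x"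
  using lderiv_AE[OF p] lderiv_AE[OF q] lderiv_AE[OF Lip_fun_lincomb[OF p q, of a b]]
proof eventually_elim
  case (elim x)
  have "((\<lambda>x. a * p x + b * q x) has_real_derivative a * lderiv p x + b * lderiv q x) (at x)"
    using elim(1,2) by (auto intro!: derivative_eq_intros)
  then show ?case using elim(3) DERIV_unique by blast
qed

lemma lderiv_local_const:
  assumes p: "p \<in> Lip_fun" and ev: "eventually (\<lambda>y. p y = c) (nhds x)"
  shows "lderiv p x = 0"
proof (rule ccontr)
  assume *: "lderiv p x \<noteq> 0"
  have "((\<lambda>_. c) has_real_derivative lderiv p x) (at x)"
    using DERIV_cong_ev[OF refl ev refl] lderiv_nonzero[OF p *] by blast
  then show False using * DERIV_const DERIV_unique by blast
qed

lemma lderiv_set_integrable: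
  assumes p: "p \<in> Lip_fun" and f: "f \<in> borel_measurable borel" and "\<And>x. x \<in> {a..b} \<Longrightarrow> \<bar>f x\<bar> \<le> C"
  shows "set_integrable lborel {a..b} (\<lambda>x. f x * lderiv p x)"
proof -
  obtain L where L: "0 \<le> L" "L-lipschitz_on UNIV p" using p by (rule Lip_fun_obtain)
  have [measurable]: "lderiv p \<in> borel_measurable borel" using p by (rule lderiv_measurable)
  note f [measurable]
  show ?thesis
    unfolding set_integrable_def
  proof (rule Bochner_Integration.integrable_bound)
    show "integrable lborel (\<lambda>x. indicator {a..b} x * (C * L))"
      by (intro integrable_mult_left integrable_real_indicator) (auto simp: emeasure_lborel_Icc_eq)
    show "AE x in lborel. norm (indicator {a..b} x *\<^sub>R (f x * lderiv p x)) \<le> norm (indicator {a..b} x * (C * L))"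
    proof (intro AE_I2)
      fix x :: real
      have "\<bar>f x\<bar> * \<bar>lderiv p x\<bar> \<le> \<bar>C * L\<bar>" if "x \<in> {a..b}"
        using assms(3)[OF that] lderiv_bound[OF L(2), of x] L
        by (intro order_trans[OF mult_mono abs_ge_self]) auto
      then show "norm (indicator {a..b} x *\<^sub>R (f x * lderiv p x)) \<le> norm (indicator {a..b} x * (C * L))"
        by (auto simp: indicator_def abs_mult)
    qed
  qed measurable
qed

text \<open>The formula holds for some density g by \<open>lipschitz_density\<close>.
  Differentiating the primitive of g shows that g is the derivative almost everywhere on [a, b],
  hence equals \<open>lderiv p\<close> there.\<close>

lemma lderiv_FTC:
  assumes p: "p \<in> Lip_fun" and "a \<le> b"
  shows "(LINT x:{a..b}|lborel. lderiv p x) = p b - p a"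
proof -
  obtain L where L: "L-lipschitz_on UNIV p" using p by (auto simp: Lip_fun_def)
  obtain g where g [measurable]: "g \<in> borel_measurable borel"
    and gi: "\<And>a b. a \<le> b \<Longrightarrow> set_integrable lborel {a..b} g"
    and gp: "\<And>a b. a \<le> b \<Longrightarrow> (LINT y:{a..b}|lborel. g y) = p b - p a"
    using lipschitz_density[OF L] by blast
  have [measurable]: "lderiv p \<in> borel_measurable borel" using p by (rule lderiv_measurable)
  let ?r = "\<lambda>x. p (max a (min x b))"
  define h where "h x = indicator {a..b} x * g x" for x
  have h: "integrable lborel h"
    using gi[OF \<open>a \<le> b\<close>] by (simp add: h_def[abs_def] set_integrable_def)
  have hr: "(LINT y:{c..d}|lborel. h y) = ?r d - ?r c" if "c \<le> d" for c d
  proof (cases "max c a \<le> min d b")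
    case True
    have "(LINT y:{c..d}|lborel. h y) = (LINT y:{max c a..min d b}|lborel. g y)"
      unfolding set_lebesgue_integral_def h_def
      by (intro Bochner_Integration.integral_cong) (auto simp: indicator_def)
    also have "\<dots> = p (min d b) - p (max c a)" using gp[OF True] .
    also have "\<dots> = ?r d - ?r c"
      using True that \<open>a \<le> b\<close> by (intro arg_cong2[where f="\<lambda>u v. p u - p v"]) auto
    finally show ?thesis .
  next
    case False
    have "(LINT y:{c..d}|lborel. h y) = (LINT y:{}|lborel. g y)"
      unfolding set_lebesgue_integral_def h_def
      using False by (intro Bochner_Integration.integral_cong) (auto simp: indicator_def)
    moreover have "max a (min c b) = max a (min d b)" using False that \<open>a \<le> b\<close> by auto
    ultimately show ?thesis by (simp add: set_lebesgue_integral_def)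
  qed
  have Dr: "AE x in lborel. (?r has_real_derivative h x) (at x)"
    by (rule AE_has_derivative_primitive[OF h]) (rule hr)
  have "AE x in lborel. x \<noteq> a \<and> x \<noteq> b"
    by (intro AE_conjI AE_lborel_singleton)
  then have "AE x in lborel. indicator {a..b} x *\<^sub>R lderiv p x = indicator {a..b} x *\<^sub>R g x"
    using Dr lderiv_AE[OF p]
  proof eventually_elim
    case (elim x)
    show ?case
    proof (cases "a < x \<and> x < b")
      case True
      have "(p has_real_derivative h x) (at x)"
        by (rule DERIV_transform_at[OF elim(2), of "min (x - a) (b - x)"])
           (use True in \<open>auto simp: dist_real_def max_def min_def abs_if split: if_splits\<close>)
      then have "h x = lderiv p x" using elim(3) DERIV_unique by blast
      then show ?thesis using True by (simp add: h_def)
    qed (use elim in \<open>auto simp: indicator_def\<close>)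
  qed
  then have "(LINT x:{a..b}|lborel. lderiv p x) = (LINT x:{a..b}|lborel. g x)"
    unfolding set_lebesgue_integral_def by (intro integral_cong_AE) auto
  then show ?thesis using gp[OF \<open>a \<le> b\<close>] by simp
qed

section \<open>Integration by parts, weak limits and smooth approximation\<close>

lemma Lip_fun_bounded_on_interval:
  fixes p :: "real \<Rightarrow> real"
  assumes "p \<in> Lip_fun"
  obtains C where "\<And>x. x \<in> {a..b} \<Longrightarrow> \<bar>p x\<bar> \<le> C"
proof -
  have "bounded (p ` {a..b})"
    by (intro compact_imp_bounded compact_continuous_image Lip_fun_continuous assms compact_Icc)
  then obtain C where "\<forall>x\<in>p ` {a..b}. norm x \<le> C" unfolding bounded_iff by blast
  then show thesis using that[of C] by simp
qed

lemma lderiv_by_parts: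
  assumes p: "p \<in> Lip_fun" and q: "q \<in> Lip_fun" and ab: "a \<le> b"
  shows "(LINT x:{a..b}|lborel. q x * lderiv p x) =
    q b * p b - q a * p a - (LINT x:{a..b}|lborel. p x * lderiv q x)"
proof -
  let ?c = "\<lambda>x. max a (min x b)"
  have c: "?c \<in> Lip_fun" by (rule Lip_funI[OF lipschitz_clamp])
  have cr: "?c x \<in> {a..b}" for x using ab by auto
  obtain C where C: "\<And>x. x \<in> {a..b} \<Longrightarrow> \<bar>p x\<bar> \<le> C" using Lip_fun_bounded_on_interval[OF p] by blast
  obtain D where D: "\<And>x. x \<in> {a..b} \<Longrightarrow> \<bar>q x\<bar> \<le> D" using Lip_fun_bounded_on_interval[OF q] by blast
  \<comment> \<open>The product of unbounded Lipschitz functions may fail to be Lipschitz; clamping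
    the argument to [a, b] makes both factors bounded.\<close>
  define r where "r x = q (?c x) * p (?c x)" for x
  have r: "r \<in> Lip_fun"
    unfolding r_def
  proof (intro Lip_fun_mult Lip_fun_compose[OF p c] Lip_fun_compose[OF q c])
    show "bounded (range (\<lambda>x. q (?c x)))" "bounded (range (\<lambda>x. p (?c x)))"
      using C[OF cr] D[OF cr] unfolding bounded_iff by auto
  qed
  have [measurable]: "p \<in> borel_measurable borel" "q \<in> borel_measurable borel"
    "lderiv p \<in> borel_measurable borel" "lderiv q \<in> borel_measurable borel" "lderiv r \<in> borel_measurable borel"
    using p q r by (auto intro: lderiv_measurable Lip_fun_measurable)
  have "AE x in lborel. x \<noteq> a \<and> x \<noteq> b"
    by (intro AE_conjI AE_lborel_singleton)
  then have "AE x in lborel. indicator {a..b} x *\<^sub>R lderiv r x =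
      indicator {a..b} x *\<^sub>R (q x * lderiv p x + p x * lderiv q x)"
    using lderiv_AE[OF p] lderiv_AE[OF q] lderiv_AE[OF r]
  proof eventually_elim
    case (elim x)
    show ?case
    proof (cases "a < x \<and> x < b")
      case True
      have "((\<lambda>x. q x * p x) has_real_derivative (q x * lderiv p x + p x * lderiv q x)) (at x)"
        using elim(2,3) by (auto intro!: derivative_eq_intros)
      then have "(r has_real_derivative (q x * lderiv p x + p x * lderiv q x)) (at x)"
        by (rule DERIV_transform_at[of _ _ _ "min (x - a) (b - x)"])
           (use True in \<open>auto simp: r_def dist_real_def max_def min_def abs_if split: if_splits\<close>)
      then show ?thesis using elim(4) DERIV_unique by fastforce
    qed (use elim in \<open>auto simp: indicator_def\<close>)
  qed
  then have "(LINT x:{a..b}|lborel. lderiv r x) = (LINT x:{a..b}|lborel. q x * lderiv p x + p x * lderiv q x)"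
    unfolding set_lebesgue_integral_def by (intro integral_cong_AE) auto
  also have "\<dots> = (LINT x:{a..b}|lborel. q x * lderiv p x) + (LINT x:{a..b}|lborel. p x * lderiv q x)"
    by (intro set_integral_add lderiv_set_integrable[OF p _ D] lderiv_set_integrable[OF q _ C]) auto
  finally show ?thesis
    using lderiv_FTC[OF r ab] ab by (simp add: r_def)
qed

text \<open>Pointwise limits with a common Lipschitz constant give no pointwise convergence of the
  derivatives. Integration by parts moves the derivative to the fixed factor q, where dominated
  convergence applies. This is the continuity axiom for integration along an edge.\<close>

lemma lderiv_weak_limit:
  fixes p :: "nat \<Rightarrow> real \<Rightarrow> real"
  assumes p: "\<And>n. L-lipschitz_on UNIV (p n)" and lim: "\<And>x. (\<lambda>n. p n x) \<longlonglongrightarrow> p' x"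
    and p': "p' \<in> Lip_fun" and q: "q \<in> Lip_fun" and ab: "a \<le> b"
  shows "(\<lambda>n. LINT x:{a..b}|lborel. q x * lderiv (p n) x) \<longlonglongrightarrow> (LINT x:{a..b}|lborel. q x * lderiv p' x)"
proof -
  have pn: "p n \<in> Lip_fun" for n using p by (rule Lip_funI)
  have [measurable]: "p n \<in> borel_measurable borel" "p' \<in> borel_measurable borel"
    "lderiv q \<in> borel_measurable borel" for n
    using pn q p' by (auto intro: lderiv_measurable Lip_fun_measurable)
  obtain M where M: "0 \<le> M" "M-lipschitz_on UNIV q" using q by (rule Lip_fun_obtain)
  have L0: "0 \<le> L" using p lipschitz_on_nonneg by blast
  obtain B where B: "\<And>n. \<bar>p n a\<bar> \<le> B"
    using convergent_imp_Bseq[OF convergentI[OF lim[of a]]] by (auto simp: Bseq_def)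
  have bound: "\<bar>p n x\<bar> \<le> B + L * (b - a)" if "x \<in> {a..b}" for n x
  proof -
    have "\<bar>p n x - p n a\<bar> \<le> L * \<bar>x - a\<bar>" using p by (rule lipschitz_real_abs)
    also have "\<dots> \<le> L * (b - a)" using that L0 by (intro mult_left_mono) auto
    finally show ?thesis using B[of n] by linarith
  qed
  have "(\<lambda>n. LINT x:{a..b}|lborel. p n x * lderiv q x) \<longlonglongrightarrow> (LINT x:{a..b}|lborel. p' x * lderiv q x)"
    unfolding set_lebesgue_integral_def
  proof (rule integral_dominated_convergence[where w="\<lambda>x. indicator {a..b} x * ((B + L * (b - a)) * M)"])
    show "integrable lborel (\<lambda>x. indicator {a..b} x * ((B + L * (b - a)) * M))"
      by (intro integrable_mult_left integrable_real_indicator) (auto simp: emeasure_lborel_Icc_eq)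
    show "AE x in lborel. (\<lambda>n. indicator {a..b} x *\<^sub>R (p n x * lderiv q x)) \<longlonglongrightarrow> indicator {a..b} x *\<^sub>R (p' x * lderiv q x)"
      by (intro AE_I2 tendsto_intros lim)
    show "AE x in lborel. norm (indicator {a..b} x *\<^sub>R (p n x * lderiv q x)) \<le> indicator {a..b} x * ((B + L * (b - a)) * M)" for n
    proof (intro AE_I2)
      fix x
      have "\<bar>p n x\<bar> * \<bar>lderiv q x\<bar> \<le> (B + L * (b - a)) * M" if "x \<in> {a..b}"
        using bound[OF that, of n] lderiv_bound[OF M(2), of x] by (intro mult_mono) auto
      then show "norm (indicator {a..b} x *\<^sub>R (p n x * lderiv q x)) \<le> indicator {a..b} x * ((B + L * (b - a)) * M)"
        by (auto simp: indicator_def abs_mult)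
    qed
  qed measurable
  then have "(\<lambda>n. q b * p n b - q a * p n a - (LINT x:{a..b}|lborel. p n x * lderiv q x)) \<longlonglongrightarrow>
      q b * p' b - q a * p' a - (LINT x:{a..b}|lborel. p' x * lderiv q x)"
    by (intro tendsto_intros lim)
  then show ?thesis
    by (simp add: lderiv_by_parts[OF pn q ab] lderiv_by_parts[OF p' q ab])
qed

lemma continuous_antiderivative:
  fixes p :: "real \<Rightarrow> real"
  assumes pc: "\<And>A. continuous_on A p"
  shows "\<exists>F. \<forall>x. (F has_real_derivative p x) (at x)"
proof -
  define F where "F x = integral {0..x} p - integral {x..0} p" for x
  have "(F has_real_derivative p x) (at x)" for x
  proof -
    \<comment> \<open>A base point to the left of both x and 0, so that near x the function F is one
      integral minus a constant.\<close>
    define A where "A = min x 0 - 1"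
    have int: "p integrable_on {c..d}" for c d by (rule integrable_continuous_interval[OF pc])
    have eq: "F y = integral {A..y} p - integral {A..0} p" if "A < y" for y
    proof (cases "0 \<le> y")
      case True
      have "integral {A..0} p + integral {0..y} p = integral {A..y} p"
        using True by (intro Henstock_Kurzweil_Integration.integral_combine int) (auto simp: A_def)
      moreover have "integral {y..0} p = 0" using True by (cases "y = 0") auto
      ultimately show ?thesis by (simp add: F_def)
    next
      case False
      have "integral {A..y} p + integral {y..0} p = integral {A..0} p"
        using False that by (intro Henstock_Kurzweil_Integration.integral_combine int) auto
      then show ?thesis using False by (simp add: F_def)
    qed
    have "((\<lambda>y. integral {A..y} p) has_vector_derivative p x) (at x within {A..x + 1})"
      by (rule integral_has_vector_derivative[OF pc]) (auto simp: A_def)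
    then have "((\<lambda>y. integral {A..y} p) has_real_derivative p x) (at x)"
      using at_within_Icc_at[of A x "x + 1"]
      by (simp add: has_real_derivative_iff_has_vector_derivative A_def)
    then have "((\<lambda>y. integral {A..y} p - integral {A..0} p) has_real_derivative p x) (at x)"
      by (auto intro!: derivative_eq_intros)
    then show ?thesis
      by (rule DERIV_transform_at[of _ _ _ 1]) (auto simp: dist_real_def A_def eq)
  qed
  then show ?thesis by blast
qed

text \<open>By averaging over shrinking intervals.\<close>

lemma lipschitz_C11_approximation:
  fixes p :: "real \<Rightarrow> real"
  assumes p: "L-lipschitz_on UNIV p"
  obtains P :: "nat \<Rightarrow> real \<Rightarrow> real" and P' :: "nat \<Rightarrow> real \<Rightarrow> real"
  where "\<And>n. L-lipschitz_on UNIV (P n)" "\<And>n x. (P n has_real_derivative P' n x) (at x)"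
    "\<And>n. P' n \<in> Lip_fun" "\<And>x. (\<lambda>n. P n x) \<longlonglongrightarrow> p x"
    "AE x in lborel. (\<lambda>n. P' n x) \<longlonglongrightarrow> lderiv p x" "\<And>n x. \<bar>P' n x\<bar> \<le> L"
proof -
  have L0: "0 \<le> L" using p by (rule lipschitz_on_nonneg)
  have pa: "\<bar>p x - p y\<bar> \<le> L * \<bar>x - y\<bar>" for x y using p by (rule lipschitz_real_abs)
  have pc: "continuous_on A p" for A by (rule Lip_fun_continuous[OF Lip_funI[OF p]])
  define h where "h n = inverse (real (Suc n))" for n
  have h0: "0 < h n" for n by (simp add: h_def)
  have hlim: "h \<longlonglongrightarrow> 0" unfolding h_def by (rule LIMSEQ_inverse_real_of_nat)
  obtain F where F: "(F has_real_derivative p x) (at x)" for x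
    using continuous_antiderivative[OF pc] by blast
  \<comment> \<open>The mean of p over [x, x + h n]. Its derivative is a difference quotient of p:
    bounded by L, Lipschitz for fixed n, and convergent wherever p is differentiable.\<close>
  define P where "P n x = (F (x + h n) - F x) / h n" for n x
  define P' where "P' n x = (p (x + h n) - p x) / h n" for n x
  have DP: "(P n has_real_derivative P' n x) (at x)" for n x
  proof -
    have "((\<lambda>x. F (x + h n)) has_real_derivative p (x + h n)) (at x)"
      using DERIV_shift[of F "p (x + h n)" x "h n"] F by simp
    then show ?thesis
      unfolding P_def P'_def using F h0[of n] by (auto intro!: derivative_eq_intros)
  qed
  have bP': "\<bar>P' n x\<bar> \<le> L" for n x
    using pa[of "x + h n" x] h0[of n] by (simp add: P'_def abs_divide pos_divide_le_eq)
  have 1: "L-lipschitz_on UNIV (P n)" for n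
  proof (rule lipschitz_onI)
    fix x y
    show "dist (P n x) (P n y) \<le> L * dist x y"
      using field_differentiable_bound[of UNIV "P n" "P' n" L x y] DP bP' by (simp add: dist_real_def)
  qed (rule L0)
  have 2: "P' n \<in> Lip_fun" for n
  proof -
    have "(\<lambda>x. p (x + h n)) \<in> Lip_fun"
    proof (rule Lip_funI[of L], rule lipschitz_onI)
      show "dist (p (x + h n)) (p (y + h n)) \<le> L * dist x y" for x y
        using pa[of "x + h n" "y + h n"] by (simp add: dist_real_def)
    qed (rule L0)
    then have "(\<lambda>x. inverse (h n) * p (x + h n) + (- inverse (h n)) * p x) \<in> Lip_fun"
      by (intro Lip_fun_lincomb Lip_funI[OF p])
    then show ?thesis
      by (simp add: P'_def[abs_def] divide_inverse algebra_simps)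
  qed
  have quot: "(\<lambda>n. (q (x + h n) - q x) / h n) \<longlonglongrightarrow> d" if "(q has_real_derivative d) (at x)" for q d x
  proof -
    have "((\<lambda>t. (q (x + t) - q x) / t) \<longlongrightarrow> d) (at 0)" using that by (simp add: DERIV_def)
    moreover have "filterlim h (at 0) sequentially"
      using hlim h0 by (intro filterlim_atI) (auto simp: less_imp_neq[symmetric])
    ultimately show ?thesis by (rule filterlim_compose)
  qed
  show thesis
  proof (rule that[OF 1 DP 2 _ _ bP'])
    show "(\<lambda>n. P n x) \<longlonglongrightarrow> p x" for x unfolding P_def by (rule quot[OF F])
    show "AE x in lborel. (\<lambda>n. P' n x) \<longlonglongrightarrow> lderiv p x"
      unfolding P'_def using lderiv_AE[OF Lip_funI[OF p]] by eventually_elim (rule quot)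
  qed
qed

lemma tendsto_zero_abs_le: "(\<And>n::nat. \<bar>f n\<bar> \<le> g n) \<Longrightarrow> g \<longlonglongrightarrow> 0 \<Longrightarrow> f \<longlonglongrightarrow> (0::real)"
  by (rule Lim_null_comparison[of f g]) auto

section \<open>Metric currents of dimension 1\<close>

lemma bLip_funI: "L-lipschitz_on UNIV f \<Longrightarrow> (\<And>x. \<bar>f x\<bar> \<le> C) \<Longrightarrow> f \<in> bLip_fun"
  unfolding bLip_fun_def bounded_iff real_norm_def using Lip_funI by blast

lemma bLip_Lip [intro]: "f \<in> bLip_fun \<Longrightarrow> f \<in> Lip_fun"
  by (simp add: bLip_fun_def)

lemma bLip_measurable [measurable_dest]: "f \<in> bLip_fun \<Longrightarrow> f \<in> borel_measurable borel"
  by (rule Lip_fun_measurable[OF bLip_Lip])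

lemma bLip_fun_bounded:
  assumes "f \<in> bLip_fun"
  shows "\<exists>C\<ge>0. \<forall>x. \<bar>f x\<bar> \<le> C"
proof -
  obtain C where C: "\<And>x. \<bar>f x\<bar> \<le> C" using assms by (auto simp: bLip_fun_def bounded_iff)
  have "0 \<le> C" using C[of undefined] by linarith
  then show ?thesis using C by blast
qed

lemma bLip_funI2: "f \<in> Lip_fun \<Longrightarrow> (\<And>x. \<bar>f x\<bar> \<le> C) \<Longrightarrow> f \<in> bLip_fun"
  unfolding bLip_fun_def bounded_iff real_norm_def by blast

lemma bLip_fun_const [intro, simp]: "(\<lambda>_. c) \<in> bLip_fun"
  by (rule bLip_funI2[OF Lip_fun_const]) (rule order_refl)

lemma bLip_fun_lincomb:
  assumes "f \<in> bLip_fun" "g \<in> bLip_fun"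
  shows "(\<lambda>x. a * f x + b * g x) \<in> bLip_fun"
proof -
  obtain C where C: "\<And>x. \<bar>f x\<bar> \<le> C" using bLip_fun_bounded[OF assms(1)] by blast
  obtain D where D: "\<And>x. \<bar>g x\<bar> \<le> D" using bLip_fun_bounded[OF assms(2)] by blast
  show ?thesis
  proof (rule bLip_funI2)
    fix x
    have "\<bar>a * f x + b * g x\<bar> \<le> \<bar>a\<bar> * \<bar>f x\<bar> + \<bar>b\<bar> * \<bar>g x\<bar>"
      using abs_triangle_ineq[of "a * f x" "b * g x"] by (simp add: abs_mult)
    also have "\<dots> \<le> \<bar>a\<bar> * C + \<bar>b\<bar> * D" using C D by (intro add_mono mult_left_mono) auto
    finally show "\<bar>a * f x + b * g x\<bar> \<le> \<bar>a\<bar> * C + \<bar>b\<bar> * D" .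
  qed (use assms in \<open>auto intro: Lip_fun_lincomb\<close>)
qed

lemma bLip_fun_add: "f \<in> bLip_fun \<Longrightarrow> g \<in> bLip_fun \<Longrightarrow> (\<lambda>x. f x + g x) \<in> bLip_fun"
  using bLip_fun_lincomb[of f g 1 1] by simp

lemma bLip_fun_diff: "f \<in> bLip_fun \<Longrightarrow> g \<in> bLip_fun \<Longrightarrow> (\<lambda>x. f x - g x) \<in> bLip_fun"
  using bLip_fun_lincomb[of f g 1 "-1"] by simp

lemma bLip_fun_cmult: "f \<in> bLip_fun \<Longrightarrow> (\<lambda>x. c * f x) \<in> bLip_fun"
  using bLip_fun_lincomb[of f f c 0] by simp

lemma bLip_fun_mult:
  assumes "f \<in> bLip_fun" "g \<in> bLip_fun"
  shows "(\<lambda>x. f x * g x) \<in> bLip_fun"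
proof -
  obtain C where C: "0 \<le> C" "\<And>x. \<bar>f x\<bar> \<le> C" using bLip_fun_bounded[OF assms(1)] by blast
  obtain D where D: "0 \<le> D" "\<And>x. \<bar>g x\<bar> \<le> D" using bLip_fun_bounded[OF assms(2)] by blast
  show ?thesis
  proof (rule bLip_funI2)
    show "\<bar>f x * g x\<bar> \<le> C * D" for x
      using C D by (simp add: abs_mult mult_mono)
  qed (use assms in \<open>auto intro!: Lip_fun_mult simp: bLip_fun_def\<close>)
qed

lemma bLip_fun_sum: "(\<And>i. i \<in> I \<Longrightarrow> f i \<in> bLip_fun) \<Longrightarrow> (\<lambda>x. \<Sum>i\<in>I. f i x) \<in> bLip_fun"
  by (induction I rule: infinite_finite_induct) (auto intro: bLip_fun_add)

lemma Lip_fun_clamp: "f \<in> Lip_fun \<Longrightarrow> (\<lambda>x. max a (min (f x) b)) \<in> Lip_fun" for f :: "_ \<Rightarrow> real"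
  using Lip_fun_compose[OF Lip_funI[OF lipschitz_clamp]] .

lemma bLip_fun_clamp: "f \<in> Lip_fun \<Longrightarrow> (\<lambda>x. max a (min (f x) b)) \<in> bLip_fun" for f :: "_ \<Rightarrow> real"
proof (rule bLip_funI2[OF Lip_fun_clamp])
  show "\<bar>max a (min (f x) b)\<bar> \<le> \<bar>a\<bar> + \<bar>b\<bar>" for x by linarith
qed

lemma Lip_fun_dist: "(\<lambda>x. dist x a) \<in> Lip_fun"
proof (rule Lip_funI[of 1], rule lipschitz_onI)
  show "dist (dist x a) (dist y a) \<le> 1 * dist x y" for x y
    using abs_dist_diff_le[of x a y] by (simp add: dist_real_def dist_commute)
qed simp

lemma Lip_fun_infdist: "(\<lambda>x. infdist x A) \<in> Lip_fun"
proof (rule Lip_funI[of 1], rule lipschitz_onI)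
  show "dist (infdist x A) (infdist y A) \<le> 1 * dist x y" for x y
    using infdist_triangle_abs[of x A y] by (simp add: dist_real_def)
qed simp

lemma bLip_fun_compose:
  fixes g :: "'a::metric_space \<Rightarrow> real"
  assumes "f \<in> bLip_fun" "g \<in> Lip_fun"
  shows "(\<lambda>x. f (g x)) \<in> bLip_fun"
proof -
  obtain C where "\<And>x. \<bar>f x\<bar> \<le> C" using bLip_fun_bounded[OF assms(1)] by blast
  then show ?thesis by (intro bLip_funI2[OF Lip_fun_compose[OF bLip_Lip[OF assms(1)] assms(2)]])
qed

section \<open>Best Lipschitz constants and mass bounds\<close>

lemma lipschitz_lip:
  assumes "f \<in> Lip_fun"
  shows "(lip f)-lipschitz_on UNIV f"
proof (rule lipschitz_onI)
  let ?S = "{L. L-lipschitz_on UNIV f}"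
  have ne: "?S \<noteq> {}" using assms by (auto simp: Lip_fun_def)
  show "0 \<le> lip f" unfolding lip_def by (rule cInf_greatest[OF ne]) (auto dest: lipschitz_on_nonneg)
  fix x y
  show "dist (f x) (f y) \<le> lip f * dist x y"
  proof (cases "x = y")
    case False
    have "dist (f x) (f y) / dist x y \<le> lip f"
      unfolding lip_def
    proof (rule cInf_greatest[OF ne])
      fix L assume "L \<in> ?S"
      then have "dist (f x) (f y) \<le> L * dist x y" by (auto dest: lipschitz_onD[of _ _ _ x y])
      then show "dist (f x) (f y) / dist x y \<le> L" using False by (simp add: pos_divide_le_eq)
    qed
    then show ?thesis using False by (simp add: pos_divide_le_eq)
  qed simp
qed

lemma lip_le: "L-lipschitz_on UNIV f \<Longrightarrow> lip f \<le> L"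
  unfolding lip_def by (rule cInf_lower) (auto intro!: bdd_belowI[of _ 0] dest: lipschitz_on_nonneg)

lemma lip_nonneg: "f \<in> Lip_fun \<Longrightarrow> 0 \<le> lip f"
  using lipschitz_lip lipschitz_on_nonneg by blast

lemma mass_boundD:
  assumes "mass_bound T \<mu>"
  shows mass_bound_sets: "sets \<mu> = sets borel"
    and mass_bound_finite: "finite_measure \<mu>"
    and mass_bound_le: "f \<in> bLip_fun \<Longrightarrow> L-lipschitz_on UNIV \<pi> \<Longrightarrow> \<bar>T f \<pi>\<bar> \<le> L * (\<integral>x. \<bar>f x\<bar> \<partial>\<mu>)"
proof -
  show "sets \<mu> = sets borel" "finite_measure \<mu>" using assms by (auto simp: mass_bound_def)
  assume f: "f \<in> bLip_fun" and L: "L-lipschitz_on UNIV \<pi>"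
  have "\<bar>T f \<pi>\<bar> \<le> lip \<pi> * (\<integral>x. \<bar>f x\<bar> \<partial>\<mu>)"
    using assms f Lip_funI[OF L] by (auto simp: mass_bound_def)
  also have "\<dots> \<le> L * (\<integral>x. \<bar>f x\<bar> \<partial>\<mu>)"
    by (intro mult_right_mono lip_le[OF L]) auto
  finally show "\<bar>T f \<pi>\<bar> \<le> L * (\<integral>x. \<bar>f x\<bar> \<partial>\<mu>)" .
qed

lemma bounded_borel_integrable:
  fixes f :: "_ \<Rightarrow> real"
  assumes "finite_measure \<mu>" "sets \<mu> = sets borel" "f \<in> borel_measurable borel" "\<And>x. \<bar>f x\<bar> \<le> C"
  shows "integrable \<mu> f"
proof -
  interpret finite_measure \<mu> by fact
  have "f \<in> borel_measurable \<mu>" using assms measurable_cong_sets[OF assms(2) refl] by blast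
  then show ?thesis using assms(4) by (intro integrable_const_bound[of _ C]) auto
qed

lemma bLip_integrable: "finite_measure \<mu> \<Longrightarrow> sets \<mu> = sets borel \<Longrightarrow> f \<in> bLip_fun \<Longrightarrow> integrable \<mu> f"
  using bLip_fun_bounded[of f] bounded_borel_integrable[of \<mu> f] bLip_measurable[of f] by blast

section \<open>Consequences of the axioms of a current\<close>

context
  fixes T :: "('a::metric_space) current1"
  assumes T: "metric_current1 T"
begin

lemma current_lincomb:
  "f \<in> bLip_fun \<Longrightarrow> g \<in> bLip_fun \<Longrightarrow> \<pi> \<in> Lip_fun \<Longrightarrow>
    T (\<lambda>x. a * f x + b * g x) \<pi> = a * T f \<pi> + b * T g \<pi>"
  by (rule T[unfolded metric_current1_def, THEN conjunct1, rule_format])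

lemma current_lincomb2:
  "f \<in> bLip_fun \<Longrightarrow> \<pi> \<in> Lip_fun \<Longrightarrow> \<rho> \<in> Lip_fun \<Longrightarrow>
    T f (\<lambda>x. a * \<pi> x + b * \<rho> x) = a * T f \<pi> + b * T f \<rho>"
  by (rule T[unfolded metric_current1_def, THEN conjunct2, THEN conjunct1, rule_format])

lemma current_limit:
  "f \<in> bLip_fun \<Longrightarrow> (\<And>n. L-lipschitz_on UNIV (\<pi>s n)) \<Longrightarrow> (\<And>x. (\<lambda>n. \<pi>s n x) \<longlonglongrightarrow> \<pi> x) \<Longrightarrow>
    (\<lambda>n. T f (\<pi>s n)) \<longlonglongrightarrow> T f \<pi>"
  by (rule T[unfolded metric_current1_def, THEN conjunct2, THEN conjunct2, THEN conjunct1, rule_format]) auto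

lemma current_local:
  "f \<in> bLip_fun \<Longrightarrow> \<pi> \<in> Lip_fun \<Longrightarrow> open U \<Longrightarrow> (\<And>x. f x \<noteq> 0 \<Longrightarrow> x \<in> U) \<Longrightarrow> (\<And>x. x \<in> U \<Longrightarrow> \<pi> x = c) \<Longrightarrow>
    T f \<pi> = 0"
  by (rule T[unfolded metric_current1_def, THEN conjunct2, THEN conjunct2, THEN conjunct2, THEN conjunct1, rule_format]) auto

lemma current_mass_bound: "\<exists>\<mu>. mass_bound T \<mu>"
  using T unfolding metric_current1_def by (elim conjE)

lemma current_add: "f \<in> bLip_fun \<Longrightarrow> g \<in> bLip_fun \<Longrightarrow> \<pi> \<in> Lip_fun \<Longrightarrow> T (\<lambda>x. f x + g x) \<pi> = T f \<pi> + T g \<pi>"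
  using current_lincomb[of f g \<pi> 1 1] by simp

lemma current_diff: "f \<in> bLip_fun \<Longrightarrow> g \<in> bLip_fun \<Longrightarrow> \<pi> \<in> Lip_fun \<Longrightarrow> T (\<lambda>x. f x - g x) \<pi> = T f \<pi> - T g \<pi>"
  using current_lincomb[of f g \<pi> 1 "-1"] by simp

lemma current_cmult: "f \<in> bLip_fun \<Longrightarrow> \<pi> \<in> Lip_fun \<Longrightarrow> T (\<lambda>x. c * f x) \<pi> = c * T f \<pi>"
  using current_lincomb[of f f \<pi> c 0] by simp

lemma current_zero: "\<pi> \<in> Lip_fun \<Longrightarrow> T (\<lambda>x. 0) \<pi> = 0"
  using current_cmult[of "\<lambda>_. 0" \<pi> 0] by simp

lemma current_diff2: "f \<in> bLip_fun \<Longrightarrow> \<pi> \<in> Lip_fun \<Longrightarrow> \<rho> \<in> Lip_fun \<Longrightarrow> T f (\<lambda>x. \<pi> x - \<rho> x) = T f \<pi> - T f \<rho>"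
  using current_lincomb2[of f \<pi> \<rho> 1 "-1"] by simp

lemma current_sum:
  "(\<And>i. i \<in> I \<Longrightarrow> f i \<in> bLip_fun) \<Longrightarrow> \<pi> \<in> Lip_fun \<Longrightarrow> T (\<lambda>x. \<Sum>i\<in>I. f i x) \<pi> = (\<Sum>i\<in>I. T (f i) \<pi>)"
  by (induction I rule: infinite_finite_induct)
     (auto simp: current_zero current_add bLip_fun_sum)

lemma current_const: "f \<in> bLip_fun \<Longrightarrow> T f (\<lambda>_. c) = 0"
  by (rule current_local[of _ _ UNIV]) (auto intro: Lip_fun_const)

lemma current_local_eq:
  assumes "f \<in> bLip_fun" "\<pi> \<in> Lip_fun" "\<rho> \<in> Lip_fun" "open U"
    "\<And>x. f x \<noteq> 0 \<Longrightarrow> x \<in> U" "\<And>x. x \<in> U \<Longrightarrow> \<pi> x = \<rho> x"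
  shows "T f \<pi> = T f \<rho>"
proof -
  have "T f (\<lambda>x. \<pi> x - \<rho> x) = 0"
    by (rule current_local[OF assms(1) _ assms(4,5), of _ 0])
       (use assms Lip_fun_lincomb[of \<pi> \<rho> 1 "-1"] in auto)
  then show ?thesis using current_diff2 assms by simp
qed

text \<open>By finite mass the values of T follow the first argument in the L^1 norm of \<mu>. The
  exceptional set is null only for the chosen \<mu>, so a bound that does not charge the vertices
  allows convergence to fail there.\<close>

lemma current_dominated_convergence:
  assumes \<mu>: "mass_bound T \<mu>" and \<pi>: "\<pi> \<in> Lip_fun" and f: "f \<in> bLip_fun" and F: "\<And>n. F n \<in> bLip_fun"
    and bd: "\<And>n x. \<bar>F n x\<bar> \<le> C" and ae: "AE x in \<mu>. (\<lambda>n. F n x) \<longlonglongrightarrow> f x"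
  shows "(\<lambda>n. T (F n) \<pi>) \<longlonglongrightarrow> T f \<pi>"
proof -
  interpret finite_measure \<mu> using \<mu> by (rule mass_bound_finite)
  have m: "g \<in> borel_measurable \<mu>" if "g \<in> bLip_fun" for g
    using bLip_integrable[OF finite_measure_axioms mass_bound_sets[OF \<mu>] that] by auto
  obtain D where D: "\<And>x. \<bar>f x\<bar> \<le> D" using bLip_fun_bounded[OF f] by blast
  have "(\<lambda>n. \<integral>x. \<bar>F n x - f x\<bar> \<partial>\<mu>) \<longlonglongrightarrow> (\<integral>x. 0 \<partial>\<mu>)"
  proof (rule integral_dominated_convergence[where w="\<lambda>_. C + D"])
    show "AE x in \<mu>. (\<lambda>n. \<bar>F n x - f x\<bar>) \<longlonglongrightarrow> 0"
      using ae by eventually_elim (simp add: LIM_zero tendsto_rabs_zero)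
    show "AE x in \<mu>. norm \<bar>F n x - f x\<bar> \<le> C + D" for n
    proof (intro AE_I2)
      fix x
      show "norm \<bar>F n x - f x\<bar> \<le> C + D" using bd[of n x] D[of x] unfolding real_norm_def by linarith
    qed
  qed (use m[OF bLip_fun_diff[OF F f]] in auto)
  then have lim: "(\<lambda>n. lip \<pi> * (\<integral>x. \<bar>F n x - f x\<bar> \<partial>\<mu>)) \<longlonglongrightarrow> 0"
    using tendsto_mult_right_zero[of _ sequentially "lip \<pi>"] by simp
  have "\<bar>T (F n) \<pi> - T f \<pi>\<bar> \<le> lip \<pi> * (\<integral>x. \<bar>F n x - f x\<bar> \<partial>\<mu>)" for n
    using mass_bound_le[OF \<mu> bLip_fun_diff[OF F f] lipschitz_lip[OF \<pi>]] current_diff[OF F f \<pi>] by simp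
  then have "(\<lambda>n. T (F n) \<pi> - T f \<pi>) \<longlonglongrightarrow> 0"
    using lim by (rule tendsto_zero_abs_le)
  then show ?thesis by (rule LIM_zero_cancel)
qed

text \<open>The density is \<mu> restricted to B. This is how sets are discarded from a mass bound:
  only the integral inequality has to be improved.\<close>

lemma mass_bound_density:
  assumes "mass_bound T \<mu>" and B: "B \<in> sets borel"
    and le: "\<And>f \<pi>. f \<in> bLip_fun \<Longrightarrow> \<pi> \<in> Lip_fun \<Longrightarrow> \<bar>T f \<pi>\<bar> \<le> lip \<pi> * (\<integral>x. indicator B x * \<bar>f x\<bar> \<partial>\<mu>)"
  shows "mass_bound T (density \<mu> (\<lambda>x. ennreal (indicator B x)))"
  unfolding mass_bound_def
proof (intro conjI ballI)
  have s [measurable_cong]: "sets \<mu> = sets borel" using assms(1) by (rule mass_bound_sets)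
  interpret finite_measure \<mu> using assms(1) by (rule mass_bound_finite)
  note B [measurable]
  show "sets (density \<mu> (\<lambda>x. ennreal (indicator B x))) = sets borel" using s by simp
  have "emeasure (density \<mu> (\<lambda>x. ennreal (indicator B x))) UNIV = emeasure \<mu> B"
    using emeasure_restricted[of B \<mu> UNIV] B s by (simp add: ennreal_indicator)
  moreover have "space \<mu> = UNIV" using sets_eq_imp_space_eq[OF s] by simp
  ultimately show "finite_measure (density \<mu> (\<lambda>x. ennreal (indicator B x)))"
    by (intro finite_measureI) simp
  fix f \<pi> assume f: "f \<in> (bLip_fun :: ('a \<Rightarrow> real) set)" and \<pi>: "\<pi> \<in> (Lip_fun :: ('a \<Rightarrow> real) set)"
  have [measurable]: "f \<in> borel_measurable borel" using f by (rule bLip_measurable)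
  have "(\<integral>x. \<bar>f x\<bar> \<partial>density \<mu> (\<lambda>x. ennreal (indicator B x))) = (\<integral>x. indicator B x * \<bar>f x\<bar> \<partial>\<mu>)"
    by (subst integral_real_density) auto
  then show "\<bar>T f \<pi>\<bar> \<le> lip \<pi> * (\<integral>x. \<bar>f x\<bar> \<partial>density \<mu> (\<lambda>x. ennreal (indicator B x)))"
    using le[OF f \<pi>] by simp
qed

text \<open>The continuity axiom forbids atoms: near a point \<open>v\<close>, a Lipschitz function \<open>\<pi>\<close> is a
  pointwise limit of functions with the same Lipschitz constant that are constant around \<open>v\<close>.\<close>

lemma mass_bound_remove_point:
  assumes \<mu>: "mass_bound T \<mu>"
  shows "mass_bound T (density \<mu> (\<lambda>x. ennreal (indicator (-{v}) x)))"
proof (rule mass_bound_density[OF \<mu>])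
  have s [measurable_cong]: "sets \<mu> = sets borel" using \<mu> by (rule mass_bound_sets)
  interpret finite_measure \<mu> using \<mu> by (rule mass_bound_finite)
  show "- {v} \<in> sets borel" by simp
  fix f \<pi> :: "'a \<Rightarrow> real" assume f: "f \<in> bLip_fun" and \<pi>: "\<pi> \<in> Lip_fun"
  obtain C where C: "0 \<le> C" "\<And>x. \<bar>f x\<bar> \<le> C" using bLip_fun_bounded[OF f] by blast
  define L where "L = lip \<pi>"
  have L: "L-lipschitz_on UNIV \<pi>" "0 \<le> L"
    unfolding L_def using lipschitz_lip[OF \<pi>] lip_nonneg[OF \<pi>] by auto
  \<comment> \<open>Cut-off equal to 1 within distance r of v and to 0 beyond 2 r.\<close>
  define w where "w r x = max 0 (min (2 - dist x v / r) 1)" for r x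
  have w: "w r \<in> bLip_fun" for r
  proof -
    have "(\<lambda>x. 1 * 2 + (- inverse r) * dist x v) \<in> Lip_fun"
      by (intro Lip_fun_lincomb Lip_fun_const Lip_fun_dist)
    moreover have "(\<lambda>x. 1 * 2 + (- inverse r) * dist x v) = (\<lambda>x. 2 - dist x v / r)"
      by (rule ext) (simp add: divide_inverse)
    ultimately have "(\<lambda>x. 2 - dist x v / r) \<in> Lip_fun" by simp
    from bLip_fun_clamp[OF this, of 0 1] show ?thesis unfolding w_def .
  qed
  have w01: "0 \<le> w r x" "w r x \<le> 1" for r x by (auto simp: w_def)
  have wv: "w r v = 1" for r by (simp add: w_def)
  have w0: "w r x = 0" if "0 < r" "x \<notin> ball v (2 * r)" for r x
  proof -
    have "2 * r \<le> dist x v" using that by (simp add: dist_commute)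
    then have "2 \<le> dist x v / r" using that(1) by (simp add: pos_le_divide_eq)
    then show ?thesis by (simp add: w_def)
  qed
  define B where "B r = ball v (2 * r) - {v}" for r
  have [measurable]: "B r \<in> sets borel" for r by (simp add: B_def)
  have fw: "(\<lambda>x. f x * w r x) \<in> bLip_fun" for r using f w by (rule bLip_fun_mult)
  have int: "integrable \<mu> g" if "g \<in> borel_measurable borel" "\<And>x. \<bar>g x\<bar> \<le> K" for g :: "'a \<Rightarrow> real" and K
    using bounded_borel_integrable[OF finite_measure_axioms s that] .
  have [measurable]: "f \<in> borel_measurable borel" "w r \<in> borel_measurable borel" for r
    using f w by (auto intro: bLip_measurable)
  have key: "\<bar>T (\<lambda>x. f x * w r x) \<pi>\<bar> \<le> L * (C * measure \<mu> (B r))" if r: "0 < r" for r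
  proof -
    define \<epsilon> where "\<epsilon> n = inverse (real (Suc n))" for n
    have e0: "0 < \<epsilon> n" for n by (simp add: \<epsilon>_def)
    \<comment> \<open>Flattens the values within \<epsilon> n of 0 and shifts the others towards 0:
      still 1-Lipschitz, and within \<epsilon> n of the identity.\<close>
    define \<beta> where "\<beta> n t = t - max (- \<epsilon> n) (min t (\<epsilon> n))" for n t
    have \<beta>L: "\<bar>\<beta> n s - \<beta> n t\<bar> \<le> \<bar>s - t\<bar>" for n s t
      using e0[of n] unfolding \<beta>_def by linarith
    have \<beta>0: "\<beta> n t = 0" if "\<bar>t\<bar> \<le> \<epsilon> n" for n t using that unfolding \<beta>_def by linarith
    have \<beta>lim: "(\<lambda>n. \<beta> n t) \<longlonglongrightarrow> t" for t
    proof -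
      have "\<bar>\<beta> n t - t\<bar> \<le> \<epsilon> n" for n using e0[of n] unfolding \<beta>_def by linarith
      moreover have "\<epsilon> \<longlonglongrightarrow> 0" unfolding \<epsilon>_def by (rule LIMSEQ_inverse_real_of_nat)
      ultimately have "(\<lambda>n. \<beta> n t - t) \<longlonglongrightarrow> 0"
        by (rule tendsto_zero_abs_le)
      then show ?thesis by (rule LIM_zero_cancel)
    qed
    define \<pi>s where "\<pi>s n x = \<beta> n (\<pi> x - \<pi> v)" for n x
    have \<pi>s: "L-lipschitz_on UNIV (\<pi>s n)" for n
    proof (rule lipschitz_onI)
      show "dist (\<pi>s n x) (\<pi>s n y) \<le> L * dist x y" for x y
        using \<beta>L[of n "\<pi> x - \<pi> v" "\<pi> y - \<pi> v"] lipschitz_onD[OF L(1), of x y]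
        by (simp add: \<pi>s_def dist_real_def)
    qed (rule L)
    have "(\<lambda>n. T (\<lambda>x. f x * w r x) (\<pi>s n)) \<longlonglongrightarrow> T (\<lambda>x. f x * w r x) (\<lambda>x. \<pi> x - \<pi> v)"
      by (rule current_limit[OF fw \<pi>s]) (simp add: \<pi>s_def \<beta>lim)
    also have "T (\<lambda>x. f x * w r x) (\<lambda>x. \<pi> x - \<pi> v) = T (\<lambda>x. f x * w r x) \<pi>"
      using current_diff2[OF fw \<pi> Lip_fun_const] current_const[OF fw] by simp
    finally have lim: "(\<lambda>n. T (\<lambda>x. f x * w r x) (\<pi>s n)) \<longlonglongrightarrow> T (\<lambda>x. f x * w r x) \<pi>" .
    have bound: "\<bar>T (\<lambda>x. f x * w r x) (\<pi>s n)\<bar> \<le> L * (C * measure \<mu> (B r))" for n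
    proof -
      \<comment> \<open>So small that \<pi> differs from \<pi> v by at most \<epsilon> n on the ball
        of radius 2 r', where \<open>\<pi>s n\<close> is therefore 0. Dividing by L + 1 avoids a
        division by 0.\<close>
      define r' where "r' = min r (\<epsilon> n / (2 * (L + 1)))"
      have r': "0 < r'" "r' \<le> r" using r e0[of n] L by (auto simp: r'_def)
      have Lr: "L * (2 * r') \<le> \<epsilon> n"
      proof -
        have "L * (2 * r') \<le> (L + 1) * (2 * (\<epsilon> n / (2 * (L + 1))))"
          using r' L by (intro mult_mono) (auto simp: r'_def)
        also have "\<dots> = \<epsilon> n" using L by (simp add: field_simps)
        finally show ?thesis .
      qed
      have z: "T (\<lambda>x. f x * w r' x) (\<pi>s n) = 0"
      proof (rule current_local[OF fw Lip_funI[OF \<pi>s], of "ball v (2 * r')" _ _ 0])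
        fix x assume x: "x \<in> ball v (2 * r')"
        have "\<bar>\<pi> x - \<pi> v\<bar> \<le> L * dist x v" using lipschitz_onD[OF L(1), of x v] by (simp add: dist_real_def)
        also have "\<dots> \<le> L * (2 * r')" using x L by (intro mult_left_mono) (auto simp: dist_commute)
        finally show "\<pi>s n x = 0" using Lr by (simp add: \<pi>s_def \<beta>0)
      qed (use w0 r' in auto)
      \<comment> \<open>Subtracting the inner cut-off changes nothing by locality, and the first
        argument that remains vanishes at v: only the punctured ball is charged.\<close>
      have "\<bar>T (\<lambda>x. f x * w r x) (\<pi>s n)\<bar> = \<bar>T (\<lambda>x. f x * w r x - f x * w r' x) (\<pi>s n)\<bar>"
        using current_diff[OF fw fw Lip_funI[OF \<pi>s], of r r' n] z by simp
      also have "\<dots> \<le> L * (\<integral>x. \<bar>f x * w r x - f x * w r' x\<bar> \<partial>\<mu>)"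
        by (intro mass_bound_le[OF \<mu> _ \<pi>s] bLip_fun_diff fw)
      also have "\<dots> \<le> L * (\<integral>x. C * indicator (B r) x \<partial>\<mu>)"
      proof (intro mult_left_mono integral_mono int L)
        fix x
        have d1: "\<bar>w r x - w r' x\<bar> \<le> 1"
          using w01[of r x] w01[of r' x] by linarith
        have d0: "w r x - w r' x = 0" if "x \<notin> B r"
          using that wv w0[OF r, of x] w0[OF r'(1), of x] r' by (auto simp: B_def)
        have "\<bar>f x * w r x - f x * w r' x\<bar> = \<bar>f x\<bar> * \<bar>w r x - w r' x\<bar>"
          unfolding abs_mult[symmetric] right_diff_distrib by simp
        also have "\<dots> \<le> C * indicator (B r) x"
          using d0 d1 C mult_mono[of "\<bar>f x\<bar>" C "\<bar>w r x - w r' x\<bar>" 1] by (auto simp: indicator_def)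
        finally show "\<bar>f x * w r x - f x * w r' x\<bar> \<le> C * indicator (B r) x" .
        moreover have "C * indicator (B r) x \<le> C" using C by (simp add: indicator_def)
        ultimately show "\<bar>\<bar>f x * w r x - f x * w r' x\<bar>\<bar> \<le> C" by linarith
        show "\<bar>C * indicator (B r) x\<bar> \<le> C" using C by (simp add: indicator_def)
      qed measurable
      also have "(\<integral>x. C * indicator (B r) x \<partial>\<mu>) = C * measure \<mu> (B r)"
        by simp
      finally show ?thesis .
    qed
    show ?thesis
      using tendsto_upperbound[OF tendsto_rabs[OF lim] always_eventually] bound by simp
  qed
  have main: "\<bar>T f \<pi>\<bar> \<le> L * (\<integral>x. indicator (-{v}) x * \<bar>f x\<bar> \<partial>\<mu>) + L * (C * measure \<mu> (B r))" if r: "0 < r" for r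
  proof -
    have d: "(\<lambda>x. f x - f x * w r x) \<in> bLip_fun" using f fw by (rule bLip_fun_diff)
    have "T f \<pi> = T (\<lambda>x. f x - f x * w r x) \<pi> + T (\<lambda>x. f x * w r x) \<pi>"
      using current_diff[OF f fw \<pi>] by simp
    moreover have "\<bar>T (\<lambda>x. f x - f x * w r x) \<pi>\<bar> \<le> L * (\<integral>x. indicator (-{v}) x * \<bar>f x\<bar> \<partial>\<mu>)"
    proof (rule order_trans[OF mass_bound_le[OF \<mu> d L(1)]], intro mult_left_mono integral_mono int L)
      fix x
      have "\<bar>f x - f x * w r x\<bar> = \<bar>f x\<bar> * \<bar>1 - w r x\<bar>"
        unfolding abs_mult[symmetric] right_diff_distrib by simp
      also have "\<dots> \<le> indicator (-{v}) x * \<bar>f x\<bar>"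
        using w01[of r x] wv mult_left_mono[of "\<bar>1 - w r x\<bar>" 1 "\<bar>f x\<bar>"] by (auto simp: indicator_def)
      finally show "\<bar>f x - f x * w r x\<bar> \<le> indicator (-{v}) x * \<bar>f x\<bar>" .
      moreover have "indicator (-{v}) x * \<bar>f x\<bar> \<le> C" using C(2) C(1) by (simp add: indicator_def)
      ultimately show "\<bar>\<bar>f x - f x * w r x\<bar>\<bar> \<le> C" by linarith
      show "\<bar>indicator (-{v}) x * \<bar>f x\<bar>\<bar> \<le> C" using C(2) C(1) by (simp add: indicator_def)
    qed measurable
    ultimately show ?thesis using key[OF r] by linarith
  qed
  \<comment> \<open>The punctured balls decrease to the empty set, so their measure tends to 0 even
    if \<mu> has an atom at v.\<close>
  have "(\<lambda>n. measure \<mu> (B (inverse (real (Suc n))))) \<longlonglongrightarrow> measure \<mu> (\<Inter>n. B (inverse (real (Suc n))))"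
  proof (rule finite_Lim_measure_decseq)
    show "decseq (\<lambda>n. B (inverse (real (Suc n))))"
    proof (rule decseq_SucI)
      fix n
      have "2 * inverse (real (Suc (Suc n))) \<le> 2 * inverse (real (Suc n))" by (simp add: field_simps)
      then show "B (inverse (real (Suc (Suc n)))) \<subseteq> B (inverse (real (Suc n)))"
        unfolding B_def by (rule Diff_mono[OF subset_ball order_refl])
    qed
    show "range (\<lambda>n. B (inverse (real (Suc n)))) \<subseteq> sets \<mu>"
      unfolding s by (intro image_subsetI) measurable
  qed
  also have "(\<Inter>n. B (inverse (real (Suc n)))) = {}"
  proof -
    have "\<exists>n. x \<notin> B (inverse (real (Suc n)))" for x
    proof (cases "x = v")
      case False
      then obtain n where "inverse (real (Suc n)) < dist v x / 2"
        using reals_Archimedean[of "dist v x / 2"] by auto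
      then show ?thesis by (intro exI[of _ n]) (auto simp: B_def)
    qed (simp add: B_def)
    then show ?thesis by blast
  qed
  finally have lim: "(\<lambda>n. measure \<mu> (B (inverse (real (Suc n))))) \<longlonglongrightarrow> 0" by simp
  have "(\<lambda>n. L * (\<integral>x. indicator (-{v}) x * \<bar>f x\<bar> \<partial>\<mu>) + L * (C * measure \<mu> (B (inverse (real (Suc n)))))) \<longlonglongrightarrow>
      L * (\<integral>x. indicator (-{v}) x * \<bar>f x\<bar> \<partial>\<mu>) + L * (C * 0)"
    by (intro tendsto_intros lim)
  then show "\<bar>T f \<pi>\<bar> \<le> lip \<pi> * (\<integral>x. indicator (-{v}) x * \<bar>f x\<bar> \<partial>\<mu>)"
    unfolding L_def[symmetric]
    by (intro tendsto_lowerbound[OF _ always_eventually]) (auto intro!: main)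
qed

text \<open>The points of V are removed one at a time from the same bound \<mu>, and dominated
  convergence leads to the complement of V. On a network this discards all vertices at once.\<close>

lemma mass_bound_null_countable:
  assumes V: "countable V"
  shows "\<exists>\<mu>. mass_bound T \<mu> \<and> emeasure \<mu> V = 0"
proof (cases "V = {}")
  case True
  then show ?thesis using current_mass_bound by auto
next
  case False
  define v where "v = from_nat_into V"
  have V_eq: "V = range v" using V False by (simp add: v_def range_from_nat_into)
  obtain \<mu> where \<mu>: "mass_bound T \<mu>" using current_mass_bound by blast
  have s [measurable_cong]: "sets \<mu> = sets borel" using \<mu> by (rule mass_bound_sets)
  interpret finite_measure \<mu> using \<mu> by (rule mass_bound_finite)
  define B where "B k = - (v ` {..<k})" for k
  have [measurable]: "B k \<in> sets borel" for k
    unfolding B_def by (intro borel_open open_Compl finite_imp_closed) auto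
  have Vb [measurable]: "V \<in> sets borel"
    using V by (intro sets.countable[of V]) auto
  have step: "mass_bound T (density \<mu> (\<lambda>x. ennreal (indicator (B k) x)))" for k
  proof (induction k)
    case 0
    have "density \<mu> (\<lambda>x. ennreal (indicator (B 0) x)) = \<mu>"
      by (simp add: B_def density_1)
    then show ?case using \<mu> by simp
  next
    case (Suc k)
    have "density (density \<mu> (\<lambda>x. ennreal (indicator (B k) x))) (\<lambda>x. ennreal (indicator (-{v k}) x)) =
        density \<mu> (\<lambda>x. ennreal (indicator (B k) x) * ennreal (indicator (-{v k}) x))"
      by (rule density_density_eq) measurable
    also have "(\<lambda>x. ennreal (indicator (B k) x) * ennreal (indicator (-{v k}) x)) = (\<lambda>x. ennreal (indicator (B (Suc k)) x))"
      by (auto simp: B_def lessThan_Suc indicator_def)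
    finally show ?case using mass_bound_remove_point[OF Suc, of "v k"] by simp
  qed
  have "mass_bound T (density \<mu> (\<lambda>x. ennreal (indicator (- V) x)))"
  proof (rule mass_bound_density[OF \<mu>])
    fix f \<pi> assume f: "f \<in> (bLip_fun :: ('a \<Rightarrow> real) set)" and \<pi>: "\<pi> \<in> (Lip_fun :: ('a \<Rightarrow> real) set)"
    obtain C where C: "0 \<le> C" "\<And>x. \<bar>f x\<bar> \<le> C" using bLip_fun_bounded[OF f] by blast
    have [measurable]: "f \<in> borel_measurable borel" using f by (rule bLip_measurable)
    have "(\<lambda>k. \<integral>x. indicator (B k) x * \<bar>f x\<bar> \<partial>\<mu>) \<longlonglongrightarrow> (\<integral>x. indicator (- V) x * \<bar>f x\<bar> \<partial>\<mu>)"
    proof (rule integral_dominated_convergence[where w="\<lambda>_. C"])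
      show "AE x in \<mu>. (\<lambda>k. indicator (B k) x * \<bar>f x\<bar>) \<longlonglongrightarrow> indicator (- V) x * \<bar>f x\<bar>"
      proof (intro AE_I2)
        fix x
        have "\<exists>K. \<forall>k\<ge>K. indicator (B k) x = (indicator (- V) x :: real)"
        proof (cases "x \<in> V")
          case True
          then obtain j where "x = v j" using V_eq by auto
          then show ?thesis using True by (intro exI[of _ "Suc j"]) (auto simp: B_def)
        qed (auto simp: B_def V_eq indicator_def)
        then have "\<forall>\<^sub>F k in sequentially. indicator (B k) x * \<bar>f x\<bar> = indicator (- V) x * \<bar>f x\<bar>"
          unfolding eventually_sequentially by auto
        then show "(\<lambda>k. indicator (B k) x * \<bar>f x\<bar>) \<longlonglongrightarrow> indicator (- V) x * \<bar>f x\<bar>"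
          by (rule tendsto_eventually)
      qed
      show "AE x in \<mu>. norm (indicator (B k) x * \<bar>f x\<bar>) \<le> C" for k
        using C by (intro AE_I2) (auto simp: indicator_def)
    qed measurable
    then have lim: "(\<lambda>k. lip \<pi> * (\<integral>x. indicator (B k) x * \<bar>f x\<bar> \<partial>\<mu>)) \<longlonglongrightarrow> lip \<pi> * (\<integral>x. indicator (- V) x * \<bar>f x\<bar> \<partial>\<mu>)"
      by (intro tendsto_intros)
    have "\<bar>T f \<pi>\<bar> \<le> lip \<pi> * (\<integral>x. indicator (B k) x * \<bar>f x\<bar> \<partial>\<mu>)" for k
    proof -
      have "\<bar>T f \<pi>\<bar> \<le> lip \<pi> * (\<integral>x. \<bar>f x\<bar> \<partial>density \<mu> (\<lambda>x. ennreal (indicator (B k) x)))"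
        by (rule mass_bound_le[OF step f lipschitz_lip[OF \<pi>]])
      also have "(\<integral>x. \<bar>f x\<bar> \<partial>density \<mu> (\<lambda>x. ennreal (indicator (B k) x))) = (\<integral>x. indicator (B k) x * \<bar>f x\<bar> \<partial>\<mu>)"
        by (subst integral_real_density) auto
      finally show ?thesis .
    qed
    then show "\<bar>T f \<pi>\<bar> \<le> lip \<pi> * (\<integral>x. indicator (- V) x * \<bar>f x\<bar> \<partial>\<mu>)"
      by (intro tendsto_lowerbound[OF lim always_eventually]) auto
  qed measurable
  moreover have "emeasure (density \<mu> (\<lambda>x. ennreal (indicator (- V) x))) V = 0"
    using emeasure_restricted[of "- V" \<mu> V] Vb s by (simp add: ennreal_indicator)
  ultimately show ?thesis by blast
qed

text \<open>The hats at 0, ..., M sum to 1 on [0, M]; the explicit value beyond M carries the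
  induction.\<close>

lemma tent_partition:
  fixes t :: real
  assumes "0 \<le> t"
  shows "(\<Sum>i\<le>M. max 0 (1 - \<bar>t - real i\<bar>)) = min 1 (max 0 (real M + 1 - t))"
proof (induction M)
  case (Suc M)
  then show ?case using assms by (auto simp: max_def min_def abs_if)
qed (use assms in \<open>auto simp: max_def min_def abs_if\<close>)

text \<open>f is cut by hats of mesh \<delta> in the values of h. On the piece around a = \<delta>
  i, P is replaced by its linear part of slope P' a; this replacement in the second argument and
  that of P' (h x) by P' a in the first each cost at most K \<delta> H times the integral of the
  piece. All pieces together cost 2 K \<delta> H I, and \<delta> is arbitrary.\<close>

lemma current_chain_rule:
  fixes P P' :: "real \<Rightarrow> real"
  assumes f: "f \<in> bLip_fun" and h: "h \<in> Lip_fun" and h0: "\<And>x. 0 \<le> h x" and hA: "\<And>x. h x \<le> A"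
    and DP: "\<And>t. (P has_real_derivative P' t) (at t)" and P': "P' \<in> Lip_fun" and P: "P \<in> Lip_fun"
  shows "T f (\<lambda>x. P (h x)) = T (\<lambda>x. f x * P' (h x)) h"
proof -
  obtain \<mu> where \<mu>: "mass_bound T \<mu>" using current_mass_bound by blast
  have s [measurable_cong]: "sets \<mu> = sets borel" using \<mu> by (rule mass_bound_sets)
  interpret finite_measure \<mu> using \<mu> by (rule mass_bound_finite)
  have Ph: "(\<lambda>x. P (h x)) \<in> Lip_fun" using P h by (rule Lip_fun_compose)
  have hb: "h \<in> bLip_fun"
  proof (rule bLip_funI2[OF h])
    show "\<bar>h x\<bar> \<le> \<bar>A\<bar>" for x using h0[of x] hA[of x] by linarith
  qed
  obtain K where K: "0 \<le> K" "K-lipschitz_on UNIV P'" using P' by (rule Lip_fun_obtain)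
  obtain H where H: "0 \<le> H" "H-lipschitz_on UNIV h" using h by (rule Lip_fun_obtain)
  have P'h: "(\<lambda>x. P' (h x)) \<in> bLip_fun"
  proof (rule bLip_funI2[OF Lip_fun_compose[OF P' h]])
    show "\<bar>P' (h x)\<bar> \<le> \<bar>P' 0\<bar> + K * \<bar>A\<bar>" for x
    proof -
      have "\<bar>P' (h x) - P' 0\<bar> \<le> K * \<bar>h x - 0\<bar>" by (rule lipschitz_real_abs[OF K(2)])
      also have "\<dots> \<le> K * \<bar>A\<bar>" using K h0[of x] hA[of x] by (intro mult_left_mono) auto
      finally show ?thesis by linarith
    qed
  qed
  define E where "E f = T f (\<lambda>x. P (h x)) - T (\<lambda>x. f x * P' (h x)) h" for f
  define I where "I = (\<integral>x. \<bar>f x\<bar> \<partial>\<mu>)"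
  have small: "\<bar>E f\<bar> \<le> 2 * K * \<delta> * H * I" if \<delta>: "0 < \<delta>" for \<delta>
  proof -
    define M where "M = nat \<lceil>A / \<delta>\<rceil>"
    have M: "h x / \<delta> \<le> real M" for x
    proof -
      have "h x / \<delta> \<le> A / \<delta>" using hA[of x] \<delta> by (simp add: divide_right_mono)
      then show ?thesis unfolding M_def using real_nat_ceiling_ge order_trans by blast
    qed
    define \<psi> where "\<psi> i x = max 0 (1 - \<bar>h x / \<delta> - real i\<bar>)" for i x
    have \<psi>0: "0 \<le> \<psi> i x" for i x by (simp add: \<psi>_def)
    have \<psi>sum: "(\<Sum>i\<le>M. \<psi> i x) = 1" for x
      unfolding \<psi>_def using tent_partition[of "h x / \<delta>" M] M[of x] h0[of x] \<delta> by simp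
    have \<psi>: "\<psi> i \<in> bLip_fun" for i
    proof -
      have "(\<lambda>t::real. max 0 (1 - \<bar>t\<bar>)) \<in> bLip_fun"
        by (rule bLip_funI[of 1 _ 1], rule lipschitz_onI) (auto simp: dist_real_def max_def)
      moreover have "(\<lambda>x. inverse \<delta> * h x + (-1) * real i) \<in> Lip_fun"
        by (intro Lip_fun_lincomb h Lip_fun_const)
      ultimately have "(\<lambda>x. max 0 (1 - \<bar>inverse \<delta> * h x + (-1) * real i\<bar>)) \<in> bLip_fun"
        by (rule bLip_fun_compose)
      then show ?thesis by (simp add: \<psi>_def[abs_def] divide_inverse mult.commute)
    qed
    have \<psi>supp: "\<bar>h x - \<delta> * real i\<bar> < \<delta>" if "\<psi> i x \<noteq> 0" for i x
    proof -
      have "\<bar>h x / \<delta> - real i\<bar> < 1" using that by (auto simp: \<psi>_def max_def split: if_splits)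
      then have "\<bar>(h x / \<delta> - real i) * \<delta>\<bar> < \<delta>" unfolding abs_mult using \<delta> by simp
      moreover have "(h x / \<delta> - real i) * \<delta> = h x - \<delta> * real i" using \<delta> by (simp add: left_diff_distrib)
      ultimately show ?thesis by simp
    qed
    define F where "F i x = f x * \<psi> i x" for i x
    have F: "F i \<in> bLip_fun" for i unfolding F_def using f \<psi> by (rule bLip_fun_mult)
    have FP: "(\<lambda>x. F i x * P' (h x)) \<in> bLip_fun" for i using F P'h by (rule bLip_fun_mult)
    have Fsum: "f x = (\<Sum>i\<le>M. F i x)" for x
      using \<psi>sum[of x] unfolding F_def sum_distrib_left[symmetric] by simp
    have Esum: "E f = (\<Sum>i\<le>M. E (F i))"
    proof -
      have "T f (\<lambda>x. P (h x)) = (\<Sum>i\<le>M. T (F i) (\<lambda>x. P (h x)))"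
        using current_sum[of "{..M}" F, OF F Ph] unfolding Fsum[symmetric] .
      moreover have "T (\<lambda>x. f x * P' (h x)) h = (\<Sum>i\<le>M. T (\<lambda>x. F i x * P' (h x)) h)"
        using current_sum[of "{..M}" "\<lambda>i x. F i x * P' (h x)", OF FP h]
        unfolding sum_distrib_right[symmetric] Fsum[symmetric] .
      ultimately show ?thesis by (simp add: E_def sum_subtractf)
    qed
    have Ei: "\<bar>E (F i)\<bar> \<le> 2 * K * \<delta> * H * (\<integral>x. \<bar>F i x\<bar> \<partial>\<mu>)" for i
    proof -
      define a where "a = \<delta> * real i"
      define Q where "Q t = P t - P' a * t" for t
      \<comment> \<open>Q has slope at most K \<delta> only within \<delta> of a; the clamp makes
        this global, and locality permits the change because the piece lives where the clamp acts
        trivially.\<close>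
      define c where "c t = max (a - \<delta>) (min t (a + \<delta>))" for t
      have Qc: "(K * \<delta> * H)-lipschitz_on UNIV (\<lambda>x. Q (c (h x)))"
      proof (rule lipschitz_onI)
        fix x y
        have "norm (Q (c (h x)) - Q (c (h y))) \<le> (K * \<delta>) * norm (c (h x) - c (h y))"
        proof (rule field_differentiable_bound[of "{a - \<delta>..a + \<delta>}" Q "\<lambda>t. P' t - P' a"])
          show "(Q has_real_derivative P' t - P' a) (at t within {a - \<delta>..a + \<delta>})" for t
          proof (rule has_field_derivative_at_within)
            show "(Q has_real_derivative P' t - P' a) (at t)"
              unfolding Q_def by (rule derivative_eq_intros DP refl)+ simp
          qed
          fix t assume "t \<in> {a - \<delta>..a + \<delta>}"
          have "\<bar>P' t - P' a\<bar> \<le> K * \<bar>t - a\<bar>" by (rule lipschitz_real_abs[OF K(2)])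
          also have "\<dots> \<le> K * \<delta>" using \<open>t \<in> _\<close> K by (intro mult_left_mono) auto
          finally show "norm (P' t - P' a) \<le> K * \<delta>" by simp
        qed (use \<delta> in \<open>auto simp: c_def\<close>)
        also have "\<dots> \<le> (K * \<delta>) * (H * dist x y)"
        proof (intro mult_left_mono)
          have "\<bar>c (h x) - c (h y)\<bar> \<le> \<bar>h x - h y\<bar>" unfolding c_def by linarith
          also have "\<dots> \<le> H * dist x y" using lipschitz_onD[OF H(2), of x y] by (simp add: dist_real_def)
          finally show "norm (c (h x) - c (h y)) \<le> H * dist x y" by simp
        qed (use K \<delta> in auto)
        finally show "dist (Q (c (h x))) (Q (c (h y))) \<le> K * \<delta> * H * dist x y"
          by (simp add: dist_real_def mult.assoc)
      qed (use K H \<delta> in auto)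
      have 1: "T (F i) (\<lambda>x. P (h x)) - P' a * T (F i) h = T (F i) (\<lambda>x. Q (c (h x)))"
      proof -
        have "T (F i) (\<lambda>x. P (h x)) - P' a * T (F i) h = T (F i) (\<lambda>x. 1 * P (h x) + (- P' a) * h x)"
          by (subst current_lincomb2[OF F Ph h]) simp
        also have "\<dots> = T (F i) (\<lambda>x. Q (c (h x)))"
        proof (rule current_local_eq[OF F Lip_fun_lincomb[OF Ph h] Lip_funI[OF Qc]])
          have "continuous_on UNIV h" by (rule Lip_fun_continuous[OF h])
          then show "open {x. \<bar>h x - a\<bar> < \<delta>}" by (intro open_Collect_less continuous_intros)
          show "x \<in> {x. \<bar>h x - a\<bar> < \<delta>}" if "F i x \<noteq> 0" for x
            using that \<psi>supp by (auto simp: F_def a_def)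
          fix x assume "x \<in> {x. \<bar>h x - a\<bar> < \<delta>}"
          then have "c (h x) = h x" by (auto simp: c_def)
          then show "1 * P (h x) + - P' a * h x = Q (c (h x))" by (simp add: Q_def)
        qed
        finally show ?thesis .
      qed
      have d: "(\<lambda>x. F i x * P' (h x) - P' a * F i x) \<in> bLip_fun"
        by (intro bLip_fun_diff FP bLip_fun_cmult F)
      have 2: "T (\<lambda>x. F i x * P' (h x)) h - P' a * T (F i) h = T (\<lambda>x. F i x * P' (h x) - P' a * F i x) h"
        using current_diff[OF FP bLip_fun_cmult[OF F] h] current_cmult[OF F h] by simp
      have 3: "(\<integral>x. \<bar>F i x * P' (h x) - P' a * F i x\<bar> \<partial>\<mu>) \<le> (\<integral>x. K * \<delta> * \<bar>F i x\<bar> \<partial>\<mu>)"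
      proof (rule integral_mono)
        show "integrable \<mu> (\<lambda>x. \<bar>F i x * P' (h x) - P' a * F i x\<bar>)" "integrable \<mu> (\<lambda>x. K * \<delta> * \<bar>F i x\<bar>)"
          using bLip_integrable[OF finite_measure_axioms s] d F by auto
        fix x
        have "\<bar>P' (h x) - P' a\<bar> * \<bar>F i x\<bar> \<le> (K * \<delta>) * \<bar>F i x\<bar>"
        proof (cases "F i x = 0")
          case False
          then have "\<bar>h x - a\<bar> < \<delta>" using \<psi>supp by (auto simp: F_def a_def)
          then have "K * \<bar>h x - a\<bar> \<le> K * \<delta>" using K by (intro mult_left_mono) auto
          then have "\<bar>P' (h x) - P' a\<bar> \<le> K * \<delta>" using lipschitz_real_abs[OF K(2), of "h x" a] by linarith
          then show ?thesis by (rule mult_right_mono) auto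
        qed simp
        then show "\<bar>F i x * P' (h x) - P' a * F i x\<bar> \<le> K * \<delta> * \<bar>F i x\<bar>"
          unfolding abs_mult[symmetric] left_diff_distrib by (simp add: mult.commute)
      qed
      have "\<bar>T (\<lambda>x. F i x * P' (h x) - P' a * F i x) h\<bar> \<le> H * (\<integral>x. \<bar>F i x * P' (h x) - P' a * F i x\<bar> \<partial>\<mu>)"
        by (rule mass_bound_le[OF \<mu> d H(2)])
      also have "\<dots> \<le> H * (\<integral>x. K * \<delta> * \<bar>F i x\<bar> \<partial>\<mu>)" by (intro mult_left_mono 3 H)
      finally have 4: "\<bar>T (\<lambda>x. F i x * P' (h x) - P' a * F i x) h\<bar> \<le> K * \<delta> * H * (\<integral>x. \<bar>F i x\<bar> \<partial>\<mu>)"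
        by (simp add: mult_ac)
      have 5: "\<bar>T (F i) (\<lambda>x. Q (c (h x)))\<bar> \<le> K * \<delta> * H * (\<integral>x. \<bar>F i x\<bar> \<partial>\<mu>)"
        by (rule mass_bound_le[OF \<mu> F Qc])
      have "E (F i) = T (F i) (\<lambda>x. Q (c (h x))) - T (\<lambda>x. F i x * P' (h x) - P' a * F i x) h"
        unfolding E_def using 1 2 by linarith
      then show ?thesis using 4 5 by linarith
    qed
    have "\<bar>E f\<bar> \<le> (\<Sum>i\<le>M. \<bar>E (F i)\<bar>)" unfolding Esum by (rule sum_abs)
    also have "\<dots> \<le> (\<Sum>i\<le>M. 2 * K * \<delta> * H * (\<integral>x. \<bar>F i x\<bar> \<partial>\<mu>))" by (intro sum_mono Ei)
    also have "\<dots> = 2 * K * \<delta> * H * (\<integral>x. (\<Sum>i\<le>M. \<bar>F i x\<bar>) \<partial>\<mu>)"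
      using bLip_integrable[OF finite_measure_axioms s F]
      by (subst Bochner_Integration.integral_sum) (auto simp: sum_distrib_left)
    also have "(\<lambda>x. \<Sum>i\<le>M. \<bar>F i x\<bar>) = (\<lambda>x. \<bar>f x\<bar>)"
    proof
      fix x
      have "(\<Sum>i\<le>M. \<bar>F i x\<bar>) = \<bar>f x\<bar> * (\<Sum>i\<le>M. \<psi> i x)"
        unfolding sum_distrib_left F_def abs_mult by (simp add: \<psi>0)
      then show "(\<Sum>i\<le>M. \<bar>F i x\<bar>) = \<bar>f x\<bar>" by (simp add: \<psi>sum)
    qed
    finally show ?thesis by (simp add: I_def)
  qed
  have "\<bar>E f\<bar> \<le> 0"
  proof (rule field_le_epsilon)
    fix e :: real assume e: "0 < e"
    define c where "c = 2 * K * H * I"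
    have c: "0 \<le> c" using K H by (simp add: c_def I_def)
    define \<delta> where "\<delta> = e / (c + 1)"
    have \<delta>: "0 < \<delta>" "(c + 1) * \<delta> = e" using e c by (auto simp: \<delta>_def)
    have *: "2 * K * \<delta> * H * I = c * \<delta>" by (simp add: c_def)
    have "\<bar>E f\<bar> \<le> c * \<delta>" using small[OF \<delta>(1)] unfolding * .
    also have "\<dots> \<le> (c + 1) * \<delta>" using \<delta>(1) by (simp add: distrib_right)
    finally show "\<bar>E f\<bar> \<le> 0 + e" using \<delta>(2) by simp
  qed
  then have "E f = 0" by simp
  then show ?thesis unfolding E_def by (rule eq_iff_diff_eq_0[THEN iffD2])
qed

end

section \<open>Currents on a network of edges\<close>

definition edge_int :: "real \<Rightarrow> (real \<Rightarrow> real) \<Rightarrow> real" where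
  "edge_int l g = (LINT s:{0..l}|lborel. g s)"

lemma bounded_set_integrable:
  fixes g :: "real \<Rightarrow> real"
  assumes "g \<in> borel_measurable borel" "\<And>s. s \<in> {a..b} \<Longrightarrow> \<bar>g s\<bar> \<le> C"
  shows "set_integrable lborel {a..b} g"
  unfolding set_integrable_def
proof (rule Bochner_Integration.integrable_bound)
  show "integrable lborel (\<lambda>x. indicator {a..b} x * C)"
    by (intro integrable_mult_left integrable_real_indicator) (auto simp: emeasure_lborel_Icc_eq)
  show "(\<lambda>x. indicator {a..b} x *\<^sub>R g x) \<in> borel_measurable lborel" using assms(1) by measurable
  show "AE x in lborel. norm (indicator {a..b} x *\<^sub>R g x) \<le> norm (indicator {a..b} x * C)"
  proof (intro AE_I2)
    fix x
    show "norm (indicator {a..b} x *\<^sub>R g x) \<le> norm (indicator {a..b} x * C)"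
      using assms(2)[of x] by (cases "x \<in> {a..b}") simp_all
  qed
qed

lemma edge_int_bound:
  assumes "0 \<le> l" "g \<in> borel_measurable borel" "\<And>s. s \<in> {0..l} \<Longrightarrow> \<bar>g s\<bar> \<le> C"
  shows "\<bar>edge_int l g\<bar> \<le> l * C"
proof -
  have int: "set_integrable lborel {0..l} (\<lambda>s. C)"
    by (rule bounded_set_integrable[of _ _ _ "\<bar>C\<bar>"]) auto
  have "\<bar>edge_int l g\<bar> \<le> (LINT s:{0..l}|lborel. \<bar>g s\<bar>)"
    unfolding edge_int_def
    using set_integral_norm_bound[OF bounded_set_integrable[OF assms(2,3)]] by simp
  also have "\<dots> \<le> (LINT s:{0..l}|lborel. C)"
  proof (rule set_integral_mono)
    show "set_integrable lborel {0..l} (\<lambda>s. \<bar>g s\<bar>)"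
      by (rule bounded_set_integrable[of _ _ _ C]) (use assms(2,3) in auto)
  qed (use int assms(3) in auto)
  also have "\<dots> = l * C" using assms(1) by (simp add: set_lebesgue_integral_def)
  finally show ?thesis .
qed

lemma edge_int_mono:
  assumes "f \<in> borel_measurable borel" "g \<in> borel_measurable borel"
    "\<And>s. s \<in> {0..l} \<Longrightarrow> \<bar>f s\<bar> \<le> C" "\<And>s. s \<in> {0..l} \<Longrightarrow> \<bar>g s\<bar> \<le> D" "\<And>s. s \<in> {0..l} \<Longrightarrow> f s \<le> g s"
  shows "edge_int l f \<le> edge_int l g"
  unfolding edge_int_def
  by (rule set_integral_mono[OF bounded_set_integrable[OF assms(1,3)] bounded_set_integrable[OF assms(2,4)] assms(5)])

lemma edge_int_lincomb:
  assumes "f \<in> borel_measurable borel" "g \<in> borel_measurable borel"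
    "\<And>s. s \<in> {0..l} \<Longrightarrow> \<bar>f s\<bar> \<le> C" "\<And>s. s \<in> {0..l} \<Longrightarrow> \<bar>g s\<bar> \<le> D"
  shows "edge_int l (\<lambda>s. a * f s + b * g s) = a * edge_int l f + b * edge_int l g"
proof -
  note F = bounded_set_integrable[OF assms(1,3)] and G = bounded_set_integrable[OF assms(2,4)]
  show ?thesis
    unfolding edge_int_def
    by (subst set_integral_add(2)) (use F G in \<open>simp_all add: set_integrable_mult_right\<close>)
qed

lemma edge_int_cong_AE:
  assumes "f \<in> borel_measurable borel" "g \<in> borel_measurable borel"
    "AE s in lborel. s \<in> {0..l} \<longrightarrow> f s = g s"
  shows "edge_int l f = edge_int l g"
  unfolding edge_int_def set_lebesgue_integral_def
  by (rule integral_cong_AE) (use assms in \<open>auto simp: indicator_def elim!: eventually_mono\<close>)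

lemma edge_int_abs_le:
  assumes "f \<in> borel_measurable borel" "g \<in> borel_measurable borel"
    "\<And>s. s \<in> {0..l} \<Longrightarrow> \<bar>g s\<bar> \<le> D" "\<And>s. s \<in> {0..l} \<Longrightarrow> \<bar>f s\<bar> \<le> g s"
  shows "\<bar>edge_int l f\<bar> \<le> edge_int l g"
proof -
  have fD: "\<bar>f s\<bar> \<le> D" if "s \<in> {0..l}" for s using assms(3,4)[OF that] by linarith
  have "\<bar>edge_int l f\<bar> \<le> edge_int l (\<lambda>s. \<bar>f s\<bar>)"
    unfolding edge_int_def
    using set_integral_norm_bound[OF bounded_set_integrable[OF assms(1) fD]] by simp
  also have "\<dots> \<le> edge_int l g"
    by (rule edge_int_mono[of _ _ _ D D]) (use assms fD in auto)
  finally show ?thesis .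
qed

lemma summable_bounded_terms:
  fixes c :: "nat \<Rightarrow> real"
  assumes "summable (\<lambda>i. \<bar>c i\<bar> * l i)" "\<And>i. \<bar>e i\<bar> \<le> l i * C"
  shows "summable (\<lambda>i. c i * e i)"
proof (rule summable_comparison_test'[of "\<lambda>i. (\<bar>c i\<bar> * l i) * C" 0])
  show "summable (\<lambda>i. (\<bar>c i\<bar> * l i) * C)" using assms(1) by (rule summable_mult2)
  show "norm (c n * e n) \<le> (\<bar>c n\<bar> * l n) * C" for n
    using mult_left_mono[OF assms(2)[of n], of "\<bar>c n\<bar>"] by (simp add: abs_mult mult.assoc)
qed

text \<open>The dominated convergence theorem for the counting measure.\<close>

lemma suminf_dominated_convergence:
  fixes F :: "nat \<Rightarrow> nat \<Rightarrow> real"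
  assumes "summable w" "\<And>k i. \<bar>F k i\<bar> \<le> w i" "\<And>i. (\<lambda>k. F k i) \<longlonglongrightarrow> G i"
  shows "(\<lambda>k. \<Sum>i. F k i) \<longlonglongrightarrow> (\<Sum>i. G i)"
proof -
  have w0: "0 \<le> w i" for i using assms(2)[of 0 i] by linarith
  have wi: "integrable (count_space UNIV) w"
    using assms(1) w0 by (simp add: integrable_count_space_nat_iff)
  have GL: "\<bar>G i\<bar> \<le> w i" for i
    by (rule tendsto_upperbound[OF tendsto_rabs[OF assms(3)] always_eventually]) (use assms(2) in auto)
  have Fi: "integrable (count_space UNIV) (F k)" for k
    by (rule Bochner_Integration.integrable_bound[OF wi]) (use assms(2) w0 in \<open>auto intro: order_trans\<close>)
  have Gi: "integrable (count_space UNIV) G"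
    by (rule Bochner_Integration.integrable_bound[OF wi]) (use GL w0 in \<open>auto intro: order_trans\<close>)
  have "(\<lambda>k. integral\<^sup>L (count_space UNIV) (F k)) \<longlonglongrightarrow> integral\<^sup>L (count_space UNIV) G"
    by (rule integral_dominated_convergence[OF _ _ wi]) (use assms in auto)
  then show ?thesis by (simp only: integral_count_space_nat[OF Fi] integral_count_space_nat[OF Gi])
qed

text \<open>A countable union of segments \<open>\<gamma> i\<close> glued at vertices. The functions \<open>cr i\<close> extend the
  arclength of the \<open>i\<close>-th segment to the whole space, and \<open>dep i\<close> is the depth below its endpoints;
  the two make the metric visible to Lipschitz test functions without a formula for the distance.\<close>

locale edge_net =
  fixes \<gamma> :: "nat \<Rightarrow> real \<Rightarrow> 'a::metric_space" and \<l> :: "nat \<Rightarrow> real" and cr dep :: "nat \<Rightarrow> 'a \<Rightarrow> real"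
  assumes len0: "0 < \<l> i"
    and clamp: "\<gamma> i s = \<gamma> i (max 0 (min s (\<l> i)))"
    and \<gamma>_lip: "dist (\<gamma> i s) (\<gamma> i t) \<le> \<bar>s - t\<bar>"
    and cr_lip: "\<bar>cr i x - cr i y\<bar> \<le> dist x y"
    and cr_\<gamma>: "0 \<le> s \<Longrightarrow> s \<le> \<l> i \<Longrightarrow> cr i (\<gamma> i s) = s"
    and cr_range: "0 \<le> cr i x" "cr i x \<le> \<l> i"
    and dep_lip: "\<bar>dep i x - dep i y\<bar> \<le> dist x y"
    and dep_\<gamma>: "0 \<le> s \<Longrightarrow> s \<le> \<l> i \<Longrightarrow> dep i (\<gamma> i s) = min s (\<l> i - s)"
    and dep_other: "i \<noteq> j \<Longrightarrow> dep i (\<gamma> j s) = 0"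
    and cover: "\<exists>i s. 0 \<le> s \<and> s \<le> \<l> i \<and> x = \<gamma> i s"
    and summable_len: "summable \<l>"
begin

section \<open>Geometry of the edges\<close>

definition edge :: "nat \<Rightarrow> 'a set" where
  "edge i = {x. 0 < dep i x}"

lemma dep_range: "0 \<le> dep i x"
proof -
  obtain j s where s: "0 \<le> s" "s \<le> \<l> j" "x = \<gamma> j s" using cover by blast
  then show ?thesis by (cases "i = j") (auto simp: dep_\<gamma> dep_other)
qed

lemma dep_notin: "x \<notin> edge i \<Longrightarrow> dep i x = 0"
  using dep_range[of i x] by (simp add: edge_def)

lemma \<gamma>_in_edge: "\<gamma> j s \<in> edge i \<longleftrightarrow> i = j \<and> 0 < s \<and> s < \<l> i"
proof (cases "i = j")
  case True
  have "dep i (\<gamma> i s) = min (max 0 (min s (\<l> i))) (\<l> i - max 0 (min s (\<l> i)))"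
    by (subst clamp, rule dep_\<gamma>) (use len0[of i] in auto)
  then show ?thesis using True len0[of i] by (auto simp: edge_def min_def max_def)
qed (simp add: edge_def dep_other)

lemma edge_coord:
  assumes "x \<in> edge i"
  shows "0 < cr i x" "cr i x < \<l> i" "\<gamma> i (cr i x) = x" "dep i x = min (cr i x) (\<l> i - cr i x)"
proof -
  obtain j s where s: "0 \<le> s" "s \<le> \<l> j" "x = \<gamma> j s" using cover by blast
  then have j: "i = j" "0 < s" "s < \<l> i" using assms \<gamma>_in_edge by auto
  then have "cr i x = s" using s cr_\<gamma> by auto
  then show "0 < cr i x" "cr i x < \<l> i" "\<gamma> i (cr i x) = x" "dep i x = min (cr i x) (\<l> i - cr i x)"
    using j s dep_\<gamma> by auto
qed

lemma edge_disjoint: "i \<noteq> j \<Longrightarrow> edge i \<inter> edge j = {}"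
proof -
  assume "i \<noteq> j"
  then have "x \<notin> edge j" if "x \<in> edge i" for x
    using edge_coord(3)[OF that] \<gamma>_in_edge[of i "cr i x" j] by auto
  then show ?thesis by blast
qed

lemma \<gamma>_lipschitz: "1-lipschitz_on UNIV (\<gamma> i)"
  by (rule lipschitz_onI) (use \<gamma>_lip in \<open>auto simp: dist_real_def\<close>)

text \<open>The upper bound comes from the parametrization, the lower one from its 1-Lipschitz left
  inverse \<open>cr i\<close>.\<close>

lemma \<gamma>_isometry: "0 \<le> s \<Longrightarrow> s \<le> \<l> i \<Longrightarrow> 0 \<le> t \<Longrightarrow> t \<le> \<l> i \<Longrightarrow> dist (\<gamma> i s) (\<gamma> i t) = \<bar>s - t\<bar>"
  using cr_lip[of i "\<gamma> i s" "\<gamma> i t"] \<gamma>_lip[of i s t] by (simp add: cr_\<gamma>)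

lemma \<gamma>_measurable [measurable]: "\<gamma> i \<in> borel_measurable borel"
  by (rule borel_measurable_continuous_onI[OF lipschitz_on_continuous_on[OF \<gamma>_lipschitz]])

lemma cr_Lip: "cr i \<in> Lip_fun" and cr_lipschitz: "1-lipschitz_on UNIV (cr i)"
proof -
  show "1-lipschitz_on UNIV (cr i)"
    by (rule lipschitz_onI) (use cr_lip in \<open>auto simp: dist_real_def\<close>)
  then show "cr i \<in> Lip_fun" by (rule Lip_funI)
qed

lemma dep_Lip: "dep i \<in> Lip_fun"
  by (rule Lip_funI[of 1], rule lipschitz_onI) (use dep_lip in \<open>auto simp: dist_real_def\<close>)

lemma edge_open: "open (edge i)"
  unfolding edge_def by (intro open_Collect_less continuous_on_const Lip_fun_continuous dep_Lip)

lemma edge_measurable [measurable]: "edge i \<in> sets borel"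
  using edge_open by (rule borel_open)

definition vertices :: "'a set" where
  "vertices = - (\<Union>i. edge i)"

lemma vertices_countable: "countable vertices"
proof (rule countable_subset)
  show "vertices \<subseteq> (\<Union>i. {\<gamma> i 0, \<gamma> i (\<l> i)})"
  proof
    fix x assume x: "x \<in> vertices"
    obtain i s where s: "0 \<le> s" "s \<le> \<l> i" "x = \<gamma> i s" using cover by blast
    then have "s = 0 \<or> s = \<l> i" using x \<gamma>_in_edge[of i s i] by (auto simp: vertices_def)
    then show "x \<in> (\<Union>i. {\<gamma> i 0, \<gamma> i (\<l> i)})" using s by blast
  qed
qed simp

section \<open>Restricting functions to an edge and extending them by 0\<close>

lemma lipschitz_along:
  assumes "L-lipschitz_on UNIV \<pi>"
  shows "L-lipschitz_on UNIV (\<lambda>s. \<pi> (\<gamma> i s))"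
proof -
  have "(L * 1)-lipschitz_on UNIV (\<pi> \<circ> \<gamma> i)"
    by (rule lipschitz_on_compose[OF \<gamma>_lipschitz]) (rule lipschitz_on_subset[OF assms], simp)
  then show ?thesis by (simp add: o_def)
qed

lemma Lip_along: "\<pi> \<in> Lip_fun \<Longrightarrow> (\<lambda>s. \<pi> (\<gamma> i s)) \<in> Lip_fun" for \<pi> :: "'a \<Rightarrow> real"
  using lipschitz_along unfolding Lip_fun_def by blast

definition ext :: "nat \<Rightarrow> (real \<Rightarrow> real) \<Rightarrow> 'a \<Rightarrow> real" where
  "ext i g x = (if x \<in> edge i then g (cr i x) else 0)"

text \<open>As g vanishes at both ends, its value at x is at most L times the depth of x, and a
  point outside the open edge is at least that depth away. Extension by 0 thus keeps the constant
  L.\<close>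

lemma ext_lipschitz:
  assumes g: "L-lipschitz_on UNIV g" "g 0 = 0" "g (\<l> i) = 0"
  shows "L-lipschitz_on UNIV (ext i g)"
proof (rule lipschitz_onI)
  show L: "0 \<le> L" using g(1) by (rule lipschitz_on_nonneg)
  have one: "\<bar>g (cr i x)\<bar> \<le> L * dist x y" if "x \<in> edge i" "y \<notin> edge i" for x y
  proof -
    have "\<bar>g (cr i x)\<bar> \<le> L * cr i x" "\<bar>g (cr i x)\<bar> \<le> L * (\<l> i - cr i x)"
      using lipschitz_real_abs[OF g(1), of "cr i x" 0] lipschitz_real_abs[OF g(1), of "cr i x" "\<l> i"]
        g(2,3) edge_coord[OF that(1)] by simp_all
    then have "\<bar>g (cr i x)\<bar> \<le> L * dep i x"
      using edge_coord(4)[OF that(1)] by (simp add: min_def)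
    also have "\<dots> \<le> L * dist x y"
      using dep_lip[of i x y] dep_notin[OF that(2)] L by (intro mult_left_mono) auto
    finally show ?thesis .
  qed
  fix x y
  show "dist (ext i g x) (ext i g y) \<le> L * dist x y"
  proof (cases "x \<in> edge i")
    case x: True
    show ?thesis
    proof (cases "y \<in> edge i")
      case True
      have "\<bar>g (cr i x) - g (cr i y)\<bar> \<le> L * \<bar>cr i x - cr i y\<bar>" by (rule lipschitz_real_abs[OF g(1)])
      also have "\<dots> \<le> L * dist x y" by (rule mult_left_mono[OF cr_lip L])
      finally show ?thesis using x True by (simp add: ext_def dist_real_def)
    next
      case False
      then show ?thesis using x one[OF x False] by (simp add: ext_def dist_real_def)
    qed
  next
    case x: False
    show ?thesis
    proof (cases "y \<in> edge i")
      case True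
      then show ?thesis using x one[OF True x] by (simp add: ext_def dist_real_def dist_commute)
    next
      case False
      then show ?thesis using x L by (simp add: ext_def)
    qed
  qed
qed

lemma ext_bLip:
  assumes g: "g \<in> Lip_fun" "g 0 = 0" "g (\<l> i) = 0"
  shows "ext i g \<in> bLip_fun"
proof -
  obtain L where L: "0 \<le> L" "L-lipschitz_on UNIV g" using g(1) by (rule Lip_fun_obtain)
  show ?thesis
  proof (rule bLip_funI[OF ext_lipschitz[OF L(2) g(2,3)]])
    fix x
    have "\<bar>g (cr i x)\<bar> \<le> L * cr i x"
      using lipschitz_real_abs[OF L(2), of "cr i x" 0] g(2) cr_range[of i x] by simp
    also have "\<dots> \<le> L * \<l> i" by (rule mult_left_mono[OF cr_range(2) L(1)])
    finally show "\<bar>ext i g x\<bar> \<le> L * \<l> i" using L(1) len0[of i] by (simp add: ext_def)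
  qed
qed

lemma ext_\<gamma>: "g 0 = 0 \<Longrightarrow> g (\<l> i) = 0 \<Longrightarrow> 0 \<le> s \<Longrightarrow> s \<le> \<l> i \<Longrightarrow> ext i g (\<gamma> i s) = g s"
  by (cases "s = 0 \<or> s = \<l> i") (auto simp: ext_def \<gamma>_in_edge cr_\<gamma>)

lemma ext_\<gamma>_other: "i \<noteq> j \<Longrightarrow> ext i g (\<gamma> j s) = 0"
  by (simp add: ext_def \<gamma>_in_edge)

section \<open>Currents with coefficients on the edges\<close>

definition finite_coeffs :: "(nat \<Rightarrow> real) \<Rightarrow> bool" where
  "finite_coeffs c \<longleftrightarrow> summable (\<lambda>i. \<bar>c i\<bar> * \<l> i)"

text \<open>The sum of the currents c i [[e_i]]. The Borel function \<open>lderiv\<close> in place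
  of \<open>deriv\<close> keeps the integrands Borel measurable, also for bounded Borel f.\<close>

definition cur :: "(nat \<Rightarrow> real) \<Rightarrow> 'a current1" where
  "cur c f \<pi> = (\<Sum>i. c i * edge_int (\<l> i) (\<lambda>s. f (\<gamma> i s) * lderiv (\<lambda>s. \<pi> (\<gamma> i s)) s))"

text \<open>Arclength weighted by |c|, pushed forward from the disjoint union of the segments. It
  turns out to be the mass measure of \<open>cur c\<close> and, for c = 1, the Hausdorff
  measure.\<close>

definition wt :: "(nat \<Rightarrow> real) \<Rightarrow> 'a measure" where
  "wt c = distr (density (count_space UNIV \<Otimes>\<^sub>M lborel) (\<lambda>(i, s). ennreal \<bar>c i\<bar> * indicator {0..\<l> i} s))
     borel (\<lambda>(i, s). \<gamma> i s)"

lemma sets_wt [simp, measurable_cong]: "sets (wt c) = sets borel"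
  by (simp add: wt_def)

lemma nn_integral_wt:
  assumes [measurable]: "f \<in> borel_measurable borel"
  shows "(\<integral>\<^sup>+x. f x \<partial>wt c) = (\<Sum>i. ennreal \<bar>c i\<bar> * (\<integral>\<^sup>+s. f (\<gamma> i s) * indicator {0..\<l> i} s \<partial>lborel))"
proof -
  have [measurable]: "(\<lambda>(i, s). \<gamma> i s) \<in> measurable (count_space UNIV \<Otimes>\<^sub>M lborel) borel"
    by (rule measurable_pair_measure_countable1) auto
  have [measurable]: "(\<lambda>(i, s). ennreal \<bar>c i\<bar> * indicator {0..\<l> i} s) \<in> borel_measurable (count_space UNIV \<Otimes>\<^sub>M lborel)"
    by (rule measurable_pair_measure_countable1) auto
  have "(\<integral>\<^sup>+x. f x \<partial>wt c) = (\<integral>\<^sup>+p. (case p of (i, s) \<Rightarrow> ennreal \<bar>c i\<bar> * indicator {0..\<l> i} s) * f (case p of (i, s) \<Rightarrow> \<gamma> i s) \<partial>(count_space UNIV \<Otimes>\<^sub>M lborel))"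
    unfolding wt_def by (subst nn_integral_distr, measurable, subst nn_integral_density) auto
  also have "\<dots> = (\<integral>\<^sup>+i. \<integral>\<^sup>+s. (ennreal \<bar>c i\<bar> * indicator {0..\<l> i} s) * f (\<gamma> i s) \<partial>lborel \<partial>count_space UNIV)"
    by (subst lborel.nn_integral_fst[symmetric]) auto
  also have "\<dots> = (\<integral>\<^sup>+i. ennreal \<bar>c i\<bar> * (\<integral>\<^sup>+s. f (\<gamma> i s) * indicator {0..\<l> i} s \<partial>lborel) \<partial>count_space UNIV)"
    by (intro nn_integral_cong, subst nn_integral_cmult[symmetric]) (auto intro!: nn_integral_cong simp: mult_ac)
  finally show ?thesis by (simp add: nn_integral_count_space_nat)
qed

text \<open>Endpoints are null, and on the open segment \<open>\<gamma> i\<close> is a bijection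
  onto the open edge; later arguments can therefore forget the vertices.\<close>

lemma emeasure_wt:
  assumes "A \<in> sets borel"
  shows "emeasure (wt c) A = (\<Sum>i. ennreal \<bar>c i\<bar> * emeasure lborel {s\<in>{0<..<\<l> i}. \<gamma> i s \<in> A})"
proof -
  note assms [measurable]
  have "emeasure (wt c) A = (\<integral>\<^sup>+x. indicator A x \<partial>wt c)" using assms by simp
  also have "\<dots> = (\<Sum>i. ennreal \<bar>c i\<bar> * (\<integral>\<^sup>+s. indicator A (\<gamma> i s) * indicator {0..\<l> i} s \<partial>lborel))"
    by (rule nn_integral_wt) measurable
  also have "(\<lambda>i. \<integral>\<^sup>+s. indicator A (\<gamma> i s) * indicator {0..\<l> i} s \<partial>lborel) =
      (\<lambda>i. emeasure lborel {s\<in>{0<..<\<l> i}. \<gamma> i s \<in> A})"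
  proof
    fix i
    have "AE s in lborel. s \<noteq> 0 \<and> s \<noteq> \<l> i" by (intro AE_conjI AE_lborel_singleton)
    then have "AE s in lborel. (indicator A (\<gamma> i s) * indicator {0..\<l> i} s :: ennreal) = indicator {s\<in>{0<..<\<l> i}. \<gamma> i s \<in> A} s"
      by eventually_elim (auto simp: indicator_def)
    then have "(\<integral>\<^sup>+s. indicator A (\<gamma> i s) * indicator {0..\<l> i} s \<partial>lborel) =
        (\<integral>\<^sup>+s. indicator {s\<in>{0<..<\<l> i}. \<gamma> i s \<in> A} s \<partial>lborel)"
      by (rule nn_integral_cong_AE)
    also have "\<dots> = emeasure lborel {s\<in>{0<..<\<l> i}. \<gamma> i s \<in> A}"
      by (intro nn_integral_indicator) measurable
    finally show "(\<integral>\<^sup>+s. indicator A (\<gamma> i s) * indicator {0..\<l> i} s \<partial>lborel) =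
        emeasure lborel {s\<in>{0<..<\<l> i}. \<gamma> i s \<in> A}" .
  qed
  finally show ?thesis .
qed

lemma emeasure_wt_UNIV:
  assumes "finite_coeffs c"
  shows "emeasure (wt c) UNIV = ennreal (\<Sum>i. \<bar>c i\<bar> * \<l> i)"
proof -
  have "emeasure lborel {s \<in> {0<..<\<l> i}. \<gamma> i s \<in> UNIV} = ennreal (\<l> i)" for i
  proof -
    have "{s \<in> {0<..<\<l> i}. \<gamma> i s \<in> UNIV} = {0<..<\<l> i}" by auto
    then show ?thesis using len0[of i] by simp
  qed
  then have "emeasure (wt c) UNIV = (\<Sum>i. ennreal (\<bar>c i\<bar> * \<l> i))"
    using len0 by (subst emeasure_wt) (simp_all add: ennreal_mult less_imp_le)
  also have "\<dots> = ennreal (\<Sum>i. \<bar>c i\<bar> * \<l> i)"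
    using assms len0 by (intro suminf_ennreal_eq) (auto simp: finite_coeffs_def less_imp_le intro: summable_sums)
  finally show ?thesis .
qed

lemma finite_measure_wt: "finite_coeffs c \<Longrightarrow> finite_measure (wt c)"
proof (rule finite_measureI)
  have "space (wt c) = UNIV" by (simp add: wt_def)
  then show "finite_coeffs c \<Longrightarrow> emeasure (wt c) (space (wt c)) \<noteq> \<infinity>" by (simp add: emeasure_wt_UNIV)
qed

lemma integral_wt:
  assumes c: "finite_coeffs c" and f [measurable]: "f \<in> borel_measurable borel"
    and b: "\<And>x. 0 \<le> f x" "\<And>x. f x \<le> C"
  shows "(\<lambda>i. \<bar>c i\<bar> * edge_int (\<l> i) (\<lambda>s. f (\<gamma> i s))) sums (\<integral>x. f x \<partial>wt c)"
proof -
  interpret finite_measure "wt c" using c by (rule finite_measure_wt)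
  have E0: "0 \<le> edge_int (\<l> i) (\<lambda>s. f (\<gamma> i s))" for i
    unfolding edge_int_def set_lebesgue_integral_def using b by (intro Bochner_Integration.integral_nonneg) auto
  have En: "(\<integral>\<^sup>+s. ennreal (f (\<gamma> i s)) * indicator {0..\<l> i} s \<partial>lborel) = ennreal (edge_int (\<l> i) (\<lambda>s. f (\<gamma> i s)))" for i
  proof -
    have "set_integrable lborel {0..\<l> i} (\<lambda>s. f (\<gamma> i s))"
      by (rule bounded_set_integrable[of _ _ _ C]) (use b in auto)
    then have "(\<integral>\<^sup>+s. ennreal (indicator {0..\<l> i} s *\<^sub>R f (\<gamma> i s)) \<partial>lborel) = ennreal (edge_int (\<l> i) (\<lambda>s. f (\<gamma> i s)))"
      unfolding edge_int_def set_integrable_def set_lebesgue_integral_def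
      using b by (intro nn_integral_eq_integral) auto
    moreover have "ennreal (f (\<gamma> i s)) * indicator {0..\<l> i} s = ennreal (indicator {0..\<l> i} s *\<^sub>R f (\<gamma> i s))" for s
      by (auto simp: indicator_def)
    ultimately show ?thesis by simp
  qed
  have sm: "summable (\<lambda>i. \<bar>c i\<bar> * edge_int (\<l> i) (\<lambda>s. f (\<gamma> i s)))"
  proof (rule summable_bounded_terms[of _ \<l> _ C])
    show "summable (\<lambda>i. \<bar>\<bar>c i\<bar>\<bar> * \<l> i)" using c by (simp add: finite_coeffs_def)
    show "\<bar>edge_int (\<l> i) (\<lambda>s. f (\<gamma> i s))\<bar> \<le> \<l> i * C" for i
      by (rule edge_int_bound) (use b len0[of i] in auto)
  qed
  have int: "integrable (wt c) f"
    by (rule integrable_const_bound[of _ C]) (use b in auto)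
  have "ennreal (\<integral>x. f x \<partial>wt c) = (\<integral>\<^sup>+x. ennreal (f x) \<partial>wt c)"
    using int b by (intro nn_integral_eq_integral[symmetric]) auto
  also have "\<dots> = (\<Sum>i. ennreal \<bar>c i\<bar> * ennreal (edge_int (\<l> i) (\<lambda>s. f (\<gamma> i s))))"
    by (subst nn_integral_wt) (auto simp: En)
  also have "\<dots> = ennreal (\<Sum>i. \<bar>c i\<bar> * edge_int (\<l> i) (\<lambda>s. f (\<gamma> i s)))"
    unfolding ennreal_mult'[OF abs_ge_zero, symmetric] using E0 sm
    by (intro suminf_ennreal_eq) (auto intro: summable_sums)
  finally have "(\<integral>x. f x \<partial>wt c) = (\<Sum>i. \<bar>c i\<bar> * edge_int (\<l> i) (\<lambda>s. f (\<gamma> i s)))"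
    using b E0 sm by (subst (asm) ennreal_inj) (auto intro!: suminf_nonneg Bochner_Integration.integral_nonneg)
  then show ?thesis using sm by (simp add: summable_sums)
qed

lemma cur_term_measurable:
  assumes "f \<in> borel_measurable borel" "\<pi> \<in> Lip_fun"
  shows "(\<lambda>s. f (\<gamma> i s) * lderiv (\<lambda>s. \<pi> (\<gamma> i s)) s) \<in> borel_measurable borel"
proof -
  note assms(1) [measurable]
  have [measurable]: "lderiv (\<lambda>s. \<pi> (\<gamma> i s)) \<in> borel_measurable borel"
    by (rule lderiv_measurable[OF Lip_along[OF assms(2)]])
  show ?thesis by measurable
qed

lemma cur_term_bound:
  assumes "\<And>x. \<bar>f x\<bar> \<le> C" "L-lipschitz_on UNIV \<pi>"
  shows "\<bar>f (\<gamma> i s) * lderiv (\<lambda>s. \<pi> (\<gamma> i s)) s\<bar> \<le> C * L"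
  unfolding abs_mult
  using assms(1)[of "\<gamma> i s"] lderiv_bound[OF lipschitz_along[OF assms(2)], of i s]
  by (intro mult_mono) auto

lemma cur_sums:
  assumes c: "finite_coeffs c" and f: "f \<in> borel_measurable borel" "\<And>x. \<bar>f x\<bar> \<le> C" and \<pi>: "\<pi> \<in> Lip_fun"
  shows "(\<lambda>i. c i * edge_int (\<l> i) (\<lambda>s. f (\<gamma> i s) * lderiv (\<lambda>s. \<pi> (\<gamma> i s)) s)) sums cur c f \<pi>"
proof -
  obtain L where L: "L-lipschitz_on UNIV \<pi>" using \<pi> by (auto simp: Lip_fun_def)
  have "\<bar>edge_int (\<l> i) (\<lambda>s. f (\<gamma> i s) * lderiv (\<lambda>s. \<pi> (\<gamma> i s)) s)\<bar> \<le> \<l> i * (C * L)" for i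
    by (rule edge_int_bound[OF less_imp_le[OF len0] cur_term_measurable[OF f(1) \<pi>] cur_term_bound[where f=f, OF f(2) L]])
  then show ?thesis
    unfolding cur_def by (rule summable_sums[OF summable_bounded_terms[OF c[unfolded finite_coeffs_def]]])
qed

text \<open>Stated for bounded Borel f because the extension of the current to products with
  indicators of open sets is estimated with it.\<close>

lemma cur_mass_le:
  assumes c: "finite_coeffs c" and f: "f \<in> borel_measurable borel" "\<And>x. \<bar>f x\<bar> \<le> C" and L: "L-lipschitz_on UNIV \<pi>"
  shows "\<bar>cur c f \<pi>\<bar> \<le> L * (\<integral>x. \<bar>f x\<bar> \<partial>wt c)"
proof -
  note f(1) [measurable]
  have L0: "0 \<le> L" using L by (rule lipschitz_on_nonneg)
  let ?t = "\<lambda>i. c i * edge_int (\<l> i) (\<lambda>s. f (\<gamma> i s) * lderiv (\<lambda>s. \<pi> (\<gamma> i s)) s)"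
  have s1: "?t sums cur c f \<pi>" by (rule cur_sums[OF c f Lip_funI[OF L]])
  have "(\<lambda>i. \<bar>c i\<bar> * edge_int (\<l> i) (\<lambda>s. \<bar>f (\<gamma> i s)\<bar>)) sums (\<integral>x. \<bar>f x\<bar> \<partial>wt c)"
    by (rule integral_wt[OF c, where f="\<lambda>x. \<bar>f x\<bar>" and C=C]) (use f(1,2) in \<open>simp_all add: borel_measurable_abs\<close>)
  then have s2: "(\<lambda>i. L * (\<bar>c i\<bar> * edge_int (\<l> i) (\<lambda>s. \<bar>f (\<gamma> i s)\<bar>))) sums (L * (\<integral>x. \<bar>f x\<bar> \<partial>wt c))"
    by (rule sums_mult)
  have le: "\<bar>?t i\<bar> \<le> L * (\<bar>c i\<bar> * edge_int (\<l> i) (\<lambda>s. \<bar>f (\<gamma> i s)\<bar>))" for i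
  proof -
    have "\<bar>edge_int (\<l> i) (\<lambda>s. f (\<gamma> i s) * lderiv (\<lambda>s. \<pi> (\<gamma> i s)) s)\<bar> \<le> edge_int (\<l> i) (\<lambda>s. L * \<bar>f (\<gamma> i s)\<bar>)"
    proof (rule edge_int_abs_le[where f="\<lambda>s. f (\<gamma> i s) * lderiv (\<lambda>s. \<pi> (\<gamma> i s)) s" and g="\<lambda>s. L * \<bar>f (\<gamma> i s)\<bar>" and D="L * C"])
      show "(\<lambda>s. f (\<gamma> i s) * lderiv (\<lambda>s. \<pi> (\<gamma> i s)) s) \<in> borel_measurable borel"
        by (rule cur_term_measurable[OF f(1) Lip_funI[OF L]])
      show "\<bar>L * \<bar>f (\<gamma> i s)\<bar>\<bar> \<le> L * C" for s
        unfolding abs_mult abs_abs abs_of_nonneg[OF L0] by (rule mult_left_mono[OF f(2) L0])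
      show "\<bar>f (\<gamma> i s) * lderiv (\<lambda>s. \<pi> (\<gamma> i s)) s\<bar> \<le> L * \<bar>f (\<gamma> i s)\<bar>" for s
        unfolding abs_mult mult.commute[of L]
        by (rule mult_left_mono[OF lderiv_bound[OF lipschitz_along[OF L]] abs_ge_zero])
    qed measurable
    also have "\<dots> = L * edge_int (\<l> i) (\<lambda>s. \<bar>f (\<gamma> i s)\<bar>)"
      by (simp add: edge_int_def)
    finally have "\<bar>c i\<bar> * \<bar>edge_int (\<l> i) (\<lambda>s. f (\<gamma> i s) * lderiv (\<lambda>s. \<pi> (\<gamma> i s)) s)\<bar> \<le>
        \<bar>c i\<bar> * (L * edge_int (\<l> i) (\<lambda>s. \<bar>f (\<gamma> i s)\<bar>))"
      by (rule mult_left_mono) simp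
    then show ?thesis by (simp add: abs_mult mult.left_commute)
  qed
  have "cur c f \<pi> \<le> L * (\<integral>x. \<bar>f x\<bar> \<partial>wt c)"
    by (rule sums_le[OF abs_le_D1[OF le] s1 s2])
  moreover have "- cur c f \<pi> \<le> L * (\<integral>x. \<bar>f x\<bar> \<partial>wt c)"
    by (rule sums_le[OF abs_le_D2[OF le] sums_minus[OF s1] s2])
  ultimately show ?thesis by (rule abs_leI)
qed

lemma mass_bound_cur: "finite_coeffs c \<Longrightarrow> mass_bound (cur c) (wt c)"
  unfolding mass_bound_def
proof (intro conjI ballI)
  fix f \<pi> assume c: "finite_coeffs c" and f: "f \<in> (bLip_fun :: ('a \<Rightarrow> real) set)" and \<pi>: "\<pi> \<in> (Lip_fun :: ('a \<Rightarrow> real) set)"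
  obtain C where "\<And>x. \<bar>f x\<bar> \<le> C" using bLip_fun_bounded[OF f] by blast
  then show "\<bar>cur c f \<pi>\<bar> \<le> lip \<pi> * (\<integral>x. \<bar>f x\<bar> \<partial>wt c)"
    by (rule cur_mass_le[OF c bLip_measurable[OF f] _ lipschitz_lip[OF \<pi>]])
qed (use finite_measure_wt in auto)

text \<open>For the continuity axiom every term converges by \<open>lderiv_weak_limit\<close>, and
  the series is dominated by the weighted lengths. For locality the integrand vanishes at every
  point: either f is 0 there or \<pi> is constant around it along the edge, which makes
  \<open>lderiv\<close> 0.\<close>

lemma metric_current_cur:
  assumes c: "finite_coeffs c"
  shows "metric_current1 (cur c)"
  unfolding metric_current1_def
proof (intro conjI ballI allI impI)
  show "\<exists>\<mu>. mass_bound (cur c) \<mu>" using mass_bound_cur[OF c] by blast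
next
  fix f g \<pi> :: "'a \<Rightarrow> real" and a b
  assume f: "f \<in> bLip_fun" and g: "g \<in> bLip_fun" and \<pi>: "\<pi> \<in> Lip_fun"
  obtain L where L: "L-lipschitz_on UNIV \<pi>" using \<pi> by (auto simp: Lip_fun_def)
  obtain C where C: "\<And>x. \<bar>f x\<bar> \<le> C" using bLip_fun_bounded[OF f] by blast
  obtain D where D: "\<And>x. \<bar>g x\<bar> \<le> D" using bLip_fun_bounded[OF g] by blast
  let ?d = "\<lambda>i s. lderiv (\<lambda>s. \<pi> (\<gamma> i s)) s"
  have eq: "edge_int (\<l> i) (\<lambda>s. (a * f (\<gamma> i s) + b * g (\<gamma> i s)) * ?d i s) =
      a * edge_int (\<l> i) (\<lambda>s. f (\<gamma> i s) * ?d i s) + b * edge_int (\<l> i) (\<lambda>s. g (\<gamma> i s) * ?d i s)" for i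
    using edge_int_lincomb[OF cur_term_measurable[OF bLip_measurable[OF f] \<pi>, where i=i] cur_term_measurable[OF bLip_measurable[OF g] \<pi>, where i=i]
      cur_term_bound[where f=f and i=i, OF C L] cur_term_bound[where f=g and i=i, OF D L], where l="\<l> i" and a=a and b=b]
    unfolding distrib_right mult.assoc .
  have "(\<lambda>i. a * (c i * edge_int (\<l> i) (\<lambda>s. f (\<gamma> i s) * ?d i s)) + b * (c i * edge_int (\<l> i) (\<lambda>s. g (\<gamma> i s) * ?d i s)))
      sums (a * cur c f \<pi> + b * cur c g \<pi>)"
    by (intro sums_add sums_mult cur_sums[OF c bLip_measurable[OF f] C \<pi>] cur_sums[OF c bLip_measurable[OF g] D \<pi>])
  moreover have "(\<lambda>i. a * (c i * edge_int (\<l> i) (\<lambda>s. f (\<gamma> i s) * ?d i s)) + b * (c i * edge_int (\<l> i) (\<lambda>s. g (\<gamma> i s) * ?d i s))) =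
      (\<lambda>i. c i * (a * edge_int (\<l> i) (\<lambda>s. f (\<gamma> i s) * ?d i s) + b * edge_int (\<l> i) (\<lambda>s. g (\<gamma> i s) * ?d i s)))"
    by (rule ext, simp only: distrib_left mult.left_commute)
  ultimately show "cur c (\<lambda>x. a * f x + b * g x) \<pi> = a * cur c f \<pi> + b * cur c g \<pi>"
    unfolding cur_def[of c "\<lambda>x. a * f x + b * g x"] eq
    by (simp only: sums_unique[symmetric])
next
  fix f \<pi> \<rho> :: "'a \<Rightarrow> real" and a b
  assume f: "f \<in> bLip_fun" and \<pi>: "\<pi> \<in> Lip_fun" and \<rho>: "\<rho> \<in> Lip_fun"
  obtain L where L: "L-lipschitz_on UNIV \<pi>" using \<pi> by (auto simp: Lip_fun_def)
  obtain M where M: "M-lipschitz_on UNIV \<rho>" using \<rho> by (auto simp: Lip_fun_def)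
  obtain C where C: "\<And>x. \<bar>f x\<bar> \<le> C" using bLip_fun_bounded[OF f] by blast
  let ?d = "\<lambda>\<pi> i s. lderiv (\<lambda>s. \<pi> (\<gamma> i s)) s"
  have fm: "f \<in> borel_measurable borel" using f by (rule bLip_measurable)
  have eq: "edge_int (\<l> i) (\<lambda>s. f (\<gamma> i s) * ?d (\<lambda>x. a * \<pi> x + b * \<rho> x) i s) =
      a * edge_int (\<l> i) (\<lambda>s. f (\<gamma> i s) * ?d \<pi> i s) + b * edge_int (\<l> i) (\<lambda>s. f (\<gamma> i s) * ?d \<rho> i s)" for i
  proof -
    have m [measurable]: "(\<lambda>s. f (\<gamma> i s) * ?d \<pi> i s) \<in> borel_measurable borel" "(\<lambda>s. f (\<gamma> i s) * ?d \<rho> i s) \<in> borel_measurable borel"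
      by (rule cur_term_measurable[OF fm \<pi>], rule cur_term_measurable[OF fm \<rho>])
    have "edge_int (\<l> i) (\<lambda>s. f (\<gamma> i s) * ?d (\<lambda>x. a * \<pi> x + b * \<rho> x) i s) =
        edge_int (\<l> i) (\<lambda>s. a * (f (\<gamma> i s) * ?d \<pi> i s) + b * (f (\<gamma> i s) * ?d \<rho> i s))"
    proof (rule edge_int_cong_AE)
      show "(\<lambda>s. f (\<gamma> i s) * ?d (\<lambda>x. a * \<pi> x + b * \<rho> x) i s) \<in> borel_measurable borel"
        by (rule cur_term_measurable[OF fm Lip_fun_lincomb[OF \<pi> \<rho>]])
      show "AE s in lborel. s \<in> {0..\<l> i} \<longrightarrow> f (\<gamma> i s) * ?d (\<lambda>x. a * \<pi> x + b * \<rho> x) i s =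
          a * (f (\<gamma> i s) * ?d \<pi> i s) + b * (f (\<gamma> i s) * ?d \<rho> i s)"
        using lderiv_lincomb[OF Lip_along[OF \<pi>, of i] Lip_along[OF \<rho>, of i], of a b]
        by eventually_elim (simp add: algebra_simps)
    qed measurable
    also have "\<dots> = a * edge_int (\<l> i) (\<lambda>s. f (\<gamma> i s) * ?d \<pi> i s) + b * edge_int (\<l> i) (\<lambda>s. f (\<gamma> i s) * ?d \<rho> i s)"
      by (rule edge_int_lincomb[OF m cur_term_bound[where f=f, OF C L] cur_term_bound[where f=f, OF C M]])
    finally show ?thesis .
  qed
  have "(\<lambda>i. a * (c i * edge_int (\<l> i) (\<lambda>s. f (\<gamma> i s) * ?d \<pi> i s)) + b * (c i * edge_int (\<l> i) (\<lambda>s. f (\<gamma> i s) * ?d \<rho> i s)))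
      sums (a * cur c f \<pi> + b * cur c f \<rho>)"
    by (intro sums_add sums_mult cur_sums[OF c fm C \<pi>] cur_sums[OF c fm C \<rho>])
  moreover have "(\<lambda>i. a * (c i * edge_int (\<l> i) (\<lambda>s. f (\<gamma> i s) * ?d \<pi> i s)) + b * (c i * edge_int (\<l> i) (\<lambda>s. f (\<gamma> i s) * ?d \<rho> i s))) =
      (\<lambda>i. c i * (a * edge_int (\<l> i) (\<lambda>s. f (\<gamma> i s) * ?d \<pi> i s) + b * edge_int (\<l> i) (\<lambda>s. f (\<gamma> i s) * ?d \<rho> i s)))"
    by (rule ext, simp only: distrib_left mult.left_commute)
  ultimately show "cur c f (\<lambda>x. a * \<pi> x + b * \<rho> x) = a * cur c f \<pi> + b * cur c f \<rho>"
    unfolding cur_def[of c f "\<lambda>x. a * \<pi> x + b * \<rho> x"] eq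
    by (simp only: sums_unique[symmetric])
next
  fix f \<pi> :: "'a \<Rightarrow> real" and \<pi>s L
  assume f: "f \<in> bLip_fun" and *: "(\<forall>n. L-lipschitz_on UNIV (\<pi>s n)) \<and> (\<forall>x. (\<lambda>n. \<pi>s n x) \<longlonglongrightarrow> \<pi> x)"
  have \<pi>s: "L-lipschitz_on UNIV (\<pi>s n)" and lim: "(\<lambda>n. \<pi>s n x) \<longlonglongrightarrow> \<pi> x" for n x
    using * by blast+
  have L: "L-lipschitz_on UNIV \<pi>"
  proof (rule lipschitz_onI)
    fix x y
    have "dist (\<pi>s n x) (\<pi>s n y) \<le> L * dist x y" for n by (rule lipschitz_onD[OF \<pi>s]) auto
    then show "dist (\<pi> x) (\<pi> y) \<le> L * dist x y"
      by (intro tendsto_upperbound[OF tendsto_dist[OF lim lim] always_eventually]) auto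
  qed (rule lipschitz_on_nonneg[OF \<pi>s])
  obtain C where C: "\<And>x. \<bar>f x\<bar> \<le> C" using bLip_fun_bounded[OF f] by blast
  have fm: "f \<in> borel_measurable borel" using f by (rule bLip_measurable)
  show "(\<lambda>n. cur c f (\<pi>s n)) \<longlonglongrightarrow> cur c f \<pi>"
    unfolding cur_def
  proof (rule suminf_dominated_convergence[where w="\<lambda>i. (\<bar>c i\<bar> * \<l> i) * (C * L)"
        and F="\<lambda>n i. c i * edge_int (\<l> i) (\<lambda>s. f (\<gamma> i s) * lderiv (\<lambda>s. \<pi>s n (\<gamma> i s)) s)"])
    show "summable (\<lambda>i. (\<bar>c i\<bar> * \<l> i) * (C * L))"
      using c by (intro summable_mult2) (simp add: finite_coeffs_def)
    fix n i
    have "\<bar>edge_int (\<l> i) (\<lambda>s. f (\<gamma> i s) * lderiv (\<lambda>s. \<pi>s n (\<gamma> i s)) s)\<bar> \<le> \<l> i * (C * L)"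
      by (rule edge_int_bound[OF less_imp_le[OF len0] cur_term_measurable[OF fm Lip_funI[OF \<pi>s]] cur_term_bound[where f=f, OF C \<pi>s]])
    then show "\<bar>c i * edge_int (\<l> i) (\<lambda>s. f (\<gamma> i s) * lderiv (\<lambda>s. \<pi>s n (\<gamma> i s)) s)\<bar> \<le> (\<bar>c i\<bar> * \<l> i) * (C * L)"
      unfolding abs_mult mult.assoc by (rule mult_left_mono[OF _ abs_ge_zero])
  next
    fix i
    show "(\<lambda>n. c i * edge_int (\<l> i) (\<lambda>s. f (\<gamma> i s) * lderiv (\<lambda>s. \<pi>s n (\<gamma> i s)) s)) \<longlonglongrightarrow>
        c i * edge_int (\<l> i) (\<lambda>s. f (\<gamma> i s) * lderiv (\<lambda>s. \<pi> (\<gamma> i s)) s)"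
      unfolding edge_int_def
      by (rule tendsto_mult_left[OF lderiv_weak_limit[OF lipschitz_along[OF \<pi>s] lim
            Lip_along[OF Lip_funI[OF L]] Lip_along[OF bLip_Lip[OF f]] less_imp_le[OF len0]]])
  qed
next
  fix f \<pi> :: "'a \<Rightarrow> real" and U k
  assume f: "f \<in> bLip_fun" and \<pi>: "\<pi> \<in> Lip_fun" and *: "open U \<and> {x. f x \<noteq> 0} \<subseteq> U \<and> (\<forall>x\<in>U. \<pi> x = k)"
  have z: "f (\<gamma> i s) * lderiv (\<lambda>s. \<pi> (\<gamma> i s)) s = 0" for i s
  proof (cases "f (\<gamma> i s) = 0")
    case False
    have "open (\<gamma> i -` U)"
      by (rule open_vimage[OF conjunct1[OF *] lipschitz_on_continuous_on[OF \<gamma>_lipschitz[of i]]])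
    moreover have "s \<in> \<gamma> i -` U" using False conjunct1[OF conjunct2[OF *]] by (auto simp: subset_iff)
    ultimately have "eventually (\<lambda>t. t \<in> \<gamma> i -` U) (nhds s)" by (rule eventually_nhds_in_open)
    moreover have "\<pi> (\<gamma> i t) = k" if "t \<in> \<gamma> i -` U" for t
      using * that by (simp add: vimage_def)
    ultimately have "eventually (\<lambda>t. \<pi> (\<gamma> i t) = k) (nhds s)" by (rule eventually_mono)
    then have "lderiv (\<lambda>s. \<pi> (\<gamma> i s)) s = 0" by (rule lderiv_local_const[OF Lip_along[OF \<pi>]])
    then show ?thesis by simp
  qed simp
  show "cur c f \<pi> = 0" unfolding cur_def z edge_int_def by (simp add: set_lebesgue_integral_def)
qed

text \<open>From Lipschitz tests to Borel sets. Cut-offs by the distance to the complement tend to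
  the indicator of an open set, and outer regularity of the transported measure on the line reaches
  Borel sets. The tests vanish at the ends so that their extension by 0 is Lipschitz.\<close>

lemma edge_measure_lower:
  assumes \<nu>: "finite_measure \<nu>" "sets \<nu> = sets borel" and n: "0 \<le> n"
    and H: "\<And>g. g \<in> Lip_fun \<Longrightarrow> (\<And>s. 0 \<le> g s) \<Longrightarrow> (\<And>s. g s \<le> 1) \<Longrightarrow> (\<And>s. s \<notin> {0<..<\<l> i} \<Longrightarrow> g s = 0) \<Longrightarrow>
      n * edge_int (\<l> i) g \<le> (\<integral>x. ext i g x \<partial>\<nu>)"
    and A: "A \<in> sets borel"
  shows "ennreal n * emeasure lborel {s\<in>{0<..<\<l> i}. \<gamma> i s \<in> A} \<le> emeasure \<nu> (A \<inter> edge i)"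
proof -
  interpret \<nu>: finite_measure \<nu> by fact
  note \<nu>(2) [measurable_cong] A [measurable]
  have sp: "space \<nu> = UNIV" using sets_eq_imp_space_eq[OF \<nu>(2)] by simp
  have [measurable]: "cr i \<in> borel_measurable borel" using cr_Lip by (rule Lip_fun_measurable)
  \<comment> \<open>The part of \<nu> on the edge, read in its coordinate; on the line this finite
    Borel measure is outer regular.\<close>
  define \<rho> where "\<rho> = distr (density \<nu> (indicator (edge i))) borel (cr i)"
  have [simp, measurable_cong]: "sets \<rho> = sets borel" by (simp add: \<rho>_def)
  have \<rho>: "emeasure \<rho> B = emeasure \<nu> (edge i \<inter> cr i -` B)" if [measurable]: "B \<in> sets borel" for B
  proof -
    have "cr i -` B \<in> sets \<nu>"
      using measurable_sets[of "cr i" borel borel B] that by (simp add: \<nu>(2))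
    then show ?thesis
      unfolding \<rho>_def using \<nu>(2)
      by (subst emeasure_distr) (auto simp: sp emeasure_restricted)
  qed
  have op: "ennreal n * emeasure lborel (U \<inter> {0<..<\<l> i}) \<le> emeasure \<rho> U" if U: "open U" for U
  proof -
    define W where "W = U \<inter> {0<..<\<l> i}"
    have W: "open W" "W \<subseteq> {0<..<\<l> i}" using U by (auto simp: W_def)
    have [measurable]: "U \<in> sets borel" "W \<in> sets borel" using U W by auto
    have "0 \<notin> W" using W(2) by auto
    then have Wc: "closed (- W)" "- W \<noteq> {}" using W(1) by (auto simp: closed_Compl)
    define g where "g k s = max 0 (min (real k * infdist s (- W)) 1)" for k s
    have g01: "0 \<le> g k s" "g k s \<le> 1" for k s by (auto simp: g_def)
    have g0: "g k s = 0" if "s \<notin> W" for k s using that by (simp add: g_def)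
    have gL: "g k \<in> Lip_fun" for k
    proof -
      have "(\<lambda>s. real k * infdist s (- W) + 0 * infdist s (- W)) \<in> Lip_fun"
        by (rule Lip_fun_lincomb[OF Lip_fun_infdist Lip_fun_infdist])
      then have "(\<lambda>s. real k * infdist s (- W)) \<in> Lip_fun" by simp
      then show ?thesis unfolding g_def by (rule Lip_fun_clamp)
    qed
    have [measurable]: "g k \<in> borel_measurable borel" for k by (rule Lip_fun_measurable[OF gL])
    have glim: "(\<lambda>k. g k s) \<longlonglongrightarrow> indicator W s" for s
    proof (cases "s \<in> W")
      case True
      have "0 < infdist s (- W)"
      proof -
        have "infdist s (- W) \<noteq> 0" using True in_closed_iff_infdist_zero[OF Wc, of s] by blast
        then show ?thesis using infdist_nonneg[of s "-W"] by linarith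
      qed
      then obtain K where K: "1 < real K * infdist s (- W)"
        using ex_less_of_nat_mult[of "infdist s (- W)" 1] by blast
      have "g k s = 1" if "K \<le> k" for k
      proof -
        have "real K * infdist s (- W) \<le> real k * infdist s (- W)"
          using that \<open>0 < infdist s (- W)\<close> by (intro mult_right_mono) auto
        then show ?thesis using K by (simp add: g_def)
      qed
      then have "\<forall>\<^sub>F k in sequentially. g k s = indicator W s"
        using True unfolding eventually_sequentially by auto
      then show ?thesis by (rule tendsto_eventually)
    qed (simp add: g0)
    have lim: "(\<lambda>k. edge_int (\<l> i) (g k)) \<longlonglongrightarrow> edge_int (\<l> i) (indicator W)"
      unfolding edge_int_def set_lebesgue_integral_def
    proof (rule integral_dominated_convergence[where w="indicator {0..\<l> i}"])
      show "integrable lborel (indicator {0..\<l> i} :: real \<Rightarrow> real)"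
        by (rule integrable_real_indicator) (auto simp: emeasure_lborel_Icc_eq)
      show "AE x in lborel. (\<lambda>k. indicator {0..\<l> i} x *\<^sub>R g k x) \<longlonglongrightarrow> indicator {0..\<l> i} x *\<^sub>R indicator W x"
        by (intro AE_I2 tendsto_scaleR tendsto_const glim)
      show "AE x in lborel. norm (indicator {0..\<l> i} x *\<^sub>R g k x) \<le> indicator {0..\<l> i} x" for k
        using g01 by (intro AE_I2) (auto simp: indicator_def)
    qed measurable
    have Wfin: "emeasure lborel W < \<infinity>"
    proof -
      have "emeasure lborel W \<le> emeasure lborel {0..\<l> i}" using W(2) by (intro emeasure_mono) auto
      also have "\<dots> < \<infinity>" by (simp add: emeasure_lborel_Icc_eq)
      finally show ?thesis .
    qed
    have "edge_int (\<l> i) (indicator W) = (\<integral>x. indicator W x \<partial>lborel)"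
      unfolding edge_int_def set_lebesgue_integral_def
      using W(2) by (intro Bochner_Integration.integral_cong) (auto simp: indicator_def)
    also have "\<dots> = measure lborel W" by simp
    finally have Wm: "edge_int (\<l> i) (indicator W) = measure lborel W" .
    have ub: "n * edge_int (\<l> i) (g k) \<le> measure \<rho> U" for k
    proof -
      have gz: "g k s = 0" if "s \<notin> {0<..<\<l> i}" for s
        by (rule g0) (use that W(2) in blast)
      have "n * edge_int (\<l> i) (g k) \<le> (\<integral>x. ext i (g k) x \<partial>\<nu>)"
        by (rule H[OF gL g01 gz])
      also have "\<dots> \<le> (\<integral>x. indicator (edge i \<inter> cr i -` U) x \<partial>\<nu>)"
      proof (rule integral_mono)
        have "g k 0 = 0" "g k (\<l> i) = 0" by (rule gz, simp)+
        then show "integrable \<nu> (ext i (g k))" by (rule bLip_integrable[OF \<nu> ext_bLip[OF gL]])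
        have "edge i \<inter> cr i -` U \<in> sets \<nu>"
          using measurable_sets[of "cr i" borel borel U] by (simp add: \<nu>(2) sets.Int)
        then show "integrable \<nu> (indicator (edge i \<inter> cr i -` U) :: 'a \<Rightarrow> real)"
          by (intro integrable_real_indicator) (auto simp: \<nu>.emeasure_eq_measure)
        show "ext i (g k) x \<le> indicator (edge i \<inter> cr i -` U) x" for x
          using g01[of k "cr i x"] g0[of "cr i x" k] by (auto simp: ext_def indicator_def W_def)
      qed
      also have "\<dots> = measure \<nu> (edge i \<inter> cr i -` U)"
        by (simp add: sp)
      also have "\<dots> = measure \<rho> U" unfolding measure_def by (simp add: \<rho>)
      finally show ?thesis .
    qed
    have "n * measure lborel W \<le> measure \<rho> U"
      unfolding Wm[symmetric]
      by (rule tendsto_upperbound[OF tendsto_mult_left[OF lim] always_eventually]) (use ub in auto)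
    then have "ennreal (n * measure lborel W) \<le> ennreal (measure \<rho> U)" by (rule ennreal_leI)
    also have "\<dots> = emeasure \<rho> U"
    proof -
      have "measure \<rho> U = measure \<nu> (edge i \<inter> cr i -` U)" unfolding measure_def by (simp add: \<rho>)
      then show ?thesis unfolding \<rho>[OF \<open>U \<in> sets borel\<close>] by (simp add: \<nu>.emeasure_eq_measure)
    qed
    finally show ?thesis
      using n Wfin by (simp add: W_def[symmetric] ennreal_mult emeasure_eq_ennreal_measure)
  qed
  have B: "\<gamma> i -` A \<in> sets borel" using measurable_sets[OF \<gamma>_measurable[of i] A] by simp
  have fin: "emeasure \<rho> (space \<rho>) \<noteq> \<infinity>"
  proof -
    have "space \<rho> = UNIV" by (simp add: \<rho>_def)
    then show ?thesis using \<rho>[of UNIV] by (simp add: \<nu>.emeasure_eq_measure)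
  qed
  have seteq: "{s\<in>{0<..<\<l> i}. \<gamma> i s \<in> A} = \<gamma> i -` A \<inter> {0<..<\<l> i}" by auto
  have "ennreal n * emeasure lborel {s\<in>{0<..<\<l> i}. \<gamma> i s \<in> A} \<le> (INF U\<in>{U. \<gamma> i -` A \<subseteq> U \<and> open U}. emeasure \<rho> U)"
  proof (intro INF_greatest)
    fix U assume "U \<in> {U. \<gamma> i -` A \<subseteq> U \<and> open U}"
    then have U: "\<gamma> i -` A \<subseteq> U" "open U" by auto
    have "ennreal n * emeasure lborel (\<gamma> i -` A \<inter> {0<..<\<l> i}) \<le> ennreal n * emeasure lborel (U \<inter> {0<..<\<l> i})"
      using U by (intro mult_left_mono emeasure_mono) auto
    also have "\<dots> \<le> emeasure \<rho> U" by (rule op[OF U(2)])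
    finally show "ennreal n * emeasure lborel {s\<in>{0<..<\<l> i}. \<gamma> i s \<in> A} \<le> emeasure \<rho> U"
      unfolding seteq .
  qed
  also have "\<dots> = emeasure \<rho> (\<gamma> i -` A)"
    by (rule outer_regular[symmetric]) (use fin B in auto)
  also have "\<dots> = emeasure \<nu> (edge i \<inter> cr i -` (\<gamma> i -` A))" by (rule \<rho>[OF B])
  also have "edge i \<inter> cr i -` (\<gamma> i -` A) = A \<inter> edge i"
    using edge_coord(3) by auto
  finally show ?thesis .
qed

end

section \<open>Cycles on a network of edges\<close>

text \<open>Functionals are total, and the axioms say nothing about values off
  \<open>bLip_fun\<close> \<times> \<open>Lip_fun\<close>. Agreement there replaces equality, and
  every notion in the theorem is invariant under it.\<close>

definition currents_agree :: "('a::metric_space) current1 \<Rightarrow> 'a current1 \<Rightarrow> bool" where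
  "currents_agree S T \<longleftrightarrow> (\<forall>f\<in>bLip_fun. \<forall>\<pi>\<in>Lip_fun. S f \<pi> = T f \<pi>)"

lemma currents_agreeD: "currents_agree S T \<Longrightarrow> f \<in> bLip_fun \<Longrightarrow> \<pi> \<in> Lip_fun \<Longrightarrow> S f \<pi> = T f \<pi>"
  by (simp add: currents_agree_def)

lemma mass_bound_agree:
  assumes "currents_agree S T"
  shows "mass_bound S = mass_bound T"
proof
  fix \<mu>
  show "mass_bound S \<mu> = mass_bound T \<mu>"
    unfolding mass_bound_def
    by (intro conj_cong refl ball_cong) (simp add: currents_agreeD[OF assms])
qed

lemma mass_measure_agree: "currents_agree S T \<Longrightarrow> mass_measure S = mass_measure T"
  unfolding mass_measure_def by (simp only: mass_bound_agree)

lemma metric_current_agree: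
  assumes S: "metric_current1 S" and ag: "currents_agree S T"
  shows "metric_current1 T"
  unfolding metric_current1_def
proof (intro conjI ballI allI impI)
  note D = currents_agreeD[OF ag, symmetric]
  show "\<exists>\<mu>. mass_bound T \<mu>"
    using current_mass_bound[OF S] unfolding mass_bound_agree[OF ag] .
  fix f g \<pi> :: "'a \<Rightarrow> real" and a b
  assume f: "f \<in> bLip_fun" and g: "g \<in> bLip_fun" and \<pi>: "\<pi> \<in> Lip_fun"
  show "T (\<lambda>x. a * f x + b * g x) \<pi> = a * T f \<pi> + b * T g \<pi>"
    unfolding D[OF f \<pi>] D[OF g \<pi>] D[OF bLip_fun_lincomb[OF f g] \<pi>] by (rule current_lincomb[OF S f g \<pi>])
next
  note D = currents_agreeD[OF ag, symmetric]
  fix f \<pi> \<rho> :: "'a \<Rightarrow> real" and a b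
  assume f: "f \<in> bLip_fun" and \<pi>: "\<pi> \<in> Lip_fun" and \<rho>: "\<rho> \<in> Lip_fun"
  show "T f (\<lambda>x. a * \<pi> x + b * \<rho> x) = a * T f \<pi> + b * T f \<rho>"
    unfolding D[OF f \<pi>] D[OF f \<rho>] D[OF f Lip_fun_lincomb[OF \<pi> \<rho>]] by (rule current_lincomb2[OF S f \<pi> \<rho>])
next
  note D = currents_agreeD[OF ag, symmetric]
  fix f \<pi> :: "'a \<Rightarrow> real" and \<pi>s L
  assume f: "f \<in> bLip_fun" and *: "(\<forall>n. L-lipschitz_on UNIV (\<pi>s n)) \<and> (\<forall>x. (\<lambda>n. \<pi>s n x) \<longlonglongrightarrow> \<pi> x)"
  have \<pi>s: "L-lipschitz_on UNIV (\<pi>s n)" and lim: "(\<lambda>n. \<pi>s n x) \<longlonglongrightarrow> \<pi> x" for n x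
    using * by blast+
  have "L-lipschitz_on UNIV \<pi>"
  proof (rule lipschitz_onI)
    fix x y
    have "dist (\<pi>s n x) (\<pi>s n y) \<le> L * dist x y" for n by (rule lipschitz_onD[OF \<pi>s]) auto
    then show "dist (\<pi> x) (\<pi> y) \<le> L * dist x y"
      by (intro tendsto_upperbound[OF tendsto_dist[OF lim lim] always_eventually]) auto
  qed (rule lipschitz_on_nonneg[OF \<pi>s])
  then have \<pi>: "\<pi> \<in> Lip_fun" by (rule Lip_funI)
  show "(\<lambda>n. T f (\<pi>s n)) \<longlonglongrightarrow> T f \<pi>"
    unfolding D[OF f \<pi>] D[OF f Lip_funI[OF \<pi>s]] by (rule current_limit[OF S f \<pi>s lim])
next
  note D = currents_agreeD[OF ag, symmetric]
  fix f \<pi> :: "'a \<Rightarrow> real" and U k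
  assume f: "f \<in> bLip_fun" and \<pi>: "\<pi> \<in> Lip_fun" and *: "open U \<and> {x. f x \<noteq> 0} \<subseteq> U \<and> (\<forall>x\<in>U. \<pi> x = k)"
  show "T f \<pi> = 0"
    unfolding D[OF f \<pi>]
  proof (rule current_local[OF S f \<pi>])
    show "open U" using * by (rule conjunct1)
    show "x \<in> U" if "f x \<noteq> 0" for x using conjunct1[OF conjunct2[OF *]] that by (simp add: subset_iff)
    show "\<pi> x = k" if "x \<in> U" for x using conjunct2[OF conjunct2[OF *]] that by (rule bspec)
  qed
qed

lemma borel_extension_agree:
  assumes "currents_agree S T" "\<pi> \<in> Lip_fun"
  shows "borel_extension S g \<pi> = borel_extension T g \<pi>"
proof -
  have "(\<forall>n. F n \<in> bLip_fun) \<and> P \<longrightarrow> (\<lambda>n. S (F n) \<pi>) \<longlonglongrightarrow> v \<longleftrightarrow>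
      (\<forall>n. F n \<in> bLip_fun) \<and> P \<longrightarrow> (\<lambda>n. T (F n) \<pi>) \<longlonglongrightarrow> v" for F v P
    using currents_agreeD[OF assms(1) _ assms(2)] by simp
  then show ?thesis
    unfolding borel_extension_def mass_measure_agree[OF assms(1)] by simp
qed

lemma restrict_current_agree:
  "currents_agree S T \<Longrightarrow> \<pi> \<in> Lip_fun \<Longrightarrow> restrict_current S A f \<pi> = restrict_current T A f \<pi>"
  unfolding restrict_current_def by (rule borel_extension_agree)

lemma integer_rectifiable_agree:
  assumes S: "integer_rectifiable1 S" and ag: "currents_agree S T"
  shows "integer_rectifiable1 T"
  unfolding integer_rectifiable1_def
proof (intro conjI ballI allI impI)
  show "metric_current1 T"
    by (rule metric_current_agree[OF S[unfolded integer_rectifiable1_def, THEN conjunct1] ag])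
  show "\<exists>S\<in>sets borel. countably_rectifiable1 S \<and> emeasure (mass_measure T) (- S) = 0"
    using S unfolding integer_rectifiable1_def mass_measure_agree[OF ag] by (elim conjE)
  show "emeasure (mass_measure T) N = 0" if "N \<in> sets borel" "hausdorff1_outer N = 0" for N
    by (rule S[unfolded integer_rectifiable1_def mass_measure_agree[OF ag], THEN conjunct2, THEN conjunct2, THEN conjunct1, rule_format, OF that])
  fix \<phi> :: "'a \<Rightarrow> real" and A :: "'a set"
  assume \<phi>: "\<phi> \<in> Lip_fun" and A: "open A"
  have ex: "\<exists>\<theta>::real \<Rightarrow> int. integrable lebesgue (\<lambda>x. real_of_int (\<theta> x)) \<and>
      (\<forall>f\<in>bLip_fun. \<forall>\<pi>\<in>Lip_fun. pushforward \<phi> (restrict_current S A) f \<pi> =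
         line_current (\<lambda>x. real_of_int (\<theta> x)) f \<pi>)"
    by (rule S[unfolded integer_rectifiable1_def, THEN conjunct2, THEN conjunct2, THEN conjunct2, rule_format, OF \<phi> A])
  have push: "pushforward \<phi> (restrict_current T A) f \<pi> = pushforward \<phi> (restrict_current S A) f \<pi>"
    if "\<pi> \<in> Lip_fun" for f \<pi>
    unfolding pushforward_def using restrict_current_agree[OF ag Lip_fun_compose[OF that \<phi>]] by simp
  show "\<exists>\<theta>::real \<Rightarrow> int. integrable lebesgue (\<lambda>x. real_of_int (\<theta> x)) \<and>
      (\<forall>f\<in>bLip_fun. \<forall>\<pi>\<in>Lip_fun. pushforward \<phi> (restrict_current T A) f \<pi> =
         line_current (\<lambda>x. real_of_int (\<theta> x)) f \<pi>)"
    using ex by (simp only: push cong: ball_cong)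
qed

lemma charac_set_agree: "currents_agree S T \<Longrightarrow> charac_set S = charac_set T"
  by (simp add: charac_set_def mass_measure_agree)

lemma is_multiplicity_agree:
  assumes ag: "currents_agree S T"
  shows "is_multiplicity S = is_multiplicity T"
proof
  fix \<theta>
  have *: "(\<forall>f\<in>bLip_fun. \<forall>\<pi>\<in>Lip_fun. X f \<pi> sums S f \<pi>) \<longleftrightarrow> (\<forall>f\<in>bLip_fun. \<forall>\<pi>\<in>Lip_fun. X f \<pi> sums T f \<pi>)"
    for X :: "('a \<Rightarrow> real) \<Rightarrow> ('a \<Rightarrow> real) \<Rightarrow> nat \<Rightarrow> real"
    using currents_agreeD[OF ag] by simp
  show "is_multiplicity S \<theta> = is_multiplicity T \<theta>"
    unfolding is_multiplicity_def mass_measure_agree[OF ag] * ..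
qed

lemma mult_inf_agree: "currents_agree S T \<Longrightarrow> mult_inf S = mult_inf T"
  by (simp add: mult_inf_def multiplicity_def is_multiplicity_agree)

lemma mass_agree: "currents_agree S T \<Longrightarrow> mass S = mass T"
  by (simp add: mass_def mass_measure_agree)

text \<open>Two least mass bounds dominate each other on Borel sets, so exhibiting one resolves the
  description behind \<open>mass_measure\<close>.\<close>

lemma mass_measure_eqI:
  assumes "mass_bound T \<mu>" "\<And>\<nu> A. mass_bound T \<nu> \<Longrightarrow> A \<in> sets borel \<Longrightarrow> emeasure \<mu> A \<le> emeasure \<nu> A"
  shows "mass_measure T = \<mu>"
  unfolding mass_measure_def
proof (rule the_equality)
  show "mass_bound T \<mu> \<and> (\<forall>\<nu>. mass_bound T \<nu> \<longrightarrow> (\<forall>A\<in>sets borel. emeasure \<mu> A \<le> emeasure \<nu> A))"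
    using assms by blast
  fix \<rho> assume \<rho>: "mass_bound T \<rho> \<and> (\<forall>\<nu>. mass_bound T \<nu> \<longrightarrow> (\<forall>A\<in>sets borel. emeasure \<rho> A \<le> emeasure \<nu> A))"
  have s: "sets \<rho> = sets borel" "sets \<mu> = sets borel"
    using \<rho> assms(1) mass_bound_sets by blast+
  show "\<rho> = \<mu>"
  proof (rule measure_eqI)
    show "sets \<rho> = sets \<mu>" by (simp add: s)
    fix A assume "A \<in> sets \<rho>"
    then have "A \<in> sets borel" by (simp add: s)
    then show "emeasure \<rho> A = emeasure \<mu> A"
      using \<rho>[THEN conjunct2, rule_format, OF assms(1)] assms(2)[OF \<rho>[THEN conjunct1]] by (intro antisym)
  qed
qed

lemma edge_int_eq_primitive:
  fixes P g :: "real \<Rightarrow> real"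
  assumes "P \<in> Lip_fun" "g \<in> borel_measurable borel" "\<And>x. (P has_real_derivative g x) (at x)" "0 \<le> l"
  shows "edge_int l g = P l - P 0"
proof -
  have "edge_int l g = edge_int l (lderiv P)"
    by (rule edge_int_cong_AE[OF assms(2) lderiv_measurable[OF assms(1)]])
       (use lderiv_eq[OF assms(1,3), of UNIV] in eventually_elim, simp)
  then show ?thesis using lderiv_FTC[OF assms(1,4)] by (simp add: edge_int_def)
qed

lemma Lip_fun_of_derivative:
  fixes P g :: "real \<Rightarrow> real"
  assumes "\<And>x. (P has_real_derivative g x) (at x)" "\<And>x. \<bar>g x\<bar> \<le> C"
  shows "P \<in> Lip_fun"
proof (rule Lip_funI[of C], rule lipschitz_onI)
  show "dist (P x) (P y) \<le> C * dist x y" for x y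
    using field_differentiable_bound[of UNIV P g C x y] assms by (simp add: dist_real_def)
  show "0 \<le> C" using assms(2)[of 0] by linarith
qed

text \<open>With t a depth or a distance to a closed set, these cut-offs are Lipschitz and tend to
  the indicator of an open set.\<close>

lemma clamp_scaled_limit:
  fixes t :: real
  assumes "0 \<le> t"
  shows "(\<lambda>k. max 0 (min (real k * t) 1)) \<longlonglongrightarrow> (if 0 < t then 1 else 0)"
proof (cases "0 < t")
  case True
  then obtain K where K: "1 < real K * t" using ex_less_of_nat_mult[of t 1] by blast
  have "max 0 (min (real k * t) 1) = 1" if "K \<le> k" for k
  proof -
    have "real K * t \<le> real k * t" using that True by (intro mult_right_mono) auto
    then show ?thesis using K by simp
  qed
  then have "\<forall>\<^sub>F k in sequentially. max 0 (min (real k * t) 1) = (if 0 < t then 1 else 0)"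
    using True unfolding eventually_sequentially by auto
  then show ?thesis by (rule tendsto_eventually)
qed (use assms in simp)

lemma bLip_clamp_scaled: "h \<in> Lip_fun \<Longrightarrow> (\<lambda>x. max 0 (min (k * h x) 1)) \<in> bLip_fun" for h :: "_ \<Rightarrow> real"
proof -
  assume h: "h \<in> Lip_fun"
  have "(\<lambda>x. k * h x + 0 * h x) \<in> Lip_fun" by (rule Lip_fun_lincomb[OF h h])
  then have "(\<lambda>x. k * h x) \<in> Lip_fun" by simp
  then show ?thesis by (rule bLip_fun_clamp)
qed

section \<open>The mass of a current with coefficients\<close>

context edge_net
begin

lemma lderiv_cr: "AE s in lborel. s \<in> {0..\<l> i} \<longrightarrow> lderiv (\<lambda>s. cr i (\<gamma> i s)) s = 1"
proof -
  have "((\<lambda>s. cr i (\<gamma> i s)) has_real_derivative 1) (at s)" if "s \<in> {0<..<\<l> i}" for s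
    by (rule DERIV_transform_at[of "\<lambda>s. s" _ _ "min s (\<l> i - s)"])
       (use that cr_\<gamma> in \<open>auto simp: dist_real_def\<close>)
  then have "AE s in lborel. s \<in> {0<..<\<l> i} \<longrightarrow> lderiv (\<lambda>s. cr i (\<gamma> i s)) s = 1"
    by (rule lderiv_eq[OF Lip_along[OF cr_Lip]])
  moreover have "AE s in lborel. s \<noteq> 0 \<and> s \<noteq> \<l> i" by (intro AE_conjI AE_lborel_singleton)
  ultimately show ?thesis by eventually_elim auto
qed

lemma cur_ext:
  assumes g0: "g 0 = 0" "g (\<l> i) = 0"
  shows "cur c (ext i g) \<pi> = c i * edge_int (\<l> i) (\<lambda>s. g s * lderiv (\<lambda>s. \<pi> (\<gamma> i s)) s)"
proof -
  have "cur c (ext i g) \<pi> = (\<Sum>j\<in>{i}. c j * edge_int (\<l> j) (\<lambda>s. ext i g (\<gamma> j s) * lderiv (\<lambda>s. \<pi> (\<gamma> j s)) s))"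
    unfolding cur_def
    by (rule suminf_finite) (auto simp: ext_\<gamma>_other edge_int_def set_lebesgue_integral_def)
  also have "\<dots> = c i * edge_int (\<l> i) (\<lambda>s. g s * lderiv (\<lambda>s. \<pi> (\<gamma> i s)) s)"
    unfolding edge_int_def set_lebesgue_integral_def
    by (auto intro!: Bochner_Integration.integral_cong simp: indicator_def ext_\<gamma>[of g, OF g0])
  finally show ?thesis .
qed

lemma cur_ext_cr:
  assumes g: "g \<in> Lip_fun" "g 0 = 0" "g (\<l> i) = 0"
  shows "cur c (ext i g) (cr i) = c i * edge_int (\<l> i) g"
proof -
  have [measurable]: "g \<in> borel_measurable borel" "lderiv (\<lambda>s. cr i (\<gamma> i s)) \<in> borel_measurable borel"
    using Lip_fun_measurable[OF g(1)] lderiv_measurable[OF Lip_along[OF cr_Lip]] by auto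
  have "edge_int (\<l> i) (\<lambda>s. g s * lderiv (\<lambda>s. cr i (\<gamma> i s)) s) = edge_int (\<l> i) g"
  proof (rule edge_int_cong_AE)
    show "AE s in lborel. s \<in> {0..\<l> i} \<longrightarrow> g s * lderiv (\<lambda>s. cr i (\<gamma> i s)) s = g s"
      using lderiv_cr[of i] by eventually_elim simp
  qed measurable
  then show ?thesis by (simp add: cur_ext[of g, OF g(2,3)])
qed

text \<open>The coordinate has Lipschitz constant 1 and slope 1 along the edge, so the mass
  inequality tested with it loses nothing: every mass bound dominates |n| times arclength on the
  edge.\<close>

lemma edge_measure_lower_current:
  assumes \<nu>: "mass_bound T \<nu>"
    and T: "\<And>g. g \<in> Lip_fun \<Longrightarrow> (\<And>s. s \<notin> {0<..<\<l> i} \<Longrightarrow> g s = 0) \<Longrightarrow> T (ext i g) (cr i) = n * edge_int (\<l> i) g"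
    and A: "A \<in> sets borel"
  shows "ennreal \<bar>n\<bar> * emeasure lborel {s\<in>{0<..<\<l> i}. \<gamma> i s \<in> A} \<le> emeasure \<nu> (A \<inter> edge i)"
proof (rule edge_measure_lower[OF mass_bound_finite[OF \<nu>] mass_bound_sets[OF \<nu>] abs_ge_zero _ A])
  fix g :: "real \<Rightarrow> real"
  assume g: "g \<in> Lip_fun" "\<And>s. 0 \<le> g s" "\<And>s. g s \<le> 1" "\<And>s. s \<notin> {0<..<\<l> i} \<Longrightarrow> g s = 0"
  have g0: "g 0 = 0" "g (\<l> i) = 0" by (rule g(4), simp)+
  have "0 \<le> edge_int (\<l> i) g"
    unfolding edge_int_def set_lebesgue_integral_def
    using g(2) by (intro Bochner_Integration.integral_nonneg) auto
  then have "\<bar>n\<bar> * edge_int (\<l> i) g = \<bar>T (ext i g) (cr i)\<bar>"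
    using T[OF g(1,4)] by (simp add: abs_mult)
  also have "\<dots> \<le> 1 * (\<integral>x. \<bar>ext i g x\<bar> \<partial>\<nu>)"
    by (rule mass_bound_le[OF \<nu> ext_bLip[OF g(1) g0] cr_lipschitz])
  also have "(\<lambda>x. \<bar>ext i g x\<bar>) = ext i g" using g(2) by (auto simp: ext_def)
  finally show "\<bar>n\<bar> * edge_int (\<l> i) g \<le> (\<integral>x. ext i g x \<partial>\<nu>)" by simp
qed

lemma edge_disjoint_family: "disjoint_family edge"
  using edge_disjoint by (auto simp: disjoint_family_on_def)

text \<open>The lower bounds on the single edges add up because open edges are disjoint; this makes
  \<open>wt c\<close> the least mass bound.\<close>

lemma mass_measure_cur:
  assumes c: "finite_coeffs c"
  shows "mass_measure (cur c) = wt c"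
proof (rule mass_measure_eqI[OF mass_bound_cur[OF c]])
  fix \<nu> A assume \<nu>: "mass_bound (cur c) \<nu>" and A: "A \<in> sets (borel :: 'a measure)"
  have s: "sets \<nu> = sets borel" using \<nu> by (rule mass_bound_sets)
  have "emeasure (wt c) A = (\<Sum>i. ennreal \<bar>c i\<bar> * emeasure lborel {s\<in>{0<..<\<l> i}. \<gamma> i s \<in> A})"
    by (rule emeasure_wt[OF A])
  also have "\<dots> \<le> (\<Sum>i. emeasure \<nu> (A \<inter> edge i))"
  proof (rule suminf_le)
    fix i
    show "ennreal \<bar>c i\<bar> * emeasure lborel {s \<in> {0<..<\<l> i}. \<gamma> i s \<in> A} \<le> emeasure \<nu> (A \<inter> edge i)"
      by (rule edge_measure_lower_current[OF \<nu> cur_ext_cr A]) auto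
  qed auto
  also have "\<dots> = emeasure \<nu> (\<Union>i. A \<inter> edge i)"
    using A edge_disjoint_family by (intro suminf_emeasure) (auto simp: s disjoint_family_on_def)
  also have "\<dots> \<le> emeasure \<nu> A"
    using A by (intro emeasure_mono) (auto simp: s)
  finally show "emeasure (wt c) A \<le> emeasure \<nu> A" .
qed

lemma mass_cur: "finite_coeffs c \<Longrightarrow> mass (cur c) = ennreal (\<Sum>i. \<bar>c i\<bar> * \<l> i)"
  by (simp add: mass_def mass_measure_cur emeasure_wt_UNIV)

section \<open>Testing a current on open edges\<close>

definition tube :: "nat \<Rightarrow> nat \<Rightarrow> 'a \<Rightarrow> real" where
  "tube k i x = max 0 (min (real k * dep i x) 1)"

lemma tube_bLip: "tube k i \<in> bLip_fun"
  unfolding tube_def using dep_Lip by (rule bLip_clamp_scaled)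

lemma tube_range: "0 \<le> tube k i x" "tube k i x \<le> 1"
  by (auto simp: tube_def)

lemma tube_support: "tube k i x \<noteq> 0 \<Longrightarrow> x \<in> edge i"
  by (rule ccontr) (simp add: tube_def dep_notin)

lemma tube_limit: "(\<lambda>k. tube k i x) \<longlonglongrightarrow> indicator (edge i) x"
proof -
  have e: "(indicator (edge i) x :: real) = (if 0 < dep i x then 1 else 0)"
    by (simp add: edge_def indicator_def)
  show ?thesis unfolding e tube_def by (rule clamp_scaled_limit[OF dep_range])
qed

lemma ext_eq_on_edge: "(\<And>x. x \<notin> edge i \<Longrightarrow> F x = 0) \<Longrightarrow> ext i (\<lambda>s. F (\<gamma> i s)) = F"
  by (auto simp: ext_def edge_coord(3) fun_eq_iff)

lemma vertices_AE:
  assumes "mass_bound T \<mu>" "emeasure \<mu> vertices = 0"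
  shows "AE x in \<mu>. x \<notin> vertices"
proof -
  have "vertices \<in> sets \<mu>"
    unfolding mass_bound_sets[OF assms(1)] vertices_def by measurable
  then show ?thesis using assms(2) by (intro AE_not_in) auto
qed

text \<open>The vertices form a countable set and are not charged.\<close>

lemma agree_if_agree_on_edges:
  assumes S: "metric_current1 S" and T: "metric_current1 T"
    and ST: "\<And>i g \<pi>. g \<in> Lip_fun \<Longrightarrow> (\<And>s. s \<notin> {0<..<\<l> i} \<Longrightarrow> g s = 0) \<Longrightarrow> \<pi> \<in> Lip_fun \<Longrightarrow>
      S (ext i g) \<pi> = T (ext i g) \<pi>"
  shows "currents_agree S T"
  unfolding currents_agree_def
proof (intro ballI)
  fix f \<pi> :: "'a \<Rightarrow> real" assume f: "f \<in> bLip_fun" and \<pi>: "\<pi> \<in> Lip_fun"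
  obtain C where C: "0 \<le> C" "\<And>x. \<bar>f x\<bar> \<le> C" using bLip_fun_bounded[OF f] by blast
  \<comment> \<open>N plays two roles: it is the slope of the cut-off inside an edge and, in F
    below, the number of edges. At a point of edge i, F N is eventually
    \<open>f x * tube N i x\<close>.\<close>
  define G where "G N i x = f x * tube N i x" for N i x
  have G: "G N i \<in> bLip_fun" for N i unfolding G_def by (rule bLip_fun_mult[OF f tube_bLip])
  have G0: "G N i x = 0" if "x \<notin> edge i" for N i x
    using tube_support[of N i x] that by (auto simp: G_def)
  define F where "F N x = (\<Sum>i<N. G N i x)" for N x
  have F: "F N \<in> bLip_fun" for N unfolding F_def by (rule bLip_fun_sum[OF G])
  have Fe: "F N x = (if i < N then G N i x else 0)" if "x \<in> edge i" for N i x
  proof -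
    have "G N j x = 0" if "j \<noteq> i" for j
      using edge_disjoint[OF that] \<open>x \<in> edge i\<close> G0 by blast
    then have "F N x = (\<Sum>j<N. if j = i then G N i x else 0)"
      unfolding F_def by (intro sum.cong) auto
    then show ?thesis by simp
  qed
  have Fb: "\<bar>F N x\<bar> \<le> C" for N x
  proof (cases "x \<in> vertices")
    case True
    then have "x \<notin> edge i" for i by (auto simp: vertices_def)
    then show ?thesis using C(1) by (simp add: F_def G0)
  next
    case False
    then obtain i where i: "x \<in> edge i" by (auto simp: vertices_def)
    have "\<bar>G N i x\<bar> \<le> C * 1"
      unfolding G_def abs_mult using C tube_range[of N i x] by (intro mult_mono) auto
    then show ?thesis using C(1) by (simp add: Fe[OF i])
  qed
  have Flim: "(\<lambda>N. F N x) \<longlonglongrightarrow> f x" if "x \<notin> vertices" for x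
  proof -
    obtain i where i: "x \<in> edge i" using \<open>x \<notin> vertices\<close> by (auto simp: vertices_def)
    have "(\<lambda>N. f x * tube N i x) \<longlonglongrightarrow> f x * indicator (edge i) x"
      by (rule tendsto_mult_left[OF tube_limit])
    then have "(\<lambda>N. G N i x) \<longlonglongrightarrow> f x" using i by (simp add: G_def)
    moreover have "\<forall>\<^sub>F N in sequentially. G N i x = F N x"
      unfolding eventually_sequentially using Fe[OF i] by (intro exI[of _ "Suc i"]) auto
    ultimately show ?thesis by (rule Lim_transform_eventually)
  qed
  have lim: "(\<lambda>N. R (F N) \<pi>) \<longlonglongrightarrow> R f \<pi>" if R: "metric_current1 R" for R
  proof -
    obtain \<mu> where \<mu>: "mass_bound R \<mu>" "emeasure \<mu> vertices = 0"
      using mass_bound_null_countable[OF R vertices_countable] by blast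
    show ?thesis
    proof (rule current_dominated_convergence[OF R \<mu>(1) \<pi> f F Fb])
      show "AE x in \<mu>. (\<lambda>N. F N x) \<longlonglongrightarrow> f x"
        using vertices_AE[OF \<mu>] by eventually_elim (rule Flim)
    qed
  qed
  have "S (F N) \<pi> = T (F N) \<pi>" for N
  proof -
    have "S (G N i) \<pi> = T (G N i) \<pi>" for i
    proof -
      have "S (ext i (\<lambda>s. G N i (\<gamma> i s))) \<pi> = T (ext i (\<lambda>s. G N i (\<gamma> i s))) \<pi>"
      proof (rule ST[OF Lip_along[OF bLip_Lip[OF G]] _ \<pi>])
        fix s assume "s \<notin> {0<..<\<l> i}"
        then show "G N i (\<gamma> i s) = 0" by (intro G0) (simp add: \<gamma>_in_edge)
      qed
      moreover have "ext i (\<lambda>s. G N i (\<gamma> i s)) = G N i"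
        by (rule ext_eq_on_edge) (rule G0)
      ultimately show ?thesis by simp
    qed
    then show ?thesis
      unfolding F_def
      by (subst current_sum[OF S G \<pi>], subst current_sum[OF T G \<pi>]) simp
  qed
  then have "(\<lambda>N. T (F N) \<pi>) \<longlonglongrightarrow> S f \<pi>" using lim[OF S] by (simp only:)
  then show "S f \<pi> = T f \<pi>" using lim[OF T] by (rule LIMSEQ_unique)
qed

section \<open>Cycles along one edge\<close>

lemma edge_closed: "closed (\<gamma> i ` {0..\<l> i})"
  by (intro compact_imp_closed compact_continuous_image lipschitz_on_continuous_on[OF lipschitz_on_subset[OF \<gamma>_lipschitz]]) auto

text \<open>Let P be the primitive of g from 0; mean zero makes it vanish at both ends, so \<pi> =
  \<open>ext i P\<close> is Lipschitz on the whole space. Write 1 = \<open>tube k i\<close> +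
  \<omega> + r. The boundary condition gives T 1 \<pi> = 0, locality removes \<omega>, the chain
  rule turns the tube term into T of tube times g against \<open>cr i\<close>, and r tends to 0 off
  the vertices, which a suitable mass bound does not charge.\<close>

lemma cycle_zero_mean:
  assumes T: "metric_current1 T" and bd: "\<And>\<pi>. \<pi> \<in> bLip_fun \<Longrightarrow> T (\<lambda>_. 1) \<pi> = 0"
    and g: "g \<in> Lip_fun" "\<And>s. s \<notin> {0<..<\<l> i} \<Longrightarrow> g s = 0" and mean: "edge_int (\<l> i) g = 0"
  shows "T (ext i g) (cr i) = 0"
proof -
  have g0: "g 0 = 0" "g (\<l> i) = 0" by (rule g(2), simp)+
  obtain B where B: "\<And>x. x \<in> {0..\<l> i} \<Longrightarrow> \<bar>g x\<bar> \<le> B" using Lip_fun_bounded_on_interval[OF g(1)] by blast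
  have gB: "\<bar>g x\<bar> \<le> \<bar>B\<bar>" for x using B[of x] g(2)[of x] by (cases "x \<in> {0<..<\<l> i}") auto
  obtain Q where Q: "\<And>x. (Q has_real_derivative g x) (at x)"
    using continuous_antiderivative[OF Lip_fun_continuous[OF g(1)]] by blast
  define P where "P x = Q x - Q 0" for x
  have DP: "(P has_real_derivative g x) (at x)" for x
    unfolding P_def using DERIV_diff[OF Q DERIV_const] by simp
  have PL: "P \<in> Lip_fun" by (rule Lip_fun_of_derivative[OF DP gB])
  have P0: "P 0 = 0" by (simp add: P_def)
  have P1: "P (\<l> i) = 0"
    using edge_int_eq_primitive[OF PL Lip_fun_measurable[OF g(1)] DP less_imp_le[OF len0]] mean P0 by simp
  define \<pi> where "\<pi> = ext i P"
  have \<pi>: "\<pi> \<in> bLip_fun" unfolding \<pi>_def by (rule ext_bLip[OF PL P0 P1])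
  obtain \<mu> where \<mu>: "mass_bound T \<mu>" "emeasure \<mu> vertices = 0"
    using mass_bound_null_countable[OF T vertices_countable] by blast
  define E where "E = \<gamma> i ` {0..\<l> i}"
  have Ene: "E \<noteq> {}" using len0[of i] by (simp add: E_def)
  have eE: "edge i \<subseteq> E"
  proof
    fix x assume "x \<in> edge i"
    then show "x \<in> E" unfolding E_def using edge_coord[of x i] by (intro image_eqI[of _ _ "cr i x"]) auto
  qed
  \<comment> \<open>Lives off the closed edge E, where \<pi> is 0. Tube and \<omega> have disjoint
    supports, and what they leave to r concentrates at the ends of the edge.\<close>
  define \<omega> where "\<omega> k x = max 0 (min (real k * infdist x E) 1)" for k x
  have \<omega>: "\<omega> k \<in> bLip_fun" for k unfolding \<omega>_def by (rule bLip_clamp_scaled[OF Lip_fun_infdist])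
  have one: "(\<lambda>_::'a. 1::real) \<in> bLip_fun" by simp
  define r where "r k x = (1 - tube k i x) - \<omega> k x" for k x
  have r: "r k \<in> bLip_fun" for k
    unfolding r_def by (rule bLip_fun_diff[OF bLip_fun_diff[OF one tube_bLip] \<omega>])
  have Tr: "(\<lambda>k. T (r k) \<pi>) \<longlonglongrightarrow> T (\<lambda>_. 0) \<pi>"
  proof (rule current_dominated_convergence[OF T \<mu>(1) bLip_Lip[OF \<pi>] bLip_fun_const r])
    show "\<bar>r k x\<bar> \<le> 1" for k x
    proof -
      have "0 \<le> \<omega> k x" "\<omega> k x \<le> 1" by (auto simp: \<omega>_def)
      moreover have "\<omega> k x = 0" if "tube k i x \<noteq> 0"
      proof -
        have "x \<in> E" using tube_support[OF that] eE by blast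
        then show ?thesis by (simp add: \<omega>_def)
      qed
      ultimately show ?thesis
        using tube_range[of k i x] unfolding r_def by (cases "tube k i x = 0") auto
    qed
    show "AE x in \<mu>. (\<lambda>k. r k x) \<longlonglongrightarrow> 0"
      using vertices_AE[OF \<mu>]
    proof eventually_elim
      case (elim x)
      \<comment> \<open>Off the vertices the closed and the open edge coincide, so the tube and
        \<omega> tend to complementary indicators.\<close>
      have e: "x \<in> edge i \<longleftrightarrow> x \<in> E"
      proof
        assume "x \<in> E"
        then obtain s where s: "s \<in> {0..\<l> i}" "x = \<gamma> i s" by (auto simp: E_def)
        obtain j where "x \<in> edge j" using elim by (auto simp: vertices_def)
        then show "x \<in> edge i" using s \<gamma>_in_edge[of i s j] by auto
      qed (use eE in blast)
      have iff: "0 < infdist x E \<longleftrightarrow> x \<notin> edge i"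
        using in_closed_iff_infdist_zero[OF edge_closed[of i, folded E_def] Ene, of x] e infdist_nonneg[of x E]
        by (simp add: less_le)
      have "(\<lambda>k. \<omega> k x) \<longlonglongrightarrow> (if 0 < infdist x E then 1 else 0)"
        unfolding \<omega>_def by (rule clamp_scaled_limit[OF infdist_nonneg])
      then have "(\<lambda>k. r k x) \<longlonglongrightarrow> (1 - indicator (edge i) x) - (if 0 < infdist x E then 1 else 0)"
        unfolding r_def by (intro tendsto_diff tendsto_const tube_limit)
      then show ?case unfolding iff by (cases "x \<in> edge i") simp_all
    qed
  qed
  have T\<omega>: "T (\<omega> k) \<pi> = 0" for k
  proof (rule current_local[OF T \<omega> bLip_Lip[OF \<pi>], of "- E" _ 0])
    show "open (- E)" using edge_closed[of i] by (simp add: E_def open_Compl)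
    show "x \<in> - E" if "\<omega> k x \<noteq> 0" for x
    proof
      assume "x \<in> E"
      then show False using that by (simp add: \<omega>_def)
    qed
    show "\<pi> x = 0" if "x \<in> - E" for x using that eE by (auto simp: \<pi>_def ext_def)
  qed
  have Tt: "T (tube k i) \<pi> = T (\<lambda>x. tube k i x * g (cr i x)) (cr i)" for k
  proof -
    have "T (tube k i) \<pi> = T (tube k i) (\<lambda>x. P (cr i x))"
      by (rule current_local_eq[OF T tube_bLip bLip_Lip[OF \<pi>] Lip_fun_compose[OF PL cr_Lip] edge_open[of i] tube_support])
         (auto simp: \<pi>_def ext_def)
    also have "\<dots> = T (\<lambda>x. tube k i x * g (cr i x)) (cr i)"
      by (rule current_chain_rule[OF T tube_bLip cr_Lip cr_range DP g(1) PL])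
    finally show ?thesis .
  qed
  have gcr: "(\<lambda>x. g (cr i x)) \<in> bLip_fun"
    by (rule bLip_funI2[OF Lip_fun_compose[OF g(1) cr_Lip] gB])
  have lim: "(\<lambda>k. T (\<lambda>x. tube k i x * g (cr i x)) (cr i)) \<longlonglongrightarrow> T (ext i g) (cr i)"
  proof (rule current_dominated_convergence[OF T \<mu>(1) cr_Lip ext_bLip[OF g(1) g0] bLip_fun_mult[OF tube_bLip gcr]])
    show "\<bar>tube k i x * g (cr i x)\<bar> \<le> 1 * \<bar>B\<bar>" for k x
      unfolding abs_mult using tube_range[of k i x] gB by (intro mult_mono) auto
    show "AE x in \<mu>. (\<lambda>k. tube k i x * g (cr i x)) \<longlonglongrightarrow> ext i g x"
    proof (intro AE_I2)
      fix x
      have "(\<lambda>k. tube k i x * g (cr i x)) \<longlonglongrightarrow> indicator (edge i) x * g (cr i x)"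
        by (rule tendsto_mult_right[OF tube_limit])
      then show "(\<lambda>k. tube k i x * g (cr i x)) \<longlonglongrightarrow> ext i g x"
        by (cases "x \<in> edge i") (simp_all add: ext_def)
    qed
  qed
  have split: "T (r k) \<pi> = - T (\<lambda>x. tube k i x * g (cr i x)) (cr i)" for k
  proof -
    have "T (r k) \<pi> = T (\<lambda>x. 1 - tube k i x) \<pi> - T (\<omega> k) \<pi>"
      unfolding r_def by (rule current_diff[OF T bLip_fun_diff[OF one tube_bLip] \<omega> bLip_Lip[OF \<pi>]])
    also have "T (\<lambda>x. 1 - tube k i x) \<pi> = T (\<lambda>_. 1) \<pi> - T (tube k i) \<pi>"
      by (rule current_diff[OF T one tube_bLip bLip_Lip[OF \<pi>]])
    finally show ?thesis by (simp add: T\<omega> Tt bd[OF \<pi>])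
  qed
  have "(\<lambda>k. T (r k) \<pi>) \<longlonglongrightarrow> - T (ext i g) (cr i)"
    unfolding split by (rule tendsto_minus[OF lim])
  then have "- T (ext i g) (cr i) = T (\<lambda>_. 0) \<pi>" using Tr by (rule LIMSEQ_unique)
  then show ?thesis using current_zero[OF T bLip_Lip[OF \<pi>]] by simp
qed

text \<open>A linear functional that vanishes on the kernel of the integral is a multiple of the
  integral; the factor is read off from one bump h of positive integral.\<close>

lemma cycle_edge_constant:
  assumes T: "metric_current1 T" and bd: "\<And>\<pi>. \<pi> \<in> bLip_fun \<Longrightarrow> T (\<lambda>_. 1) \<pi> = 0"
  shows "\<exists>n. \<forall>g. g \<in> Lip_fun \<and> (\<forall>s. s \<notin> {0<..<\<l> i} \<longrightarrow> g s = 0) \<longrightarrow> T (ext i g) (cr i) = n * edge_int (\<l> i) g"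
proof -
  define h where "h s = max 0 (min s (\<l> i - s))" for s
  have h0: "h s = 0" if "s \<notin> {0<..<\<l> i}" for s using that by (auto simp: h_def)
  have hL: "h \<in> Lip_fun"
  proof (rule Lip_funI[of 1], rule lipschitz_onI)
    fix s t
    have "\<bar>min s (\<l> i - s) - min t (\<l> i - t)\<bar> \<le> \<bar>s - t\<bar>" by (simp add: min_def) linarith
    moreover have "\<bar>max 0 u - max 0 v\<bar> \<le> \<bar>u - v\<bar>" for u v :: real by linarith
    ultimately show "dist (h s) (h t) \<le> 1 * dist s t"
      unfolding h_def dist_real_def mult_1 using order_trans by blast
  qed simp
  have hm [measurable]: "h \<in> borel_measurable borel" by (rule Lip_fun_measurable[OF hL])
  have hb: "\<bar>h s\<bar> \<le> \<l> i" for s using len0[of i] unfolding h_def by linarith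
  have pos: "0 < edge_int (\<l> i) h"
  proof -
    \<comment> \<open>On the middle half [a, b] of the edge h is at least a.\<close>
    define a b where "a = \<l> i / 4" and "b = 3 * \<l> i / 4"
    have "edge_int (\<l> i) (\<lambda>s. a * indicator {a..b} s) \<le> edge_int (\<l> i) h"
    proof (rule edge_int_mono[of _ _ _ "\<bar>a\<bar>" "\<l> i"])
      show "\<bar>a * indicator {a..b} s\<bar> \<le> \<bar>a\<bar>" for s by (simp add: indicator_def)
      show "a * indicator {a..b} s \<le> h s" for s
        using len0[of i] by (auto simp: indicator_def h_def a_def b_def min_def)
    qed (use hb in auto)
    also have "edge_int (\<l> i) (\<lambda>s. a * indicator {a..b} s) = a * (\<integral>s. indicator {a..b} s \<partial>lborel)"
      unfolding edge_int_def set_lebesgue_integral_def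
      by (subst Bochner_Integration.integral_mult_right_zero[symmetric], rule Bochner_Integration.integral_cong)
         (use len0[of i] in \<open>auto simp: indicator_def a_def b_def\<close>)
    also have "\<dots> = a * (b - a)" using len0[of i] by (simp add: a_def b_def)
    finally have "a * (b - a) \<le> edge_int (\<l> i) h" .
    moreover have "0 < a * (b - a)" using len0[of i] by (simp add: a_def b_def)
    ultimately show ?thesis by linarith
  qed
  define n where "n = T (ext i h) (cr i) / edge_int (\<l> i) h"
  have "T (ext i g) (cr i) = n * edge_int (\<l> i) g"
    if g: "g \<in> Lip_fun" "\<And>s. s \<notin> {0<..<\<l> i} \<Longrightarrow> g s = 0" for g :: "real \<Rightarrow> real"
  proof -
    define q where "q = edge_int (\<l> i) g / edge_int (\<l> i) h"
    obtain B where B: "\<And>x. x \<in> {0..\<l> i} \<Longrightarrow> \<bar>g x\<bar> \<le> B" using Lip_fun_bounded_on_interval[OF g(1)] by blast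
    have dL: "(\<lambda>s. 1 * g s + (- q) * h s) \<in> Lip_fun" by (rule Lip_fun_lincomb[OF g(1) hL])
    have d0: "1 * g s + (- q) * h s = 0" if "s \<notin> {0<..<\<l> i}" for s using g(2)[OF that] h0[OF that] by simp
    have dm: "edge_int (\<l> i) (\<lambda>s. 1 * g s + (- q) * h s) = 0"
    proof -
      have "edge_int (\<l> i) (\<lambda>s. 1 * g s + (- q) * h s) = 1 * edge_int (\<l> i) g + (- q) * edge_int (\<l> i) h"
        by (rule edge_int_lincomb[OF Lip_fun_measurable[OF g(1)] hm B hb])
      then show ?thesis using pos by (simp add: q_def)
    qed
    have e: "ext i (\<lambda>s. 1 * g s + (- q) * h s) = (\<lambda>x. 1 * ext i g x + (- q) * ext i h x)"
      by (auto simp: ext_def fun_eq_iff)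
    have gb: "ext i g \<in> bLip_fun" by (rule ext_bLip[OF g(1)]) (rule g(2), simp)+
    have hb': "ext i h \<in> bLip_fun" by (rule ext_bLip[OF hL]) (rule h0, simp)+
    have "0 = T (ext i (\<lambda>s. 1 * g s + (- q) * h s)) (cr i)"
      by (rule cycle_zero_mean[OF T bd dL d0 dm, symmetric])
    also have "\<dots> = 1 * T (ext i g) (cr i) + (- q) * T (ext i h) (cr i)"
      unfolding e by (rule current_lincomb[OF T gb hb' cr_Lip])
    finally have "T (ext i g) (cr i) = q * T (ext i h) (cr i)" by simp
    then show ?thesis by (simp add: n_def q_def)
  qed
  then show ?thesis by blast
qed

text \<open>On the open edge \<pi> is a function p of the coordinate, and locality lets
  \<open>p (cr i x)\<close> replace it. The chain rule asks for a Lipschitz derivative, so p is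
  approximated by C^{1,1} functions whose derivatives converge almost everywhere.\<close>

lemma edge_formula:
  assumes T: "metric_current1 T"
    and n: "\<And>g. g \<in> Lip_fun \<Longrightarrow> (\<And>s. s \<notin> {0<..<\<l> i} \<Longrightarrow> g s = 0) \<Longrightarrow> T (ext i g) (cr i) = n * edge_int (\<l> i) g"
    and g: "g \<in> Lip_fun" "\<And>s. s \<notin> {0<..<\<l> i} \<Longrightarrow> g s = 0" and \<pi>: "\<pi> \<in> Lip_fun"
  shows "T (ext i g) \<pi> = n * edge_int (\<l> i) (\<lambda>s. g s * lderiv (\<lambda>s. \<pi> (\<gamma> i s)) s)"
proof -
  have g0: "g 0 = 0" "g (\<l> i) = 0" by (rule g(2), simp)+
  obtain B where B: "\<And>x. x \<in> {0..\<l> i} \<Longrightarrow> \<bar>g x\<bar> \<le> B" using Lip_fun_bounded_on_interval[OF g(1)] by blast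
  have gB: "\<bar>g x\<bar> \<le> \<bar>B\<bar>" for x using B[of x] g(2)[of x] by (cases "x \<in> {0<..<\<l> i}") auto
  have eg: "ext i g \<in> bLip_fun" by (rule ext_bLip[OF g(1) g0])
  define p where "p s = \<pi> (\<gamma> i s)" for s
  obtain L where L: "0 \<le> L" "L-lipschitz_on UNIV \<pi>" using \<pi> by (rule Lip_fun_obtain)
  have pL: "L-lipschitz_on UNIV p" unfolding p_def by (rule lipschitz_along[OF L(2)])
  obtain P P' where P: "\<And>k. L-lipschitz_on UNIV (P k)" "\<And>k x. (P k has_real_derivative P' k x) (at x)"
    "\<And>k. P' k \<in> Lip_fun" "\<And>x. (\<lambda>k. P k x) \<longlonglongrightarrow> p x"
    "AE x in lborel. (\<lambda>k. P' k x) \<longlonglongrightarrow> lderiv p x" "\<And>k x. \<bar>P' k x\<bar> \<le> L"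
    using lipschitz_C11_approximation[OF pL] by blast
  have 1: "T (ext i g) \<pi> = T (ext i g) (\<lambda>x. p (cr i x))"
  proof (rule current_local_eq[OF T eg \<pi> Lip_fun_compose[OF Lip_funI[OF pL] cr_Lip] edge_open[of i]])
    show "x \<in> edge i" if "ext i g x \<noteq> 0" for x using that by (auto simp: ext_def split: if_splits)
    show "\<pi> x = p (cr i x)" if "x \<in> edge i" for x using edge_coord(3)[OF that] by (simp add: p_def)
  qed
  have Pcr: "L-lipschitz_on UNIV (\<lambda>x. P k (cr i x))" for k
  proof -
    have "(L * 1)-lipschitz_on UNIV (P k \<circ> cr i)"
      by (rule lipschitz_on_compose[OF cr_lipschitz]) (rule lipschitz_on_subset[OF P(1)], simp)
    then show ?thesis by (simp add: o_def)
  qed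
  have 2: "(\<lambda>k. T (ext i g) (\<lambda>x. P k (cr i x))) \<longlonglongrightarrow> T (ext i g) (\<lambda>x. p (cr i x))"
    by (rule current_limit[OF T eg Pcr]) (rule P(4))
  have 3: "T (ext i g) (\<lambda>x. P k (cr i x)) = n * edge_int (\<l> i) (\<lambda>s. g s * P' k s)" for k
  proof -
    have gP: "(\<lambda>s. g s * P' k s) \<in> Lip_fun"
    proof (rule Lip_fun_mult[OF g(1) P(3)])
      show "bounded (range g)" "bounded (range (P' k))" using gB P(6)[of k] unfolding bounded_iff by auto
    qed
    have "T (ext i g) (\<lambda>x. P k (cr i x)) = T (\<lambda>x. ext i g x * P' k (cr i x)) (cr i)"
      by (rule current_chain_rule[OF T eg cr_Lip cr_range P(2,3) Lip_funI[OF P(1)]])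
    also have "(\<lambda>x. ext i g x * P' k (cr i x)) = ext i (\<lambda>s. g s * P' k s)"
      by (auto simp: ext_def)
    also have "T (ext i (\<lambda>s. g s * P' k s)) (cr i) = n * edge_int (\<l> i) (\<lambda>s. g s * P' k s)"
      by (rule n[OF gP]) (simp add: g(2))
    finally show ?thesis .
  qed
  have gm [measurable]: "g \<in> borel_measurable borel" by (rule Lip_fun_measurable[OF g(1)])
  have Pm [measurable]: "P' k \<in> borel_measurable borel" for k by (rule Lip_fun_measurable[OF P(3)])
  have pm [measurable]: "lderiv p \<in> borel_measurable borel" by (rule lderiv_measurable[OF Lip_funI[OF pL]])
  have 4: "(\<lambda>k. edge_int (\<l> i) (\<lambda>s. g s * P' k s)) \<longlonglongrightarrow> edge_int (\<l> i) (\<lambda>s. g s * lderiv p s)"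
    unfolding edge_int_def set_lebesgue_integral_def
  proof (rule integral_dominated_convergence[where w="\<lambda>s. indicator {0..\<l> i} s * (\<bar>B\<bar> * L)"])
    show "integrable lborel (\<lambda>s. indicator {0..\<l> i} s * (\<bar>B\<bar> * L))"
      by (intro integrable_mult_left integrable_real_indicator) (auto simp: emeasure_lborel_Icc_eq)
    show "AE s in lborel. (\<lambda>k. indicator {0..\<l> i} s *\<^sub>R (g s * P' k s)) \<longlonglongrightarrow> indicator {0..\<l> i} s *\<^sub>R (g s * lderiv p s)"
      using P(5) by eventually_elim (intro tendsto_scaleR tendsto_mult tendsto_const)
    show "AE s in lborel. norm (indicator {0..\<l> i} s *\<^sub>R (g s * P' k s)) \<le> indicator {0..\<l> i} s * (\<bar>B\<bar> * L)" for k
    proof (intro AE_I2)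
      fix s
      have "\<bar>g s\<bar> * \<bar>P' k s\<bar> \<le> \<bar>B\<bar> * L" using gB P(6) by (intro mult_mono) auto
      then show "norm (indicator {0..\<l> i} s *\<^sub>R (g s * P' k s)) \<le> indicator {0..\<l> i} s * (\<bar>B\<bar> * L)"
        by (simp add: abs_mult indicator_def)
    qed
  qed measurable
  have "(\<lambda>k. T (ext i g) (\<lambda>x. P k (cr i x))) \<longlonglongrightarrow> n * edge_int (\<l> i) (\<lambda>s. g s * lderiv p s)"
    unfolding 3 by (rule tendsto_mult_left[OF 4])
  then have "T (ext i g) (\<lambda>x. p (cr i x)) = n * edge_int (\<l> i) (\<lambda>s. g s * lderiv p s)"
    using LIMSEQ_unique[OF 2] by blast
  then show ?thesis unfolding 1 by (simp add: p_def[abs_def])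
qed

text \<open>The weighted lengths are summable because each |c i| times length is at most the
  \<mu>-measure of the i-th open edge, and these edges are disjoint in a space of finite
  measure.\<close>

theorem cycle_structure:
  assumes T: "metric_current1 T" and bd: "\<And>\<pi>. \<pi> \<in> bLip_fun \<Longrightarrow> T (\<lambda>_. 1) \<pi> = 0"
  shows "\<exists>c. finite_coeffs c \<and> currents_agree T (cur c)"
proof -
  have "\<exists>c. \<forall>i g. g \<in> Lip_fun \<and> (\<forall>s. s \<notin> {0<..<\<l> i} \<longrightarrow> g s = 0) \<longrightarrow> T (ext i g) (cr i) = c i * edge_int (\<l> i) g"
    by (rule choice) (rule allI, rule cycle_edge_constant[OF T bd])
  then obtain c where c: "\<And>i g. g \<in> Lip_fun \<Longrightarrow> (\<And>s. s \<notin> {0<..<\<l> i} \<Longrightarrow> g s = 0) \<Longrightarrow> T (ext i g) (cr i) = c i * edge_int (\<l> i) g"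
    by blast
  obtain \<mu> where \<mu>: "mass_bound T \<mu>" using current_mass_bound[OF T] by blast
  interpret finite_measure \<mu> using \<mu> by (rule mass_bound_finite)
  have "(\<lambda>i. measure \<mu> (edge i)) sums measure \<mu> (\<Union>i. edge i)"
    by (rule finite_measure_UNION[OF _ edge_disjoint_family]) (auto simp: mass_bound_sets[OF \<mu>])
  then have sm: "summable (\<lambda>i. measure \<mu> (edge i))" by (rule sums_summable)
  have le: "\<bar>c i\<bar> * \<l> i \<le> measure \<mu> (edge i)" for i
  proof -
    have "{s \<in> {0<..<\<l> i}. \<gamma> i s \<in> UNIV} = {0<..<\<l> i}" by auto
    then have "ennreal \<bar>c i\<bar> * ennreal (\<l> i) \<le> emeasure \<mu> (edge i)"
      using edge_measure_lower_current[OF \<mu> c, of i UNIV] len0[of i] by simp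
    then have "ennreal (\<bar>c i\<bar> * \<l> i) \<le> ennreal (measure \<mu> (edge i))"
      using len0[of i] by (simp add: ennreal_mult emeasure_eq_measure)
    then show ?thesis by (simp add: ennreal_le_iff)
  qed
  have fc: "finite_coeffs c"
    unfolding finite_coeffs_def
    by (rule summable_comparison_test'[OF sm, of 0]) (use le len0 in \<open>simp add: abs_mult less_imp_le\<close>)
  have "currents_agree T (cur c)"
  proof (rule agree_if_agree_on_edges[OF T metric_current_cur[OF fc]])
    fix i g \<pi> assume g: "g \<in> Lip_fun" "\<And>s. s \<notin> {0<..<\<l> i} \<Longrightarrow> g s = (0::real)" and \<pi>: "\<pi> \<in> (Lip_fun :: ('a \<Rightarrow> real) set)"
    have g0: "g 0 = 0" "g (\<l> i) = 0" by (rule g(2), simp)+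
    show "T (ext i g) \<pi> = cur c (ext i g) \<pi>"
      unfolding cur_ext[of g, OF g0] by (rule edge_formula[OF T c g \<pi>])
  qed
  then show ?thesis using fc by blast
qed

end

section \<open>Hausdorff measure and multiplicity on a network of edges\<close>

text \<open>\<open>deriv\<close> and \<open>vector_derivative\<close> are not known to be Borel, and
  the definitions integrate them over the completed measure; this trades them for a Borel function
  equal almost everywhere.\<close>

lemma lebesgue_AE_eq:
  fixes f g :: "real \<Rightarrow> real"
  assumes g: "g \<in> borel_measurable borel" and ae: "AE x in lborel. f x = g x"
  shows "f \<in> borel_measurable lebesgue" "integral\<^sup>L lebesgue f = integral\<^sup>L lborel g"
proof -
  have gl: "g \<in> borel_measurable lebesgue" using g by (simp add: measurable_completion)
  have ael: "AE x in lebesgue. f x = g x" using ae by (rule AE_completion)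
  obtain N where N: "{x \<in> space lebesgue. f x \<noteq> g x} \<subseteq> N" "emeasure lebesgue N = 0" "N \<in> sets lebesgue"
    using ael by (rule AE_E)
  then have Nn: "N \<in> null_sets lebesgue" by auto
  show m: "f \<in> borel_measurable lebesgue"
  proof (rule measurableI)
    fix B :: "real set" assume B: "B \<in> sets borel"
    have "f -` B = (g -` B - N) \<union> (f -` B \<inter> N)" using N(1) by auto
    moreover have "g -` B \<in> sets lebesgue" using measurable_sets[OF gl B] by simp
    moreover have "f -` B \<inter> N \<in> sets lebesgue"
      by (rule null_setsD2[OF null_sets_completion_subset[OF _ Nn]]) simp
    ultimately have "f -` B \<in> sets lebesgue"
      using sets.Un[OF sets.Diff[OF _ N(3), of "g -` B"], of "f -` B \<inter> N"] by simp
    then show "f -` B \<inter> space lebesgue \<in> sets lebesgue" by simp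
  qed simp
  have "integral\<^sup>L lebesgue f = integral\<^sup>L lebesgue g" by (rule integral_cong_AE[OF m gl ael])
  also have "\<dots> = integral\<^sup>L lborel g" by (rule integral_completion) (simp add: g)
  finally show "integral\<^sup>L lebesgue f = integral\<^sup>L lborel g" .
qed

text \<open>The covering lemma for gauges gives nonoverlapping intervals. The gauge at x is a ball
  of radius at most \<delta> / 2 and, for x in U, contained in U, so the intervals are short and
  stay in U. It serves for Hausdorff covers and, with S = U, for cutting an open set into
  intervals.\<close>

lemma real_interval_cover:
  fixes S U :: "real set"
  assumes S: "S \<subseteq> {a..b}" "a < b" and U: "open U" "S \<subseteq> U" and \<delta>: "0 < \<delta>"
  shows "\<exists>u v :: nat \<Rightarrow> real. (\<forall>n. u n \<le> v n \<and> v n - u n \<le> \<delta> \<and> (u n < v n \<longrightarrow> {u n..v n} \<subseteq> U)) \<and>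
    disjoint_family (\<lambda>n. {u n<..<v n}) \<and> S \<subseteq> (\<Union>n. {u n..v n})"
proof -
  have "\<exists>r>0. r \<le> \<delta> / 2 \<and> (x \<in> U \<longrightarrow> ball x r \<subseteq> U)" for x
  proof (cases "x \<in> U")
    case True
    then obtain e where e: "0 < e" "ball x e \<subseteq> U" using U(1) openE by blast
    then have "ball x (min e (\<delta> / 2)) \<subseteq> U" by auto
    then show ?thesis using e \<delta> by (intro exI[of _ "min e (\<delta> / 2)"]) auto
  next
    case False
    then show ?thesis using \<delta> by (intro exI[of _ "\<delta> / 2"]) auto
  qed
  then obtain r where r: "\<And>x. 0 < r x" "\<And>x. r x \<le> \<delta> / 2" "\<And>x. x \<in> U \<Longrightarrow> ball x (r x) \<subseteq> U" by metis
  have "gauge (\<lambda>x. ball x (r x))" using r(1) by (auto simp: gauge_def)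
  then have g: "gauge (\<lambda>x. ball x (r x))" .
  have Sc: "S \<subseteq> cbox a b" "box a b \<noteq> {}" using S by (simp_all add: cbox_interval box_real)
  have "\<exists>D. countable D \<and> (\<forall>K\<in>D. interior K \<noteq> {} \<and> (\<exists>c d. K = cbox c d)) \<and>
    pairwise (\<lambda>A B. interior A \<inter> interior B = {}) D \<and>
    (\<forall>K\<in>D. \<exists>x \<in> S \<inter> K. K \<subseteq> ball x (r x)) \<and> S \<subseteq> \<Union>D"
  proof (rule covering_lemma[OF Sc g])
    fix D assume D: "countable D" "\<And>K. K \<in> D \<Longrightarrow> interior K \<noteq> {} \<and> (\<exists>c d. K = cbox c d)"
      "pairwise (\<lambda>A B. interior A \<inter> interior B = {}) D"
      "\<And>K. K \<in> D \<Longrightarrow> \<exists>x \<in> S \<inter> K. K \<subseteq> ball x (r x)" "S \<subseteq> \<Union>D"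
    show ?thesis by (intro exI[of _ D] conjI ballI D(1,3,5)) (use D(2,4) in auto)
  qed
  then obtain D where D1: "countable D" and D2: "\<forall>K\<in>D. interior K \<noteq> {} \<and> (\<exists>c d. K = cbox c d)"
    and D3: "pairwise (\<lambda>A B. interior A \<inter> interior B = {}) D"
    and D4: "\<forall>K\<in>D. \<exists>x \<in> S \<inter> K. K \<subseteq> ball x (r x)" and D5: "S \<subseteq> \<Union>D"
    by (elim exE conjE) (rule that)
  note D = D1 bspec[OF D2] D3 bspec[OF D4] D5
  have K: "\<exists>c d. K = {c..d} \<and> c < d \<and> d - c \<le> \<delta> \<and> {c..d} \<subseteq> U" if KD: "K \<in> D" for K
  proof -
    obtain c d where K: "K = {c..d}" "interior K \<noteq> {}" using D(2)[OF KD] by (auto simp: cbox_interval)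
    then have cd: "c < d" by (auto simp: interior_atLeastAtMost_real)
    obtain x where x: "x \<in> S" "K \<subseteq> ball x (r x)" using D(4)[OF KD] by blast
    have "c \<in> K" "d \<in> K" using K(1) cd by auto
    then have "c \<in> ball x (r x)" "d \<in> ball x (r x)" using x(2) by blast+
    then have "d - c \<le> \<delta>" using r(2)[of x] by (auto simp: dist_real_def)
    moreover have "{c..d} \<subseteq> U" using x K(1) r(3)[of x] U(2) by blast
    ultimately show ?thesis using K cd by blast
  qed
  define Q where "Q K c d \<longleftrightarrow> K = {c..d} \<and> c < d \<and> d - c \<le> \<delta> \<and> {c..d} \<subseteq> U" for K c d
  have "\<forall>K\<in>D. \<exists>c d. Q K c d" using K unfolding Q_def by blast
  then obtain c d where "\<forall>K\<in>D. Q K (c K) (d K)" by metis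
  then have cdK: "\<And>K. K \<in> D \<Longrightarrow> K = {c K..d K}"
    and cd: "\<And>K. K \<in> D \<Longrightarrow> c K < d K \<and> d K - c K \<le> \<delta> \<and> {c K..d K} \<subseteq> U"
    unfolding Q_def by blast+
  define ix where "ix = to_nat_on D"
  have inj: "inj_on ix D" unfolding ix_def using D(1) by (rule inj_on_to_nat_on)
  \<comment> \<open>The family D may be finite: other indices receive the degenerate interval
    [0, 0], which need not lie in U.\<close>
  define KK where "KK n = (if n \<in> ix ` D then inv_into D ix n else {0..0})" for n
  define u v where "u n = (if n \<in> ix ` D then c (KK n) else 0)" and "v n = (if n \<in> ix ` D then d (KK n) else 0)" for n
  have KD: "KK n \<in> D" if "n \<in> ix ` D" for n using that by (simp add: KK_def inv_into_into)
  have Kix: "KK (ix k) = k" if "k \<in> D" for k using that inj by (simp add: KK_def)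
  have int: "interior k = {c k<..<d k}" if "k \<in> D" for k
    using arg_cong[OF cdK[OF that], of interior] unfolding interior_atLeastAtMost_real .
  have p1: "u n \<le> v n \<and> v n - u n \<le> \<delta> \<and> (u n < v n \<longrightarrow> {u n..v n} \<subseteq> U)" for n
    using cd[OF KD[of n]] \<delta> by (cases "n \<in> ix ` D") (auto simp: u_def v_def)
  have p2: "{u m<..<v m} \<inter> {u n<..<v n} = {}" if "m \<noteq> n" for m n
  proof (cases "m \<in> ix ` D \<and> n \<in> ix ` D")
    case True
    have "KK m \<noteq> KK n"
      using True that f_inv_into_f[of m ix D] f_inv_into_f[of n ix D] by (auto simp: KK_def)
    then have "interior (KK m) \<inter> interior (KK n) = {}"
      using pairwiseD[OF D(3) KD KD] True by blast
    then have "{c (KK m)<..<d (KK m)} \<inter> {c (KK n)<..<d (KK n)} = {}"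
      using True int[OF KD, of m] int[OF KD, of n] by (simp only:)
    then show ?thesis using True by (simp only: u_def v_def if_True)
  next
    case False
    then show ?thesis by (auto simp: u_def v_def)
  qed
  have p3: "S \<subseteq> (\<Union>n. {u n..v n})"
  proof
    fix x assume "x \<in> S"
    then obtain k where k: "k \<in> D" "x \<in> k" using D(5) by blast
    have "x \<in> {c k..d k}" by (rule subsetD[OF equalityD1[OF cdK[OF k(1)]] k(2)])
    then have "x \<in> {u (ix k)..v (ix k)}" using Kix[OF k(1)] k(1) by (simp add: u_def v_def)
    then show "x \<in> (\<Union>n. {u n..v n})" by blast
  qed
  show ?thesis
    using p1 p2 p3 by (intro exI[of _ u] exI[of _ v]) (auto simp: disjoint_family_on_def)
qed

lemma emeasure_disjoint_intervals:
  assumes "\<And>n. u n \<le> v n" "disjoint_family (\<lambda>n. {u n<..<v n})" "\<And>n. u n < v n \<Longrightarrow> {u n..v n} \<subseteq> U" "open U"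
  shows "(\<Sum>n. ennreal (v n - u n)) \<le> emeasure lborel (U :: real set)"
proof -
  have "(\<Sum>n. ennreal (v n - u n)) = (\<Sum>n. emeasure lborel {u n<..<v n})" using assms(1) by simp
  also have "\<dots> = emeasure lborel (\<Union>n. {u n<..<v n})"
    by (rule suminf_emeasure[OF _ assms(2)]) auto
  also have "\<dots> \<le> emeasure lborel U"
  proof (rule emeasure_mono)
    show "(\<Union>n. {u n<..<v n}) \<subseteq> U"
    proof
      fix x assume "x \<in> (\<Union>n. {u n<..<v n})"
      then obtain n where "u n < x" "x < v n" by auto
      then show "x \<in> U" using assms(3)[of n] by auto
    qed
  qed (use assms(4) in auto)
  finally show ?thesis .
qed

context edge_net
begin

section \<open>Hausdorff measure equals arclength\<close>

lemma finite_coeffs_one: "finite_coeffs (\<lambda>_. 1)"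
  using summable_len by (simp add: finite_coeffs_def)

text \<open>The parameters of A are covered by short intervals whose total length exceeds the
  measure by little; as \<open>\<gamma> i\<close> is 1-Lipschitz, the images have diameters no
  larger than these lengths.\<close>

lemma hausdorff1_content_le:
  assumes A: "A \<in> sets borel" and \<delta>: "0 < \<delta>"
  shows "hausdorff1_content \<delta> A \<le> emeasure (wt (\<lambda>_. 1)) A"
proof (rule ennreal_le_epsilon)
  note A [measurable]
  fix \<epsilon> :: real assume \<epsilon>: "0 < \<epsilon>"
  define S where "S i = {s \<in> {0..\<l> i}. \<gamma> i s \<in> A}" for i
  have [measurable]: "S i \<in> sets borel" for i unfolding S_def by measurable
  have Sle: "emeasure lborel (S i) \<le> emeasure lborel {s \<in> {0<..<\<l> i}. \<gamma> i s \<in> A}" for i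
  proof -
    have "emeasure lborel (S i) \<le> emeasure lborel ({s \<in> {0<..<\<l> i}. \<gamma> i s \<in> A} \<union> {0, \<l> i})"
      by (rule emeasure_mono) (auto simp: S_def)
    also have "\<dots> \<le> emeasure lborel {s \<in> {0<..<\<l> i}. \<gamma> i s \<in> A} + emeasure lborel {0, \<l> i}"
      by (rule emeasure_subadditive) auto
    also have "emeasure lborel {0, \<l> i} = 0" by (rule emeasure_lborel_countable) simp
    finally show ?thesis by simp
  qed
  \<comment> \<open>The error allowed on edge i; these errors add up to \<epsilon>.\<close>
  define e where "e i = \<epsilon> * (1/2) ^ Suc i" for i
  have e0: "0 < e i" for i using \<epsilon> by (simp add: e_def)
  have "\<exists>U. open U \<and> S i \<subseteq> U \<and> emeasure lborel U \<le> emeasure lborel (S i) + ennreal (e i)" for i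
  proof -
    have "S i \<in> sets lebesgue" by simp
    then obtain U where U: "open U" "S i \<subseteq> U" "emeasure lebesgue (U - S i) < ennreal (e i)"
      using sets_lebesgue_outer_open[OF _ e0[of i]] by blast
    have [measurable]: "U \<in> sets borel" using U by auto
    have "emeasure lborel U = emeasure lborel (S i \<union> (U - S i))" using U(2) by (simp add: Un_absorb1)
    also have "\<dots> \<le> emeasure lborel (S i) + emeasure lborel (U - S i)"
      by (rule emeasure_subadditive) auto
    also have "emeasure lborel (U - S i) = emeasure lebesgue (U - S i)" by simp
    also have "emeasure lborel (S i) + emeasure lebesgue (U - S i) \<le> emeasure lborel (S i) + ennreal (e i)"
      by (rule add_left_mono[OF less_imp_le[OF U(3)]])
    finally show ?thesis using U by blast
  qed
  then have "\<exists>U. \<forall>i. open (U i) \<and> S i \<subseteq> U i \<and> emeasure lborel (U i) \<le> emeasure lborel (S i) + ennreal (e i)"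
    by (intro choice) simp
  then obtain U where U0: "\<forall>i. open (U i) \<and> S i \<subseteq> U i \<and> emeasure lborel (U i) \<le> emeasure lborel (S i) + ennreal (e i)"
    by (elim exE) (rule that)
  have U: "\<And>i. open (U i)" "\<And>i. S i \<subseteq> U i"
    "\<And>i. emeasure lborel (U i) \<le> emeasure lborel (S i) + ennreal (e i)" using U0 by simp_all
  define Q where "Q i u v \<longleftrightarrow> (\<forall>n. u n \<le> v n \<and> v n - u n \<le> \<delta> \<and> (u n < v n \<longrightarrow> {u n..v n} \<subseteq> U i)) \<and>
    disjoint_family (\<lambda>n. {u n<..<v n}) \<and> S i \<subseteq> (\<Union>n. {u n..v n})" for i and u v :: "nat \<Rightarrow> real"
  have "S i \<subseteq> {0..\<l> i}" for i by (auto simp: S_def)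
  then have "\<exists>u v. Q i u v" for i
    unfolding Q_def by (rule real_interval_cover[OF _ len0 U(1,2) \<delta>])
  then obtain u v where Q: "\<forall>i. Q i (u i) (v i)" by metis
  have uv: "\<And>i n. u i n \<le> v i n" "\<And>i n. v i n - u i n \<le> \<delta>" "\<And>i n. u i n < v i n \<Longrightarrow> {u i n..v i n} \<subseteq> U i"
    and dj: "\<And>i. disjoint_family (\<lambda>n. {u i n<..<v i n})" and cov: "\<And>i. S i \<subseteq> (\<Union>n. {u i n..v i n})"
  proof -
    fix i
    have "(\<forall>n. u i n \<le> v i n \<and> v i n - u i n \<le> \<delta> \<and> (u i n < v i n \<longrightarrow> {u i n..v i n} \<subseteq> U i)) \<and>
      disjoint_family (\<lambda>n. {u i n<..<v i n}) \<and> S i \<subseteq> (\<Union>n. {u i n..v i n})"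
      using Q[rule_format, of i] unfolding Q_def .
    then show "\<And>n. u i n \<le> v i n" "\<And>n. v i n - u i n \<le> \<delta>" "\<And>n. u i n < v i n \<Longrightarrow> {u i n..v i n} \<subseteq> U i"
      "disjoint_family (\<lambda>n. {u i n<..<v i n})" "S i \<subseteq> (\<Union>n. {u i n..v i n})"
      by simp_all
  qed
  \<comment> \<open>Pairing turns the doubly indexed family into the sequence that the Hausdorff
    content asks for.\<close>
  define C where "C k = (case prod_decode k of (i, n) \<Rightarrow> \<gamma> i ` {u i n..v i n})" for k
  have diam: "bounded (\<gamma> i ` {u i n..v i n})" "diameter (\<gamma> i ` {u i n..v i n}) \<le> v i n - u i n" for i n
  proof -
    have d: "dist (\<gamma> i s) (\<gamma> i t) \<le> v i n - u i n" if "s \<in> {u i n..v i n}" "t \<in> {u i n..v i n}" for s t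
      using \<gamma>_lip[of i s t] that by auto
    show "bounded (\<gamma> i ` {u i n..v i n})"
      unfolding bounded_def
    proof (intro exI ballI)
      fix y assume "y \<in> \<gamma> i ` {u i n..v i n}"
      then obtain t where "t \<in> {u i n..v i n}" "y = \<gamma> i t" by blast
      then show "dist (\<gamma> i (u i n)) y \<le> v i n - u i n" using d[of "u i n" t] uv(1)[of i n] by simp
    qed
    have ne: "\<gamma> i ` {u i n..v i n} \<noteq> {}" using uv(1)[of i n] by simp
    have "(SUP (x, y)\<in>\<gamma> i ` {u i n..v i n} \<times> \<gamma> i ` {u i n..v i n}. dist x y) \<le> v i n - u i n"
    proof (rule cSUP_least)
      fix p assume "p \<in> \<gamma> i ` {u i n..v i n} \<times> \<gamma> i ` {u i n..v i n}"
      then obtain s t where st: "s \<in> {u i n..v i n}" "t \<in> {u i n..v i n}" "p = (\<gamma> i s, \<gamma> i t)" by blast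
      show "(case p of (x, y) \<Rightarrow> dist x y) \<le> v i n - u i n" using d[OF st(1,2)] st(3) by simp
    qed (use ne in simp)
    then show "diameter (\<gamma> i ` {u i n..v i n}) \<le> v i n - u i n"
      unfolding diameter_def using ne by simp
  qed
  have "hausdorff1_content \<delta> A \<le> (\<Sum>k. ennreal (diameter (C k)))"
    unfolding hausdorff1_content_def
  proof (rule INF_lower, intro CollectI conjI allI)
    show "A \<subseteq> (\<Union>k. C k)"
    proof
      fix x assume x: "x \<in> A"
      obtain i s where s: "0 \<le> s" "s \<le> \<l> i" "x = \<gamma> i s" using cover by blast
      then have "s \<in> S i" using x by (simp add: S_def)
      then obtain n where "s \<in> {u i n..v i n}" using cov by blast
      then have "x \<in> C (prod_encode (i, n))" using s by (simp add: C_def)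
      then show "x \<in> (\<Union>k. C k)" by blast
    qed
    show "bounded (C k)" for k
    proof -
      obtain i n where k: "prod_decode k = (i, n)" by (cases "prod_decode k")
      show ?thesis using diam(1)[of i n] by (simp add: C_def k)
    qed
    show "diameter (C k) \<le> \<delta>" for k
    proof -
      obtain i n where k: "prod_decode k = (i, n)" by (cases "prod_decode k")
      show ?thesis using order_trans[OF diam(2) uv(2), of i n] by (simp add: C_def k)
    qed
  qed
  also have "\<dots> \<le> (\<Sum>k. (\<lambda>(i, n). ennreal (v i n - u i n)) (prod_decode k))"
  proof (rule suminf_le)
    fix k
    obtain i n where k: "prod_decode k = (i, n)" by (cases "prod_decode k")
    show "ennreal (diameter (C k)) \<le> (\<lambda>(i, n). ennreal (v i n - u i n)) (prod_decode k)"
      using ennreal_leI[OF diam(2)[of i n]] by (simp add: C_def k)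
  qed auto
  also have "\<dots> = (\<Sum>i. \<Sum>n. ennreal (v i n - u i n))"
    by (rule suminf_ennreal_2dimen[where f="\<lambda>(i, n). ennreal (v i n - u i n)"]) simp
  also have "\<dots> \<le> (\<Sum>i. emeasure lborel {s \<in> {0<..<\<l> i}. \<gamma> i s \<in> A} + ennreal (e i))"
  proof (rule suminf_le)
    fix i
    have "(\<Sum>n. ennreal (v i n - u i n)) \<le> emeasure lborel (U i)"
      by (rule emeasure_disjoint_intervals[OF uv(1) dj uv(3) U(1)])
    also have "\<dots> \<le> emeasure lborel (S i) + ennreal (e i)" by (rule U(3))
    also have "\<dots> \<le> emeasure lborel {s \<in> {0<..<\<l> i}. \<gamma> i s \<in> A} + ennreal (e i)"
      by (rule add_right_mono[OF Sle])
    finally show "(\<Sum>n. ennreal (v i n - u i n)) \<le> emeasure lborel {s \<in> {0<..<\<l> i}. \<gamma> i s \<in> A} + ennreal (e i)" .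
  qed auto
  also have "\<dots> = (\<Sum>i. emeasure lborel {s \<in> {0<..<\<l> i}. \<gamma> i s \<in> A}) + (\<Sum>i. ennreal (e i))"
    by (rule suminf_add[symmetric]) auto
  also have "(\<Sum>i. emeasure lborel {s \<in> {0<..<\<l> i}. \<gamma> i s \<in> A}) = emeasure (wt (\<lambda>_. 1)) A"
    by (simp add: emeasure_wt[OF A])
  also have "(\<Sum>i. ennreal (e i)) = ennreal \<epsilon>"
  proof -
    have "e sums (\<epsilon> * 1)" unfolding e_def by (rule sums_mult[OF power_half_series])
    then show ?thesis using e0 by (intro suminf_ennreal_eq) (auto simp: less_imp_le)
  qed
  finally show "hausdorff1_content \<delta> A \<le> emeasure (wt (\<lambda>_. 1)) A + ennreal \<epsilon>" .
qed

text \<open>A set of small diameter meets the inner parts of at most one edge, and meets that edge in a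
  set contained in an interval no longer than its diameter.\<close>

lemma hausdorff1_content_ge:
  assumes A: "A \<in> sets borel" and \<eta>: "0 < \<eta>"
  shows "(\<Sum>i<N. emeasure lborel {s \<in> {0<..<\<l> i}. \<gamma> i s \<in> A \<and> \<eta> \<le> min s (\<l> i - s)}) \<le> hausdorff1_content (\<eta> / 2) A"
  unfolding hausdorff1_content_def
proof (rule INF_greatest)
  fix C :: "nat \<Rightarrow> 'a set"
  assume "C \<in> {C. A \<subseteq> (\<Union>i. C i) \<and> (\<forall>i. bounded (C i) \<and> diameter (C i) \<le> \<eta> / 2)}"
  then have C: "A \<subseteq> (\<Union>k. C k)" "\<And>k. bounded (C k)" "\<And>k. diameter (C k) \<le> \<eta> / 2" by auto
  define S where "S i k = {s \<in> {0<..<\<l> i}. \<gamma> i s \<in> C k \<and> \<eta> \<le> min s (\<l> i - s)}" for i k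
  define I where "I i k = (if S i k = {} then {} else {Inf (S i k)..Sup (S i k)})" for i k
  have [measurable]: "I i k \<in> sets borel" for i k by (simp add: I_def)
  have bdd: "bdd_below (S i k)" "bdd_above (S i k)" for i k
    by (auto simp: S_def intro!: bdd_belowI[of _ 0] bdd_aboveI[of _ "\<l> i"])
  have SI: "S i k \<subseteq> I i k" for i k
  proof
    fix s assume s: "s \<in> S i k"
    then have "S i k \<noteq> {}" by blast
    then show "s \<in> I i k" using cInf_lower[OF s bdd(1)] cSup_upper[OF s bdd(2)] by (simp add: I_def)
  qed
  have dS: "t - s \<le> diameter (C k)" if "s \<in> S i k" "t \<in> S i k" for i k s t
  proof -
    have "dist (\<gamma> i s) (\<gamma> i t) \<le> diameter (C k)"
      using that by (intro diameter_bounded_bound[OF C(2)]) (auto simp: S_def)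
    moreover have "dist (\<gamma> i s) (\<gamma> i t) = \<bar>s - t\<bar>"
      using that by (intro \<gamma>_isometry) (auto simp: S_def)
    ultimately show ?thesis by linarith
  qed
  have Ile: "emeasure lborel (I i k) \<le> ennreal (diameter (C k))" for i k
  proof (cases "S i k = {}")
    case False
    have "Sup (S i k) \<le> s + diameter (C k)" if "s \<in> S i k" for s
    proof (rule cSup_least[OF False])
      fix t assume "t \<in> S i k"
      then show "t \<le> s + diameter (C k)" using dS[OF that, of t] by linarith
    qed
    then have "Sup (S i k) - diameter (C k) \<le> Inf (S i k)"
      by (intro cInf_greatest[OF False]) (simp add: diff_le_eq)
    moreover have "Inf (S i k) \<le> Sup (S i k)"
    proof -
      obtain s where s: "s \<in> S i k" using False by blast
      show ?thesis by (rule order_trans[OF cInf_lower[OF s bdd(1)] cSup_upper[OF s bdd(2)]])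
    qed
    ultimately show ?thesis using False by (simp add: I_def ennreal_leI)
  qed (simp add: I_def)
  \<comment> \<open>Two points of one covering set are at most \<eta> / 2 apart, while the depth for
    edge i falls from at least \<eta> to 0 on passing to another edge.\<close>
  have uniq: "i = j" if ne: "S i k \<noteq> {}" "S j k \<noteq> {}" for i j k
  proof (rule ccontr)
    assume "i \<noteq> j"
    obtain s t where s: "s \<in> S i k" and t: "t \<in> S j k" using ne by blast
    have "dist (\<gamma> i s) (\<gamma> j t) \<le> diameter (C k)"
      using s t by (intro diameter_bounded_bound[OF C(2)]) (auto simp: S_def)
    moreover have "dep i (\<gamma> i s) = min s (\<l> i - s)" using s by (intro dep_\<gamma>) (auto simp: S_def)
    moreover have "dep i (\<gamma> j t) = 0" using \<open>i \<noteq> j\<close> by (rule dep_other)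
    moreover have "\<eta> \<le> min s (\<l> i - s)" using s by (simp add: S_def)
    ultimately show False using dep_lip[of i "\<gamma> i s" "\<gamma> j t"] C(3)[of k] \<eta> by linarith
  qed
  have sumI: "(\<Sum>i<N. emeasure lborel (I i k)) \<le> ennreal (diameter (C k))" for k
  proof (cases "\<exists>i<N. S i k \<noteq> {}")
    case True
    then obtain i where i: "i < N" "S i k \<noteq> {}" by blast
    have "(\<Sum>j<N. emeasure lborel (I j k)) = (\<Sum>j<N. if j = i then emeasure lborel (I i k) else 0)"
    proof (rule sum.cong)
      fix j
      show "emeasure lborel (I j k) = (if j = i then emeasure lborel (I i k) else 0)"
      proof (cases "j = i")
        case False
        then have "S j k = {}" using uniq[of j k i] i(2) by blast
        then show ?thesis using False by (simp add: I_def)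
      qed simp
    qed simp
    also have "\<dots> = emeasure lborel (I i k)" using i by simp
    finally show ?thesis using Ile[of i k] by simp
  qed (auto simp: I_def)
  have "(\<Sum>i<N. emeasure lborel {s \<in> {0<..<\<l> i}. \<gamma> i s \<in> A \<and> \<eta> \<le> min s (\<l> i - s)}) \<le>
      (\<Sum>i<N. \<Sum>k. emeasure lborel (I i k))"
  proof (rule sum_mono)
    fix i
    have "{s \<in> {0<..<\<l> i}. \<gamma> i s \<in> A \<and> \<eta> \<le> min s (\<l> i - s)} \<subseteq> (\<Union>k. I i k)"
    proof
      fix s assume s: "s \<in> {s \<in> {0<..<\<l> i}. \<gamma> i s \<in> A \<and> \<eta> \<le> min s (\<l> i - s)}"
      then obtain k where "\<gamma> i s \<in> C k" using C(1) by blast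
      then have "s \<in> S i k" using s by (simp add: S_def)
      then show "s \<in> (\<Union>k. I i k)" using SI by blast
    qed
    then have "emeasure lborel {s \<in> {0<..<\<l> i}. \<gamma> i s \<in> A \<and> \<eta> \<le> min s (\<l> i - s)} \<le> emeasure lborel (\<Union>k. I i k)"
      by (rule emeasure_mono) (auto intro!: sets.countable_UN)
    also have "\<dots> \<le> (\<Sum>k. emeasure lborel (I i k))"
      by (rule emeasure_subadditive_countably) auto
    finally show "emeasure lborel {s \<in> {0<..<\<l> i}. \<gamma> i s \<in> A \<and> \<eta> \<le> min s (\<l> i - s)} \<le> (\<Sum>k. emeasure lborel (I i k))" .
  qed
  also have "\<dots> = (\<Sum>k. \<Sum>i<N. emeasure lborel (I i k))" by (rule suminf_sum[symmetric]) auto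
  also have "\<dots> \<le> (\<Sum>k. ennreal (diameter (C k)))" by (rule suminf_le[OF sumI]) auto
  finally show "(\<Sum>i<N. emeasure lborel {s \<in> {0<..<\<l> i}. \<gamma> i s \<in> A \<and> \<eta> \<le> min s (\<l> i - s)}) \<le> (\<Sum>k. ennreal (diameter (C k)))" .
qed

text \<open>For the lower bound, the content at scale h m / 2 sees the points of depth at least h m
  on the first N edges. These exhaust the open edges as m grows, and N is released last.\<close>

lemma hausdorff1_outer_eq:
  assumes A: "A \<in> sets borel"
  shows "hausdorff1_outer A = emeasure (wt (\<lambda>_. 1)) A"
proof (rule antisym)
  show "hausdorff1_outer A \<le> emeasure (wt (\<lambda>_. 1)) A"
    unfolding hausdorff1_outer_def by (rule SUP_least) (use hausdorff1_content_le[OF A] in auto)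
  note A [measurable]
  define h where "h m = inverse (real (Suc m))" for m
  have h0: "0 < h m" for m by (simp add: h_def)
  define S where "S i m = {s \<in> {0<..<\<l> i}. \<gamma> i s \<in> A \<and> h m \<le> min s (\<l> i - s)}" for i m
  have SN: "(\<Sum>i<N. emeasure lborel {s \<in> {0<..<\<l> i}. \<gamma> i s \<in> A}) \<le> hausdorff1_outer A" for N
  proof -
    have lim: "(\<lambda>m. emeasure lborel (S i m)) \<longlonglongrightarrow> emeasure lborel {s \<in> {0<..<\<l> i}. \<gamma> i s \<in> A}" for i
    proof -
      have "(\<lambda>m. emeasure lborel (S i m)) \<longlonglongrightarrow> emeasure lborel (\<Union>m. S i m)"
      proof (rule Lim_emeasure_incseq)
        show "range (S i) \<subseteq> sets lborel"
        proof (rule image_subsetI)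
          fix m show "S i m \<in> sets lborel" unfolding S_def by measurable
        qed
        show "incseq (S i)"
        proof (rule incseq_SucI)
          fix m
          have "h (Suc m) \<le> h m" by (simp add: h_def field_simps)
          then show "S i m \<subseteq> S i (Suc m)" by (auto simp: S_def)
        qed
      qed
      also have "(\<Union>m. S i m) = {s \<in> {0<..<\<l> i}. \<gamma> i s \<in> A}"
      proof (intro set_eqI iffI)
        fix s assume s: "s \<in> {s \<in> {0<..<\<l> i}. \<gamma> i s \<in> A}"
        then have "0 < min s (\<l> i - s)" by simp
        then obtain m where "h m < min s (\<l> i - s)" unfolding h_def using reals_Archimedean by blast
        then show "s \<in> (\<Union>m. S i m)" using s by (auto simp: S_def intro!: exI[of _ m])
      qed (auto simp: S_def)
      finally show ?thesis .
    qed
    have "(\<lambda>m. \<Sum>i<N. emeasure lborel (S i m)) \<longlonglongrightarrow> (\<Sum>i<N. emeasure lborel {s \<in> {0<..<\<l> i}. \<gamma> i s \<in> A})"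
      by (rule tendsto_sum[OF lim])
    moreover have "(\<Sum>i<N. emeasure lborel (S i m)) \<le> hausdorff1_outer A" for m
    proof -
      have "(\<Sum>i<N. emeasure lborel (S i m)) \<le> hausdorff1_content (h m / 2) A"
        unfolding S_def by (rule hausdorff1_content_ge[OF A h0])
      also have "\<dots> \<le> hausdorff1_outer A"
        unfolding hausdorff1_outer_def using h0[of m] by (intro SUP_upper) simp
      finally show ?thesis .
    qed
    ultimately show ?thesis by (intro LIMSEQ_le_const2) auto
  qed
  have "emeasure (wt (\<lambda>_. 1)) A = (\<Sum>i. emeasure lborel {s \<in> {0<..<\<l> i}. \<gamma> i s \<in> A})"
    by (simp add: emeasure_wt[OF A])
  also have "\<dots> \<le> hausdorff1_outer A"
    by (rule suminf_le_const[OF summableI SN])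
  finally show "emeasure (wt (\<lambda>_. 1)) A \<le> hausdorff1_outer A" .
qed

text \<open>\<open>measure_of\<close> needs a countably additive set function to reproduce its
  values; equality with the measure \<open>wt (\<lambda>_. 1)\<close> on Borel sets supplies the
  additivity.\<close>

lemma hausdorff1_eq: "(hausdorff1 :: 'a measure) = wt (\<lambda>_. 1)"
proof -
  have "space (wt (\<lambda>_. 1)) = UNIV" by (simp add: wt_def)
  then have "wt (\<lambda>_. 1) = measure_of UNIV (sets borel) (emeasure (wt (\<lambda>_. 1)))"
    using measure_of_of_measure[of "wt (\<lambda>_. 1)"] by simp
  also have "\<dots> = measure_of UNIV (sets borel) hausdorff1_outer"
  proof (rule measure_of_eq)
    fix A :: "'a set" assume "A \<in> sigma_sets UNIV (sets borel)"
    then have "A \<in> sets borel" using sets.sigma_sets_eq[of "borel :: 'a measure"] by simp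
    then show "emeasure (wt (\<lambda>_. 1)) A = hausdorff1_outer A" by (rule hausdorff1_outer_eq[symmetric])
  qed simp
  finally show ?thesis by (simp add: hausdorff1_def)
qed

section \<open>Multiplicities and their essential supremum\<close>

lemma edge_image: "\<gamma> i ` {0<..<\<l> i} = edge i"
proof (intro set_eqI iffI)
  fix x assume "x \<in> edge i"
  then show "x \<in> \<gamma> i ` {0<..<\<l> i}" using edge_coord[of x i] by (intro image_eqI[of _ _ "cr i x"]) auto
qed (auto simp: \<gamma>_in_edge)

text \<open>The multiplicity is taken by choice, so a witness is due: the open edges parametrized by
  arclength, with the constant m i on the i-th.\<close>

lemma is_multiplicity_cur:
  assumes c: "finite_coeffs (\<lambda>i. real_of_int (m i))"
  shows "\<exists>\<theta>. is_multiplicity (cur (\<lambda>i. real_of_int (m i))) \<theta>"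
proof -
  let ?c = "\<lambda>i. real_of_int (m i)"
  \<comment> \<open>Vertices lie on none of the pieces, where the definition demands the value
    0.\<close>
  define \<theta> where "\<theta> x = (if x \<in> vertices then 0 else nat \<bar>m (THE i. x \<in> edge i)\<bar>)" for x
  have \<theta>e: "\<theta> x = nat \<bar>m i\<bar>" if "x \<in> edge i" for x i
  proof -
    have "(THE i. x \<in> edge i) = i"
    proof (rule the_equality)
      show "x \<in> edge i" by (rule that)
      show "j = i" if "x \<in> edge j" for j
        using edge_disjoint[of j i] that \<open>x \<in> edge i\<close> by (cases "j = i") auto
    qed
    moreover have "x \<notin> vertices" using that by (auto simp: vertices_def)
    ultimately show ?thesis by (simp add: \<theta>_def)
  qed
  have vm: "vertices \<in> sets borel" unfolding vertices_def by measurable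
  have \<theta>m: "\<theta> \<in> borel \<rightarrow>\<^sub>M count_space UNIV"
    unfolding measurable_count_space_eq2_countable
  proof (intro conjI ballI)
    fix n
    have "\<theta> -` {n} = (\<Union>i\<in>{i. nat \<bar>m i\<bar> = n}. edge i) \<union> (if n = 0 then vertices else {})"
    proof (intro set_eqI iffI)
      fix x assume x: "x \<in> \<theta> -` {n}"
      show "x \<in> (\<Union>i\<in>{i. nat \<bar>m i\<bar> = n}. edge i) \<union> (if n = 0 then vertices else {})"
      proof (cases "x \<in> vertices")
        case True
        then have "\<theta> x = 0" by (simp add: \<theta>_def)
        then show ?thesis using x True by auto
      next
        case False
        then obtain i where "x \<in> edge i" by (auto simp: vertices_def)
        then show ?thesis using \<theta>e[of x i] x by auto
      qed
    next
      fix x assume "x \<in> (\<Union>i\<in>{i. nat \<bar>m i\<bar> = n}. edge i) \<union> (if n = 0 then vertices else {})"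
      then consider i where "nat \<bar>m i\<bar> = n" "x \<in> edge i" | "n = 0" "x \<in> vertices"
        by (cases "n = 0") auto
      then show "x \<in> \<theta> -` {n}"
      proof cases
        case 1
        then show ?thesis using \<theta>e[of x] by simp
      next
        case 2
        then show ?thesis by (simp add: \<theta>_def)
      qed
    qed
    moreover have "(\<Union>i\<in>{i. nat \<bar>m i\<bar> = n}. edge i) \<in> sets borel"
      by (intro sets.countable_UN') auto
    ultimately show "\<theta> -` {n} \<inter> space borel \<in> sets borel" using vm by auto
  qed auto
  have sums: "(\<lambda>i. LINT s:{0<..<\<l> i}|lebesgue. real_of_int (m i) * f (\<gamma> i s) *
       vector_derivative (\<lambda>t. \<pi> (\<gamma> i t)) (at s within {0<..<\<l> i})) sums cur ?c f \<pi>"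
    if f: "f \<in> bLip_fun" and \<pi>: "\<pi> \<in> Lip_fun" for f \<pi> :: "'a \<Rightarrow> real"
  proof -
    obtain C where C: "\<And>x. \<bar>f x\<bar> \<le> C" using bLip_fun_bounded[OF f] by blast
    have "(LINT s:{0<..<\<l> i}|lebesgue. real_of_int (m i) * f (\<gamma> i s) *
       vector_derivative (\<lambda>t. \<pi> (\<gamma> i t)) (at s within {0<..<\<l> i})) =
       ?c i * edge_int (\<l> i) (\<lambda>s. f (\<gamma> i s) * lderiv (\<lambda>s. \<pi> (\<gamma> i s)) s)" for i
    proof -
      have [measurable]: "(\<lambda>s. f (\<gamma> i s) * lderiv (\<lambda>s. \<pi> (\<gamma> i s)) s) \<in> borel_measurable borel"
        by (rule cur_term_measurable[OF bLip_measurable[OF f] \<pi>])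
      have "AE s in lborel. s \<noteq> 0 \<and> s \<noteq> \<l> i" by (intro AE_conjI AE_lborel_singleton)
      then have ae: "AE s in lborel. indicator {0<..<\<l> i} s *\<^sub>R (real_of_int (m i) * f (\<gamma> i s) *
          vector_derivative (\<lambda>t. \<pi> (\<gamma> i t)) (at s within {0<..<\<l> i})) =
          ?c i * (indicator {0..\<l> i} s *\<^sub>R (f (\<gamma> i s) * lderiv (\<lambda>s. \<pi> (\<gamma> i s)) s))"
        using lderiv_AE[OF Lip_along[OF \<pi>, of i]]
      proof eventually_elim
        case (elim s)
        show ?case
        proof (cases "s \<in> {0<..<\<l> i}")
          case True
          then have w: "at s within {0<..<\<l> i} = at s" by (intro at_within_open) auto
          have "vector_derivative (\<lambda>t. \<pi> (\<gamma> i t)) (at s) = lderiv (\<lambda>s. \<pi> (\<gamma> i s)) s"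
            by (rule vector_derivative_at)
               (use elim(2) in \<open>simp add: has_real_derivative_iff_has_vector_derivative\<close>)
          then show ?thesis using True w by simp
        qed (use elim(1) in auto)
      qed
      have gm: "(\<lambda>s. ?c i * (indicator {0..\<l> i} s *\<^sub>R (f (\<gamma> i s) * lderiv (\<lambda>s. \<pi> (\<gamma> i s)) s))) \<in> borel_measurable borel"
        by measurable
      show ?thesis
        unfolding set_lebesgue_integral_def edge_int_def lebesgue_AE_eq(2)[OF gm ae] by simp
    qed
    then show ?thesis using cur_sums[OF c bLip_measurable[OF f] C \<pi>] by simp
  qed
  have mm: "emeasure (mass_measure (cur ?c)) A = (\<integral>\<^sup>+x\<in>A. of_nat (\<theta> x) \<partial>hausdorff1)" if A: "A \<in> sets borel" for A
  proof -
    note A [measurable] \<theta>m [measurable]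
    have "(\<integral>\<^sup>+x\<in>A. of_nat (\<theta> x) \<partial>hausdorff1) =
        (\<Sum>i. ennreal \<bar>1\<bar> * (\<integral>\<^sup>+s. (of_nat (\<theta> (\<gamma> i s)) * indicator A (\<gamma> i s)) * indicator {0..\<l> i} s \<partial>lborel))"
      unfolding hausdorff1_eq by (rule nn_integral_wt) measurable
    also have "\<dots> = (\<Sum>i. ennreal \<bar>?c i\<bar> * emeasure lborel {s \<in> {0<..<\<l> i}. \<gamma> i s \<in> A})"
    proof (rule suminf_cong)
      fix i
      have "AE s in lborel. s \<noteq> 0 \<and> s \<noteq> \<l> i" by (intro AE_conjI AE_lborel_singleton)
      then have "AE s in lborel. (of_nat (\<theta> (\<gamma> i s)) * indicator A (\<gamma> i s)) * indicator {0..\<l> i} s =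
          ennreal \<bar>?c i\<bar> * indicator {s \<in> {0<..<\<l> i}. \<gamma> i s \<in> A} s"
      proof eventually_elim
        case (elim s)
        show ?case
        proof (cases "s \<in> {0<..<\<l> i}")
          case True
          then have "\<gamma> i s \<in> edge i" by (simp add: \<gamma>_in_edge)
          then have "\<theta> (\<gamma> i s) = nat \<bar>m i\<bar>" by (rule \<theta>e)
          then have "(of_nat (\<theta> (\<gamma> i s)) :: ennreal) = ennreal \<bar>?c i\<bar>"
            by (simp add: ennreal_of_nat_eq_real_of_nat)
          then show ?thesis using True by (simp add: indicator_def)
        qed (use elim in \<open>auto simp: indicator_def\<close>)
      qed
      then have "(\<integral>\<^sup>+s. (of_nat (\<theta> (\<gamma> i s)) * indicator A (\<gamma> i s)) * indicator {0..\<l> i} s \<partial>lborel) =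
          (\<integral>\<^sup>+s. ennreal \<bar>?c i\<bar> * indicator {s \<in> {0<..<\<l> i}. \<gamma> i s \<in> A} s \<partial>lborel)"
        by (rule nn_integral_cong_AE)
      also have "\<dots> = ennreal \<bar>?c i\<bar> * emeasure lborel {s \<in> {0<..<\<l> i}. \<gamma> i s \<in> A}"
        by (rule nn_integral_cmult_indicator) measurable
      finally show "ennreal \<bar>1\<bar> * (\<integral>\<^sup>+s. (of_nat (\<theta> (\<gamma> i s)) * indicator A (\<gamma> i s)) * indicator {0..\<l> i} s \<partial>lborel) =
          ennreal \<bar>?c i\<bar> * emeasure lborel {s \<in> {0<..<\<l> i}. \<gamma> i s \<in> A}" by simp
    qed
    finally show ?thesis by (simp add: mass_measure_cur[OF c] emeasure_wt[OF A])
  qed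
  have "is_multiplicity (cur ?c) \<theta>"
    unfolding is_multiplicity_def
  proof (intro exI[of _ "\<lambda>i. {0<..<\<l> i}"] exI[of _ \<gamma>] exI[of _ "\<lambda>i s. m i"] conjI allI ballI impI)
    show "\<exists>c>0. \<exists>L. \<forall>s\<in>{0<..<\<l> i}. \<forall>t\<in>{0<..<\<l> i}.
        c * \<bar>s - t\<bar> \<le> dist (\<gamma> i s) (\<gamma> i t) \<and> dist (\<gamma> i s) (\<gamma> i t) \<le> L * \<bar>s - t\<bar>" for i
      by (intro exI[of _ 1] conjI) (auto simp: \<gamma>_isometry)
    show "disjoint_family (\<lambda>i. \<gamma> i ` {0<..<\<l> i})" unfolding edge_image by (rule edge_disjoint_family)
    show "set_integrable lebesgue {0<..<\<l> i} (\<lambda>s. real_of_int (m i))" for i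
      unfolding set_integrable_def
      using less_imp_le[OF len0[of i]] by (intro integrable_scaleR_left integrable_real_indicator) auto
    show "\<theta> (\<gamma> i s) = nat \<bar>m i\<bar>" if "s \<in> {0<..<\<l> i}" for i s
      by (rule \<theta>e) (use that in \<open>simp add: \<gamma>_in_edge\<close>)
    show "\<theta> x = 0" if "x \<notin> (\<Union>i. \<gamma> i ` {0<..<\<l> i})" for x
      using that unfolding edge_image by (simp add: \<theta>_def vertices_def)
  qed (use sums \<theta>m mm in auto)
  then show ?thesis by blast
qed

text \<open>Two functions with these properties agree almost everywhere for the Hausdorff measure,
  so the essential supremum does not depend on the choice.\<close>

lemma multiplicity_cur:
  assumes c: "finite_coeffs (\<lambda>i. real_of_int (m i))"
  defines "\<theta> \<equiv> multiplicity (cur (\<lambda>i. real_of_int (m i)))"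
  shows "\<theta> \<in> borel \<rightarrow>\<^sub>M count_space UNIV"
    and "A \<in> sets borel \<Longrightarrow> emeasure (wt (\<lambda>i. real_of_int (m i))) A = (\<integral>\<^sup>+x\<in>A. of_nat (\<theta> x) \<partial>wt (\<lambda>_. 1))"
proof -
  have "is_multiplicity (cur (\<lambda>i. real_of_int (m i))) \<theta>"
    unfolding \<theta>_def multiplicity_def using is_multiplicity_cur[OF c] by (rule someI_ex)
  then have *: "\<theta> \<in> borel \<rightarrow>\<^sub>M count_space UNIV \<and>
     (\<forall>A\<in>sets borel. emeasure (mass_measure (cur (\<lambda>i. real_of_int (m i)))) A = (\<integral>\<^sup>+x\<in>A. of_nat (\<theta> x) \<partial>hausdorff1))"
    unfolding is_multiplicity_def by (elim exE conjE) (intro conjI)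
  then show "\<theta> \<in> borel \<rightarrow>\<^sub>M count_space UNIV" by (rule conjunct1)
  show "A \<in> sets borel \<Longrightarrow> emeasure (wt (\<lambda>i. real_of_int (m i))) A = (\<integral>\<^sup>+x\<in>A. of_nat (\<theta> x) \<partial>wt (\<lambda>_. 1))"
    using * by (simp add: mass_measure_cur[OF c] hausdorff1_eq)
qed

lemma emeasure_wt_edge: "emeasure (wt c) (edge i) = ennreal \<bar>c i\<bar> * ennreal (\<l> i)"
proof -
  have e: "{s \<in> {0<..<\<l> j}. \<gamma> j s \<in> edge i} = (if j = i then {0<..<\<l> i} else {})" for j
    by (auto simp: \<gamma>_in_edge)
  have "emeasure (wt c) (edge i) = (\<Sum>j. ennreal \<bar>c j\<bar> * emeasure lborel {s \<in> {0<..<\<l> j}. \<gamma> j s \<in> edge i})"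
    by (rule emeasure_wt) simp
  also have "\<dots> = (\<Sum>j\<in>{i}. ennreal \<bar>c j\<bar> * emeasure lborel {s \<in> {0<..<\<l> j}. \<gamma> j s \<in> edge i})"
    by (rule suminf_finite) (simp_all only: e singleton_iff if_False emeasure_empty mult_zero_right finite.intros)
  also have "\<dots> = ennreal \<bar>c i\<bar> * ennreal (\<l> i)"
    unfolding e using len0[of i] by simp
  finally show ?thesis .
qed

lemma mult_inf_ge_two:
  assumes c: "finite_coeffs (\<lambda>i. real_of_int (m i))" and i: "2 \<le> \<bar>m i\<bar>"
  shows "2 \<le> mult_inf (cur (\<lambda>i. real_of_int (m i)))"
proof (rule ccontr)
  define \<theta> where "\<theta> = multiplicity (cur (\<lambda>i. real_of_int (m i)))"
  note \<theta> = multiplicity_cur[OF c, folded \<theta>_def]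
  assume "\<not> ?thesis"
  then have lt: "esssup (wt (\<lambda>_. 1)) (\<lambda>x. of_nat (\<theta> x) :: ennreal) < 2"
    unfolding mult_inf_def hausdorff1_eq \<theta>_def[symmetric] not_le .
  have "AE x in wt (\<lambda>_. 1). (of_nat (\<theta> x) :: ennreal) * indicator (edge i) x \<le> indicator (edge i) x"
    using esssup_AE[where M="wt (\<lambda>_. 1)" and f="\<lambda>x. of_nat (\<theta> x) :: ennreal"]
  proof eventually_elim
    case (elim x)
    have "(of_nat (\<theta> x) :: ennreal) < of_nat 2" using le_less_trans[OF elim lt] by simp
    then have "\<theta> x < 2" by (simp only: of_nat_less_iff)
    then have "(of_nat (\<theta> x) :: ennreal) \<le> of_nat 1" by (intro of_nat_mono) simp
    then show ?case by (simp add: indicator_def)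
  qed
  then have "(\<integral>\<^sup>+x\<in>edge i. of_nat (\<theta> x) \<partial>wt (\<lambda>_. 1)) \<le> (\<integral>\<^sup>+x. indicator (edge i) x \<partial>wt (\<lambda>_. 1))"
    by (rule nn_integral_mono_AE)
  then have "ennreal \<bar>real_of_int (m i)\<bar> * ennreal (\<l> i) \<le> ennreal \<bar>1\<bar> * ennreal (\<l> i)"
    using \<theta>(2)[OF edge_measurable, of i] by (simp add: emeasure_wt_edge)
  then have "ennreal (\<bar>real_of_int (m i)\<bar> * \<l> i) \<le> ennreal (\<l> i)"
    using len0[of i] by (simp add: ennreal_mult)
  then have "\<bar>real_of_int (m i)\<bar> * \<l> i \<le> \<l> i"
    using len0[of i] by (simp add: ennreal_le_iff)
  moreover have "2 * \<l> i \<le> \<bar>real_of_int (m i)\<bar> * \<l> i"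
    using i len0[of i] by (intro mult_right_mono) linarith+
  ultimately show False using len0[of i] by linarith
qed

text \<open>Where the multiplicity is at least 3, on a set B, the mass is at least 3 |B|, yet by the
  coefficients at most 2 |B|; since |B| is finite it is 0.\<close>

lemma mult_inf_le_two:
  assumes c: "finite_coeffs (\<lambda>i. real_of_int (m i))" and m: "\<And>i. \<bar>m i\<bar> \<le> 2"
  shows "mult_inf (cur (\<lambda>i. real_of_int (m i))) \<le> 2"
proof -
  define \<theta> where "\<theta> = multiplicity (cur (\<lambda>i. real_of_int (m i)))"
  note \<theta> = multiplicity_cur[OF c, folded \<theta>_def]
  note \<theta>(1) [measurable]
  interpret H: finite_measure "wt (\<lambda>_. 1)" by (rule finite_measure_wt[OF finite_coeffs_one])
  define B where "B = {x. 3 \<le> \<theta> x}"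
  have B [measurable]: "B \<in> sets borel" unfolding B_def by measurable
  have "3 * emeasure (wt (\<lambda>_. 1)) B = (\<integral>\<^sup>+x. 3 * indicator B x \<partial>wt (\<lambda>_. 1))"
    by (rule nn_integral_cmult_indicator[symmetric]) simp
  also have "\<dots> \<le> (\<integral>\<^sup>+x\<in>B. of_nat (\<theta> x) \<partial>wt (\<lambda>_. 1))"
  proof (rule nn_integral_mono)
    fix x
    have "(of_nat 3 :: ennreal) \<le> of_nat (\<theta> x)" if "x \<in> B" using that by (intro of_nat_mono) (simp add: B_def)
    then show "3 * indicator B x \<le> (of_nat (\<theta> x) :: ennreal) * indicator B x" by (simp add: indicator_def)
  qed
  also have "\<dots> = emeasure (wt (\<lambda>i. real_of_int (m i))) B" by (rule \<theta>(2)[OF B, symmetric])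
  also have "\<dots> = (\<Sum>i. ennreal \<bar>real_of_int (m i)\<bar> * emeasure lborel {s \<in> {0<..<\<l> i}. \<gamma> i s \<in> B})"
    by (rule emeasure_wt[OF B])
  also have "\<dots> \<le> (\<Sum>i. 2 * emeasure lborel {s \<in> {0<..<\<l> i}. \<gamma> i s \<in> B})"
  proof (rule suminf_le)
    fix i
    have "ennreal \<bar>real_of_int (m i)\<bar> \<le> ennreal 2" using m[of i] by (intro ennreal_leI) linarith
    then show "ennreal \<bar>real_of_int (m i)\<bar> * emeasure lborel {s \<in> {0<..<\<l> i}. \<gamma> i s \<in> B} \<le>
        2 * emeasure lborel {s \<in> {0<..<\<l> i}. \<gamma> i s \<in> B}"
      by (intro mult_right_mono) auto
  qed auto
  also have "\<dots> = 2 * emeasure (wt (\<lambda>_. 1)) B"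
    by (simp add: emeasure_wt[OF B] ennreal_suminf_cmult)
  finally have "3 * emeasure (wt (\<lambda>_. 1)) B \<le> 2 * emeasure (wt (\<lambda>_. 1)) B" .
  then have "ennreal (3 * measure (wt (\<lambda>_. 1)) B) \<le> ennreal (2 * measure (wt (\<lambda>_. 1)) B)"
    by (simp add: H.emeasure_eq_measure ennreal_mult)
  then have "measure (wt (\<lambda>_. 1)) B \<le> 0"
    by (subst (asm) ennreal_le_iff) auto
  then have "emeasure (wt (\<lambda>_. 1)) B = 0"
    by (simp add: H.emeasure_eq_measure ennreal_eq_0_iff)
  then have "AE x in wt (\<lambda>_. 1). x \<notin> B" by (intro AE_not_in) auto
  then have "AE x in wt (\<lambda>_. 1). (of_nat (\<theta> x) :: ennreal) \<le> 2"
  proof eventually_elim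
    case (elim x)
    then have "(of_nat (\<theta> x) :: ennreal) \<le> of_nat 2" by (intro of_nat_mono) (simp add: B_def)
    then show ?case by simp
  qed
  then have "esssup (wt (\<lambda>_. 1)) (\<lambda>x. of_nat (\<theta> x) :: ennreal) \<le> 2"
    by (intro esssup_I) measurable
  then show ?thesis unfolding mult_inf_def hausdorff1_eq \<theta>_def[symmetric] .
qed

end

section \<open>Integer rectifiability on a network of edges\<close>

text \<open>Degree of a path from u to v on the line, that is, the density of the push-forward of
  its current. A backward path gets the sign -1, and for u = v the two terms cancel.\<close>

definition sg :: "real \<Rightarrow> real \<Rightarrow> real \<Rightarrow> int" where
  "sg u v y = (if u \<le> y \<and> y \<le> v then 1 else 0) - (if v \<le> y \<and> y \<le> u then 1 else 0)"

lemma sg_real: "real_of_int (sg u v y) = indicator {u..v} y - indicator {v..u} y"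
  by (simp add: sg_def indicator_def)

lemma sg_measurable [measurable]: "(\<lambda>y. real_of_int (sg u v y)) \<in> borel_measurable borel"
  unfolding sg_real by measurable

lemma integrable_sg: "integrable lborel (\<lambda>y. real_of_int (sg u v y))"
  unfolding sg_real by (intro Bochner_Integration.integrable_diff integrable_real_indicator) (auto simp: emeasure_lborel_Icc_eq)

lemma integral_abs_sg: "(\<integral>y. \<bar>real_of_int (sg u v y)\<bar> \<partial>lborel) = \<bar>v - u\<bar>"
proof (cases "u \<le> v")
  case True
  have "AE y in lborel. y \<noteq> u" by (rule AE_lborel_singleton)
  then have "AE y in lborel. \<bar>real_of_int (sg u v y)\<bar> = indicator {u..v} y"
    by eventually_elim (use True in \<open>auto simp: sg_def\<close>)
  then have "(\<integral>y. \<bar>real_of_int (sg u v y)\<bar> \<partial>lborel) = (\<integral>y. indicator {u..v} y \<partial>lborel)"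
    by (intro integral_cong_AE) auto
  then show ?thesis using True by simp
next
  case False
  have "\<bar>real_of_int (sg u v y)\<bar> = indicator {v..u} y" for y
    using False by (auto simp: sg_def)
  then have "(\<integral>y. \<bar>real_of_int (sg u v y)\<bar> \<partial>lborel) = (\<integral>y. indicator {v..u} y \<partial>lborel)" by simp
  then show ?thesis using False by simp
qed

lemma integral_sg_mult:
  assumes "w \<in> borel_measurable borel" "\<And>y. \<bar>w y\<bar> \<le> C"
  shows "(\<integral>y. real_of_int (sg u v y) * w y \<partial>lborel) = (LINT y:{u..v}|lborel. w y) - (LINT y:{v..u}|lborel. w y)"
proof -
  have i: "integrable lborel (\<lambda>y. indicator {a..b} y *\<^sub>R w y)" for a b
    using bounded_set_integrable[OF assms(1), of a b C] assms(2) by (simp add: set_integrable_def)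
  show ?thesis
    unfolding sg_real set_lebesgue_integral_def
    by (subst Bochner_Integration.integral_diff[OF i i, symmetric]) (simp add: left_diff_distrib)
qed

text \<open>Summable L^1 norms make the series absolutely convergent almost everywhere; integer
  terms that tend to 0 vanish eventually, so the sum is an integer there.\<close>

lemma integer_series_density:
  fixes G :: "nat \<Rightarrow> real \<Rightarrow> int"
  assumes G: "\<And>k. integrable lborel (\<lambda>y. real_of_int (G k y))"
    and sm: "summable (\<lambda>k. \<integral>y. \<bar>real_of_int (G k y)\<bar> \<partial>lborel)"
  shows "\<exists>\<theta>::real \<Rightarrow> int. integrable lborel (\<lambda>y. real_of_int (\<theta> y)) \<and>
    (\<integral>y. \<bar>real_of_int (\<theta> y)\<bar> \<partial>lborel) \<le> (\<Sum>k. \<integral>y. \<bar>real_of_int (G k y)\<bar> \<partial>lborel) \<and>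
    (\<forall>q C. q \<in> borel_measurable borel \<longrightarrow> (\<forall>y. \<bar>q y\<bar> \<le> C) \<longrightarrow>
      (\<lambda>k. \<integral>y. real_of_int (G k y) * q y \<partial>lborel) sums (\<integral>y. real_of_int (\<theta> y) * q y \<partial>lborel))"
proof -
  define F where "F k y = real_of_int (G k y)" for k y
  have F: "integrable lborel (F k)" for k using G[of k] by (simp add: F_def[abs_def])
  have [measurable]: "F k \<in> borel_measurable borel" for k using F[of k] by auto
  have smF: "summable (\<lambda>k. \<integral>y. \<bar>F k y\<bar> \<partial>lborel)" using sm by (simp add: F_def)
  have "(\<integral>\<^sup>+y. (\<Sum>k. ennreal \<bar>F k y\<bar>) \<partial>lborel) = (\<Sum>k. \<integral>\<^sup>+y. ennreal \<bar>F k y\<bar> \<partial>lborel)"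
    by (rule nn_integral_suminf) measurable
  also have "\<dots> = (\<Sum>k. ennreal (\<integral>y. \<bar>F k y\<bar> \<partial>lborel))"
    using F by (simp add: nn_integral_eq_integral)
  also have "\<dots> = ennreal (\<Sum>k. \<integral>y. \<bar>F k y\<bar> \<partial>lborel)"
    using smF by (intro suminf_ennreal_eq) (auto intro: summable_sums)
  finally have "(\<integral>\<^sup>+y. (\<Sum>k. ennreal \<bar>F k y\<bar>) \<partial>lborel) \<noteq> \<infinity>" by simp
  then have "AE y in lborel. (\<Sum>k. ennreal \<bar>F k y\<bar>) \<noteq> \<infinity>"
    by (intro nn_integral_noteq_infinite) measurable
  then have ae: "AE y in lborel. summable (\<lambda>k. \<bar>F k y\<bar>)"
  proof eventually_elim
    case (elim y)
    show ?case by (rule summable_suminf_not_top) (use elim in simp_all)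
  qed
  \<comment> \<open>The floor yields an integer at the exceptional points too and changes nothing
    elsewhere.\<close>
  define \<theta> where "\<theta> y = \<lfloor>\<Sum>k. F k y\<rfloor>" for y
  have \<theta>m [measurable]: "(\<lambda>y. real_of_int (\<theta> y)) \<in> borel_measurable borel"
    unfolding \<theta>_def by measurable
  have \<theta>eq: "real_of_int (\<theta> y) = (\<Sum>k. F k y)" if s: "summable (\<lambda>k. \<bar>F k y\<bar>)" for y
  proof -
    have "(\<lambda>k. \<bar>F k y\<bar>) \<longlonglongrightarrow> 0" using s by (rule summable_LIMSEQ_zero)
    then have "\<forall>\<^sub>F k in sequentially. \<bar>F k y\<bar> < 1" by (rule order_tendstoD) simp
    then obtain K where K: "\<And>k. K \<le> k \<Longrightarrow> \<bar>F k y\<bar> < 1" unfolding eventually_sequentially by blast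
    have z: "F k y = 0" if "k \<notin> {..<K}" for k
    proof -
      have "\<bar>real_of_int (G k y)\<bar> < 1" using K[of k] that by (simp add: F_def)
      then have "G k y = 0" by linarith
      then show ?thesis by (simp add: F_def)
    qed
    have "(\<Sum>k. F k y) = (\<Sum>k<K. F k y)" by (rule suminf_finite[OF _ z]) simp
    also have "\<dots> = real_of_int (\<Sum>k<K. G k y)" by (simp add: F_def)
    finally have e: "(\<Sum>k. F k y) = real_of_int (\<Sum>k<K. G k y)" .
    show ?thesis unfolding \<theta>_def e floor_of_int ..
  qed
  have ae\<theta>: "AE y in lborel. (\<Sum>k. F k y) = real_of_int (\<theta> y)"
    using ae by eventually_elim (rule \<theta>eq[symmetric])
  have int_sum: "integrable lborel (\<lambda>y. \<Sum>k. F k y)"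
    by (rule integrable_suminf[OF F]) (use ae smF in simp_all)
  have \<theta>i: "integrable lborel (\<lambda>y. real_of_int (\<theta> y))"
    using int_sum ae\<theta> by (subst integrable_cong_AE[symmetric]) auto
  have absF: "integrable lborel (\<lambda>y. \<bar>F k y\<bar>)" for k using F by simp
  have int_abs: "integrable lborel (\<lambda>y. \<Sum>k. \<bar>F k y\<bar>)"
    by (rule integrable_suminf[OF absF]) (use ae smF in simp_all)
  have "(\<integral>y. \<bar>real_of_int (\<theta> y)\<bar> \<partial>lborel) \<le> (\<integral>y. (\<Sum>k. \<bar>F k y\<bar>) \<partial>lborel)"
  proof (rule integral_mono_AE)
    show "AE y in lborel. \<bar>real_of_int (\<theta> y)\<bar> \<le> (\<Sum>k. \<bar>F k y\<bar>)"
      using ae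
    proof eventually_elim
      case (elim y)
      show ?case unfolding \<theta>eq[OF elim] by (rule summable_rabs[OF elim])
    qed
  qed (use \<theta>i int_abs in auto)
  also have "\<dots> = (\<Sum>k. \<integral>y. \<bar>F k y\<bar> \<partial>lborel)"
    by (rule integral_suminf[OF absF]) (use ae smF in simp_all)
  finally have bound: "(\<integral>y. \<bar>real_of_int (\<theta> y)\<bar> \<partial>lborel) \<le> (\<Sum>k. \<integral>y. \<bar>real_of_int (G k y)\<bar> \<partial>lborel)"
    by (simp add: F_def)
  have sums: "(\<lambda>k. \<integral>y. real_of_int (G k y) * q y \<partial>lborel) sums (\<integral>y. real_of_int (\<theta> y) * q y \<partial>lborel)"
    if q [measurable]: "q \<in> borel_measurable borel" and C: "\<forall>y. \<bar>q y\<bar> \<le> C" for q :: "real \<Rightarrow> real" and C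
  proof -
    have C0: "0 \<le> C" using C[rule_format, of 0] by linarith
    have Fq: "integrable lborel (\<lambda>y. F k y * q y)" for k
    proof (rule Bochner_Integration.integrable_bound)
      show "integrable lborel (\<lambda>y. C * \<bar>F k y\<bar>)" using absF by simp
      show "AE y in lborel. norm (F k y * q y) \<le> norm (C * \<bar>F k y\<bar>)"
      proof (rule AE_I2)
        fix y
        have "\<bar>F k y\<bar> * \<bar>q y\<bar> \<le> \<bar>F k y\<bar> * C" by (rule mult_left_mono[OF C[rule_format] abs_ge_zero])
        then show "norm (F k y * q y) \<le> norm (C * \<bar>F k y\<bar>)" using C0 by (simp add: abs_mult mult.commute)
      qed
    qed measurable
    have aeq: "AE y in lborel. summable (\<lambda>k. norm (F k y * q y))"
      using ae
    proof eventually_elim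
      case (elim y)
      have "summable (\<lambda>k. \<bar>F k y\<bar> * \<bar>q y\<bar>)" by (rule summable_mult2[OF elim])
      then show ?case by (simp add: abs_mult)
    qed
    have smq: "summable (\<lambda>k. \<integral>y. norm (F k y * q y) \<partial>lborel)"
    proof (rule summable_comparison_test'[of "\<lambda>k. C * (\<integral>y. \<bar>F k y\<bar> \<partial>lborel)" 0])
      show "summable (\<lambda>k. C * (\<integral>y. \<bar>F k y\<bar> \<partial>lborel))" by (rule summable_mult[OF smF])
      fix k
      have "(\<integral>y. norm (F k y * q y) \<partial>lborel) \<le> (\<integral>y. C * \<bar>F k y\<bar> \<partial>lborel)"
      proof (rule integral_mono)
        fix y
        have "\<bar>F k y\<bar> * \<bar>q y\<bar> \<le> \<bar>F k y\<bar> * C" by (rule mult_left_mono[OF C[rule_format] abs_ge_zero])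
        then show "norm (F k y * q y) \<le> C * \<bar>F k y\<bar>" by (simp add: abs_mult mult.commute)
      qed (use Fq absF in auto)
      then show "norm (\<integral>y. norm (F k y * q y) \<partial>lborel) \<le> C * (\<integral>y. \<bar>F k y\<bar> \<partial>lborel)" by simp
    qed
    have "(\<lambda>k. \<integral>y. F k y * q y \<partial>lborel) sums (\<integral>y. (\<Sum>k. F k y * q y) \<partial>lborel)"
      by (rule sums_integral[OF Fq aeq smq])
    also have "(\<integral>y. (\<Sum>k. F k y * q y) \<partial>lborel) = (\<integral>y. real_of_int (\<theta> y) * q y \<partial>lborel)"
    proof (rule integral_cong_AE)
      show "AE y in lborel. (\<Sum>k. F k y * q y) = real_of_int (\<theta> y) * q y"
        using ae
      proof eventually_elim
        case (elim y)
        show ?case unfolding \<theta>eq[OF elim] by (rule suminf_mult2[OF summable_rabs_cancel[OF elim], symmetric])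
      qed
    qed measurable
    finally show ?thesis by (simp add: F_def)
  qed
  show ?thesis
  proof (intro exI[of _ \<theta>] conjI allI impI)
    show "integrable lborel (\<lambda>y. real_of_int (\<theta> y))" by (rule \<theta>i)
  next
    show "(\<integral>y. \<bar>real_of_int (\<theta> y)\<bar> \<partial>lborel) \<le> (\<Sum>k. \<integral>y. \<bar>real_of_int (G k y)\<bar> \<partial>lborel)" by (rule bound)
  next
    fix q :: "real \<Rightarrow> real" and C assume "q \<in> borel_measurable borel" "\<forall>y. \<bar>q y\<bar> \<le> C"
    then show "(\<lambda>k. \<integral>y. real_of_int (G k y) * q y \<partial>lborel) sums (\<integral>y. real_of_int (\<theta> y) * q y \<partial>lborel)"
      by (rule sums)
  qed
qed

text \<open>For \<open>\<pi>\<close> of class \<open>C\<^sup>1\<^sup>,\<^sup>1\<close> both sides are increments of a primitive of \<open>f \<pi>'\<close>; the general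
  case follows by approximation.\<close>

lemma change_of_variables:
  fixes h \<pi> f :: "real \<Rightarrow> real"
  assumes h: "h \<in> Lip_fun" and \<pi>: "\<pi> \<in> Lip_fun" and f: "f \<in> bLip_fun" and ab: "a \<le> b"
  shows "(LINT s:{a..b}|lborel. f (h s) * lderiv (\<lambda>s. \<pi> (h s)) s) =
    (\<integral>y. real_of_int (sg (h a) (h b) y) * (f y * lderiv \<pi> y) \<partial>lborel)"
proof -
  obtain L where L: "0 \<le> L" "L-lipschitz_on UNIV \<pi>" using \<pi> by (rule Lip_fun_obtain)
  obtain H where H: "0 \<le> H" "H-lipschitz_on UNIV h" using h by (rule Lip_fun_obtain)
  obtain C where C: "0 \<le> C" "\<And>x. \<bar>f x\<bar> \<le> C" using bLip_fun_bounded[OF f] by blast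
  obtain P P' where P: "\<And>k. L-lipschitz_on UNIV (P k)" "\<And>k x. (P k has_real_derivative P' k x) (at x)"
    "\<And>k. P' k \<in> Lip_fun" "\<And>x. (\<lambda>k. P k x) \<longlonglongrightarrow> \<pi> x"
    "AE x in lborel. (\<lambda>k. P' k x) \<longlonglongrightarrow> lderiv \<pi> x" "\<And>k x. \<bar>P' k x\<bar> \<le> L"
    using lipschitz_C11_approximation[OF L(2)] by blast
  have fm [measurable]: "f \<in> borel_measurable borel" by (rule bLip_measurable[OF f])
  have P'm [measurable]: "P' k \<in> borel_measurable borel" for k by (rule Lip_fun_measurable[OF P(3)])
  have \<pi>m [measurable]: "lderiv \<pi> \<in> borel_measurable borel" by (rule lderiv_measurable[OF \<pi>])
  have fh: "(\<lambda>s. f (h s)) \<in> Lip_fun" by (rule Lip_fun_compose[OF bLip_Lip[OF f] h])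
  have fhm [measurable]: "(\<lambda>s. f (h s)) \<in> borel_measurable borel" by (rule Lip_fun_measurable[OF fh])
  have PhL: "(L * H)-lipschitz_on UNIV (\<lambda>s. P k (h s))" for k
  proof -
    have "(L * H)-lipschitz_on UNIV (P k \<circ> h)"
      by (rule lipschitz_on_compose[OF H(2)]) (rule lipschitz_on_subset[OF P(1)], simp)
    then show ?thesis by (simp add: o_def)
  qed
  have step: "(LINT s:{a..b}|lborel. f (h s) * lderiv (\<lambda>s. P k (h s)) s) =
    (\<integral>y. real_of_int (sg (h a) (h b) y) * (f y * P' k y) \<partial>lborel)" for k
  proof -
    define w where "w y = f y * P' k y" for y
    have wb: "\<bar>w y\<bar> \<le> C * L" for y
      unfolding w_def abs_mult using C P(6)[of k y] by (intro mult_mono) auto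
    have wL: "w \<in> Lip_fun"
      unfolding w_def
    proof (rule Lip_fun_mult[OF bLip_Lip[OF f] P(3)])
      show "bounded (range f)" "bounded (range (P' k))" using C(2) P(6)[of k] unfolding bounded_iff by auto
    qed
    have wm [measurable]: "w \<in> borel_measurable borel" by (rule Lip_fun_measurable[OF wL])
    obtain G where G: "\<And>x. (G has_real_derivative w x) (at x)"
      using continuous_antiderivative[OF Lip_fun_continuous[OF wL]] by blast
    have GL: "G \<in> Lip_fun" by (rule Lip_fun_of_derivative[OF G wb])
    have Gh: "(\<lambda>s. G (h s)) \<in> Lip_fun" by (rule Lip_fun_compose[OF GL h])
    have "AE s in lborel. f (h s) * lderiv (\<lambda>s. P k (h s)) s = lderiv (\<lambda>s. G (h s)) s"
      using lderiv_AE[OF h] lderiv_AE[OF Lip_funI[OF PhL[of k]]] lderiv_AE[OF Gh]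
    proof eventually_elim
      case (elim s)
      have 1: "((\<lambda>s. P k (h s)) has_real_derivative P' k (h s) * lderiv h s) (at s)"
        by (rule DERIV_chain2[OF P(2) elim(1)])
      have 2: "((\<lambda>s. G (h s)) has_real_derivative w (h s) * lderiv h s) (at s)"
        by (rule DERIV_chain2[OF G elim(1)])
      have "lderiv (\<lambda>s. P k (h s)) s = P' k (h s) * lderiv h s" by (rule DERIV_unique[OF elim(2) 1])
      moreover have "lderiv (\<lambda>s. G (h s)) s = w (h s) * lderiv h s" by (rule DERIV_unique[OF elim(3) 2])
      ultimately show ?case by (simp add: w_def)
    qed
    then have "AE s in lborel. indicator {a..b} s *\<^sub>R (f (h s) * lderiv (\<lambda>s. P k (h s)) s) = indicator {a..b} s *\<^sub>R lderiv (\<lambda>s. G (h s)) s"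
      by eventually_elim simp
    moreover have [measurable]: "lderiv (\<lambda>s. P k (h s)) \<in> borel_measurable borel" "lderiv (\<lambda>s. G (h s)) \<in> borel_measurable borel"
      by (rule lderiv_measurable[OF Lip_funI[OF PhL]], rule lderiv_measurable[OF Gh])
    ultimately have "(LINT s:{a..b}|lborel. f (h s) * lderiv (\<lambda>s. P k (h s)) s) = (LINT s:{a..b}|lborel. lderiv (\<lambda>s. G (h s)) s)"
      unfolding set_lebesgue_integral_def by (intro integral_cong_AE) measurable
    also have "\<dots> = G (h b) - G (h a)" by (rule lderiv_FTC[OF Gh ab])
    finally have lhs: "(LINT s:{a..b}|lborel. f (h s) * lderiv (\<lambda>s. P k (h s)) s) = G (h b) - G (h a)" .
    have ft: "(LINT y:{u..v}|lborel. w y) = G v - G u" if "u \<le> v" for u v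
    proof -
      have "AE y in lborel. y \<in> UNIV \<longrightarrow> lderiv G y = w y" by (rule lderiv_eq[OF GL G])
      then have "AE y in lborel. indicator {u..v} y *\<^sub>R w y = indicator {u..v} y *\<^sub>R lderiv G y"
        by eventually_elim simp
      moreover have [measurable]: "lderiv G \<in> borel_measurable borel" by (rule lderiv_measurable[OF GL])
      ultimately have "(LINT y:{u..v}|lborel. w y) = (LINT y:{u..v}|lborel. lderiv G y)"
        unfolding set_lebesgue_integral_def by (intro integral_cong_AE) measurable
      then show ?thesis using lderiv_FTC[OF GL that] by simp
    qed
    have "(\<integral>y. real_of_int (sg (h a) (h b) y) * w y \<partial>lborel) = (LINT y:{h a..h b}|lborel. w y) - (LINT y:{h b..h a}|lborel. w y)"
      by (rule integral_sg_mult[OF wm wb])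
    also have "\<dots> = G (h b) - G (h a)"
    proof (cases "h a < h b")
      case True
      then have "{h b..h a} = {}" by simp
      then show ?thesis using ft[of "h a" "h b"] True by (simp add: set_lebesgue_integral_def)
    next
      case False
      show ?thesis
      proof (cases "h a = h b")
        case True
        then show ?thesis by simp
      next
        case ne: False
        then have "{h a..h b} = {}" using False by simp
        then show ?thesis using ft[of "h b" "h a"] False by (simp add: set_lebesgue_integral_def)
      qed
    qed
    finally show ?thesis unfolding lhs w_def by simp
  qed
  have \<pi>h: "(\<lambda>s. \<pi> (h s)) \<in> Lip_fun" by (rule Lip_fun_compose[OF \<pi> h])
  have "(\<lambda>k. LINT s:{a..b}|lborel. f (h s) * lderiv (\<lambda>s. P k (h s)) s) \<longlonglongrightarrow>
      (LINT s:{a..b}|lborel. f (h s) * lderiv (\<lambda>s. \<pi> (h s)) s)"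
    by (rule lderiv_weak_limit[OF PhL P(4) \<pi>h fh ab])
  then have l1: "(\<lambda>k. \<integral>y. real_of_int (sg (h a) (h b) y) * (f y * P' k y) \<partial>lborel) \<longlonglongrightarrow>
      (LINT s:{a..b}|lborel. f (h s) * lderiv (\<lambda>s. \<pi> (h s)) s)"
    unfolding step .
  have "(\<lambda>k. \<integral>y. real_of_int (sg (h a) (h b) y) * (f y * P' k y) \<partial>lborel) \<longlonglongrightarrow>
      (\<integral>y. real_of_int (sg (h a) (h b) y) * (f y * lderiv \<pi> y) \<partial>lborel)"
  proof (rule integral_dominated_convergence[where w="\<lambda>y. \<bar>real_of_int (sg (h a) (h b) y)\<bar> * (C * L)"])
    show "integrable lborel (\<lambda>y. \<bar>real_of_int (sg (h a) (h b) y)\<bar> * (C * L))"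
      by (rule integrable_mult_left[OF integrable_abs[OF integrable_sg]])
    show "AE y in lborel. (\<lambda>k. real_of_int (sg (h a) (h b) y) * (f y * P' k y)) \<longlonglongrightarrow>
        real_of_int (sg (h a) (h b) y) * (f y * lderiv \<pi> y)"
      using P(5) by eventually_elim (intro tendsto_mult tendsto_const)
    show "AE y in lborel. norm (real_of_int (sg (h a) (h b) y) * (f y * P' k y)) \<le> \<bar>real_of_int (sg (h a) (h b) y)\<bar> * (C * L)" for k
    proof (rule AE_I2)
      fix y
      have "\<bar>f y\<bar> * \<bar>P' k y\<bar> \<le> C * L" using C P(6)[of k y] by (intro mult_mono) auto
      then show "norm (real_of_int (sg (h a) (h b) y) * (f y * P' k y)) \<le> \<bar>real_of_int (sg (h a) (h b) y)\<bar> * (C * L)"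
        unfolding real_norm_def abs_mult by (rule mult_left_mono[OF _ abs_ge_zero])
    qed
  qed measurable
  then show ?thesis by (rule LIMSEQ_unique[OF l1])
qed

text \<open>Up to countably many points W is a disjoint union of open intervals. On each, change of
  variables gives the density \<open>sg\<close>, and the integer series adds them up. The bound L l
  on the L^1 norm lets a further summation, over the edges, converge.\<close>

lemma open_set_density:
  fixes h :: "real \<Rightarrow> real"
  assumes h: "L-lipschitz_on UNIV h" and W: "open W" "W \<subseteq> {0..l}" "0 < l"
  shows "\<exists>\<theta>::real \<Rightarrow> int. integrable lborel (\<lambda>y. real_of_int (\<theta> y)) \<and>
    (\<integral>y. \<bar>real_of_int (\<theta> y)\<bar> \<partial>lborel) \<le> L * l \<and>
    (\<forall>f\<in>bLip_fun. \<forall>\<pi>\<in>Lip_fun. (LINT s:W|lborel. f (h s) * lderiv (\<lambda>s. \<pi> (h s)) s) =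
      (\<integral>y. real_of_int (\<theta> y) * (f y * lderiv \<pi> y) \<partial>lborel))"
proof -
  have L0: "0 \<le> L" by (rule lipschitz_on_nonneg[OF h])
  obtain u v :: "nat \<Rightarrow> real" where uv: "\<forall>n. u n \<le> v n \<and> v n - u n \<le> 1 \<and> (u n < v n \<longrightarrow> {u n..v n} \<subseteq> W)"
    and dj: "disjoint_family (\<lambda>n. {u n<..<v n})" and cov: "W \<subseteq> (\<Union>n. {u n..v n})"
    using real_interval_cover[OF W(2,3,1) order_refl zero_less_one] by (elim exE conjE) (rule that)
  have uv1: "u n \<le> v n" for n using uv by blast
  have uv2: "{u n..v n} \<subseteq> W" if "u n < v n" for n using uv that by blast
  have "(\<Sum>n. ennreal (v n - u n)) \<le> emeasure lborel W"
    by (rule emeasure_disjoint_intervals[OF uv1 dj uv2 W(1)])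
  also have "\<dots> \<le> emeasure lborel {0..l}" using W by (intro emeasure_mono) auto
  also have "\<dots> = ennreal l" using W(3) by simp
  finally have len: "(\<Sum>n. ennreal (v n - u n)) \<le> ennreal l" .
  have nn: "0 \<le> v n - u n" for n using uv1[of n] by simp
  have "(\<Sum>n. ennreal (v n - u n)) \<noteq> top" using len by (auto simp: top_unique)
  then have sl: "summable (\<lambda>n. v n - u n)" by (rule summable_suminf_not_top[OF nn])
  have "ennreal (\<Sum>n. v n - u n) \<le> ennreal l"
    using len suminf_ennreal_eq[OF nn summable_sums[OF sl]] by simp
  then have sle: "(\<Sum>n. v n - u n) \<le> l" using W(3) by (simp add: ennreal_le_iff)
  define G where "G n = sg (h (u n)) (h (v n))" for n
  have Gi: "integrable lborel (\<lambda>y. real_of_int (G n y))" for n unfolding G_def by (rule integrable_sg)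
  have Gn: "(\<integral>y. \<bar>real_of_int (G n y)\<bar> \<partial>lborel) \<le> L * (v n - u n)" for n
    unfolding G_def integral_abs_sg using lipschitz_real_abs[OF h, of "v n" "u n"] uv1[of n] by simp
  have Gs: "summable (\<lambda>n. \<integral>y. \<bar>real_of_int (G n y)\<bar> \<partial>lborel)"
    by (rule summable_comparison_test'[OF summable_mult[OF sl, of L], of 0]) (use Gn in simp)
  obtain \<theta> :: "real \<Rightarrow> int" where \<theta>: "integrable lborel (\<lambda>y. real_of_int (\<theta> y))"
    "(\<integral>y. \<bar>real_of_int (\<theta> y)\<bar> \<partial>lborel) \<le> (\<Sum>k. \<integral>y. \<bar>real_of_int (G k y)\<bar> \<partial>lborel)"
    and \<theta>s: "\<forall>q C. q \<in> borel_measurable borel \<longrightarrow> (\<forall>y. \<bar>q y\<bar> \<le> C) \<longrightarrow>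
      (\<lambda>k. \<integral>y. real_of_int (G k y) * q y \<partial>lborel) sums (\<integral>y. real_of_int (\<theta> y) * q y \<partial>lborel)"
    using integer_series_density[OF Gi Gs] by (elim exE conjE) (rule that)
  have "(\<Sum>k. \<integral>y. \<bar>real_of_int (G k y)\<bar> \<partial>lborel) \<le> (\<Sum>k. L * (v k - u k))"
    by (rule suminf_le[OF Gn Gs summable_mult[OF sl]])
  also have "\<dots> = L * (\<Sum>k. v k - u k)" by (rule suminf_mult[OF sl])
  also have "\<dots> \<le> L * l" by (rule mult_left_mono[OF sle L0])
  finally have b: "(\<integral>y. \<bar>real_of_int (\<theta> y)\<bar> \<partial>lborel) \<le> L * l" using \<theta>(2) by linarith
  have main: "(LINT s:W|lborel. f (h s) * lderiv (\<lambda>s. \<pi> (h s)) s) = (\<integral>y. real_of_int (\<theta> y) * (f y * lderiv \<pi> y) \<partial>lborel)"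
    if f: "f \<in> bLip_fun" and \<pi>: "\<pi> \<in> Lip_fun" for f \<pi>
  proof -
    have hL: "h \<in> Lip_fun" by (rule Lip_funI[OF h])
    have \<pi>h: "(\<lambda>s. \<pi> (h s)) \<in> Lip_fun" by (rule Lip_fun_compose[OF \<pi> hL])
    have fh: "(\<lambda>s. f (h s)) \<in> Lip_fun" by (rule Lip_fun_compose[OF bLip_Lip[OF f] hL])
    obtain C where C: "0 \<le> C" "\<And>x. \<bar>f x\<bar> \<le> C" using bLip_fun_bounded[OF f] by blast
    obtain M where M: "0 \<le> M" "M-lipschitz_on UNIV \<pi>" using \<pi> by (rule Lip_fun_obtain)
    define w where "w s = f (h s) * lderiv (\<lambda>s. \<pi> (h s)) s" for s
    have wm [measurable]: "w \<in> borel_measurable borel"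
      unfolding w_def using Lip_fun_measurable[OF fh] lderiv_measurable[OF \<pi>h] by (rule borel_measurable_times)
    have wi: "set_integrable lborel {0..l} w"
      unfolding w_def by (rule lderiv_set_integrable[OF \<pi>h Lip_fun_measurable[OF fh] C(2)])
    define V where "V = (\<Union>n. {u n<..<v n})"
    have VW: "V \<subseteq> W"
    proof
      fix x assume "x \<in> V"
      then obtain n where "u n < x" "x < v n" by (auto simp: V_def)
      then show "x \<in> W" using uv2[of n] by auto
    qed
    have Vb [measurable]: "V \<in> sets borel" unfolding V_def by (intro borel_open open_UN) auto
    have Wb [measurable]: "W \<in> sets borel" using W(1) by (rule borel_open)
    \<comment> \<open>The covering intervals are closed and may touch; dropping their ends is a null
      change that makes them disjoint.\<close>
    have "AE x in lborel. x \<notin> (range u \<union> range v)"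
    proof (rule AE_not_in)
      have "countable (range u \<union> range v)" by simp
      then show "range u \<union> range v \<in> null_sets lborel" by (rule countable_imp_null_set_lborel)
    qed
    then have "AE x in lborel. indicator W x *\<^sub>R w x = indicator V x *\<^sub>R w x"
    proof eventually_elim
      case (elim x)
      have "x \<in> W \<longleftrightarrow> x \<in> V"
      proof
        assume "x \<in> W"
        then obtain n where "x \<in> {u n..v n}" using cov by blast
        moreover have "x \<noteq> u n" "x \<noteq> v n" using elim by auto
        ultimately show "x \<in> V" unfolding V_def by (intro UN_I[of n]) auto
      qed (use VW in blast)
      then show ?case by (simp add: indicator_def)
    qed
    then have "(LINT s:W|lborel. w s) = (LINT s:V|lborel. w s)"
      unfolding set_lebesgue_integral_def by (intro integral_cong_AE) measurable
    also have "\<dots> = (\<Sum>n. LINT s:{u n<..<v n}|lborel. w s)"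
      unfolding V_def
    proof (rule lebesgue_integral_countable_add)
      show "{u i<..<v i} \<inter> {u j<..<v j} = {}" if "i \<noteq> j" for i j
        using dj that by (simp add: disjoint_family_on_def)
      show "set_integrable lborel (\<Union>i. {u i<..<v i}) w"
        by (rule set_integrable_subset[OF wi]) (use VW W(2) in \<open>auto simp: V_def[symmetric]\<close>)
    qed simp
    also have "(\<lambda>n. LINT s:{u n<..<v n}|lborel. w s) = (\<lambda>n. \<integral>y. real_of_int (G n y) * (f y * lderiv \<pi> y) \<partial>lborel)"
    proof
      fix n
      have "AE s in lborel. s \<noteq> u n \<and> s \<noteq> v n" by (intro AE_conjI AE_lborel_singleton)
      then have "AE s in lborel. indicator {u n<..<v n} s *\<^sub>R w s = indicator {u n..v n} s *\<^sub>R w s"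
        by eventually_elim (auto simp: indicator_def)
      then have "(LINT s:{u n<..<v n}|lborel. w s) = (LINT s:{u n..v n}|lborel. w s)"
        unfolding set_lebesgue_integral_def by (intro integral_cong_AE) measurable
      also have "\<dots> = (\<integral>y. real_of_int (G n y) * (f y * lderiv \<pi> y) \<partial>lborel)"
        unfolding w_def G_def by (rule change_of_variables[OF hL \<pi> f uv1])
      finally show "(LINT s:{u n<..<v n}|lborel. w s) = (\<integral>y. real_of_int (G n y) * (f y * lderiv \<pi> y) \<partial>lborel)" .
    qed
    also have "(\<Sum>n. \<integral>y. real_of_int (G n y) * (f y * lderiv \<pi> y) \<partial>lborel) = (\<integral>y. real_of_int (\<theta> y) * (f y * lderiv \<pi> y) \<partial>lborel)"
    proof (rule sums_unique[symmetric])
      have qm: "(\<lambda>y. f y * lderiv \<pi> y) \<in> borel_measurable borel"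
        using bLip_measurable[OF f] lderiv_measurable[OF \<pi>] by (rule borel_measurable_times)
      have qb: "\<forall>y. \<bar>f y * lderiv \<pi> y\<bar> \<le> C * M"
        unfolding abs_mult using C lderiv_bound[OF M(2)] by (intro allI mult_mono) auto
      show "(\<lambda>n. \<integral>y. real_of_int (G n y) * (f y * lderiv \<pi> y) \<partial>lborel) sums (\<integral>y. real_of_int (\<theta> y) * (f y * lderiv \<pi> y) \<partial>lborel)"
        using \<theta>s qm qb by blast
    qed
    finally show ?thesis unfolding w_def .
  qed
  show ?thesis using \<theta>(1) b main by blast
qed

lemma line_current_lderiv:
  fixes \<theta> :: "real \<Rightarrow> real"
  assumes \<theta>: "\<theta> \<in> borel_measurable borel" and f: "f \<in> borel_measurable borel" and \<pi>: "\<pi> \<in> Lip_fun"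
  shows "line_current \<theta> f \<pi> = (\<integral>y. \<theta> y * (f y * lderiv \<pi> y) \<partial>lborel)"
  unfolding line_current_def
proof (rule lebesgue_AE_eq(2))
  show "(\<lambda>y. \<theta> y * (f y * lderiv \<pi> y)) \<in> borel_measurable borel"
    using \<theta> f lderiv_measurable[OF \<pi>] by (intro borel_measurable_times)
  show "AE y in lborel. \<theta> y * f y * deriv \<pi> y = \<theta> y * (f y * lderiv \<pi> y)"
    using lderiv_AE[OF \<pi>]
  proof eventually_elim
    case (elim y)
    show ?case using DERIV_imp_deriv[OF elim] by simp
  qed
qed

section \<open>Restriction to open sets and push-forward to the line\<close>

context edge_net
begin

lemma cur_diff:
  assumes c: "finite_coeffs c" and f: "f \<in> borel_measurable borel" "\<And>x. \<bar>f x\<bar> \<le> C"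
    and g: "g \<in> borel_measurable borel" "\<And>x. \<bar>g x\<bar> \<le> D" and \<pi>: "\<pi> \<in> Lip_fun"
  shows "cur c (\<lambda>x. f x - g x) \<pi> = cur c f \<pi> - cur c g \<pi>"
proof -
  obtain L where L: "L-lipschitz_on UNIV \<pi>" using \<pi> by (auto simp: Lip_fun_def)
  let ?e = "\<lambda>f i. edge_int (\<l> i) (\<lambda>s. f (\<gamma> i s) * lderiv (\<lambda>s. \<pi> (\<gamma> i s)) s)"
  have e: "?e (\<lambda>x. f x - g x) i = ?e f i - ?e g i" for i
  proof -
    have "edge_int (\<l> i) (\<lambda>s. 1 * (f (\<gamma> i s) * lderiv (\<lambda>s. \<pi> (\<gamma> i s)) s) + (-1) * (g (\<gamma> i s) * lderiv (\<lambda>s. \<pi> (\<gamma> i s)) s)) =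
        1 * ?e f i + (-1) * ?e g i"
      by (rule edge_int_lincomb[OF cur_term_measurable[OF f(1) \<pi>] cur_term_measurable[OF g(1) \<pi>]
            cur_term_bound[where f=f, OF f(2) L] cur_term_bound[where f=g, OF g(2) L]])
    then show ?thesis by (simp add: left_diff_distrib)
  qed
  have "(\<lambda>i. c i * ?e f i - c i * ?e g i) sums (cur c f \<pi> - cur c g \<pi>)"
    by (rule sums_diff[OF cur_sums[OF c f \<pi>] cur_sums[OF c g \<pi>]])
  then show ?thesis
    unfolding cur_def[of c "\<lambda>x. f x - g x"] e right_diff_distrib by (simp only: sums_unique[symmetric])
qed

text \<open>Finite mass makes every admissible sequence converge to \<open>cur c g \<pi>\<close>.
  The sequence \<open>F0\<close> makes the description unique: with no admissible sequence every
  number would satisfy it.\<close>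

lemma borel_extension_cur:
  assumes c: "finite_coeffs c" and g: "g \<in> borel_measurable borel" "\<And>x. \<bar>g x\<bar> \<le> C"
    and F0: "\<And>n. F0 n \<in> bLip_fun" "\<And>n x. \<bar>F0 n x\<bar> \<le> C" "\<And>x. (\<lambda>n. F0 n x) \<longlonglongrightarrow> g x"
    and \<pi>: "\<pi> \<in> Lip_fun"
  shows "borel_extension (cur c) g \<pi> = cur c g \<pi>"
proof -
  interpret M: finite_measure "wt c" using c by (rule finite_measure_wt)
  obtain L where L: "0 \<le> L" "L-lipschitz_on UNIV \<pi>" using \<pi> by (rule Lip_fun_obtain)
  have nn: "(\<integral>\<^sup>+x. ennreal \<bar>f x - g x\<bar> \<partial>wt c) = ennreal (\<integral>x. \<bar>f x - g x\<bar> \<partial>wt c)"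
    if f: "f \<in> bLip_fun" for f
  proof -
    obtain D where D: "\<And>x. \<bar>f x\<bar> \<le> D" using bLip_fun_bounded[OF f] by blast
    have fm [measurable]: "f \<in> borel_measurable borel" by (rule bLip_measurable[OF f])
    note g(1) [measurable]
    have "integrable (wt c) (\<lambda>x. \<bar>f x - g x\<bar>)"
    proof (rule bounded_borel_integrable[OF M.finite_measure_axioms sets_wt])
      show "\<bar>\<bar>f x - g x\<bar>\<bar> \<le> D + C" for x using D[of x] g(2)[of x] by linarith
    qed measurable
    then show ?thesis by (rule nn_integral_eq_integral) simp
  qed
  have conv: "(\<lambda>n. cur c (F n) \<pi>) \<longlonglongrightarrow> cur c g \<pi>"
    if F: "\<And>n. F n \<in> bLip_fun" and lim: "(\<lambda>n. \<integral>\<^sup>+x. ennreal \<bar>F n x - g x\<bar> \<partial>wt c) \<longlonglongrightarrow> 0" for F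
  proof -
    have "(\<lambda>n. ennreal (\<integral>x. \<bar>F n x - g x\<bar> \<partial>wt c)) \<longlonglongrightarrow> ennreal 0"
      using lim unfolding nn[OF F] by simp
    then have "(\<lambda>n. \<integral>x. \<bar>F n x - g x\<bar> \<partial>wt c) \<longlonglongrightarrow> 0"
      by (rule tendsto_ennrealD) auto
    then have l0: "(\<lambda>n. L * (\<integral>x. \<bar>F n x - g x\<bar> \<partial>wt c)) \<longlonglongrightarrow> 0"
      by (rule tendsto_mult_right_zero)
    have "\<bar>cur c (F n) \<pi> - cur c g \<pi>\<bar> \<le> L * (\<integral>x. \<bar>F n x - g x\<bar> \<partial>wt c)" for n
    proof -
      obtain D where D: "\<And>x. \<bar>F n x\<bar> \<le> D" using bLip_fun_bounded[OF F[of n]] by blast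
      have m: "(\<lambda>x. F n x - g x) \<in> borel_measurable borel"
        using bLip_measurable[OF F] g(1) by (rule borel_measurable_diff)
      have b: "\<bar>F n x - g x\<bar> \<le> D + C" for x using D[of x] g(2)[of x] by linarith
      have "cur c (F n) \<pi> - cur c g \<pi> = cur c (\<lambda>x. F n x - g x) \<pi>"
        by (rule cur_diff[where f="F n" and g=g, OF c bLip_measurable[OF F] D g \<pi>, symmetric])
      then show ?thesis using cur_mass_le[where f="\<lambda>x. F n x - g x", OF c m b L(2)] by simp
    qed
    then have "(\<lambda>n. cur c (F n) \<pi> - cur c g \<pi>) \<longlonglongrightarrow> 0" using l0 by (rule tendsto_zero_abs_le)
    then show ?thesis by (rule LIM_zero_cancel)
  qed
  have F0lim: "(\<lambda>n. \<integral>\<^sup>+x. ennreal \<bar>F0 n x - g x\<bar> \<partial>wt c) \<longlonglongrightarrow> 0"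
  proof -
    note g(1) [measurable]
    have F0m [measurable]: "F0 n \<in> borel_measurable borel" for n by (rule bLip_measurable[OF F0(1)])
    have "(\<lambda>n. \<integral>x. \<bar>F0 n x - g x\<bar> \<partial>wt c) \<longlonglongrightarrow> (\<integral>x. 0 \<partial>wt c)"
    proof (rule integral_dominated_convergence[where w="\<lambda>_. C + C"])
      show "AE x in wt c. (\<lambda>n. \<bar>F0 n x - g x\<bar>) \<longlonglongrightarrow> 0"
      proof (rule AE_I2)
        fix x
        have "(\<lambda>n. F0 n x - g x) \<longlonglongrightarrow> 0" using F0(3) by (rule LIM_zero)
        then show "(\<lambda>n. \<bar>F0 n x - g x\<bar>) \<longlonglongrightarrow> 0" by (rule tendsto_rabs_zero)
      qed
      show "AE x in wt c. norm \<bar>F0 n x - g x\<bar> \<le> C + C" for n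
      proof (rule AE_I2)
        fix x show "norm \<bar>F0 n x - g x\<bar> \<le> C + C" using F0(2)[of n x] g(2)[of x] unfolding real_norm_def by linarith
      qed
    qed auto
    then have "(\<lambda>n. ennreal (\<integral>x. \<bar>F0 n x - g x\<bar> \<partial>wt c)) \<longlonglongrightarrow> ennreal 0"
      by (intro tendsto_ennrealI) simp
    then show ?thesis unfolding nn[OF F0(1)] by simp
  qed
  show ?thesis
    unfolding borel_extension_def mass_measure_cur[OF c]
  proof (rule the_equality)
    show "\<forall>F. (\<forall>n. F n \<in> bLip_fun) \<and> (\<lambda>n. \<integral>\<^sup>+x. ennreal \<bar>F n x - g x\<bar> \<partial>wt c) \<longlonglongrightarrow> 0 \<longrightarrow>
        (\<lambda>n. cur c (F n) \<pi>) \<longlonglongrightarrow> cur c g \<pi>"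
      by (intro allI impI, elim conjE) (rule conv, simp_all)
    fix v assume "\<forall>F. (\<forall>n. F n \<in> bLip_fun) \<and> (\<lambda>n. \<integral>\<^sup>+x. ennreal \<bar>F n x - g x\<bar> \<partial>wt c) \<longlonglongrightarrow> 0 \<longrightarrow>
        (\<lambda>n. cur c (F n) \<pi>) \<longlonglongrightarrow> v"
    then have "(\<lambda>n. cur c (F0 n) \<pi>) \<longlonglongrightarrow> v" using F0(1) F0lim by simp
    then show "v = cur c g \<pi>" by (rule LIMSEQ_unique) (rule conv[OF F0(1) F0lim])
  qed
qed

lemma restrict_current_cur:
  assumes c: "finite_coeffs c" and A: "open A" and f: "f \<in> bLip_fun" and \<pi>: "\<pi> \<in> Lip_fun"
  shows "restrict_current (cur c) A f \<pi> = cur c (\<lambda>x. f x * indicator A x) \<pi>"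
proof -
  obtain C where C: "0 \<le> C" "\<And>x. \<bar>f x\<bar> \<le> C" using bLip_fun_bounded[OF f] by blast
  have Ab [measurable]: "A \<in> sets borel" using A by (rule borel_open)
  have fm [measurable]: "f \<in> borel_measurable borel" by (rule bLip_measurable[OF f])
  \<comment> \<open>The distance to the empty set is 0 by convention, hence the separate case A =
    UNIV.\<close>
  define ct where "ct n x = (if A = UNIV then 1 else max 0 (min (real n * infdist x (- A)) 1))" for n x
  have ch: "ct n \<in> bLip_fun" for n
    using bLip_clamp_scaled[OF Lip_fun_infdist[of "- A"], of "real n"] by (cases "A = UNIV") (simp_all add: ct_def[abs_def])
  have ch01: "0 \<le> ct n x" "ct n x \<le> 1" for n x by (auto simp: ct_def)
  have chlim: "(\<lambda>n. ct n x) \<longlonglongrightarrow> indicator A x" for x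
  proof (cases "A = UNIV")
    case False
    have "closed (- A)" "- A \<noteq> {}" using A False by auto
    then have "0 < infdist x (- A) \<longleftrightarrow> x \<in> A"
      using in_closed_iff_infdist_zero[of "- A" x] infdist_nonneg[of x "- A"] by (auto simp: less_le)
    then have "(indicator A x :: real) = (if 0 < infdist x (- A) then 1 else 0)" by (simp add: indicator_def)
    then show ?thesis
      using clamp_scaled_limit[OF infdist_nonneg[of x "- A"]] False by (simp add: ct_def)
  qed (simp add: ct_def)
  show ?thesis
    unfolding restrict_current_def
  proof (rule borel_extension_cur[where C=C and ?F0.0="\<lambda>n x. f x * ct n x", OF c _ _ _ _ _ \<pi>])
    show "\<bar>f x * indicator A x\<bar> \<le> C" for x using C by (simp add: indicator_def)
    show "(\<lambda>x. f x * ct n x) \<in> bLip_fun" for n by (rule bLip_fun_mult[OF f ch])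
    show "\<bar>f x * ct n x\<bar> \<le> C" for n x
    proof -
      have "\<bar>f x\<bar> * \<bar>ct n x\<bar> \<le> C * 1" using C ch01[of n x] by (intro mult_mono) auto
      then show ?thesis by (simp add: abs_mult)
    qed
    show "(\<lambda>n. f x * ct n x) \<longlonglongrightarrow> f x * indicator A x" for x by (rule tendsto_mult_left[OF chlim])
  qed measurable
qed

text \<open>Edge i contributes m i times the integer density of the open set of its parameters in A.
  The L^1 norms are at most |m i| L times the length, so \<open>integer_series_density\<close> sums
  these densities to one integer density.\<close>

lemma pushforward_cur:
  assumes c: "finite_coeffs (\<lambda>i. real_of_int (m i))" and \<phi>: "\<phi> \<in> Lip_fun" and A: "open A"
  shows "\<exists>\<theta>::real \<Rightarrow> int. integrable lebesgue (\<lambda>x. real_of_int (\<theta> x)) \<and>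
    (\<forall>f\<in>bLip_fun. \<forall>\<pi>\<in>Lip_fun. pushforward \<phi> (restrict_current (cur (\<lambda>i. real_of_int (m i))) A) f \<pi> =
       line_current (\<lambda>x. real_of_int (\<theta> x)) f \<pi>)"
proof -
  let ?c = "\<lambda>i. real_of_int (m i)"
  obtain L where L: "0 \<le> L" "L-lipschitz_on UNIV \<phi>" using \<phi> by (rule Lip_fun_obtain)
  have Ab [measurable]: "A \<in> sets borel" using A by (rule borel_open)
  define W where "W i = {s \<in> {0<..<\<l> i}. \<gamma> i s \<in> A}" for i
  have Wo: "open (W i)" for i
  proof -
    have "W i = \<gamma> i -` A \<inter> {0<..<\<l> i}" by (auto simp: W_def)
    then show ?thesis
      using open_vimage[OF A lipschitz_on_continuous_on[OF \<gamma>_lipschitz]] by (simp add: open_Int)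
  qed
  have Wl: "W i \<subseteq> {0..\<l> i}" for i by (auto simp: W_def)
  define Q where "Q i \<theta> \<longleftrightarrow> integrable lborel (\<lambda>y. real_of_int (\<theta> y)) \<and>
    (\<integral>y. \<bar>real_of_int (\<theta> y)\<bar> \<partial>lborel) \<le> L * \<l> i \<and>
    (\<forall>f\<in>bLip_fun. \<forall>\<pi>\<in>Lip_fun. (LINT s:W i|lborel. f (\<phi> (\<gamma> i s)) * lderiv (\<lambda>s. \<pi> (\<phi> (\<gamma> i s))) s) =
      (\<integral>y. real_of_int (\<theta> y) * (f y * lderiv \<pi> y) \<partial>lborel))" for i and \<theta> :: "real \<Rightarrow> int"
  have "\<exists>\<theta>. Q i \<theta>" for i
    unfolding Q_def by (rule open_set_density[OF lipschitz_along[OF L(2)] Wo Wl len0])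
  then obtain \<theta>s where "\<And>i. Q i (\<theta>s i)" by metis
  then have \<theta>1: "\<And>i. integrable lborel (\<lambda>y. real_of_int (\<theta>s i y))"
    and \<theta>2: "\<And>i. (\<integral>y. \<bar>real_of_int (\<theta>s i y)\<bar> \<partial>lborel) \<le> L * \<l> i"
    and \<theta>3: "\<And>i f \<pi>. f \<in> bLip_fun \<Longrightarrow> \<pi> \<in> Lip_fun \<Longrightarrow>
      (LINT s:W i|lborel. f (\<phi> (\<gamma> i s)) * lderiv (\<lambda>s. \<pi> (\<phi> (\<gamma> i s))) s) =
      (\<integral>y. real_of_int (\<theta>s i y) * (f y * lderiv \<pi> y) \<partial>lborel)"
    unfolding Q_def by simp_all
  define G where "G i y = m i * \<theta>s i y" for i y
  have Gi: "integrable lborel (\<lambda>y. real_of_int (G i y))" for i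
    using integrable_mult_right[OF \<theta>1[of i], of "?c i"] by (simp add: G_def)
  have Gn: "(\<integral>y. \<bar>real_of_int (G i y)\<bar> \<partial>lborel) = \<bar>?c i\<bar> * (\<integral>y. \<bar>real_of_int (\<theta>s i y)\<bar> \<partial>lborel)" for i
    by (simp add: G_def abs_mult)
  have Gs: "summable (\<lambda>i. \<integral>y. \<bar>real_of_int (G i y)\<bar> \<partial>lborel)"
  proof (rule summable_comparison_test'[of "\<lambda>i. (\<bar>?c i\<bar> * \<l> i) * L" 0])
    show "summable (\<lambda>i. (\<bar>?c i\<bar> * \<l> i) * L)" using c unfolding finite_coeffs_def by (rule summable_mult2)
    show "norm (\<integral>y. \<bar>real_of_int (G i y)\<bar> \<partial>lborel) \<le> (\<bar>?c i\<bar> * \<l> i) * L" for i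
      using mult_left_mono[OF \<theta>2[of i] abs_ge_zero[of "?c i"]] unfolding Gn
      by (simp add: abs_mult mult_ac)
  qed
  obtain \<theta> :: "real \<Rightarrow> int" where \<theta>i: "integrable lborel (\<lambda>y. real_of_int (\<theta> y))"
    and \<theta>sum: "\<forall>q C. q \<in> borel_measurable borel \<longrightarrow> (\<forall>y. \<bar>q y\<bar> \<le> C) \<longrightarrow>
      (\<lambda>k. \<integral>y. real_of_int (G k y) * q y \<partial>lborel) sums (\<integral>y. real_of_int (\<theta> y) * q y \<partial>lborel)"
    using integer_series_density[OF Gi Gs] by (elim exE conjE) (rule that)
  have \<theta>m: "(\<lambda>y. real_of_int (\<theta> y)) \<in> borel_measurable borel"
    using borel_measurable_integrable[OF \<theta>i] by simp
  have "integrable lebesgue (\<lambda>y. real_of_int (\<theta> y))"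
    using \<theta>i by (subst integrable_completion) (simp_all add: \<theta>m)
  moreover have "pushforward \<phi> (restrict_current (cur ?c) A) f \<pi> = line_current (\<lambda>x. real_of_int (\<theta> x)) f \<pi>"
    if f: "f \<in> bLip_fun" and \<pi>: "\<pi> \<in> Lip_fun" for f \<pi>
  proof -
    obtain C where C: "0 \<le> C" "\<And>x. \<bar>f x\<bar> \<le> C" using bLip_fun_bounded[OF f] by blast
    obtain M where M: "0 \<le> M" "M-lipschitz_on UNIV \<pi>" using \<pi> by (rule Lip_fun_obtain)
    have f\<phi>: "(\<lambda>x. f (\<phi> x)) \<in> bLip_fun" by (rule bLip_fun_compose[OF f \<phi>])
    have \<pi>\<phi>: "(\<lambda>x. \<pi> (\<phi> x)) \<in> Lip_fun" by (rule Lip_fun_compose[OF \<pi> \<phi>])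
    have term_eq: "edge_int (\<l> i) (\<lambda>s. (f (\<phi> (\<gamma> i s)) * indicator A (\<gamma> i s)) * lderiv (\<lambda>s. \<pi> (\<phi> (\<gamma> i s))) s) =
        (\<integral>y. real_of_int (\<theta>s i y) * (f y * lderiv \<pi> y) \<partial>lborel)" for i
    proof -
      have wm [measurable]: "(\<lambda>s. f (\<phi> (\<gamma> i s)) * lderiv (\<lambda>s. \<pi> (\<phi> (\<gamma> i s))) s) \<in> borel_measurable borel"
        by (rule cur_term_measurable[OF bLip_measurable[OF f\<phi>] \<pi>\<phi>])
      have wm2 [measurable]: "(\<lambda>s. (f (\<phi> (\<gamma> i s)) * indicator A (\<gamma> i s)) * lderiv (\<lambda>s. \<pi> (\<phi> (\<gamma> i s))) s) \<in> borel_measurable borel"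
      proof (rule cur_term_measurable[OF _ \<pi>\<phi>])
        show "(\<lambda>x. f (\<phi> x) * indicator A x) \<in> borel_measurable borel"
          using bLip_measurable[OF f\<phi>] by measurable
      qed
      have Wm [measurable]: "W i \<in> sets borel" using Wo by (rule borel_open)
      have "AE s in lborel. s \<noteq> 0 \<and> s \<noteq> \<l> i" by (intro AE_conjI AE_lborel_singleton)
      then have "AE s in lborel. indicator {0..\<l> i} s *\<^sub>R ((f (\<phi> (\<gamma> i s)) * indicator A (\<gamma> i s)) * lderiv (\<lambda>s. \<pi> (\<phi> (\<gamma> i s))) s) =
          indicator (W i) s *\<^sub>R (f (\<phi> (\<gamma> i s)) * lderiv (\<lambda>s. \<pi> (\<phi> (\<gamma> i s))) s)"
        by eventually_elim (auto simp: indicator_def W_def)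
      then have "edge_int (\<l> i) (\<lambda>s. (f (\<phi> (\<gamma> i s)) * indicator A (\<gamma> i s)) * lderiv (\<lambda>s. \<pi> (\<phi> (\<gamma> i s))) s) =
          (LINT s:W i|lborel. f (\<phi> (\<gamma> i s)) * lderiv (\<lambda>s. \<pi> (\<phi> (\<gamma> i s))) s)"
        unfolding edge_int_def set_lebesgue_integral_def by (intro integral_cong_AE) measurable
      then show ?thesis using \<theta>3[OF f \<pi>, of i] by simp
    qed
    have "pushforward \<phi> (restrict_current (cur ?c) A) f \<pi> = cur ?c (\<lambda>x. f (\<phi> x) * indicator A x) (\<lambda>x. \<pi> (\<phi> x))"
      unfolding pushforward_def by (rule restrict_current_cur[OF c A f\<phi> \<pi>\<phi>])
    also have "\<dots> = (\<Sum>i. ?c i * (\<integral>y. real_of_int (\<theta>s i y) * (f y * lderiv \<pi> y) \<partial>lborel))"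
      unfolding cur_def term_eq ..
    also have "(\<lambda>i. ?c i * (\<integral>y. real_of_int (\<theta>s i y) * (f y * lderiv \<pi> y) \<partial>lborel)) =
        (\<lambda>i. \<integral>y. real_of_int (G i y) * (f y * lderiv \<pi> y) \<partial>lborel)"
      by (rule ext) (simp add: G_def mult.assoc)
    also have "(\<Sum>i. \<integral>y. real_of_int (G i y) * (f y * lderiv \<pi> y) \<partial>lborel) = (\<integral>y. real_of_int (\<theta> y) * (f y * lderiv \<pi> y) \<partial>lborel)"
    proof (rule sums_unique[symmetric])
      have qm: "(\<lambda>y. f y * lderiv \<pi> y) \<in> borel_measurable borel"
        using bLip_measurable[OF f] lderiv_measurable[OF \<pi>] by (rule borel_measurable_times)
      have qb: "\<forall>y. \<bar>f y * lderiv \<pi> y\<bar> \<le> C * M"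
        unfolding abs_mult using C lderiv_bound[OF M(2)] by (intro allI mult_mono) auto
      show "(\<lambda>n. \<integral>y. real_of_int (G n y) * (f y * lderiv \<pi> y) \<partial>lborel) sums (\<integral>y. real_of_int (\<theta> y) * (f y * lderiv \<pi> y) \<partial>lborel)"
        using \<theta>sum qm qb by blast
    qed
    also have "\<dots> = line_current (\<lambda>x. real_of_int (\<theta> x)) f \<pi>"
      by (rule line_current_lderiv[OF \<theta>m bLip_measurable[OF f] \<pi>, symmetric])
    finally show ?thesis .
  qed
  ultimately show ?thesis by blast
qed

text \<open>Rectifiability is witnessed by the edges themselves, and a Hausdorff null set meets each
  edge in parameters of length 0.\<close>

lemma integer_rectifiable_cur:
  assumes c: "finite_coeffs (\<lambda>i. real_of_int (m i))"
  shows "integer_rectifiable1 (cur (\<lambda>i. real_of_int (m i)))"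
  unfolding integer_rectifiable1_def
proof (intro conjI ballI allI impI)
  let ?c = "\<lambda>i. real_of_int (m i)"
  show "metric_current1 (cur ?c)" by (rule metric_current_cur[OF c])
  show "\<exists>S\<in>sets borel. countably_rectifiable1 S \<and> emeasure (mass_measure (cur ?c)) (- S) = 0"
  proof (intro bexI[of _ UNIV] conjI)
    show "countably_rectifiable1 (UNIV :: 'a set)"
      unfolding countably_rectifiable1_def
    proof (intro exI[of _ "\<lambda>i. {0..\<l> i}"] exI[of _ \<gamma>] conjI allI)
      show "\<exists>L. L-lipschitz_on {0..\<l> i} (\<gamma> i)" for i
        by (intro exI[of _ 1]) (rule lipschitz_on_subset[OF \<gamma>_lipschitz], simp)
      have e: "UNIV - (\<Union>i. \<gamma> i ` {0..\<l> i}) = {}"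
      proof -
        have "x \<in> (\<Union>i. \<gamma> i ` {0..\<l> i})" for x
        proof -
          obtain i s where "0 \<le> s" "s \<le> \<l> i" "x = \<gamma> i s" using cover by blast
          then show ?thesis by (intro UN_I[of i] image_eqI[of _ _ s]) auto
        qed
        then show ?thesis by blast
      qed
      show "hausdorff1_outer (UNIV - (\<Union>i. \<gamma> i ` {0..\<l> i})) = 0"
        unfolding e using hausdorff1_outer_eq[of "{}"] by simp
    qed
  qed simp_all
  fix N :: "'a set" assume N: "N \<in> sets borel" "hausdorff1_outer N = 0"
  then have "(\<Sum>i. ennreal \<bar>1\<bar> * emeasure lborel {s \<in> {0<..<\<l> i}. \<gamma> i s \<in> N}) = 0"
    by (simp only: hausdorff1_outer_eq emeasure_wt)
  then have "emeasure lborel {s \<in> {0<..<\<l> i}. \<gamma> i s \<in> N} = 0" for i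
    by (subst (asm) suminf_eq_zero_iff) (auto intro: summableI)
  then show "emeasure (mass_measure (cur ?c)) N = 0"
    unfolding mass_measure_cur[OF c] emeasure_wt[OF N(1)] by (simp only: mult_zero_right suminf_zero)
next
  fix \<phi> :: "'a \<Rightarrow> real" and A :: "'a set" assume "\<phi> \<in> Lip_fun" "open A"
  then show "\<exists>\<theta>::real \<Rightarrow> int. integrable lebesgue (\<lambda>x. real_of_int (\<theta> x)) \<and>
    (\<forall>f\<in>bLip_fun. \<forall>\<pi>\<in>Lip_fun. pushforward \<phi> (restrict_current (cur (\<lambda>i. real_of_int (m i))) A) f \<pi> =
       line_current (\<lambda>x. real_of_int (\<theta> x)) f \<pi>)"
    by (rule pushforward_cur[OF c])
qed

text \<open>Restriction to the open edge and push-forward by its coordinate give c i times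
  integration over the segment, while rectifiability gives an integer density \<theta>. Tested with
  the identity as \<pi>, both produce the same integrals against every f. Differentiating primitives
  turns this into \<theta> = c i almost everywhere on the segment.\<close>

lemma integer_coefficients:
  assumes c: "finite_coeffs c" and rect: "integer_rectifiable1 (cur c)"
  shows "c i \<in> \<int>"
proof -
  have ex: "\<exists>\<theta>::real \<Rightarrow> int. integrable lebesgue (\<lambda>x. real_of_int (\<theta> x)) \<and>
      (\<forall>f\<in>bLip_fun. \<forall>\<pi>\<in>Lip_fun. pushforward (cr i) (restrict_current (cur c) (edge i)) f \<pi> =
         line_current (\<lambda>x. real_of_int (\<theta> x)) f \<pi>)"
    by (rule rect[unfolded integer_rectifiable1_def, THEN conjunct2, THEN conjunct2, THEN conjunct2, rule_format, OF cr_Lip edge_open])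
  then obtain \<theta> :: "real \<Rightarrow> int" where \<theta>: "integrable lebesgue (\<lambda>x. real_of_int (\<theta> x))"
    and \<theta>f: "\<forall>f\<in>bLip_fun. \<forall>\<pi>\<in>Lip_fun. pushforward (cr i) (restrict_current (cur c) (edge i)) f \<pi> =
         line_current (\<lambda>x. real_of_int (\<theta> x)) f \<pi>"
    by (elim exE conjE) (rule that)
  \<comment> \<open>\<theta> is only Lebesgue measurable; g is a Borel representative.\<close>
  obtain g where g [measurable]: "g \<in> borel_measurable lborel" and ge: "AE x in lborel. real_of_int (\<theta> x) = g x"
    using completion_ex_borel_measurable_real[OF borel_measurable_integrable[OF \<theta>]] by blast
  have gb: "g \<in> borel_measurable borel" using g by simp
  have gl: "g \<in> borel_measurable lebesgue" using g by (rule measurable_completion)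
  have "integrable lebesgue g"
    using integrable_cong_AE[OF borel_measurable_integrable[OF \<theta>] gl AE_completion[OF ge]] \<theta> by simp
  then have gi: "integrable lborel g" using g by (simp add: integrable_completion)
  have idL: "(\<lambda>y::real. y) \<in> Lip_fun"
    by (rule Lip_funI[of 1], rule lipschitz_onI) auto
  have key: "(\<integral>y. g y * f y \<partial>lborel) = c i * edge_int (\<l> i) f" if f: "f \<in> bLip_fun" for f
  proof -
    have fm [measurable]: "f \<in> borel_measurable borel" by (rule bLip_measurable[OF f])
    have "line_current (\<lambda>x. real_of_int (\<theta> x)) f (\<lambda>y. y) = (\<integral>y. g y * f y \<partial>lborel)"
      unfolding line_current_def
    proof (rule lebesgue_AE_eq(2))
      show "AE x in lborel. real_of_int (\<theta> x) * f x * deriv (\<lambda>y. y) x = g x * f x"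
        using ge by eventually_elim simp
    qed (use gb fm in measurable)
    moreover have "pushforward (cr i) (restrict_current (cur c) (edge i)) f (\<lambda>y. y) = line_current (\<lambda>x. real_of_int (\<theta> x)) f (\<lambda>y. y)"
      using \<theta>f f idL by blast
    moreover have "pushforward (cr i) (restrict_current (cur c) (edge i)) f (\<lambda>y. y) = c i * edge_int (\<l> i) f"
    proof -
      have fc: "(\<lambda>x. f (cr i x)) \<in> bLip_fun" by (rule bLip_fun_compose[OF f cr_Lip])
      have "pushforward (cr i) (restrict_current (cur c) (edge i)) f (\<lambda>y. y) = cur c (\<lambda>x. f (cr i x) * indicator (edge i) x) (cr i)"
        unfolding pushforward_def using restrict_current_cur[OF c edge_open fc cr_Lip] by simp
      also have "\<dots> = (\<Sum>j\<in>{i}. c j * edge_int (\<l> j) (\<lambda>s. (f (cr i (\<gamma> j s)) * indicator (edge i) (\<gamma> j s)) * lderiv (\<lambda>s. cr i (\<gamma> j s)) s))"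
        unfolding cur_def
      proof (rule suminf_finite)
        fix j assume "j \<notin> {i}"
        then have "indicator (edge i) (\<gamma> j s) = (0::real)" for s by (simp add: \<gamma>_in_edge)
        then show "c j * edge_int (\<l> j) (\<lambda>s. (f (cr i (\<gamma> j s)) * indicator (edge i) (\<gamma> j s)) * lderiv (\<lambda>s. cr i (\<gamma> j s)) s) = 0"
          by (simp add: edge_int_def set_lebesgue_integral_def)
      qed simp
      also have "\<dots> = c i * edge_int (\<l> i) (\<lambda>s. (f (cr i (\<gamma> i s)) * indicator (edge i) (\<gamma> i s)) * lderiv (\<lambda>s. cr i (\<gamma> i s)) s)"
        by simp
      also have "edge_int (\<l> i) (\<lambda>s. (f (cr i (\<gamma> i s)) * indicator (edge i) (\<gamma> i s)) * lderiv (\<lambda>s. cr i (\<gamma> i s)) s) = edge_int (\<l> i) f"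
      proof (rule edge_int_cong_AE[OF _ fm])
        show "(\<lambda>s. (f (cr i (\<gamma> i s)) * indicator (edge i) (\<gamma> i s)) * lderiv (\<lambda>s. cr i (\<gamma> i s)) s) \<in> borel_measurable borel"
        proof (rule cur_term_measurable[OF _ cr_Lip])
          show "(\<lambda>x. f (cr i x) * indicator (edge i) x) \<in> borel_measurable borel"
            using bLip_measurable[OF fc] by measurable
        qed
        have "AE s in lborel. s \<noteq> 0 \<and> s \<noteq> \<l> i" by (intro AE_conjI AE_lborel_singleton)
        then show "AE s in lborel. s \<in> {0..\<l> i} \<longrightarrow> (f (cr i (\<gamma> i s)) * indicator (edge i) (\<gamma> i s)) * lderiv (\<lambda>s. cr i (\<gamma> i s)) s = f s"
          using lderiv_cr[of i]
        proof eventually_elim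
          case (elim s)
          show ?case
          proof
            assume s: "s \<in> {0..\<l> i}"
            then have "\<gamma> i s \<in> edge i" using elim(1) by (simp add: \<gamma>_in_edge less_le)
            then show "(f (cr i (\<gamma> i s)) * indicator (edge i) (\<gamma> i s)) * lderiv (\<lambda>s. cr i (\<gamma> i s)) s = f s"
              using elim(2) s by (simp add: cr_\<gamma>)
          qed
        qed
      qed
      finally show ?thesis .
    qed
    ultimately show ?thesis by simp
  qed
  \<comment> \<open>The expected primitive of the truncated density q; inside the segment its slope
    is c i.\<close>
  define p where "p t = c i * max 0 (min t (\<l> i))" for t
  define q where "q y = indicator {0..\<l> i} y * g y" for y
  have qi: "integrable lborel q" using integrable_real_mult_indicator[OF _ gi, of "{0..\<l> i}"]
    by (simp add: q_def[abs_def] mult.commute)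
  have qp: "(LINT y:{a..b}|lborel. q y) = p b - p a" if ab: "a \<le> b" for a b
  proof (cases "max a 0 \<le> min b (\<l> i)")
    case False
    then have z: "indicator {a..b} y *\<^sub>R q y = 0" for y by (auto simp: q_def indicator_def)
    have "max 0 (min a (\<l> i)) = max 0 (min b (\<l> i))" using False ab len0[of i] by auto
    then show ?thesis unfolding set_lebesgue_integral_def z p_def by simp
  next
    case True
    define a' b' where "a' = max a 0" and "b' = min b (\<l> i)"
    have ab': "a' \<le> b'" "0 \<le> a'" "b' \<le> \<l> i" using True by (auto simp: a'_def b'_def)
    define J where "J = {a'..b'}"
    have J: "closed J" "J \<noteq> {}" using ab' by (auto simp: J_def)
    have Jm [measurable]: "J \<in> sets borel" by (simp add: J_def)
    \<comment> \<open>Lipschitz functions that decrease to the indicator of the closed interval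
      J.\<close>
    define f where "f k y = 1 - max 0 (min (real k * infdist y J) 1)" for k y
    have fb: "f k \<in> bLip_fun" for k
      unfolding f_def by (rule bLip_fun_diff[OF bLip_fun_const bLip_clamp_scaled[OF Lip_fun_infdist]])
    have f01: "0 \<le> f k y" "f k y \<le> 1" for k y by (auto simp: f_def)
    have fm [measurable]: "f k \<in> borel_measurable borel" for k by (rule bLip_measurable[OF fb])
    have flim: "(\<lambda>k. f k y) \<longlonglongrightarrow> indicator J y" for y
    proof -
      have "(\<lambda>k. f k y) \<longlonglongrightarrow> 1 - (if 0 < infdist y J then 1 else 0)"
        unfolding f_def by (intro tendsto_diff tendsto_const clamp_scaled_limit infdist_nonneg)
      moreover have "0 < infdist y J \<longleftrightarrow> y \<notin> J"
        using in_closed_iff_infdist_zero[OF J, of y] infdist_nonneg[of y J] by (simp add: less_le)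
      ultimately show ?thesis by (simp add: indicator_def split: if_splits)
    qed
    have l1: "(\<lambda>k. \<integral>y. g y * f k y \<partial>lborel) \<longlonglongrightarrow> (\<integral>y. g y * indicator J y \<partial>lborel)"
    proof (rule integral_dominated_convergence[where w="\<lambda>y. \<bar>g y\<bar>"])
      show "AE y in lborel. (\<lambda>k. g y * f k y) \<longlonglongrightarrow> g y * indicator J y"
        by (rule AE_I2) (rule tendsto_mult_left[OF flim])
      show "AE y in lborel. norm (g y * f k y) \<le> \<bar>g y\<bar>" for k
      proof (rule AE_I2)
        fix y
        show "norm (g y * f k y) \<le> \<bar>g y\<bar>"
          using f01[of k y] mult_left_mono[of "f k y" 1 "\<bar>g y\<bar>"] by (simp add: abs_mult)
      qed
    qed (use gi gb in auto)
    have l2: "(\<lambda>k. edge_int (\<l> i) (f k)) \<longlonglongrightarrow> edge_int (\<l> i) (indicator J)"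
      unfolding edge_int_def set_lebesgue_integral_def
    proof (rule integral_dominated_convergence[where w="indicator {0..\<l> i}"])
      show "integrable lborel (indicator {0..\<l> i} :: real \<Rightarrow> real)"
        by (rule integrable_real_indicator) (auto simp: emeasure_lborel_Icc_eq)
      show "AE y in lborel. (\<lambda>k. indicator {0..\<l> i} y *\<^sub>R f k y) \<longlonglongrightarrow> indicator {0..\<l> i} y *\<^sub>R indicator J y"
        by (rule AE_I2) (rule tendsto_scaleR[OF tendsto_const flim])
      show "AE y in lborel. norm (indicator {0..\<l> i} y *\<^sub>R f k y) \<le> indicator {0..\<l> i} y" for k
        using f01 by (intro AE_I2) (auto simp: indicator_def)
    qed measurable
    have "(\<lambda>k. \<integral>y. g y * f k y \<partial>lborel) \<longlonglongrightarrow> c i * edge_int (\<l> i) (indicator J)"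
      unfolding key[OF fb] by (rule tendsto_mult_left[OF l2])
    then have eq: "(\<integral>y. g y * indicator J y \<partial>lborel) = c i * edge_int (\<l> i) (indicator J)"
      by (rule LIMSEQ_unique[OF l1])
    have "edge_int (\<l> i) (indicator J) = (\<integral>y. indicator J y \<partial>lborel)"
      unfolding edge_int_def set_lebesgue_integral_def
      using ab' by (intro Bochner_Integration.integral_cong) (auto simp: indicator_def J_def)
    also have "\<dots> = b' - a'" using ab' by (simp add: J_def)
    finally have "edge_int (\<l> i) (indicator J) = b' - a'" .
    moreover have "(LINT y:{a..b}|lborel. q y) = (\<integral>y. g y * indicator J y \<partial>lborel)"
      unfolding set_lebesgue_integral_def
      by (intro Bochner_Integration.integral_cong) (auto simp: q_def J_def indicator_def a'_def b'_def)
    moreover have "max 0 (min b (\<l> i)) = b'" "max 0 (min a (\<l> i)) = a'"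
      using True ab len0[of i] unfolding a'_def b'_def by linarith+
    then have "p b = c i * b'" "p a = c i * a'" by (simp_all add: p_def)
    ultimately show ?thesis using eq by (simp add: right_diff_distrib)
  qed
  have D: "AE x in lborel. (p has_real_derivative q x) (at x)"
    by (rule AE_has_derivative_primitive[OF qi]) (rule qp)
  have "AE x in lborel. x \<in> {0<..<\<l> i} \<longrightarrow> c i \<in> \<int>"
    using D ge
  proof eventually_elim
    case (elim x)
    show ?case
    proof
      assume x: "x \<in> {0<..<\<l> i}"
      have "((\<lambda>t. c i * t) has_real_derivative c i) (at x)" by (auto intro!: derivative_eq_intros)
      then have "(p has_real_derivative c i) (at x)"
        by (rule DERIV_transform_at[of _ _ _ "min x (\<l> i - x)"])
           (use x in \<open>auto simp: p_def dist_real_def abs_less_iff\<close>)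
      then have "q x = c i" using elim(1) by (rule DERIV_unique[symmetric])
      then have "c i = real_of_int (\<theta> x)" using elim(2) x by (simp add: q_def)
      then show "c i \<in> \<int>" by simp
    qed
  qed
  show ?thesis
  proof (rule ccontr)
    assume "c i \<notin> \<int>"
    then have "AE x in lborel. x \<notin> {0<..<\<l> i}"
      using \<open>AE x in lborel. x \<in> {0<..<\<l> i} \<longrightarrow> c i \<in> \<int>\<close> by simp
    moreover have eqI: "{x. 0 < x \<and> x < \<l> i} = {0<..<\<l> i}" by auto
    ultimately have "emeasure lborel {0<..<\<l> i} = 0"
      by (subst (asm) AE_iff_measurable[OF _ refl]) (auto simp: eqI)
    then show False using len0[of i] by simp
  qed
qed

text \<open>A zero coefficient leaves a small ball around the midpoint of the edge without
  mass.\<close>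

lemma charac_set_nonzero:
  assumes c: "finite_coeffs c" and full: "charac_set (cur c) = UNIV"
  shows "c i \<noteq> 0"
proof
  assume z: "c i = 0"
  define x where "x = \<gamma> i (\<l> i / 2)"
  have dx: "dep i x = \<l> i / 2" unfolding x_def using len0[of i] by (subst dep_\<gamma>) auto
  have b0: "emeasure (wt c) (ball x r) = 0" if "r < \<l> i / 2" for r
  proof -
    have "ball x r \<subseteq> edge i"
    proof
      fix y assume "y \<in> ball x r"
      then show "y \<in> edge i" using dep_lip[of i x y] dx that by (auto simp: edge_def)
    qed
    then have "emeasure (wt c) (ball x r) \<le> emeasure (wt c) (edge i)" by (intro emeasure_mono) auto
    also have "\<dots> = 0" by (simp add: emeasure_wt_edge z)
    finally show ?thesis by simp
  qed
  have "\<forall>\<^sub>F r in at_right (0::real). r < \<l> i / 2"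
    by (rule eventually_at_rightI[of 0 "\<l> i / 2"]) (use len0[of i] in auto)
  then have ev: "\<forall>\<^sub>F r in at_right (0::real). emeasure (wt c) (ball x r) / ennreal (2 * r) = 0"
    by eventually_elim (simp add: b0)
  have "Liminf (at_right 0) (\<lambda>r. emeasure (wt c) (ball x r) / ennreal (2 * r)) = 0"
    by (rule lim_imp_Liminf[OF trivial_limit_at_right_real tendsto_eventually[OF ev]])
  then have "x \<notin> charac_set (cur c)" by (simp add: charac_set_def mass_measure_cur[OF c])
  then show False using full by simp
qed

text \<open>Every point, vertices included, lies on a closed edge, along which an interval of length
  r starts or ends at the point. This interval alone keeps the quotient above |c i| / 2; other edges
  near the point, even infinitely many, can only add mass.\<close>

lemma charac_set_full:
  assumes c: "finite_coeffs c" and nz: "\<And>i. c i \<noteq> 0"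
  shows "charac_set (cur c) = UNIV"
proof -
  have "x \<in> charac_set (cur c)" for x
  proof -
    obtain i s where s: "0 \<le> s" "s \<le> \<l> i" "x = \<gamma> i s" using cover by blast
    have low: "ennreal (\<bar>c i\<bar> / 2) \<le> emeasure (wt c) (ball x r) / ennreal (2 * r)"
      if r: "0 < r" "r < \<l> i / 2" for r
    proof -
      \<comment> \<open>The interval of length r adjacent to s, on the side of the farther end of
        the edge.\<close>
      define a where "a = (if s \<le> \<l> i / 2 then s else s - r)"
      have a: "0 \<le> a" "a + r \<le> \<l> i" "\<And>t. t \<in> {a<..<a + r} \<Longrightarrow> \<bar>s - t\<bar> < r"
        using s r by (cases "s \<le> \<l> i / 2"; auto simp: a_def abs_less_iff)+
      have "ennreal (\<bar>c i\<bar> * r) = ennreal \<bar>c i\<bar> * emeasure lborel {a<..<a + r}"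
        using r by (simp add: ennreal_mult)
      also have "\<dots> \<le> ennreal \<bar>c i\<bar> * emeasure lborel {t \<in> {0<..<\<l> i}. \<gamma> i t \<in> ball x r}"
      proof (intro mult_left_mono emeasure_mono)
        have bm [measurable]: "ball x r \<in> sets borel" by simp
        show "{t \<in> {0<..<\<l> i}. \<gamma> i t \<in> ball x r} \<in> sets lborel" by measurable
        show "{a<..<a + r} \<subseteq> {t \<in> {0<..<\<l> i}. \<gamma> i t \<in> ball x r}"
        proof
          fix t assume t: "t \<in> {a<..<a + r}"
          have "dist x (\<gamma> i t) \<le> \<bar>s - t\<bar>" unfolding s(3) by (rule \<gamma>_lip)
          then show "t \<in> {t \<in> {0<..<\<l> i}. \<gamma> i t \<in> ball x r}" using a(1,2) a(3)[OF t] t by auto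
        qed
      qed simp
      also have "\<dots> \<le> (\<Sum>j. ennreal \<bar>c j\<bar> * emeasure lborel {t \<in> {0<..<\<l> j}. \<gamma> j t \<in> ball x r})"
        using sum_le_suminf[OF summableI, of "{i}" "\<lambda>j. ennreal \<bar>c j\<bar> * emeasure lborel {t \<in> {0<..<\<l> j}. \<gamma> j t \<in> ball x r}"]
        by simp
      also have "\<dots> = emeasure (wt c) (ball x r)" by (rule emeasure_wt[symmetric]) simp
      finally have le: "ennreal (\<bar>c i\<bar> * r) \<le> emeasure (wt c) (ball x r)" .
      have "ennreal (\<bar>c i\<bar> / 2) = ennreal (\<bar>c i\<bar> * r) / ennreal (2 * r)"
        using r by (subst divide_ennreal) auto
      also have "\<dots> \<le> emeasure (wt c) (ball x r) / ennreal (2 * r)" by (rule divide_right_mono_ennreal[OF le])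
      finally show ?thesis .
    qed
    have ev1: "\<forall>\<^sub>F r in at_right (0::real). r < \<l> i / 2"
      by (rule eventually_at_rightI[of 0 "\<l> i / 2"]) (use len0[of i] in auto)
    have ev2: "\<forall>\<^sub>F r in at_right (0::real). 0 < r" by (rule eventually_at_right_less)
    have "ennreal (\<bar>c i\<bar> / 2) \<le> Liminf (at_right 0) (\<lambda>r. emeasure (wt c) (ball x r) / ennreal (2 * r))"
    proof (rule Liminf_bounded)
      show "\<forall>\<^sub>F r in at_right 0. ennreal (\<bar>c i\<bar> / 2) \<le> emeasure (wt c) (ball x r) / ennreal (2 * r)"
        using ev1 ev2 by eventually_elim (rule low)
    qed
    moreover have "0 < ennreal (\<bar>c i\<bar> / 2)" using nz[of i] by simp
    ultimately have "0 < Liminf (at_right 0) (\<lambda>r. emeasure (wt c) (ball x r) / ennreal (2 * r))"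
      by (rule less_le_trans[rotated])
    then show ?thesis by (simp add: charac_set_def mass_measure_cur[OF c])
  qed
  then show ?thesis by blast
qed

end

section \<open>Lipschitz functions on the diamond chain\<close>

lemma walk_lower:
  fixes h :: "'p \<Rightarrow> real"
  assumes "\<And>p q a. step p q a \<Longrightarrow> \<bar>h p - h q\<bar> \<le> a" and "walk step p q l"
  shows "\<bar>h p - h q\<bar> \<le> l"
  using assms(2)
proof (induction rule: walk.induct)
  case (walk_nil p)
  then show ?case by simp
next
  case (walk_cons p q a r l)
  then show ?case using assms(1)[OF walk_cons.hyps(1)] by linarith
qed

text \<open>Every walk pays at least for the change of h, so the infimum does too; no shortest walk
  has to be found.\<close>

lemma path_dist_lower:
  fixes h :: "'p \<Rightarrow> real"
  assumes "\<And>p q a. step p q a \<Longrightarrow> \<bar>h p - h q\<bar> \<le> a" and "walk step p q l"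
  shows "\<bar>h p - h q\<bar> \<le> path_dist step p q"
  unfolding path_dist_def
proof (rule cInf_greatest)
  show "{l. walk step p q l} \<noteq> {}" using assms(2) by blast
  fix m assume "m \<in> {l. walk step p q l}"
  then have w: "walk step p q m" by simp
  show "\<bar>h p - h q\<bar> \<le> m" by (rule walk_lower[where h=h, OF assms(1) w])
qed

lemma z_point_not_chain: "z_point \<notin> chain_points"
  by (simp add: z_point_def chain_points_def)

lemma cauchy_rep_simps:
  "p \<in> chain_points \<Longrightarrow> cauchy_rep p n = p" "cauchy_rep z_point n = (EU (Suc n), 0)"
  using z_point_not_chain by (auto simp: cauchy_rep_def)

lemma completed_dist_chain:
  "p \<in> chain_points \<Longrightarrow> q \<in> chain_points \<Longrightarrow> completed_dist p q = chain_dist p q"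
  by (simp add: completed_dist_def cauchy_rep_simps)

lemma completed_dist_limit:
  assumes "p \<in> insert z_point chain_points" "q \<in> insert z_point chain_points"
  shows "(\<lambda>n. chain_dist (cauchy_rep p n) (cauchy_rep q n)) \<longlonglongrightarrow> completed_dist p q"
proof -
  consider "p = z_point" "q = z_point" | "p = z_point" "q \<in> chain_points"
    | "p \<in> chain_points" "q = z_point" | "p \<in> chain_points" "q \<in> chain_points"
    using assms by blast
  then have "convergent (\<lambda>n. chain_dist (cauchy_rep p n) (cauchy_rep q n))"
  proof cases
    case 1
    then show ?thesis by (simp add: chain_dist_refl convergent_const)
  next
    case 2
    then show ?thesis
      using chain_dist_a_convergent[of q] by (simp add: cauchy_rep_simps chain_dist_sym[of _ q])
  next
    case 3
    then show ?thesis using chain_dist_a_convergent[of p] by (simp add: cauchy_rep_simps)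
  next
    case 4
    then show ?thesis by (simp add: cauchy_rep_simps convergent_const)
  qed
  then show ?thesis by (simp add: completed_dist_def convergent_LIMSEQ_iff)
qed

text \<open>Functions that descend to 1-Lipschitz functions on the space. The last clause is there
  because z is not glued to the chain but enters as the limit of the a_k.\<close>

definition chain_fun :: "(edge_point \<Rightarrow> real) \<Rightarrow> bool" where
  "chain_fun h \<longleftrightarrow>
     (\<forall>e s t. (e, s) \<in> edge_points \<longrightarrow> (e, t) \<in> edge_points \<longrightarrow> \<bar>h (e, s) - h (e, t)\<bar> \<le> \<bar>s - t\<bar>) \<and>
     (\<forall>p q v. at_vertex p v \<longrightarrow> at_vertex q v \<longrightarrow> h p = h q) \<and>
     (\<lambda>n. h (EU (Suc n), 0)) \<longlonglongrightarrow> h z_point"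

lemma chain_funD:
  assumes "chain_fun h"
  shows "(e, s) \<in> edge_points \<Longrightarrow> (e, t) \<in> edge_points \<Longrightarrow> \<bar>h (e, s) - h (e, t)\<bar> \<le> \<bar>s - t\<bar>"
    and "at_vertex p v \<Longrightarrow> at_vertex q v \<Longrightarrow> h p = h q"
    and "(\<lambda>n. h (EU (Suc n), 0)) \<longlonglongrightarrow> h z_point"
  using assms unfolding chain_fun_def by blast+

lemma chain_fun_chain_dist:
  assumes h: "chain_fun h" and pq: "p \<in> chain_points" "q \<in> chain_points"
  shows "\<bar>h p - h q\<bar> \<le> chain_dist p q"
proof -
  obtain l where l: "walk chain_step p q l" using chain_walk[OF pq] by blast
  have step: "\<bar>h p - h q\<bar> \<le> a" if "chain_step p q a" for p q a
    using that
  proof cases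
    case (chain_along e s t)
    then show ?thesis using chain_funD(1)[OF h, of e s t] by (simp add: chain_points_def)
  next
    case (chain_glue v)
    then show ?thesis using chain_funD(2)[OF h, of p v q] by simp
  qed
  show ?thesis unfolding chain_dist_def by (rule path_dist_lower[where h=h, OF step l])
qed

text \<open>A step in the completed chain costs a limit of chain distances. The inequality on
  representatives passes to the limit because h follows the Cauchy sequence that represents
  z.\<close>

lemma chain_fun_graph_dist:
  assumes h: "chain_fun h" and pq: "p \<in> edge_points" "q \<in> edge_points"
  shows "\<bar>h p - h q\<bar> \<le> graph_dist p q"
proof -
  obtain l where l: "walk graph_step p q l" using graph_walk[OF pq] by blast
  have rep: "(\<lambda>n. h (cauchy_rep x n)) \<longlonglongrightarrow> h x" for x
    using chain_funD(3)[OF h] by (cases "x = z_point") (simp_all add: cauchy_rep_def)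
  have step: "\<bar>h p - h q\<bar> \<le> a" if "graph_step p q a" for p q a
    using that
  proof cases
    case graph_chain
    have "\<bar>h p - h q\<bar> \<le> completed_dist p q"
    proof (rule LIMSEQ_le)
      show "(\<lambda>n. \<bar>h (cauchy_rep p n) - h (cauchy_rep q n)\<bar>) \<longlonglongrightarrow> \<bar>h p - h q\<bar>"
        by (rule tendsto_rabs[OF tendsto_diff[OF rep rep]])
      show "(\<lambda>n. chain_dist (cauchy_rep p n) (cauchy_rep q n)) \<longlonglongrightarrow> completed_dist p q"
        by (rule completed_dist_limit[OF graph_chain(2,3)])
      have "\<bar>h (cauchy_rep p n) - h (cauchy_rep q n)\<bar> \<le> chain_dist (cauchy_rep p n) (cauchy_rep q n)" for n
        by (rule chain_fun_chain_dist[OF h cauchy_rep_points[OF graph_chain(2)] cauchy_rep_points[OF graph_chain(3)]])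
      then show "\<exists>N. \<forall>n\<ge>N. \<bar>h (cauchy_rep p n) - h (cauchy_rep q n)\<bar> \<le> chain_dist (cauchy_rep p n) (cauchy_rep q n)"
        by simp
    qed
    then show ?thesis using graph_chain(1) by simp
  next
    case (graph_along s t)
    then show ?thesis using chain_funD(1)[OF h, of EC s t] by simp
  next
    case (graph_glue v)
    then show ?thesis using chain_funD(2)[OF h, of p v q] by simp
  qed
  show ?thesis unfolding graph_dist_def by (rule path_dist_lower[where h=h, OF step l])
qed

lemma same_point_refl: "p \<in> edge_points \<Longrightarrow> same_point p p"
  by (simp add: same_point_def graph_dist_refl)

lemma dist_abs:
  "p \<in> edge_points \<Longrightarrow> q \<in> edge_points \<Longrightarrow>
    dist (abs_diamond_chain p) (abs_diamond_chain q) = graph_dist p q"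
  by (rule dist_diamond_chain.abs_eq) (simp_all add: same_point_refl)

lemma rep_point: "rep_diamond_chain x \<in> edge_points"
  using Quotient_rep_reflp[OF Quotient_diamond_chain, of x] by (simp add: same_point_def)

lemma abs_rep: "abs_diamond_chain (rep_diamond_chain x) = x"
  by (rule Quotient_abs_rep[OF Quotient_diamond_chain])

definition on_chain :: "(edge_point \<Rightarrow> real) \<Rightarrow> diamond_chain \<Rightarrow> real" where
  "on_chain h x = h (rep_diamond_chain x)"

lemma on_chain_lip:
  assumes "chain_fun h"
  shows "\<bar>on_chain h x - on_chain h y\<bar> \<le> dist x y"
  using chain_fun_graph_dist[OF assms rep_point rep_point, of x y] dist_abs[OF rep_point rep_point, of x y]
  by (simp add: on_chain_def abs_rep)

lemma on_chain_abs:
  assumes h: "chain_fun h" and p: "p \<in> edge_points"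
  shows "on_chain h (abs_diamond_chain p) = h p"
proof -
  let ?x = "abs_diamond_chain p"
  have "\<bar>h (rep_diamond_chain ?x) - h p\<bar> \<le> graph_dist (rep_diamond_chain ?x) p"
    by (rule chain_fun_graph_dist[OF h rep_point p])
  also have "\<dots> = dist (abs_diamond_chain (rep_diamond_chain ?x)) ?x"
    by (rule dist_abs[OF rep_point p, symmetric])
  finally show ?thesis by (simp add: on_chain_def abs_rep)
qed

lemma on_chain_Lip:
  assumes "chain_fun h"
  shows "on_chain h \<in> Lip_fun"
  by (rule Lip_funI[of 1], rule lipschitz_onI)
     (use on_chain_lip[OF assms] in \<open>simp_all add: dist_real_def\<close>)

section \<open>The edges as a network\<close>

lemma lam_Suc: "lam (Suc k) = lam k / 2"
  by (simp add: lam_def)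

lemma lam_Suc_power: "lam (Suc n) = 1 / 8 * (1 / 2) ^ n"
  by (induction n) (simp_all add: lam_Suc[of "Suc _"], simp add: lam_def)

lemma lam_sums: "(\<lambda>n. lam (Suc n)) sums (1 / 4)"
  unfolding lam_Suc_power using sums_mult[OF geometric_sums[of "1 / 2 :: real"], of "1 / 8"] by simp

lemma lam_tendsto: "(\<lambda>n. lam (Suc n)) \<longlonglongrightarrow> 0"
  by (rule summable_LIMSEQ_zero[OF sums_summable[OF lam_sums]])

lemma lam_le: "1 \<le> k \<Longrightarrow> lam k \<le> 1 / 8"
  using lam_Suc_power[of "k - 1"] power_le_one[of "1 / 2 :: real" "k - 1"] by simp

lemma len_le:
  assumes "e \<in> edges"
  shows "len e \<le> 1 / 4"
proof -
  have "lam k \<le> 1 / 4" if "1 \<le> k" for k using lam_le[OF that] by simp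
  then show ?thesis using assms by (cases e) auto
qed

lemma at_vertex_src: "e \<in> edges \<Longrightarrow> at_vertex (e, 0) (src e)"
  and at_vertex_tgt: "e \<in> edges \<Longrightarrow> at_vertex (e, len e) (tgt e)"
  using len_pos[of e] by (simp_all add: at_vertex_def edge_points_def)

lemma at_vertexE:
  assumes "at_vertex p v"
  obtains e where "e \<in> edges" "p = (e, 0)" "v = src e" | e where "e \<in> edges" "p = (e, len e)" "v = tgt e"
  using assms by (cases p) (auto simp: at_vertex_def edge_points_def)

lemma param_eq: "0 \<le> s \<Longrightarrow> s \<le> len e \<Longrightarrow> param e s = abs_diamond_chain (e, s)"
  by (simp add: param_def)

lemma clamp_point: "e \<in> edges \<Longrightarrow> (e, max 0 (min s (len e))) \<in> edge_points"
  using len_pos[of e] by (simp add: edge_points_def)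

lemma graph_dist_edge:
  assumes "(e, s) \<in> edge_points" "(e, t) \<in> edge_points"
  shows "graph_dist (e, s) (e, t) \<le> \<bar>s - t\<bar>"
proof (cases "e = EC")
  case True
  then show ?thesis
    using path_dist_le[of graph_step, OF graph_step_nonneg walk_single[of graph_step, OF graph_along]] assms
    by (simp add: graph_dist_def)
next
  case False
  then have c: "(e, s) \<in> chain_points" "(e, t) \<in> chain_points" using assms by (simp_all add: chain_points_def)
  have "graph_dist (e, s) (e, t) \<le> completed_dist (e, s) (e, t)"
    unfolding graph_dist_def
    by (rule path_dist_le[of graph_step, OF graph_step_nonneg walk_single[of graph_step, OF graph_chain]])
       (use c in auto)
  also have "\<dots> = chain_dist (e, s) (e, t)" by (rule completed_dist_chain[OF c])
  also have "\<dots> \<le> \<bar>s - t\<bar>"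
    unfolding chain_dist_def by (rule path_dist_le[of chain_step, OF chain_step_nonneg chain_along_walk[OF c]])
  finally show ?thesis .
qed

lemma dist_param:
  assumes "e \<in> edges"
  shows "dist (param e s) (param e t) \<le> \<bar>s - t\<bar>"
proof -
  have "dist (param e s) (param e t) \<le> \<bar>max 0 (min s (len e)) - max 0 (min t (len e))\<bar>"
    unfolding param_def dist_abs[OF clamp_point[OF assms] clamp_point[OF assms]]
    by (rule graph_dist_edge[OF clamp_point[OF assms] clamp_point[OF assms]])
  also have "\<dots> \<le> \<bar>s - t\<bar>" using len_pos[of e] by linarith
  finally show ?thesis .
qed

text \<open>The edges are laid out on a circle of length 1; \<open>u\<^sub>k\<close> and \<open>v\<^sub>k\<close> share an arc.\<close>

fun off :: "edge \<Rightarrow> real" where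
  "off EC = 3 / 4"
| "off (ET k) = (if k = 0 then 0 else 3 / 4 - 3 * lam k)"
| "off (EU k) = 3 / 4 - 4 * lam k"
| "off (EV k) = 3 / 4 - 4 * lam k"

text \<open>The chain from a_k to z has length 4 \<open>lam k\<close>, the sum of 2
  \<open>lam j\<close> over j \<ge> k. This puts z at 3/4, a_1 at 1/4, and the end of c at
  1.\<close>

fun vertex_pos :: "vertex \<Rightarrow> real" where
  "vertex_pos VO = 0"
| "vertex_pos (VA k) = 3 / 4 - 4 * lam k"
| "vertex_pos (VB k) = 3 / 4 - 3 * lam k"
| "vertex_pos VZ = 3 / 4"

lemma off_src: "off e = vertex_pos (src e)"
  by (cases e) simp_all

text \<open>The exception is c, which closes the circle: it reaches o in position 1 instead of
  0.\<close>

lemma off_tgt: "off e + len e = vertex_pos (tgt e) \<or> tgt e = VO \<and> off e + len e = 1"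
  by (cases e) (simp_all add: lam_Suc, simp add: lam_def)

lemma off_range: "e \<in> edges \<Longrightarrow> 0 \<le> off e" "e \<in> edges \<Longrightarrow> off e \<le> 1"
proof -
  assume e: "e \<in> edges"
  have *: "1 \<le> k \<Longrightarrow> 0 \<le> 3 / 4 - 4 * lam k \<and> 3 / 4 - 4 * lam k \<le> 1 \<and> 0 \<le> 3 / 4 - 3 * lam k \<and> 3 / 4 - 3 * lam k \<le> 1" for k
    using lam_le[of k] lam_pos[of k] by linarith
  show "0 \<le> off e" using e * by (cases e) force+
  show "off e \<le> 1" using e * by (cases e) force+
qed

text \<open>The gluing at o is the equation H 0 = H 1; the limit at z holds because the positions of
  the a_k tend to 3/4.\<close>

lemma chain_fun_circle:
  assumes H: "\<And>x y. \<bar>H x - H y\<bar> \<le> \<bar>x - y :: real\<bar>" and H01: "H 0 = H 1"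
  shows "chain_fun (\<lambda>p. H (off (fst p) + snd p))"
  unfolding chain_fun_def
proof (intro conjI allI impI)
  fix e and s t :: real
  show "\<bar>H (off (fst (e, s)) + snd (e, s)) - H (off (fst (e, t)) + snd (e, t))\<bar> \<le> \<bar>s - t\<bar>"
    using H[of "off e + s" "off e + t"] by simp
next
  have v: "H (off (fst p) + snd p) = H (vertex_pos v)" if "at_vertex p v" for p v
    using that
  proof (cases rule: at_vertexE)
    case (1 e)
    then show ?thesis by (simp add: off_src)
  next
    case (2 e)
    then show ?thesis using off_tgt[of e] H01 by auto
  qed
  fix p q v assume "at_vertex p v" "at_vertex q v"
  then show "H (off (fst p) + snd p) = H (off (fst q) + snd q)" using v by simp
next
  have "(\<lambda>n. 4 * lam (Suc n)) \<longlonglongrightarrow> 0" using tendsto_mult_left[OF lam_tendsto, of 4] by simp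
  then have "(\<lambda>n. H (3 / 4 - 4 * lam (Suc n)) - H (3 / 4)) \<longlonglongrightarrow> 0"
  proof (rule Lim_null_comparison[rotated])
    show "\<forall>\<^sub>F n in sequentially. norm (H (3 / 4 - 4 * lam (Suc n)) - H (3 / 4)) \<le> 4 * lam (Suc n)"
    proof (rule always_eventually, rule allI)
      fix n
      show "norm (H (3 / 4 - 4 * lam (Suc n)) - H (3 / 4)) \<le> 4 * lam (Suc n)"
        using H[of "3 / 4 - 4 * lam (Suc n)" "3 / 4"] lam_pos[of "Suc n"] unfolding real_norm_def by linarith
    qed
  qed
  then have "(\<lambda>n. H (3 / 4 - 4 * lam (Suc n))) \<longlonglongrightarrow> H (3 / 4)" by (rule LIM_zero_cancel)
  then show "(\<lambda>n. H (off (fst (EU (Suc n), 0)) + snd (EU (Suc n), 0))) \<longlonglongrightarrow> H (off (fst z_point) + snd z_point)"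
    by (simp add: z_point_def)
qed

text \<open>Distance from position a on the circle of length 1. Edges have length at most 1/4, so
  from the start of an edge the shorter way to its points runs along the edge, and this distance is
  its arclength.\<close>

definition arc :: "real \<Rightarrow> real \<Rightarrow> real" where
  "arc a x = min \<bar>x - a\<bar> (1 - \<bar>x - a\<bar>)"

lemma chain_fun_arc:
  assumes "e \<in> edges"
  shows "chain_fun (\<lambda>p. arc (off e) (off (fst p) + snd p))"
proof (rule chain_fun_circle)
  show "\<bar>arc (off e) x - arc (off e) y\<bar> \<le> \<bar>x - y\<bar>" for x y unfolding arc_def by linarith
  show "arc (off e) 0 = arc (off e) 1" using off_range[OF assms] by (simp add: arc_def)
qed

definition edge_coord :: "edge \<Rightarrow> diamond_chain \<Rightarrow> real" where
  "edge_coord e x = max 0 (min (on_chain (\<lambda>p. arc (off e) (off (fst p) + snd p)) x) (len e))"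

lemma edge_coord_param:
  assumes e: "e \<in> edges" and s: "0 \<le> s" "s \<le> len e"
  shows "edge_coord e (param e s) = s"
proof -
  have p: "(e, s) \<in> edge_points" using e s by (simp add: edge_points_def)
  have "on_chain (\<lambda>p. arc (off e) (off (fst p) + snd p)) (param e s) = arc (off e) (off e + s)"
    unfolding param_eq[OF s] by (subst on_chain_abs[OF chain_fun_arc[OF e] p]) simp
  also have "\<dots> = s" using s len_le[OF e] by (simp add: arc_def)
  finally show ?thesis using s by (simp add: edge_coord_def)
qed

definition depth :: "edge \<Rightarrow> edge_point \<Rightarrow> real" where
  "depth e p = (if fst p = e then min (snd p) (len e - snd p) else 0)"

text \<open>All vertices have depth 0, which settles both the gluing and the limit at z.\<close>

lemma chain_fun_depth: "chain_fun (depth e)"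
  unfolding chain_fun_def
proof (intro conjI allI impI)
  fix e' and s t :: real
  show "\<bar>depth e (e', s) - depth e (e', t)\<bar> \<le> \<bar>s - t\<bar>"
    by (cases "e' = e") (simp_all add: depth_def)
next
  have v: "depth e p = 0" if "at_vertex p v" for p v
    using that
  proof (cases rule: at_vertexE)
    case (1 e')
    then show ?thesis using len_pos[of e] by (simp add: depth_def)
  next
    case (2 e')
    then show ?thesis using len_pos[of e] by (simp add: depth_def)
  qed
  fix p q v assume "at_vertex p v" "at_vertex q v"
  then show "depth e p = depth e q" using v by simp
next
  have "depth e (e', 0) = 0" for e' using len_pos[of e] by (simp add: depth_def)
  then show "(\<lambda>n. depth e (EU (Suc n), 0)) \<longlonglongrightarrow> depth e z_point" by (simp add: z_point_def)
qed

text \<open>The order is c, t_0, u_1, v_1, t_1, u_2, and so on: after two terms a series over the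
  edges falls into blocks of three, one for each diamond with its outgoing edge.\<close>

definition edg :: "nat \<Rightarrow> edge" where
  "edg i = (if i = 0 then EC else if i mod 3 = 1 then ET (i div 3)
     else if i mod 3 = 2 then EU (Suc (i div 3)) else EV (i div 3))"

definition iT :: "nat \<Rightarrow> nat" where "iT n = 3 * n + 1"
definition iU :: "nat \<Rightarrow> nat" where "iU n = 3 * n + 2"
definition iV :: "nat \<Rightarrow> nat" where "iV n = 3 * n + 3"

lemma index_cases:
  obtains "i = 0" | n where "i = iT n" | n where "i = iU n" | n where "i = iV n"
proof -
  have "i = 0 \<or> i = 3 * (i div 3) + 1 \<or> i = 3 * (i div 3) + 2 \<or> i = 3 * (i div 3 - 1) + 3" by presburger
  then show thesis using that unfolding iT_def iU_def iV_def by blast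
qed

lemma index_mod:
  "iT n mod 3 = 1" "iT n div 3 = n" "iU n mod 3 = 2" "iU n div 3 = n" "iV n mod 3 = 0" "iV n div 3 = Suc n"
  "(iT n + 1) div 3 = n" "(iU n + 1) div 3 = Suc n" "(iV n + 1) div 3 = Suc n"
  unfolding iT_def iU_def iV_def by presburger+

lemma index_neq [simp]:
  "iT n \<noteq> 0" "iU n \<noteq> 0" "iV n \<noteq> 0" "0 \<noteq> iT n" "0 \<noteq> iU n" "0 \<noteq> iV n"
  "iT n \<noteq> iU m" "iT n \<noteq> iV m" "iU n \<noteq> iT m" "iU n \<noteq> iV m" "iV n \<noteq> iT m" "iV n \<noteq> iU m"
  unfolding iT_def iU_def iV_def by presburger+

lemma index_inj [simp]: "iT n = iT m \<longleftrightarrow> n = m" "iU n = iU m \<longleftrightarrow> n = m" "iV n = iV m \<longleftrightarrow> n = m"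
  unfolding iT_def iU_def iV_def by presburger+

lemma edg_simps [simp]:
  "edg 0 = EC" "edg (iT n) = ET n" "edg (iU n) = EU (Suc n)" "edg (iV n) = EV (Suc n)"
  by (simp_all add: edg_def index_mod)

lemma edg_edges [simp]: "edg i \<in> edges"
  by (cases i rule: index_cases) simp_all

lemma edg_inj: "edg i = edg j \<Longrightarrow> i = j"
  by (cases i rule: index_cases; cases j rule: index_cases) auto

lemma edg_surj:
  assumes "e \<in> edges"
  obtains i where "edg i = e"
proof (cases e)
  case EC
  then show thesis using that[of 0] by simp
next
  case (ET k)
  then show thesis using that[of "iT k"] by simp
next
  case (EU k)
  then have "k = Suc (k - 1)" using assms by simp
  then show thesis using that[of "iU (k - 1)"] EU by simp
next
  case (EV k)
  then have "k = Suc (k - 1)" using assms by simp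
  then show thesis using that[of "iV (k - 1)"] EV by simp
qed

text \<open>\<open>lam\<close> halves with every three indices, and the cube 64/125 of 4/5 exceeds
  1/2.\<close>

lemma len_edg_le: "len (edg i) \<le> (4 / 5) ^ i"
proof -
  \<comment> \<open>3 n + 4 is the index of t_{n+1}, the last edge of length
    \<open>lam (Suc n)\<close>.\<close>
  have b: "lam (Suc n) \<le> (4 / 5) ^ (3 * n + 4)" for n
  proof -
    have "(1 / 2 :: real) ^ n \<le> (64 / 125) ^ n" by (rule power_mono) simp_all
    then have "lam (Suc n) \<le> 256 / 625 * (64 / 125) ^ n" unfolding lam_Suc_power by (intro mult_mono) simp_all
    also have "\<dots> = (4 / 5) ^ 4 * ((4 / 5) ^ 3) ^ n" by (simp add: power_divide)
    also have "\<dots> = (4 / 5) ^ (3 * n + 4)" unfolding power_mult[symmetric] power_add[symmetric] by (simp add: add.commute)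
    finally show ?thesis .
  qed
  have dec: "(4 / 5 :: real) ^ (3 * n + 4) \<le> (4 / 5) ^ j" if "j \<le> 3 * n + 4" for n j
    by (rule power_decreasing[OF that]) simp_all
  show ?thesis
  proof (cases i rule: index_cases)
    case (2 n)
    show ?thesis
    proof (cases n)
      case 0
      then have l: "len (edg i) = 1 / 4" and i: "i = 1" using 2 by simp (use 0 2 in \<open>simp add: iT_def\<close>)
      show ?thesis unfolding l unfolding i by simp
    next
      case (Suc m)
      have "lam (Suc m) \<le> (4 / 5) ^ iT n" by (rule order_trans[OF b dec]) (simp add: iT_def Suc)
      then show ?thesis using 2 Suc by simp
    qed
  next
    case (3 n)
    have "lam (Suc n) \<le> (4 / 5) ^ iU n" by (rule order_trans[OF b dec]) (simp add: iU_def)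
    then show ?thesis using 3 by simp
  next
    case (4 n)
    have "lam (Suc n) \<le> (4 / 5) ^ iV n" by (rule order_trans[OF b dec]) (simp add: iV_def)
    then show ?thesis using 4 by simp
  qed simp
qed

interpretation net: edge_net "\<lambda>i. param (edg i)" "\<lambda>i. len (edg i)"
  "\<lambda>i. edge_coord (edg i)" "\<lambda>i. on_chain (depth (edg i))"
proof (unfold_locales)
  fix i j :: nat and s t :: real and x y :: diamond_chain
  have E: "edg i \<in> edges" by simp
  show "0 < len (edg i)" by (rule len_pos)
  have "max 0 (min (max 0 (min s (len (edg i)))) (len (edg i))) = max 0 (min s (len (edg i)))"
    using len_pos[of "edg i"] by linarith
  then show "param (edg i) s = param (edg i) (max 0 (min s (len (edg i))))" by (simp only: param_def)
  show "dist (param (edg i) s) (param (edg i) t) \<le> \<bar>s - t\<bar>" by (rule dist_param[OF E])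
  show "\<bar>edge_coord (edg i) x - edge_coord (edg i) y\<bar> \<le> dist x y"
    using on_chain_lip[OF chain_fun_arc[OF E], of x y] unfolding edge_coord_def by linarith
  show "edge_coord (edg i) (param (edg i) s) = s" if "0 \<le> s" "s \<le> len (edg i)"
    by (rule edge_coord_param[OF E that])
  show "0 \<le> edge_coord (edg i) x" "edge_coord (edg i) x \<le> len (edg i)"
    using len_pos[of "edg i"] by (simp_all add: edge_coord_def)
  show "\<bar>on_chain (depth (edg i)) x - on_chain (depth (edg i)) y\<bar> \<le> dist x y"
    by (rule on_chain_lip[OF chain_fun_depth])
  show "on_chain (depth (edg i)) (param (edg i) s) = min s (len (edg i) - s)" if s: "0 \<le> s" "s \<le> len (edg i)"
  proof -
    have "(edg i, s) \<in> edge_points" using s by (simp add: edge_points_def)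
    then show ?thesis unfolding param_eq[OF s] by (subst on_chain_abs[OF chain_fun_depth]) (simp_all add: depth_def)
  qed
  show "on_chain (depth (edg i)) (param (edg j) s) = 0" if "i \<noteq> j"
  proof -
    have "edg j \<noteq> edg i" using that edg_inj[of j i] by blast
    then show ?thesis
      unfolding param_def by (subst on_chain_abs[OF chain_fun_depth clamp_point[OF edg_edges]]) (simp add: depth_def)
  qed
  show "\<exists>i s. 0 \<le> s \<and> s \<le> len (edg i) \<and> x = param (edg i) s"
  proof -
    obtain e s where es: "rep_diamond_chain x = (e, s)" by (cases "rep_diamond_chain x")
    then have p: "e \<in> edges" "0 \<le> s" "s \<le> len e" using rep_point[of x] by (simp_all add: edge_points_def)
    obtain i where "edg i = e" using edg_surj[OF p(1)] .
    moreover have "x = param e s" using abs_rep[of x] unfolding param_eq[OF p(2,3)] es by simp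
    ultimately show ?thesis using p by blast
  qed
  show "summable (\<lambda>i. len (edg i))"
    by (rule summable_comparison_test'[of "\<lambda>i. (4 / 5) ^ i" 0])
       (use len_edg_le len_pos in \<open>simp_all add: less_imp_le\<close>)
qed

section \<open>Cycles on the diamond chain\<close>

lemma finite_coeffs_bounded:
  assumes "\<And>i. \<bar>c i\<bar> \<le> C"
  shows "net.finite_coeffs c"
  unfolding net.finite_coeffs_def
proof (rule summable_comparison_test'[of "\<lambda>i. C * len (edg i)" 0])
  show "summable (\<lambda>i. C * len (edg i))" by (rule summable_mult[OF net.summable_len])
  fix i
  have "\<bar>c i\<bar> * len (edg i) \<le> C * len (edg i)"
    using assms[of i] len_pos[of "edg i"] by (intro mult_right_mono) simp_all
  then show "norm (\<bar>c i\<bar> * len (edg i)) \<le> C * len (edg i)"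
    using len_pos[of "edg i"] by (simp add: abs_mult)
qed

lemma sums_diamonds:
  fixes g :: "nat \<Rightarrow> real"
  assumes "g sums s"
  shows "(\<lambda>n. g (iU n) + g (iV n) + g (iT (Suc n))) sums (s - g 0 - g (iT 0))"
proof -
  have e: "(\<Sum>i<2. g i) = g 0 + g (iT 0)" by (simp add: iT_def numeral_2_eq_2)
  have "(\<lambda>i. g (i + 2)) sums (s - g 0 - g (iT 0))"
    using sums_split_initial_segment[OF assms, of 2] unfolding e by (simp add: algebra_simps)
  from sums_group[OF this, of 3]
  have "(\<lambda>n. \<Sum>i\<in>{n * 3..<n * 3 + 3}. g (i + 2)) sums (s - g 0 - g (iT 0))" by simp
  moreover have "(\<Sum>i\<in>{n * 3..<n * 3 + 3}. g (i + 2)) = g (iU n) + g (iV n) + g (iT (Suc n))" for n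
  proof -
    have s: "{n * 3..<n * 3 + 3} = {3 * n, 3 * n + 1, 3 * n + 2}" by auto
    have "(\<Sum>i\<in>{3 * n, 3 * n + 1, 3 * n + 2}. g (i + 2)) = g (3 * n + 2) + (g (3 * n + 1 + 2) + g (3 * n + 2 + 2))"
      by simp
    moreover have "g (3 * n + 1 + 2) = g (iV n)" "g (3 * n + 2 + 2) = g (iT (Suc n))" "g (3 * n + 2) = g (iU n)"
      by (rule arg_cong[where f=g], simp add: iT_def iU_def iV_def)+
    ultimately show ?thesis unfolding s by linarith
  qed
  ultimately show ?thesis by simp
qed

lemma edge_current_eq:
  assumes f: "f \<in> bLip_fun" and \<pi>: "\<pi> \<in> Lip_fun"
  shows "edge_current (edg i) f \<pi> =
    edge_int (len (edg i)) (\<lambda>s. f (param (edg i) s) * lderiv (\<lambda>s. \<pi> (param (edg i) s)) s)"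
proof -
  let ?p = "\<lambda>s. \<pi> (param (edg i) s)"
  let ?g = "\<lambda>s. indicator {0..len (edg i)} s * f (param (edg i) s) * lderiv ?p s"
  note p = net.Lip_along[OF \<pi>, of i]
  have [measurable]: "lderiv ?p \<in> borel_measurable borel" by (rule lderiv_measurable[OF p])
  have [measurable]: "(\<lambda>s. f (param (edg i) s)) \<in> borel_measurable borel"
    by (rule Lip_fun_measurable[OF net.Lip_along[OF bLip_Lip[OF f]]])
  have "?g \<in> borel_measurable borel" by measurable
  moreover have "AE s in lborel. indicator {0..len (edg i)} s * f (param (edg i) s) * deriv ?p s = ?g s"
    using lderiv_AE[OF p] by eventually_elim (simp add: DERIV_imp_deriv)
  ultimately have "(\<integral>s. indicator {0..len (edg i)} s * f (param (edg i) s) * deriv ?p s \<partial>lebesgue) = (\<integral>s. ?g s \<partial>lborel)"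
    by (rule lebesgue_AE_eq(2))
  then show ?thesis
    by (simp add: edge_current_def pushforward_def line_current_def edge_int_def set_lebesgue_integral_def mult.assoc)
qed

lemma cur_edge_sums:
  assumes c: "net.finite_coeffs c" and f: "f \<in> bLip_fun" and \<pi>: "\<pi> \<in> Lip_fun"
  shows "(\<lambda>i. c i * edge_current (edg i) f \<pi>) sums net.cur c f \<pi>"
proof -
  obtain C where C: "\<And>x. \<bar>f x\<bar> \<le> C" using bLip_fun_bounded[OF f] by blast
  show ?thesis
    unfolding edge_current_eq[OF f \<pi>] by (rule net.cur_sums[OF c bLip_measurable[OF f] C \<pi>])
qed

lemma edge_current_one:
  assumes \<pi>: "\<pi> \<in> Lip_fun"
  shows "edge_current (edg i) (\<lambda>_. 1) \<pi> = \<pi> (param (edg i) (len (edg i))) - \<pi> (param (edg i) 0)"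
  using lderiv_FTC[OF net.Lip_along[OF \<pi>, of i], of 0 "len (edg i)"] len_pos[of "edg i"]
  by (simp add: edge_current_eq[OF bLip_fun_const \<pi>] edge_int_def)

text \<open>Hat of height r and slope 1 at v, the two inner expressions serving edges that leave v
  and edges that enter it.\<close>

definition tent :: "vertex \<Rightarrow> real \<Rightarrow> edge_point \<Rightarrow> real" where
  "tent v r p = max 0 (max (if src (fst p) = v then r - snd p else 0)
     (if tgt (fst p) = v then r - (len (fst p) - snd p) else 0))"

lemma tent_vertex:
  assumes r: "0 < r" "\<And>e. e \<in> edges \<Longrightarrow> src e = v \<or> tgt e = v \<Longrightarrow> r \<le> len e" and p: "at_vertex p w"
  shows "tent v r p = (if w = v then r else 0)"
  using p
proof (cases rule: at_vertexE)
  case (1 e)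
  have "tgt e = v \<Longrightarrow> r \<le> len e" using r(2)[OF 1(1)] by simp
  then show ?thesis using r(1) by (cases "src e = v"; cases "tgt e = v") (simp_all add: tent_def 1)
next
  case (2 e)
  have "src e = v \<Longrightarrow> r \<le> len e" using r(2)[OF 2(1)] by simp
  then show ?thesis using r(1) by (cases "src e = v"; cases "tgt e = v") (simp_all add: tent_def 2)
qed

text \<open>At most one a_k equals v, so the hat is eventually 0 along the a_k, as at z. For v = z
  this would fail: the hat is r at z but 0 at every a_k.\<close>

lemma chain_fun_tent:
  assumes r: "0 < r" "\<And>e. e \<in> edges \<Longrightarrow> src e = v \<or> tgt e = v \<Longrightarrow> r \<le> len e" and v: "v \<noteq> VZ"
  shows "chain_fun (tent v r)"
  unfolding chain_fun_def
proof (intro conjI allI impI)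
  fix e and s t :: real
  have aux: "\<bar>max 0 (max A B) - max 0 (max A' B')\<bar> \<le> d" if "\<bar>A - A'\<bar> \<le> d" "\<bar>B - B'\<bar> \<le> d" for A A' B B' d :: real
    using that by linarith
  show "\<bar>tent v r (e, s) - tent v r (e, t)\<bar> \<le> \<bar>s - t\<bar>"
    unfolding tent_def by (rule aux) (simp_all add: abs_minus_commute)
next
  fix p q w assume "at_vertex p w" "at_vertex q w"
  then show "tent v r p = tent v r q" using tent_vertex[where v=v and r=r, OF r] by simp
next
  have "at_vertex z_point VZ" using at_vertex_src[of EC] by (simp add: z_point_def)
  then have z: "tent v r z_point = 0" using tent_vertex[where v=v and r=r, OF r] v by simp
  have a: "tent v r (EU (Suc n), 0) = (if VA (Suc n) = v then r else 0)" for n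
    using tent_vertex[where v=v and r=r, OF r at_vertex_src[of "EU (Suc n)"]] by simp
  have "\<exists>N. \<forall>n\<ge>N. VA (Suc n) \<noteq> v"
  proof (cases v)
    case (VA k)
    then show ?thesis by (intro exI[of _ k]) auto
  qed simp_all
  then obtain N where N: "\<And>n. N \<le> n \<Longrightarrow> VA (Suc n) \<noteq> v" by blast
  show "(\<lambda>n. tent v r (EU (Suc n), 0)) \<longlonglongrightarrow> tent v r z_point"
    unfolding z by (rule tendsto_eventually, rule eventually_sequentiallyI[of N]) (use N in \<open>simp add: a\<close>)
qed

text \<open>Against the hat at v the boundary of an edge is r if the edge enters v and -r if it
  leaves v. Only the finitely many edges of N can contribute, so the series becomes a finite
  sum.\<close>

lemma vertex_balance:
  assumes c: "net.finite_coeffs c" and zero: "\<And>\<pi>. \<pi> \<in> bLip_fun \<Longrightarrow> net.cur c (\<lambda>_. 1) \<pi> = 0"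
    and r: "0 < r" "\<And>e. e \<in> edges \<Longrightarrow> src e = v \<or> tgt e = v \<Longrightarrow> r \<le> len e" and v: "v \<noteq> VZ"
    and N: "finite N" "\<And>i. i \<notin> N \<Longrightarrow> src (edg i) \<noteq> v \<and> tgt (edg i) \<noteq> v"
  shows "(\<Sum>i\<in>N. c i * (of_bool (tgt (edg i) = v) - of_bool (src (edg i) = v))) = 0"
proof -
  let ?\<pi> = "on_chain (tent v r)"
  let ?b = "\<lambda>i. of_bool (tgt (edg i) = v) - of_bool (src (edg i) = v) :: real"
  have h: "chain_fun (tent v r)" by (rule chain_fun_tent[where v=v and r=r, OF r v])
  note L = on_chain_Lip[OF h]
  have at: "?\<pi> (abs_diamond_chain p) = r * of_bool (w = v)" if p: "at_vertex p w" for p w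
  proof -
    have "p \<in> edge_points" using p by (simp add: at_vertex_def)
    then show ?thesis using on_chain_abs[OF h] tent_vertex[where v=v and r=r, OF r p] by simp
  qed
  have bd: "\<bar>?\<pi> x\<bar> \<le> r" for x
  proof -
    obtain e s where es: "rep_diamond_chain x = (e, s)" by (cases "rep_diamond_chain x")
    then have p: "e \<in> edges" "0 \<le> s" "s \<le> len e" using rep_point[of x] by (simp_all add: edge_points_def)
    have "0 \<le> tent v r (e, s)" "tent v r (e, s) \<le> r"
      using p r(1) by (simp_all add: tent_def)
    then show ?thesis by (simp add: on_chain_def es)
  qed
  have b: "?\<pi> \<in> bLip_fun" by (rule bLip_funI2[OF L bd])
  have e1: "?\<pi> (param (edg i) (len (edg i))) = r * of_bool (tgt (edg i) = v)" for i
    using at[OF at_vertex_tgt[OF edg_edges]] len_pos[of "edg i"] by (simp add: param_eq)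
  have e0: "?\<pi> (param (edg i) 0) = r * of_bool (src (edg i) = v)" for i
    using at[OF at_vertex_src[OF edg_edges]] len_pos[of "edg i"] by (simp add: param_eq)
  have E: "edge_current (edg i) (\<lambda>_. 1) ?\<pi> = r * ?b i" for i
    unfolding edge_current_one[OF L] e1 e0 by (simp add: right_diff_distrib)
  have "(\<lambda>i. c i * (r * ?b i)) sums net.cur c (\<lambda>_. 1) ?\<pi>"
    using cur_edge_sums[OF c bLip_fun_const[of 1] L] by (simp only: E)
  moreover have "(\<lambda>i. c i * (r * ?b i)) sums (\<Sum>i\<in>N. c i * (r * ?b i))"
    by (rule sums_finite[OF N(1)]) (use N(2) in simp)
  ultimately have "net.cur c (\<lambda>_. 1) ?\<pi> = (\<Sum>i\<in>N. c i * (r * ?b i))" by (rule sums_unique2)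
  then have "(\<Sum>i\<in>N. c i * (r * ?b i)) = 0" using zero[OF b] by simp
  also have "(\<Sum>i\<in>N. c i * (r * ?b i)) = r * (\<Sum>i\<in>N. c i * ?b i)"
    by (simp add: sum_distrib_left mult.left_commute)
  finally show ?thesis using r(1) by simp
qed

text \<open>The law at o equates c and t_0; those at a_{n+1} and b_{n+1} carry the value of t_n
  through the diamond to t_{n+1}.\<close>

lemma flow_conservation:
  assumes c: "net.finite_coeffs c" and zero: "\<And>\<pi>. \<pi> \<in> bLip_fun \<Longrightarrow> net.cur c (\<lambda>_. 1) \<pi> = 0"
  shows flow_diamond: "c (iU n) + c (iV n) = c 0" and flow_edge: "c (iT n) = c 0"
proof -
  have VO: "c 0 = c (iT 0)"
  proof -
    have "(\<Sum>i\<in>{0, iT 0}. c i * (of_bool (tgt (edg i) = VO) - of_bool (src (edg i) = VO))) = 0"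
    proof (rule vertex_balance[where r="1 / 4", OF c zero])
      fix e assume "e \<in> edges" "src e = VO \<or> tgt e = VO"
      then show "1 / 4 \<le> len e" by (cases e) (auto split: if_splits)
    next
      fix i assume "i \<notin> {0, iT 0}"
      then show "src (edg i) \<noteq> VO \<and> tgt (edg i) \<noteq> VO" by (cases i rule: index_cases) auto
    qed simp_all
    then show ?thesis by simp
  qed
  have VA: "c (iT n) = c (iU n) + c (iV n)" for n
  proof -
    have "(\<Sum>i\<in>{iT n, iU n, iV n}. c i * (of_bool (tgt (edg i) = VA (Suc n)) - of_bool (src (edg i) = VA (Suc n)))) = 0"
    proof (rule vertex_balance[where r="lam (Suc n)", OF c zero])
      fix e assume "e \<in> edges" "src e = VA (Suc n) \<or> tgt e = VA (Suc n)"
      \<comment> \<open>The edge t_n that enters a_{n+1} has length \<open>lam n\<close>, or 1/4 for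
        n = 0.\<close>
      moreover have "lam (Suc n) \<le> lam n" "lam (Suc n) \<le> 1 / 4"
        using lam_Suc[of n] lam_pos[of n] lam_le[of "Suc n"] by linarith+
      ultimately show "lam (Suc n) \<le> len e" by (cases e) (auto split: if_splits)
    next
      fix i assume "i \<notin> {iT n, iU n, iV n}"
      then show "src (edg i) \<noteq> VA (Suc n) \<and> tgt (edg i) \<noteq> VA (Suc n)" by (cases i rule: index_cases) auto
    qed simp_all
    then show ?thesis by (cases "n = 0") simp_all
  qed
  have VB: "c (iU n) + c (iV n) = c (iT (Suc n))" for n
  proof -
    have "(\<Sum>i\<in>{iU n, iV n, iT (Suc n)}. c i * (of_bool (tgt (edg i) = VB (Suc n)) - of_bool (src (edg i) = VB (Suc n)))) = 0"
    proof (rule vertex_balance[where r="lam (Suc n)", OF c zero])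
      fix e assume "e \<in> edges" "src e = VB (Suc n) \<or> tgt e = VB (Suc n)"
      then show "lam (Suc n) \<le> len e" by (cases e) (auto split: if_splits)
    next
      fix i assume "i \<notin> {iU n, iV n, iT (Suc n)}"
      then show "src (edg i) \<noteq> VB (Suc n) \<and> tgt (edg i) \<noteq> VB (Suc n)" by (cases i rule: index_cases) auto
    qed simp_all
    then show ?thesis by simp
  qed
  have T: "c (iT n) = c 0" for n
  proof (induction n)
    case 0
    show ?case using VO by simp
  next
    case (Suc n)
    then show ?case using VA[of n] VB[of n] by linarith
  qed
  show "c (iT n) = c 0" by (rule T)
  show "c (iU n) + c (iV n) = c 0" using VA[of n] T[of n] by simp
qed

section \<open>Lower bounds for full cycles\<close>

lemma cycle_multiplicity:
  fixes m :: "nat \<Rightarrow> int"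
  assumes nz: "\<And>i. m i \<noteq> 0" and flow: "\<And>n. m (iU n) + m (iV n) = m 0"
  shows "\<exists>i. 2 \<le> \<bar>m i\<bar>"
proof (rule ccontr)
  assume "\<not> ?thesis"
  then have "\<not> 2 \<le> \<bar>m i\<bar>" for i by blast
  then have one: "\<bar>m i\<bar> = 1" for i using nz[of i] by (smt (verit))
  have "m i = 1 \<or> m i = -1" for i using one[of i] by linarith
  from this[of 0] this[of "iU 0"] this[of "iV 0"] show False using flow[of 0] by auto
qed

lemma sum_three_abs:
  fixes u v w :: int
  assumes "u \<noteq> 0" "v \<noteq> 0" "w \<noteq> 0" "u + v = w"
  shows "4 \<le> \<bar>u\<bar> + \<bar>v\<bar> + \<bar>w\<bar>"
proof (rule ccontr)
  assume "\<not> ?thesis"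
  then have "\<bar>u\<bar> = 1" "\<bar>v\<bar> = 1" "\<bar>w\<bar> = 1" using assms(1-3) by linarith+
  then have "even (u + v) \<and> odd w" by (auto simp: abs_if split: if_splits)
  then show False using assms(4) by simp
qed

text \<open>The three edges of a block have the same length, so only the sum of their moduli
  matters. With D = 4 and unit coefficients on c and t_0 the bound is 1/4 + 1/4 + 1.\<close>

lemma cycle_mass_sum:
  assumes c: "net.finite_coeffs c"
    and diamond: "\<And>n. D \<le> \<bar>c (iU n)\<bar> + \<bar>c (iV n)\<bar> + \<bar>c (iT (Suc n))\<bar>"
  shows "\<bar>c 0\<bar> / 4 + \<bar>c (iT 0)\<bar> / 4 + D / 4 \<le> (\<Sum>i. \<bar>c i\<bar> * len (edg i))"
proof -
  have s: "(\<lambda>n. \<bar>c (iU n)\<bar> * lam (Suc n) + \<bar>c (iV n)\<bar> * lam (Suc n) + \<bar>c (iT (Suc n))\<bar> * lam (Suc n)) sums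
    ((\<Sum>i. \<bar>c i\<bar> * len (edg i)) - \<bar>c 0\<bar> / 4 - \<bar>c (iT 0)\<bar> / 4)"
    using sums_diamonds[OF summable_sums[OF c[unfolded net.finite_coeffs_def]]] by simp
  have d: "(\<lambda>n. D * lam (Suc n)) sums (D / 4)" using sums_mult[OF lam_sums, of D] by simp
  have "D * lam (Suc n) \<le> \<bar>c (iU n)\<bar> * lam (Suc n) + \<bar>c (iV n)\<bar> * lam (Suc n) + \<bar>c (iT (Suc n))\<bar> * lam (Suc n)" for n
    using mult_right_mono[OF diamond[of n] less_imp_le[OF lam_pos[of "Suc n"]]] by (simp add: distrib_right)
  from sums_le[OF this d s]
  have "D / 4 \<le> (\<Sum>i. \<bar>c i\<bar> * len (edg i)) - \<bar>c 0\<bar> / 4 - \<bar>c (iT 0)\<bar> / 4" .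
  then show ?thesis by simp
qed

lemma full_cycle_bounds:
  assumes R: "R \<in> full_cycles"
  shows full_cycle_mult: "2 \<le> mult_inf R" and full_cycle_mass: "ennreal (3 / 2) \<le> mass R"
proof -
  have ir: "integer_rectifiable1 R" and bd: "\<And>\<pi>. \<pi> \<in> bLip_fun \<Longrightarrow> R (\<lambda>_. 1) \<pi> = 0" and full: "charac_set R = UNIV"
    using R by (simp_all add: full_cycles_def integral_currents1_def boundary_def)
  have mc: "metric_current1 R" using ir by (simp add: integer_rectifiable1_def)
  obtain c where c: "net.finite_coeffs c" and ag: "currents_agree R (net.cur c)"
    using net.cycle_structure[OF mc bd] by blast
  have "c i \<in> \<int>" for i by (rule net.integer_coefficients[OF c integer_rectifiable_agree[OF ir ag]])
  then have "\<forall>i. \<exists>k. c i = real_of_int k" by (auto elim!: Ints_cases)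
  then obtain m where cm: "\<And>i. c i = real_of_int (m i)" by metis
  have ceq: "c = (\<lambda>i. real_of_int (m i))" using cm by blast
  note c' = c[unfolded ceq]
  have nc: "c i \<noteq> 0" for i
    by (rule net.charac_set_nonzero[OF c]) (use full charac_set_agree[OF ag] in simp)
  have nz: "m i \<noteq> 0" for i using nc[of i] cm[of i] by simp
  have zero: "net.cur c (\<lambda>_. 1) \<pi> = 0" if "\<pi> \<in> bLip_fun" for \<pi>
    using currents_agreeD[OF ag bLip_fun_const bLip_Lip[OF that]] bd[OF that] by simp
  have flow: "m (iU n) + m (iV n) = m 0" for n
  proof -
    have "c (iU n) + c (iV n) = c 0" by (rule flow_diamond[OF c zero])
    then show ?thesis unfolding cm of_int_add[symmetric] of_int_eq_iff .
  qed
  have edge: "m (iT n) = m 0" for n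
  proof -
    have "c (iT n) = c 0" by (rule flow_edge[OF c zero])
    then show ?thesis unfolding cm of_int_eq_iff .
  qed
  obtain i where i: "2 \<le> \<bar>m i\<bar>" using cycle_multiplicity[OF nz flow] by blast
  have "2 \<le> mult_inf (net.cur c)" unfolding ceq by (rule net.mult_inf_ge_two[OF c' i])
  then show "2 \<le> mult_inf R" using mult_inf_agree[OF ag] by simp
  have "4 \<le> \<bar>m (iU n)\<bar> + \<bar>m (iV n)\<bar> + \<bar>m (iT (Suc n))\<bar>" for n
    by (rule sum_three_abs[OF nz nz nz]) (simp add: flow edge)
  then have "real_of_int 4 \<le> real_of_int (\<bar>m (iU n)\<bar> + \<bar>m (iV n)\<bar> + \<bar>m (iT (Suc n))\<bar>)" for n
    unfolding of_int_le_iff .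
  then have "4 \<le> \<bar>c (iU n)\<bar> + \<bar>c (iV n)\<bar> + \<bar>c (iT (Suc n))\<bar>" for n by (simp add: cm)
  from cycle_mass_sum[OF c this]
  have "\<bar>c 0\<bar> / 4 + \<bar>c (iT 0)\<bar> / 4 + 1 \<le> (\<Sum>i. \<bar>c i\<bar> * len (edg i))" by simp
  moreover have "1 \<le> \<bar>m i\<bar>" for i using nz[of i] by linarith
  then have "1 \<le> \<bar>c i\<bar>" for i by (simp add: cm flip: of_int_abs)
  then have "1 \<le> \<bar>c 0\<bar>" "1 \<le> \<bar>c (iT 0)\<bar>" by blast+
  ultimately have "3 / 2 \<le> (\<Sum>i. \<bar>c i\<bar> * len (edg i))" by linarith
  then show "ennreal (3 / 2) \<le> mass R"
    unfolding mass_agree[OF ag] net.mass_cur[OF c] by (rule ennreal_leI)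
qed

section \<open>The minimizer\<close>

definition star_mult :: "nat \<Rightarrow> int" where
  "star_mult i = (if i mod 3 = 2 then 2 else if i mod 3 = 0 \<and> i \<noteq> 0 then -1 else 1)"

text \<open>The number of the \<open>star_term\<close> to which the i-th edge belongs.\<close>

definition block :: "nat \<Rightarrow> nat" where
  "block i = (i + 1) div 3"

lemma star_mult_simps [simp]:
  "star_mult 0 = 1" "star_mult (iT n) = 1" "star_mult (iU n) = 2" "star_mult (iV n) = -1"
  by (simp_all add: star_mult_def index_mod)

lemma block_simps [simp]: "block 0 = 0" "block (iT n) = n" "block (iU n) = Suc n" "block (iV n) = Suc n"
  unfolding block_def index_mod by simp_all

abbreviation star_coeff :: "nat \<Rightarrow> real" where
  "star_coeff \<equiv> \<lambda>i. real_of_int (star_mult i)"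

lemma star_mult_bounds: "\<bar>star_mult i\<bar> \<le> 2" "star_mult i \<noteq> 0"
  by (cases i rule: index_cases; simp)+

lemma star_coeff_bound: "\<bar>star_coeff i\<bar> \<le> 2"
  by (cases i rule: index_cases) simp_all

lemma finite_coeffs_star: "net.finite_coeffs (\<lambda>i. if P i then star_coeff i else 0)"
  by (rule finite_coeffs_bounded[of _ 2]) (use star_coeff_bound in simp)

lemma finite_star_coeff: "net.finite_coeffs star_coeff"
  by (rule finite_coeffs_bounded[OF star_coeff_bound])

lemma star_term_agree: "currents_agree (net.cur (\<lambda>i. if block i = k then star_coeff i else 0)) (star_term k)"
  unfolding currents_agree_def
proof (intro ballI)
  fix f \<pi> :: "diamond_chain \<Rightarrow> real" assume f: "f \<in> bLip_fun" and \<pi>: "\<pi> \<in> Lip_fun"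
  let ?t = "\<lambda>i. (if block i = k then star_coeff i else 0) * edge_current (edg i) f \<pi>"
  have cur: "?t sums net.cur (\<lambda>i. if block i = k then star_coeff i else 0) f \<pi>"
    by (rule cur_edge_sums[OF finite_coeffs_star f \<pi>])
  define N where "N = (case k of 0 \<Rightarrow> {0, iT 0} | Suc n \<Rightarrow> {iU n, iV n, iT (Suc n)})"
  have fin: "finite N" by (cases k) (simp_all add: N_def)
  have "?t i = 0" if "i \<notin> N" for i
    using that by (cases i rule: index_cases; cases k) (auto simp: N_def)
  from sums_unique2[OF cur sums_finite[OF fin this]]
  have "net.cur (\<lambda>i. if block i = k then star_coeff i else 0) f \<pi> = (\<Sum>i\<in>N. ?t i)" .
  also have "\<dots> = star_term k f \<pi>" by (cases k) (simp_all add: N_def)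
  finally show "net.cur (\<lambda>i. if block i = k then star_coeff i else 0) f \<pi> = star_term k f \<pi>" .
qed

lemma R_star_agree: "currents_agree (net.cur star_coeff) R_star"
  unfolding currents_agree_def
proof (intro ballI)
  fix f \<pi> :: "diamond_chain \<Rightarrow> real" assume f: "f \<in> bLip_fun" and \<pi>: "\<pi> \<in> Lip_fun"
  have "(\<lambda>n. star_term (Suc n) f \<pi>) sums (net.cur star_coeff f \<pi> - star_term 0 f \<pi>)"
    using sums_diamonds[OF cur_edge_sums[OF finite_star_coeff f \<pi>]] by (simp add: diff_diff_eq)
  from sums_Suc[OF this] have "(\<lambda>n. star_term n f \<pi>) sums net.cur star_coeff f \<pi>" by simp
  then show "net.cur star_coeff f \<pi> = R_star f \<pi>" unfolding R_star_def by (rule sums_unique)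
qed

text \<open>After n terms the remainder agrees with the current that keeps the coefficients from
  block n on. Its mass is a sum over those edges, which tends to 0 by dominated convergence since
  each edge eventually drops out.\<close>

lemma R_star_sums: "mass_sums star_term R_star"
  unfolding mass_sums_def
proof (intro conjI allI)
  show "metric_current1 (star_term n)" for n
    by (rule metric_current_agree[OF net.metric_current_cur[OF finite_coeffs_star] star_term_agree])
  show "metric_current1 R_star"
    by (rule metric_current_agree[OF net.metric_current_cur[OF finite_star_coeff] R_star_agree])
  let ?d = "\<lambda>k i. if block i = k then star_coeff i else 0"
  let ?r = "\<lambda>n i. if n \<le> block i then star_coeff i else 0"
  have ag: "currents_agree (\<lambda>f \<pi>. R_star f \<pi> - (\<Sum>i<n. star_term i f \<pi>)) (net.cur (?r n))" for n
    unfolding currents_agree_def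
  proof (intro ballI)
    fix f \<pi> :: "diamond_chain \<Rightarrow> real" assume f: "f \<in> bLip_fun" and \<pi>: "\<pi> \<in> Lip_fun"
    let ?E = "\<lambda>i. edge_current (edg i) f \<pi>"
    have "(\<lambda>i. star_coeff i * ?E i - (\<Sum>k<n. ?d k i * ?E i)) sums
        (net.cur star_coeff f \<pi> - (\<Sum>k<n. net.cur (?d k) f \<pi>))"
      by (intro sums_diff sums_sum cur_edge_sums finite_star_coeff finite_coeffs_star f \<pi>)
    moreover have "star_coeff i * ?E i - (\<Sum>k<n. ?d k i * ?E i) = ?r n i * ?E i" for i
    proof -
      have "(\<Sum>k<n. ?d k i) = (if block i < n then star_coeff i else 0)"
        by (simp add: sum.delta)
      then show ?thesis unfolding sum_distrib_right[symmetric] by (auto simp: not_le)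
    qed
    ultimately have "(\<lambda>i. ?r n i * ?E i) sums (net.cur star_coeff f \<pi> - (\<Sum>k<n. net.cur (?d k) f \<pi>))" by simp
    from sums_unique2[OF this cur_edge_sums[OF finite_coeffs_star f \<pi>]]
    show "R_star f \<pi> - (\<Sum>i<n. star_term i f \<pi>) = net.cur (?r n) f \<pi>"
      using currents_agreeD[OF R_star_agree f \<pi>] currents_agreeD[OF star_term_agree f \<pi>] by simp
  qed
  have "(\<lambda>n. \<Sum>i. \<bar>?r n i\<bar> * len (edg i)) \<longlonglongrightarrow> (\<Sum>i. 0)"
  proof (rule suminf_dominated_convergence[where w="\<lambda>i. 2 * len (edg i)"])
    show "summable (\<lambda>i. 2 * len (edg i))" by (rule summable_mult[OF net.summable_len])
    show "\<bar>\<bar>?r n i\<bar> * len (edg i)\<bar> \<le> 2 * len (edg i)" for n i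
      using star_coeff_bound[of i] len_pos[of "edg i"] by (simp add: abs_mult)
    show "(\<lambda>n. \<bar>?r n i\<bar> * len (edg i)) \<longlonglongrightarrow> 0" for i
      by (rule tendsto_eventually, rule eventually_sequentiallyI[of "Suc (block i)"]) simp
  qed
  then have "(\<lambda>n. ennreal (\<Sum>i. \<bar>?r n i\<bar> * len (edg i))) \<longlonglongrightarrow> 0" using tendsto_ennrealI by fastforce
  then show "(\<lambda>n. mass (\<lambda>f \<pi>. R_star f \<pi> - (\<Sum>i<n. star_term i f \<pi>))) \<longlonglongrightarrow> 0"
    unfolding mass_agree[OF ag] net.mass_cur[OF finite_coeffs_star] .
qed

section \<open>The boundary of the minimizer\<close>

definition vertex_point :: "vertex \<Rightarrow> diamond_chain" where
  "vertex_point v = abs_diamond_chain (SOME p. at_vertex p v)"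

lemma vertex_point_eq:
  assumes "at_vertex p v"
  shows "abs_diamond_chain p = vertex_point v"
proof -
  define q where "q = (SOME p. at_vertex p v)"
  have q: "at_vertex q v" unfolding q_def by (rule someI[of "\<lambda>p. at_vertex p v", OF assms])
  have "dist (abs_diamond_chain p) (abs_diamond_chain q) = graph_dist p q"
    using assms q by (intro dist_abs) (simp_all add: at_vertex_def)
  also have "\<dots> \<le> 0"
    unfolding graph_dist_def
    by (rule path_dist_le[of graph_step, OF graph_step_nonneg walk_single[of graph_step, OF graph_glue[OF assms q]]])
  finally show ?thesis by (simp add: vertex_point_def q_def)
qed

lemma param_vertex:
  "param (edg i) 0 = vertex_point (src (edg i))" "param (edg i) (len (edg i)) = vertex_point (tgt (edg i))"
  using vertex_point_eq[OF at_vertex_src[OF edg_edges]] vertex_point_eq[OF at_vertex_tgt[OF edg_edges]]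
    len_pos[of "edg i"] by (simp_all add: param_eq)

lemma chain_tail_walk:
  "n \<le> m \<Longrightarrow> walk chain_step (EU (Suc n), 0) (EU (Suc m), 0) (4 * lam (Suc n) - 4 * lam (Suc m))"
proof (induction m rule: dec_induct)
  case base
  show ?case using walk_nil[of chain_step "(EU (Suc n), 0)"] by simp
next
  case (step m)
  from walk_append[OF step.IH chain_diamond_walk[of "Suc m"]]
  show ?case by (simp add: lam_Suc)
qed

text \<open>Walks from a_{n+1} to later a_m have length below 4 \<open>lam (Suc n)\<close>; the
  limit that defines the completed distance turns this into a bound for the distance to z.\<close>

lemma vertex_points_tendsto: "(\<lambda>n. vertex_point (VA (Suc n))) \<longlonglongrightarrow> vertex_point VZ"
proof (rule iffD2[OF tendsto_dist_iff])
  have a: "vertex_point (VA (Suc n)) = abs_diamond_chain (EU (Suc n), 0)" for n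
    using vertex_point_eq[OF at_vertex_src[of "EU (Suc n)"]] by simp
  have z: "vertex_point VZ = abs_diamond_chain z_point"
    using vertex_point_eq[OF at_vertex_src[of EC]] by (simp add: z_point_def)
  have zp: "z_point \<in> edge_points" by (simp add: z_point_def edge_points_def)
  have ap: "(EU (Suc n), 0) \<in> edge_points" for n using chain_a_points[of n] by (simp add: chain_points_def)
  have bound: "dist (vertex_point (VA (Suc n))) (vertex_point VZ) \<le> 4 * lam (Suc n)" for n
  proof -
    have "dist (vertex_point (VA (Suc n))) (vertex_point VZ) = graph_dist (EU (Suc n), 0) z_point"
      unfolding a z by (rule dist_abs[OF ap zp])
    also have "\<dots> \<le> completed_dist (EU (Suc n), 0) z_point"
      unfolding graph_dist_def
      by (rule path_dist_le[of graph_step, OF graph_step_nonneg walk_single[of graph_step, OF graph_chain]])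
         (use chain_a_points in auto)
    also have "\<dots> \<le> 4 * lam (Suc n)"
    proof (rule LIMSEQ_le_const2)
      show "(\<lambda>m. chain_dist (cauchy_rep (EU (Suc n), 0) m) (cauchy_rep z_point m)) \<longlonglongrightarrow> completed_dist (EU (Suc n), 0) z_point"
        by (rule completed_dist_limit) (use chain_a_points in auto)
      have "chain_dist (EU (Suc n), 0) (EU (Suc m), 0) \<le> 4 * lam (Suc n)" if "n \<le> m" for m
      proof -
        have "chain_dist (EU (Suc n), 0) (EU (Suc m), 0) \<le> 4 * lam (Suc n) - 4 * lam (Suc m)"
          unfolding chain_dist_def
          by (rule path_dist_le[of chain_step, OF chain_step_nonneg chain_tail_walk[OF that]])
        then show ?thesis using lam_pos[of "Suc m"] by linarith
      qed
      then show "\<exists>N. \<forall>m\<ge>N. chain_dist (cauchy_rep (EU (Suc n), 0) m) (cauchy_rep z_point m) \<le> 4 * lam (Suc n)"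
        unfolding cauchy_rep_simps(1)[OF chain_a_points] cauchy_rep_simps(2) by blast
    qed
    finally show ?thesis .
  qed
  show "(\<lambda>n. dist (vertex_point (VA (Suc n))) (vertex_point VZ)) \<longlonglongrightarrow> 0"
  proof (rule Lim_null_comparison)
    show "\<forall>\<^sub>F n in sequentially. norm (dist (vertex_point (VA (Suc n))) (vertex_point VZ)) \<le> 4 * lam (Suc n)"
      using bound by simp
    show "(\<lambda>n. 4 * lam (Suc n)) \<longlonglongrightarrow> 0" using tendsto_mult_left[OF lam_tendsto, of 4] by simp
  qed
qed

text \<open>The coefficients 2 and -1 carry net flow 1 across a diamond, so block k contributes the
  difference of \<pi> at a_{k+1} and a_k. The series telescopes to the value at z minus that at a_1,
  since \<pi> is continuous and a_k tends to z; t_0 and c cancel the rest.\<close>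

lemma R_star_boundary:
  assumes "\<pi> \<in> bLip_fun"
  shows "R_star (\<lambda>_. 1) \<pi> = 0"
proof -
  have \<pi>: "\<pi> \<in> Lip_fun" using assms by (rule bLip_Lip)
  let ?v = "\<lambda>v. \<pi> (vertex_point v)"
  have E: "edge_current (edg i) (\<lambda>_. 1) \<pi> = ?v (tgt (edg i)) - ?v (src (edg i))" for i
    by (simp add: edge_current_one[OF \<pi>] param_vertex)
  have "(\<lambda>n. ?v (VA (Suc (Suc n))) - ?v (VA (Suc n))) sums
      (net.cur star_coeff (\<lambda>_. 1) \<pi> - (?v VO - ?v VZ) - (?v (VA 1) - ?v VO))"
    using sums_diamonds[OF cur_edge_sums[OF finite_star_coeff bLip_fun_const[of 1] \<pi>]] unfolding E
    by (simp add: algebra_simps)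
  moreover have "(\<lambda>n. ?v (VA (Suc n))) \<longlonglongrightarrow> ?v VZ"
  proof (rule tendsto_compose[OF _ vertex_points_tendsto])
    have "isCont \<pi> (vertex_point VZ)"
      using Lip_fun_continuous[OF \<pi>, of UNIV] by (simp add: continuous_on_eq_continuous_at)
    then show "\<pi> \<midarrow>vertex_point VZ\<rightarrow> ?v VZ" by (rule isContD)
  qed
  from telescope_sums[OF this]
  have "(\<lambda>n. ?v (VA (Suc (Suc n))) - ?v (VA (Suc n))) sums (?v VZ - ?v (VA 1))" by simp
  ultimately have "net.cur star_coeff (\<lambda>_. 1) \<pi> - (?v VO - ?v VZ) - (?v (VA 1) - ?v VO) = ?v VZ - ?v (VA 1)"
    by (rule sums_unique2)
  then show ?thesis using currents_agreeD[OF R_star_agree bLip_fun_const \<pi>, of 1] by simp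
qed

lemma R_star_full_cycle: "R_star \<in> full_cycles"
  unfolding full_cycles_def integral_currents1_def mem_Collect_eq
proof (intro conjI)
  show "integer_rectifiable1 R_star"
    by (rule integer_rectifiable_agree[OF net.integer_rectifiable_cur[OF finite_star_coeff] R_star_agree])
  show "integer_rectifiable0 (boundary R_star)"
    unfolding integer_rectifiable0_def boundary_def
    by (rule exI[of _ "{}"]) (simp add: R_star_boundary)
  show "\<forall>f\<in>bLip_fun. boundary R_star f = 0" by (simp add: boundary_def R_star_boundary)
  have "charac_set (net.cur star_coeff) = UNIV"
    by (rule net.charac_set_full[OF finite_star_coeff]) (use star_mult_bounds(2) in simp)
  then show "charac_set R_star = UNIV" using charac_set_agree[OF R_star_agree] by simp
qed

text \<open>Equality case of \<open>cycle_mass_sum\<close>: the moduli in each block are 2, 1, 1,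
  and those of c and t_0 are 1.\<close>

lemma R_star_mass: "mass R_star = ennreal (3 / 2)"
proof -
  have "(\<lambda>n. 4 * lam (Suc n)) sums ((\<Sum>i. \<bar>star_coeff i\<bar> * len (edg i)) - 1 / 4 - 1 / 4)"
    using sums_diamonds[OF summable_sums[OF finite_star_coeff[unfolded net.finite_coeffs_def]]] by simp
  moreover have "(\<lambda>n. 4 * lam (Suc n)) sums 1" using sums_mult[OF lam_sums, of 4] by simp
  ultimately have "(\<Sum>i. \<bar>star_coeff i\<bar> * len (edg i)) - 1 / 4 - 1 / 4 = 1" by (rule sums_unique2)
  then have "(\<Sum>i. \<bar>star_coeff i\<bar> * len (edg i)) = 3 / 2" by linarith
  then show ?thesis unfolding mass_agree[OF R_star_agree, symmetric] net.mass_cur[OF finite_star_coeff] by simp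
qed

lemma R_star_mult: "mult_inf R_star = 2"
proof (rule antisym)
  show "mult_inf R_star \<le> 2"
    using net.mult_inf_le_two[OF finite_star_coeff star_mult_bounds(1)] mult_inf_agree[OF R_star_agree] by simp
  show "2 \<le> mult_inf R_star" by (rule full_cycle_mult[OF R_star_full_cycle])
qed

theorem corollary6p4:
  shows "mass_sums star_term R_star \<and>
    R_star \<in> full_cycles \<and>
    (\<forall>R\<in>full_cycles. 2 \<le> mult_inf R) \<and> mult_inf R_star = 2 \<and>
    (\<forall>R\<in>full_cycles. ennreal (3 / 2) \<le> mass R) \<and> mass R_star = ennreal (3 / 2)"
  using R_star_sums R_star_full_cycle full_cycle_mult R_star_mult full_cycle_mass R_star_mass by blast

end
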